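(* Let $\Omega\subset\mathbb R^2$ be a bounded Lipschitz domain with connected complement $\mathbb R^2\setminus\overline\Omega$, let $\mathbf 0\in\partial\Omega$, and suppose that $\Omega\cap B_h=W\cap B_h=:S_h$ for some $h>0$, where $W$ is the open sector with angles $\theta_m,\theta_M$ satisfying $-\pi<\theta_m<\theta_M<\pi$ and $\theta_M-\theta_m\ne\pi$. Let $(\mathbf v,\mathbf w)\in H^1(\Omega)^2\times H^1(\Omega)^2$ and $\omega\in\mathbb R_+$ satisfy $$\mathcal L\mathbf v+\omega^2\mathbf v=\mathbf 0\ \text{in }\Omega,\qquad \mathcal L\mathbf w+\omega^2(1+V)\mathbf w=\mathbf 0\ \text{in }\Omega,\qquad \mathbf w=\mathbf v,\ \ T_\nu\mathbf v=T_\nu\mathbf w\ \text{on }\Gamma,$$ where $\Gamma\subset\partial\Omega$ is an open subset containing $\Gamma_h^+\cup\Gamma_h^-$. Let $q:=1+V$ and suppose $q\mathbf w\in C^\alpha(\overline{S_h})^2$ for some $0<\alpha<1$. Assume that for given constants $\gamma,\beta_1,\beta_2$ with $\gamma>\max\{\beta_1,\beta_2\}>0$ there is a sequence of elastic Herglotz wave functions $\{\mathbf v_j\}_{j=1}^\infty$ with kernels $(g_{jp},g_{js})$ such that for all $j$ $$\|\mathbf v-\mathbf v_j\|_{H^1(S_h)^2}\le j^{-\gamma},\quad \|g_{jp}\|_{L^2(\mathbb S^1)}\le j^{\beta_1},\quad \|g_{js}\|_{L^2(\mathbb S^1)}\le j^{\beta_2}.$$ Then $$\lim_{\rho\to+0}\frac{1}{m(B(\mathbf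 0,\rho)\cap\Omega)}\int_{B(\mathbf 0,\rho)\cap\Omega}|V(\mathbf x)\mathbf w(\mathbf x)|\,\mathrm d\mathbf x=0,$$ where $m(\cdot)$ denotes Lebesgue measure.
   Context: Real constants $\lambda,\mu$ satisfy $\mu>0$ and $2\lambda+2\mu>0$. The Lamé operator is $\mathcal L\mathbf u=\mu\Delta\mathbf u+(\lambda+\mu)\nabla(\nabla\cdot\mathbf u)$. $V\in L^\infty(\Omega)$ is real-valued and nontrivial. Functions $\mathbf v,\mathbf w$ are $\mathbb C^2$-valued; the equations hold in the distributional sense and boundary values in the trace sense. With $\nu$ the outward unit normal and $\nu^\perp$ its anticlockwise rotation by $\pi/2$, the boundary traction is $T_\nu\mathbf v=2\mu\,\partial_\nu\mathbf v+\lambda\nu(\nabla\cdot\mathbf v)+\mu(\partial_2v_1-\partial_1v_2)\nu^\perp$. Sector: $W=\{\mathbf x\in\mathbb R^2:\mathbf x\ne\mathbf 0,\ \theta_m<\arg(x_1+\mathrm ix_2)<\theta_M\}$; its sides are $\Gamma^-=\{\mathbf x\ne\mathbf 0:\arg(x_1+\mathrm ix_2)=\theta_m\}$ and $\Gamma^+=\{\mathbf x\ne\mathbf 0:\arg(x_1+\mathrm ix_2)=\theta_M\}$. $B_h$ is the open disk of radius $h$ centred at $\mathbf 0$; $S_h=W\cap B_h$; $\Gamma_h^\pm=\Gamma^\pm\cap B_h$. Set $k_p=\omega/\sqrt{\lambda+2\mu}$, $k_s=\omega/\sqrt\mu$. The elastic Herglotz wave function with kernel $(g_{jp},g_{js})\in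 L^2(\mathbb S^1)^2$ is $$\mathbf v_j(\mathbf x)=e^{-\mathrm i\pi/4}\int_{\mathbb S^1}\Big\{\sqrt{\tfrac{k_p}{\omega}}\,e^{\mathrm ik_p\mathbf d\cdot\mathbf x}g_{jp}(\mathbf d)\,\mathbf d+\sqrt{\tfrac{k_s}{\omega}}\,e^{\mathrm ik_s\mathbf d\cdot\mathbf x}g_{js}(\mathbf d)\,\mathbf d^\perp\Big\}\mathrm d\sigma(\mathbf d),$$ where $\mathbf d^\perp\in\mathbb S^1$ is perpendicular to $\mathbf d$ (rotation of $\mathbf d$ by $\pi/2$). *)

theory Defs
  imports "HOL-Analysis.Analysis"
begin

type_synonym plane = "real^2"

section \<open>Smooth functions and distributions on the plane\<close>

definition pd :: "2 \<Rightarrow> (plane \<Rightarrow> 'b) \<Rightarrow> plane \<Rightarrow> 'b::real_normed_vector" where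
  "pd i f x = frechet_derivative f (at x) (axis i 1)"

primrec C_k :: "nat \<Rightarrow> (plane \<Rightarrow> 'b::real_normed_vector) \<Rightarrow> bool" where
  "C_k 0 f \<longleftrightarrow> continuous_on UNIV f"
| "C_k (Suc k) f \<longleftrightarrow> (\<forall>x. f differentiable (at x)) \<and> (\<forall>i. C_k k (pd i f))"

definition C_infinity :: "(plane \<Rightarrow> 'b::real_normed_vector) \<Rightarrow> bool" where
  "C_infinity f \<longleftrightarrow> (\<forall>k. C_k k f)"

definition supp :: "(plane \<Rightarrow> real) \<Rightarrow> plane set" where
  "supp \<phi> = closure {x. \<phi> x \<noteq> 0}"

definition test_function :: "plane set \<Rightarrow> (plane \<Rightarrow> real) \<Rightarrow> bool" where
  "test_function \<Omega> \<phi> \<longleftrightarrow> C_infinity \<phi> \<and> compact (supp \<phi>) \<and> supp \<phi> \<subseteq> \<Omega>"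

text \<open>Distributions are represented by their action on real scalar test functions and take
  values in the target space of the functions they generalise (for instance
  \<^typ>\<open>complex^2\<close>); for complex test functions the pairing is determined by linearity.\<close>

type_synonym 'b distribution = "(plane \<Rightarrow> real) \<Rightarrow> 'b"

definition regular_distribution ::
    "plane set \<Rightarrow> (plane \<Rightarrow> 'b::{banach, second_countable_topology}) \<Rightarrow> 'b distribution" where
  "regular_distribution \<Omega> f \<phi> = (LINT x|lebesgue_on \<Omega>. \<phi> x *\<^sub>R f x)"

definition dpd :: "2 \<Rightarrow> 'b::real_normed_vector distribution \<Rightarrow> 'b distribution" where
  "dpd i T \<phi> = - T (pd i \<phi>)"

definition ddiv :: "(complex^2) distribution \<Rightarrow> complex distribution" where
  "ddiv T \<phi> = (\<Sum>i\<in>UNIV. dpd i T \<phi> $ i)"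

definition lame :: "real \<Rightarrow> real \<Rightarrow> (complex^2) distribution \<Rightarrow> (complex^2) distribution" where
  "lame la mu T \<phi> =
     mu *\<^sub>R (\<Sum>i\<in>UNIV. dpd i (dpd i T) \<phi>) + (la + mu) *\<^sub>R (\<chi> k. dpd k (ddiv T) \<phi>)"


section \<open>\<open>L\<^sup>2\<close>, \<open>L\<^sup>\<infinity>\<close>, \<open>H\<^sup>1\<close> and Hoelder classes\<close>

definition L2_mem :: "'a measure \<Rightarrow> ('a \<Rightarrow> 'b::euclidean_space) \<Rightarrow> bool" where
  "L2_mem M f \<longleftrightarrow> f \<in> borel_measurable M \<and> integrable M (\<lambda>x. (norm (f x))\<^sup>2)"

definition L2_norm :: "'a measure \<Rightarrow> ('a \<Rightarrow> 'b::euclidean_space) \<Rightarrow> real" where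
  "L2_norm M f = sqrt (LINT x|M. (norm (f x))\<^sup>2)"

definition Linfinity_mem :: "'a measure \<Rightarrow> ('a \<Rightarrow> real) \<Rightarrow> bool" where
  "Linfinity_mem M f \<longleftrightarrow> f \<in> borel_measurable M \<and> (\<exists>C. AE x in M. \<bar>f x\<bar> \<le> C)"

definition is_weak_pd ::
    "plane set \<Rightarrow> 2 \<Rightarrow> (plane \<Rightarrow> 'b) \<Rightarrow> (plane \<Rightarrow> 'b::euclidean_space) \<Rightarrow> bool" where
  "is_weak_pd \<Omega> i f g \<longleftrightarrow> L2_mem (lebesgue_on \<Omega>) g \<and>
     (\<forall>\<phi>. test_function \<Omega> \<phi> \<longrightarrow>
        dpd i (regular_distribution \<Omega> f) \<phi> = regular_distribution \<Omega> g \<phi>)"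

definition H1_mem :: "plane set \<Rightarrow> (plane \<Rightarrow> 'b::euclidean_space) \<Rightarrow> bool" where
  "H1_mem \<Omega> f \<longleftrightarrow> L2_mem (lebesgue_on \<Omega>) f \<and> (\<forall>i. \<exists>g. is_weak_pd \<Omega> i f g)"

text \<open>For \<open>f\<close> in \<open>H\<^sup>1(\<Omega>)\<close> the weak derivative exists and is unique up to null sets of \<open>\<Omega>\<close>;
  it is only ever used under integrals over \<open>\<Omega>\<close>.\<close>

definition weak_pd :: "plane set \<Rightarrow> 2 \<Rightarrow> (plane \<Rightarrow> 'b) \<Rightarrow> plane \<Rightarrow> 'b::euclidean_space" where
  "weak_pd \<Omega> i f = (SOME g. is_weak_pd \<Omega> i f g)"

definition H1_norm :: "plane set \<Rightarrow> (plane \<Rightarrow> 'b::euclidean_space) \<Rightarrow> real" where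
  "H1_norm \<Omega> f = sqrt ((L2_norm (lebesgue_on \<Omega>) f)\<^sup>2
     + (\<Sum>i\<in>UNIV. (L2_norm (lebesgue_on \<Omega>) (weak_pd \<Omega> i f))\<^sup>2))"

definition holder_on :: "real \<Rightarrow> plane set \<Rightarrow> (plane \<Rightarrow> 'b::metric_space) \<Rightarrow> bool" where
  "holder_on \<alpha> S f \<longleftrightarrow> (\<exists>C. \<forall>x\<in>S. \<forall>y\<in>S. dist (f x) (f y) \<le> C * dist x y powr \<alpha>)"

text \<open>Membership of an almost everywhere defined function in \<open>C\<^sup>\<alpha>\<close> of the closure of an open
  set \<open>S\<close> refers to a representative.\<close>

definition holder_class ::
    "real \<Rightarrow> plane set \<Rightarrow> (plane \<Rightarrow> 'b::euclidean_space) \<Rightarrow> bool" where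
  "holder_class \<alpha> S f \<longleftrightarrow>
     (\<exists>F. holder_on \<alpha> (closure S) F \<and> (AE x in lebesgue_on S. f x = F x))"


section \<open>Lipschitz domains and boundary measure\<close>

definition lipschitz_boundary :: "plane set \<Rightarrow> bool" where
  "lipschitz_boundary \<Omega> \<longleftrightarrow>
     (\<forall>p\<in>frontier \<Omega>. \<exists>(A :: plane \<Rightarrow> plane) (\<psi> :: real \<Rightarrow> real) r L.
        orthogonal_transformation A \<and> L-lipschitz_on UNIV \<psi> \<and> r > 0 \<and>
        (\<forall>x\<in>ball p r. x \<in> \<Omega> \<longleftrightarrow> A (x - p) $ 2 > \<psi> (A (x - p) $ 1)))"

definition bounded_lipschitz_domain :: "plane set \<Rightarrow> bool" where
  "bounded_lipschitz_domain \<Omega> \<longleftrightarrow>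
     open \<Omega> \<and> connected \<Omega> \<and> \<Omega> \<noteq> {} \<and> bounded \<Omega> \<and> lipschitz_boundary \<Omega>"

definition hausdorff1_delta :: "real \<Rightarrow> plane set \<Rightarrow> ennreal" where
  "hausdorff1_delta \<delta> A =
     (INF C \<in> {C :: nat \<Rightarrow> plane set.
          A \<subseteq> (\<Union>i. C i) \<and> (\<forall>i. bounded (C i) \<and> diameter (C i) \<le> \<delta>)}.
        \<Sum>i. ennreal (diameter (C i)))"

text \<open>One-dimensional Hausdorff measure on the Borel sets (a metric outer measure is countably
  additive there, so \<^const>\<open>measure_of\<close> does not collapse); on a Lipschitz boundary it is
  the arc-length measure.\<close>

definition hausdorff1 :: "plane measure" where
  "hausdorff1 = measure_of UNIV (sets borel) (\<lambda>A. SUP \<delta>\<in>{0<..}. hausdorff1_delta \<delta> A)"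


section \<open>Boundary values\<close>

text \<open>The trace operator is the \<open>H\<^sup>1(\<Omega>)\<close>-to-\<open>L\<^sup>2(\<partial>\<Omega>)\<close> continuous extension of the restriction
  of smooth functions to the boundary.\<close>

definition has_trace ::
    "plane set \<Rightarrow> (plane \<Rightarrow> 'b) \<Rightarrow> (plane \<Rightarrow> 'b::euclidean_space) \<Rightarrow> bool" where
  "has_trace \<Omega> u g \<longleftrightarrow> H1_mem \<Omega> u \<and> g \<in> borel_measurable borel \<and>
     (\<exists>\<Phi> :: nat \<Rightarrow> plane \<Rightarrow> 'b. (\<forall>n. C_infinity (\<Phi> n)) \<and>
        (\<lambda>n. H1_norm \<Omega> (\<lambda>x. \<Phi> n x - u x)) \<longlonglongrightarrow> 0 \<and>
        (\<lambda>n. \<integral>\<^sup>+x\<in>frontier \<Omega>. ennreal ((norm (\<Phi> n x - g x))\<^sup>2) \<partial>hausdorff1) \<longlonglongrightarrow> 0)"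

definition trace_eq_on ::
    "plane set \<Rightarrow> plane set \<Rightarrow> (plane \<Rightarrow> 'b) \<Rightarrow> (plane \<Rightarrow> 'b::euclidean_space) \<Rightarrow> bool" where
  "trace_eq_on \<Omega> \<Gamma> u v \<longleftrightarrow>
     (\<exists>g g'. has_trace \<Omega> u g \<and> has_trace \<Omega> v g' \<and>
        (AE x in hausdorff1. x \<in> \<Gamma> \<longrightarrow> g x = g' x))"

definition perp :: "plane \<Rightarrow> plane" where
  "perp d = vector [- (d $ 2), d $ 1]"

definition cvec :: "plane \<Rightarrow> complex^2" where
  "cvec d = (\<chi> k. complex_of_real (d $ k))"

text \<open>The traction formula as a function of the Jacobian \<open>J $ k $ i = \<partial>\<^sub>i v\<^sub>k\<close> and of a
  direction \<open>n\<close>.\<close>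

definition traction_formula :: "real \<Rightarrow> real \<Rightarrow> complex^2^2 \<Rightarrow> plane \<Rightarrow> complex^2" where
  "traction_formula la mu J n =
     (2 * mu) *\<^sub>R (J *v cvec n) + la *\<^sub>R ((J $ 1 $ 1 + J $ 2 $ 2) *s cvec n)
     + mu *\<^sub>R ((J $ 1 $ 2 - J $ 2 $ 1) *s cvec (perp n))"

definition weak_jacobian :: "plane set \<Rightarrow> (plane \<Rightarrow> complex^2) \<Rightarrow> plane \<Rightarrow> complex^2^2" where
  "weak_jacobian \<Omega> v x = (\<chi> k i. weak_pd \<Omega> i v x $ k)"

text \<open>Weak normal trace. If \<open>F\<^sub>1, F\<^sub>2\<close> are in \<open>L\<^sup>2(\<Omega>)\<close> with \<open>D = \<partial>\<^sub>1F\<^sub>1 + \<partial>\<^sub>2F\<^sub>2\<close> in \<open>L\<^sup>2(\<Omega>)\<close>, then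
  the boundary value of \<open>\<nu>\<^sub>1F\<^sub>1 + \<nu>\<^sub>2F\<^sub>2\<close> (\<open>\<nu>\<close> the outward unit normal) is the functional given by
  the divergence theorem, which for smooth \<open>F\<close> is
  \<open>\<psi> \<mapsto> \<integral>\<^bsub>\<partial>\<Omega>\<^esub> \<psi> (\<nu>\<^sub>1F\<^sub>1 + \<nu>\<^sub>2F\<^sub>2) d\<sigma>\<close>.\<close>

definition is_weak_div ::
    "plane set \<Rightarrow> (2 \<Rightarrow> plane \<Rightarrow> 'b) \<Rightarrow> (plane \<Rightarrow> 'b::euclidean_space) \<Rightarrow> bool" where
  "is_weak_div \<Omega> F D \<longleftrightarrow> L2_mem (lebesgue_on \<Omega>) D \<and>
     (\<forall>\<phi>. test_function \<Omega> \<phi> \<longrightarrow>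
        (\<Sum>i\<in>UNIV. dpd i (regular_distribution \<Omega> (F i)) \<phi>) = regular_distribution \<Omega> D \<phi>)"

definition weak_div :: "plane set \<Rightarrow> (2 \<Rightarrow> plane \<Rightarrow> 'b) \<Rightarrow> plane \<Rightarrow> 'b::euclidean_space" where
  "weak_div \<Omega> F = (SOME D. is_weak_div \<Omega> F D)"

definition normal_trace ::
    "plane set \<Rightarrow> (2 \<Rightarrow> plane \<Rightarrow> 'b::euclidean_space) \<Rightarrow> (plane \<Rightarrow> real) \<Rightarrow> 'b" where
  "normal_trace \<Omega> F \<psi> =
     (LINT x|lebesgue_on \<Omega>. (\<Sum>i\<in>UNIV. pd i \<psi> x *\<^sub>R F i x) + \<psi> x *\<^sub>R weak_div \<Omega> F x)"

text \<open>The traction formula is linear in the normal: \<open>T\<^sub>\<nu>v = \<nu>\<^sub>1 T\<^bsub>e1\<^esub>v + \<nu>\<^sub>2 T\<^bsub>e2\<^esub>v\<close>. Its row-wise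
  divergence is the Lame operator applied to \<open>v\<close>, which is in \<open>L\<^sup>2(\<Omega>)\<close> for solutions of the
  equations considered, so that the functional below is the traction in \<open>H\<^sup>-\<^sup>1\<^sup>/\<^sup>2(\<partial>\<Omega>)\<^sup>2\<close>.\<close>

definition traction ::
    "real \<Rightarrow> real \<Rightarrow> plane set \<Rightarrow> (plane \<Rightarrow> complex^2) \<Rightarrow> (plane \<Rightarrow> real) \<Rightarrow> complex^2" where
  "traction la mu \<Omega> v =
     normal_trace \<Omega> (\<lambda>i x. traction_formula la mu (weak_jacobian \<Omega> v x) (axis i 1))"

text \<open>Equality on a relatively open part \<open>\<Gamma>\<close> of the boundary: the functionals agree on test
  functions of the plane whose support meets the boundary only inside \<open>\<Gamma>\<close>.\<close>

definition traction_eq_on ::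
    "real \<Rightarrow> real \<Rightarrow> plane set \<Rightarrow> plane set
      \<Rightarrow> (plane \<Rightarrow> complex^2) \<Rightarrow> (plane \<Rightarrow> complex^2) \<Rightarrow> bool" where
  "traction_eq_on la mu \<Omega> \<Gamma> u v \<longleftrightarrow>
     (\<forall>\<psi>. test_function UNIV \<psi> \<and> supp \<psi> \<inter> frontier \<Omega> \<subseteq> \<Gamma> \<longrightarrow>
        traction la mu \<Omega> u \<psi> = traction la mu \<Omega> v \<psi>)"


section \<open>Sectors and elastic Herglotz wave functions\<close>

definition polar_angle :: "plane \<Rightarrow> real" where
  "polar_angle x = Arg (Complex (x $ 1) (x $ 2))"

definition sector :: "real \<Rightarrow> real \<Rightarrow> plane set" where
  "sector \<theta>m \<theta>M = {x. x \<noteq> 0 \<and> \<theta>m < polar_angle x \<and> polar_angle x < \<theta>M}"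

definition truncated_sector :: "real \<Rightarrow> real \<Rightarrow> real \<Rightarrow> plane set" where
  "truncated_sector \<theta>m \<theta>M h = sector \<theta>m \<theta>M \<inter> ball 0 h"

definition ray :: "real \<Rightarrow> plane set" where
  "ray \<theta> = {x. x \<noteq> 0 \<and> polar_angle x = \<theta>}"

definition circle_measure :: "plane measure" where
  "circle_measure =
     distr (restrict_space lborel {0..<2 * pi}) borel (\<lambda>t. vector [cos t, sin t])"

definition k_p :: "real \<Rightarrow> real \<Rightarrow> real \<Rightarrow> real" where
  "k_p la mu \<omega> = \<omega> / sqrt (la + 2 * mu)"

definition k_s :: "real \<Rightarrow> real \<Rightarrow> real" where
  "k_s mu \<omega> = \<omega> / sqrt mu"

definition herglotz ::
    "real \<Rightarrow> real \<Rightarrow> real \<Rightarrow> (plane \<Rightarrow> complex) \<Rightarrow> (plane \<Rightarrow> complex) \<Rightarrow> plane \<Rightarrow> complex^2" where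
  "herglotz la mu \<omega> gp gs x =
     exp (- \<i> * complex_of_real (pi / 4)) *s
       (LINT d|circle_measure.
          (complex_of_real (sqrt (k_p la mu \<omega> / \<omega>))
             * exp (\<i> * complex_of_real (k_p la mu \<omega> * (d \<bullet> x))) * gp d) *s cvec d
        + (complex_of_real (sqrt (k_s mu \<omega> / \<omega>))
             * exp (\<i> * complex_of_real (k_s mu \<omega> * (d \<bullet> x))) * gs d) *s cvec (perp d))"

end

theory Submission
  imports Defs
begin

text \<open>
  Let \<open>Q = (1 + V) w\<close>, with vertex value \<open>Q(0)\<close> taken from its Hoelder representative. The difference
  \<open>U = w - v\<close> has vanishing trace and traction on both sides of the sector, so it can be tested near
  the vertex without boundary terms; a cutoff at scale \<open>\<delta>\<close> around the vertex itself costs only the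
  \<open>L\<^sup>2\<close> norm of \<open>\<nabla>U\<close> at distance \<open>O(\<delta>)\<close>. For \<open>\<sigma> = \<plusminus>i\<close> and \<open>f\<close> with \<open>\<partial>\<^sub>1f + \<sigma>\<partial>\<^sub>2f = 0\<close> the field
  \<open>(f, \<sigma>f)\<close> is the gradient of a harmonic function, hence annihilated by the Lame operator, whence
  \<open>\<integral> f ((Q - v)\<^sub>1 + \<sigma>(Q - v)\<^sub>2) = O(\<epsilon>\<^sup>4)\<close> over the sector of radius \<open>h\<close> for the kernels, in \<open>z = x\<^sub>1 + \<sigma>x\<^sub>2\<close>,
  \<open>f(z) = \<epsilon>\<^sup>4 / (\<epsilon> + z)\<^sup>4\<close>, which concentrate at the vertex at scale \<open>\<epsilon>\<close>. Their mass is \<open>\<epsilon>\<^sup>2\<close> times the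
  integral of \<open>e\<^sup>-\<^sup>2\<^sup>\<sigma>\<^sup>\<theta> / 6\<close> over \<open>(\<theta>m, \<theta>M)\<close>, which is nonzero as the opening is not \<open>\<pi>\<close>.

  Replacing \<open>v\<close> by the Herglotz wave \<open>v\<^sub>j\<close>, whose Lipschitz constant is \<open>O(j\<^sup>\<beta>)\<close> with
  \<open>\<beta> = max \<beta>1 \<beta>2\<close>, costs \<open>O(\<epsilon> j\<^sup>\<beta> + j\<^sup>-\<^sup>\<gamma> / \<epsilon>)\<close> after division by \<open>\<epsilon>\<^sup>2\<close>; with \<open>\<epsilon> = j\<^sup>-\<^sup>\<kappa>\<close>,
  \<open>\<beta> < \<kappa> < \<gamma>\<close>, this tends to \<open>0\<close>, so \<open>v\<^sub>j(0) \<rightarrow> Q(0)\<close>. Finally \<open>V w = (Q - Q(0)) + (Q(0) - v) + (v - w)\<close>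
  is averaged over the sector of radius \<open>\<rho>\<close>: the first term by Hoelder continuity, the second by
  comparison with \<open>v\<^sub>j\<close> for \<open>j\<^sup>-\<^sup>\<kappa> \<approx> \<rho>\<close>, the third by the Poincare inequality for functions with
  vanishing trace on a side.
\<close>

subsection \<open>Smooth functions\<close>

text \<open>The sector may be wider than a half-plane, so no exponential of a linear function decays
  on all of it. The kernel \<epsilon>^4 / (\<epsilon> + z)^4 works for every opening: the angles
  stay in (-pi, pi), so its pole on the negative axis is off the closed sector. The power 4 is the
  least integer for which |f| |x| stays integrable at infinity, so Lipschitz errors are
  O(\<epsilon>^3) against the mass \<epsilon>^2; away from the vertex everything is O(\<epsilon>^4).
  The choices \<sigma> = i and \<sigma> = -i recover both components of a vector. At opening pi the
  \<epsilon>^2 term would vanish, since e^(-2 \<sigma> \<theta>) integrates to 0 over a period.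

  The cutoff at the vertex is forced: the data are given on the open sides, and the vertex need not
  lie in \<Gamma>. Its gradient has size 1/\<delta> on an area \<delta>^2, so Cauchy-Schwarz alone
  gives no decay; absolute continuity of the energy of U does. The part of the stress of U that does
  not combine into \<partial>1 f + \<sigma> \<partial>2 f is a rotated gradient, which one
  integration by parts removes because U has zero trace.\<close>

lemma pd_eqI:
  assumes "(f has_derivative f') (at x)"
  shows "pd i f x = f' (axis i 1)"
  unfolding pd_def using frechet_derivative_at[OF assms] by simp

lemma has_derivative_pd:
  fixes f :: "plane \<Rightarrow> 'b::real_normed_vector"
  assumes "f differentiable (at x)"
  shows "(f has_derivative (\<lambda>h. \<Sum>i\<in>UNIV. h $ i *\<^sub>R pd i f x)) (at x)"
proof -
  let ?D = "frechet_derivative f (at x)"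
  have D: "(f has_derivative ?D) (at x)"
    using assms by (simp add: frechet_derivative_works)
  interpret bounded_linear ?D using D by (rule has_derivative_bounded_linear)
  have "?D h = (\<Sum>i\<in>UNIV. h $ i *\<^sub>R pd i f x)" for h
  proof -
    have "h = (\<Sum>i\<in>UNIV. h $ i *\<^sub>R axis i 1)"
      by (simp add: vec_eq_iff axis_def if_distrib sum.delta cong: if_cong)
    then have "?D h = ?D (\<Sum>i\<in>UNIV. h $ i *\<^sub>R axis i 1)" by simp
    then show ?thesis by (simp add: sum scaleR pd_def)
  qed
  then have "?D = (\<lambda>h. \<Sum>i\<in>UNIV. h $ i *\<^sub>R pd i f x)" by auto
  then show ?thesis using D by simp
qed

lemma pd_add:
  assumes "f differentiable (at x)" "g differentiable (at x)"
  shows "pd i (\<lambda>x. f x + g x) x = pd i f x + pd i g x"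
  using pd_eqI[OF has_derivative_add[OF assms[unfolded frechet_derivative_works]]]
  by (simp add: pd_def)

lemma pd_bounded_linear:
  assumes "bounded_linear T" "f differentiable (at x)"
  shows "pd i (\<lambda>x. T (f x)) x = T (pd i f x)"
  using pd_eqI[OF bounded_linear.has_derivative[OF assms(1) assms(2)[unfolded frechet_derivative_works]]]
  by (simp add: pd_def)

lemma pd_diff:
  assumes "f differentiable (at x)" "g differentiable (at x)"
  shows "pd i (\<lambda>x. f x - g x) x = pd i f x - pd i g x"
  using pd_eqI[OF has_derivative_diff[OF assms[unfolded frechet_derivative_works]]]
  by (simp add: pd_def)

lemma pd_bilinear:
  assumes "bounded_bilinear pr" "f differentiable (at x)" "g differentiable (at x)"
  shows "pd i (\<lambda>x. pr (f x) (g x)) x = pr (f x) (pd i g x) + pr (pd i f x) (g x)"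
  using pd_eqI[OF bounded_bilinear.FDERIV[OF assms(1) assms(2,3)[unfolded frechet_derivative_works]]]
  by (simp add: pd_def)

lemmas pd_mult = pd_bilinear[OF bounded_bilinear_mult]
lemmas pd_scaleR = pd_bilinear[OF bounded_bilinear_scaleR]

lemma C_k_SucD: "C_k (Suc k) f \<Longrightarrow> C_k k f"
proof (induction k arbitrary: f)
  case 0
  then have "\<forall>x. f differentiable (at x)" by simp
  then show ?case
    by (simp add: continuous_on_eq_continuous_at differentiable_imp_continuous_within)
next
  case (Suc k)
  then show ?case by simp
qed

lemma C_k_const: "C_k k (\<lambda>x. c)"
proof (induction k arbitrary: c)
  case (Suc k)
  have "pd i (\<lambda>x. c) = (\<lambda>x. 0)" for i
    using pd_eqI[of "\<lambda>x. c" "\<lambda>x. 0"] by auto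
  then show ?case using Suc by simp
qed simp

lemma C_k_add: "C_k k f \<Longrightarrow> C_k k g \<Longrightarrow> C_k k (\<lambda>x. f x + g x)"
proof (induction k arbitrary: f g)
  case 0
  then show ?case by (simp add: continuous_on_add)
next
  case (Suc k)
  have "pd i (\<lambda>x. f x + g x) = (\<lambda>x. pd i f x + pd i g x)" for i
    using Suc.prems by (auto simp: pd_add)
  then show ?case using Suc by simp
qed

lemma C_k_bounded_linear:
  assumes "bounded_linear T"
  shows "C_k k f \<Longrightarrow> C_k k (\<lambda>x. T (f x))"
proof (induction k arbitrary: f)
  case 0
  then show ?case using assms by (simp add: bounded_linear.continuous_on)
next
  case (Suc k)
  have "pd i (\<lambda>x. T (f x)) = (\<lambda>x. T (pd i f x))" for i
    using Suc.prems by (auto simp: pd_bounded_linear[OF assms])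
  moreover have "(\<lambda>x. T (f x)) differentiable (at x)" for x
    using Suc.prems bounded_linear.has_derivative[OF assms]
    unfolding differentiable_def by (simp add: differentiable_def) blast
  ultimately show ?case using Suc by simp
qed

lemma C_k_bilinear:
  assumes "bounded_bilinear pr"
  shows "C_k k f \<Longrightarrow> C_k k g \<Longrightarrow> C_k k (\<lambda>x. pr (f x) (g x))"
proof (induction k arbitrary: f g)
  case 0
  then show ?case using assms by (simp add: bounded_bilinear.continuous_on)
next
  case (Suc k)
  have "pd i (\<lambda>x. pr (f x) (g x)) = (\<lambda>x. pr (f x) (pd i g x) + pr (pd i f x) (g x))" for i
    using Suc.prems by (auto simp: pd_bilinear[OF assms])
  moreover have "(\<lambda>x. pr (f x) (g x)) differentiable (at x)" for x
    using Suc.prems bounded_bilinear.FDERIV[OF assms]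
    unfolding differentiable_def by (simp add: differentiable_def) blast
  moreover have "C_k k f" "C_k k g" using Suc.prems C_k_SucD by blast+
  ultimately show ?case using Suc by (simp add: C_k_add)
qed

lemma C_k_inverse:
  fixes f :: "plane \<Rightarrow> 'a::real_normed_field"
  assumes "\<And>x. f x \<noteq> 0"
  shows "C_k k f \<Longrightarrow> C_k k (\<lambda>x. inverse (f x))"
proof (induction k)
  case 0
  then show ?case using assms by (simp add: continuous_on_inverse)
next
  case (Suc k)
  have d: "((\<lambda>x. inverse (f x)) has_derivative
      (\<lambda>h. - (inverse (f x) * frechet_derivative f (at x) h * inverse (f x)))) (at x)" for x
    using Suc.prems assms Deriv.has_derivative_inverse[of f x "frechet_derivative f (at x)" UNIV]
    by (simp add: frechet_derivative_works)
  have "pd i (\<lambda>x. inverse (f x)) = (\<lambda>x. - (inverse (f x) * pd i f x * inverse (f x)))" for i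
    using pd_eqI[OF d] by (auto simp: pd_def)
  moreover have "C_k k (\<lambda>x. inverse (f x))" using Suc C_k_SucD by blast
  ultimately show ?case using Suc.prems d
    by (auto intro!: C_k_bounded_linear[OF bounded_linear_minus[OF bounded_linear_ident]]
        C_k_bilinear[OF bounded_bilinear_mult] simp: differentiable_def)
qed

lemma C_infinity_iff:
  "C_infinity f \<longleftrightarrow> (\<forall>x. f differentiable (at x)) \<and> (\<forall>i. C_infinity (pd i f))"
  unfolding C_infinity_def
  by (metis C_k.simps(2) C_k_SucD)

lemma C_infinity_differentiable: "C_infinity f \<Longrightarrow> f differentiable (at x)"
  and C_infinity_pd: "C_infinity f \<Longrightarrow> C_infinity (pd i f)"
  using C_infinity_iff by blast+

lemma C_infinity_continuous: "C_infinity f \<Longrightarrow> continuous_on S f"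
  unfolding C_infinity_def by (metis C_k.simps(1) continuous_on_subset subset_UNIV)

lemma C_infinity_const: "C_infinity (\<lambda>x. c)"
  by (simp add: C_infinity_def C_k_const)

lemma C_infinity_add: "C_infinity f \<Longrightarrow> C_infinity g \<Longrightarrow> C_infinity (\<lambda>x. f x + g x)"
  by (simp add: C_infinity_def C_k_add)

lemma C_infinity_bounded_linear:
  "bounded_linear T \<Longrightarrow> C_infinity f \<Longrightarrow> C_infinity (\<lambda>x. T (f x))"
  by (simp add: C_infinity_def C_k_bounded_linear)

lemma C_infinity_minus: "C_infinity f \<Longrightarrow> C_infinity (\<lambda>x. - f x)"
  by (rule C_infinity_bounded_linear[OF bounded_linear_minus[OF bounded_linear_ident]])

lemma C_infinity_diff: "C_infinity f \<Longrightarrow> C_infinity g \<Longrightarrow> C_infinity (\<lambda>x. f x - g x)"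
  using C_infinity_add[of f "\<lambda>x. - g x"] C_infinity_minus[of g] by simp

lemma C_infinity_mult:
  fixes f :: "plane \<Rightarrow> 'a::real_normed_algebra"
  shows "C_infinity f \<Longrightarrow> C_infinity g \<Longrightarrow> C_infinity (\<lambda>x. f x * g x)"
  by (simp add: C_infinity_def C_k_bilinear[OF bounded_bilinear_mult])

lemma C_infinity_scaleR: "C_infinity f \<Longrightarrow> C_infinity g \<Longrightarrow> C_infinity (\<lambda>x. f x *\<^sub>R g x)"
  by (simp add: C_infinity_def C_k_bilinear[OF bounded_bilinear_scaleR])

lemma C_infinity_power:
  fixes f :: "plane \<Rightarrow> 'a::real_normed_algebra_1"
  shows "C_infinity f \<Longrightarrow> C_infinity (\<lambda>x. f x ^ n)"
  by (induction n) (simp_all add: C_infinity_const C_infinity_mult)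

lemma C_infinity_inverse:
  fixes f :: "plane \<Rightarrow> 'a::real_normed_field"
  shows "C_infinity f \<Longrightarrow> (\<And>x. f x \<noteq> 0) \<Longrightarrow> C_infinity (\<lambda>x. inverse (f x))"
  by (simp add: C_infinity_def C_k_inverse)

lemma pd_linear:
  assumes "bounded_linear T"
  shows "pd i T x = T (axis i 1)"
  using pd_eqI[OF bounded_linear_imp_has_derivative[OF assms]] .

lemma C_infinity_linear:
  assumes "bounded_linear T"
  shows "C_infinity T"
proof -
  have "pd i T = (\<lambda>x. T (axis i 1))" for i
    using pd_linear[OF assms] by blast
  then show ?thesis
    using C_infinity_const bounded_linear_imp_differentiable[OF assms]
    by (subst C_infinity_iff) auto
qed

lemma C_infinity_component: "C_infinity (\<lambda>x. x $ i)"
  by (intro C_infinity_linear bounded_linear_vec_nth)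

lemmas C_infinity_intros = C_infinity_const C_infinity_add C_infinity_minus C_infinity_diff
  C_infinity_mult C_infinity_scaleR C_infinity_power C_infinity_component C_infinity_pd

subsection \<open>Smooth cutoffs\<close>

text \<open>The power \<open>m\<close> makes the family closed under differentiation: each
  derivative is a combination of members with larger powers. Smoothness then follows by induction on
  the order, for all \<open>m\<close> at once.\<close>

definition flat_exp :: "nat \<Rightarrow> real \<Rightarrow> real" where
  "flat_exp m t = (if t > 0 then inverse t ^ m * exp (- inverse t) else 0)"

lemma tendsto_flat_exp: "((\<lambda>t. inverse t ^ m * exp (- inverse t)) \<longlongrightarrow> (0::real)) (at_right 0)"
proof -
  have "((\<lambda>s. s ^ m / exp s) \<longlongrightarrow> (0::real)) at_top"
    by (rule tendsto_power_div_exp_0)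
  from filterlim_compose[OF this filterlim_inverse_at_top_right]
  show ?thesis by (simp add: exp_minus divide_inverse)
qed

lemma has_field_derivative_flat_exp:
  "(flat_exp m has_field_derivative flat_exp (m + 2) t - m * flat_exp (m + 1) t) (at t)"
proof -
  consider "t > 0" | "t < 0" | "t = 0" by linarith
  then show ?thesis
  proof cases
    case 1
    have inv: "(inverse has_field_derivative - (inverse t * inverse t)) (at t)"
      using DERIV_inverse[of t UNIV] 1 by (simp add: numeral_2_eq_2)
    have "((\<lambda>t. inverse t ^ m) has_field_derivative - real m * inverse t ^ (m + 1)) (at t)"
      by (rule DERIV_cong[OF DERIV_power[OF inv, of m]]) (cases m; simp add: algebra_simps)
    moreover have "((\<lambda>t. exp (- inverse t)) has_field_derivative exp (- inverse t) * (inverse t * inverse t)) (at t)"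
      using DERIV_fun_exp[OF DERIV_minus[OF inv]] by simp
    ultimately have "((\<lambda>t. inverse t ^ m * exp (- inverse t)) has_field_derivative
        flat_exp (m + 2) t - m * flat_exp (m + 1) t) (at t)"
      by (rule DERIV_cong[OF DERIV_mult]) (use 1 in \<open>simp add: flat_exp_def algebra_simps\<close>)
    then show ?thesis
      by (rule DERIV_cong_ev[OF refl _ refl, THEN iffD1, rotated])
        (use 1 eventually_nhds_in_open[of "{0<..}" t] in \<open>auto elim!: eventually_mono simp: flat_exp_def\<close>)
  next
    case 2
    have "((\<lambda>t. 0) has_field_derivative flat_exp (m + 2) t - m * flat_exp (m + 1) t) (at t)"
      using 2 by (simp add: flat_exp_def)
    then show ?thesis
      by (rule DERIV_cong_ev[OF refl _ refl, THEN iffD1, rotated])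
        (use 2 eventually_nhds_in_open[of "{..<0}" t] in \<open>auto elim!: eventually_mono simp: flat_exp_def\<close>)
  next
    case 3
    \<comment> \<open>To the right of 0 the difference quotient is y^(-m-1) exp(-1/y), so the
      flatness limit for \<open>m + 1\<close> applies.\<close>
    have "((\<lambda>y. (flat_exp m y - flat_exp m 0) / (y - 0)) \<longlongrightarrow> 0) (at_right 0)"
      by (rule Lim_transform_eventually[OF tendsto_flat_exp[of "m + 1"]])
        (auto simp: flat_exp_def eventually_at_filter field_simps)
    moreover have "((\<lambda>y. (flat_exp m y - flat_exp m 0) / (y - 0)) \<longlongrightarrow> 0) (at_left 0)"
      by (rule Lim_transform_eventually[OF tendsto_const])
        (auto simp: flat_exp_def eventually_at_filter field_simps)
    ultimately show ?thesis using 3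
      by (simp add: has_field_derivative_iff filterlim_split_at flat_exp_def)
  qed
qed

lemma C_infinity_flat_exp:
  assumes "C_infinity f"
  shows "C_infinity (\<lambda>x. flat_exp m (f x))"
proof -
  have "C_k k (\<lambda>x. flat_exp m (f x))" for k m
  proof (induction k arbitrary: m)
    case 0
    have "continuous_on UNIV (flat_exp m)"
      by (rule DERIV_continuous_on[OF has_field_derivative_flat_exp])
    then show ?case
      by (auto intro!: continuous_on_compose2[of UNIV "flat_exp m"] C_infinity_continuous[OF assms])
  next
    case (Suc k)
    have hd: "((\<lambda>x. flat_exp m (f x)) has_derivative (\<lambda>h. (flat_exp (m + 2) (f x) - m * flat_exp (m + 1) (f x)) *
        frechet_derivative f (at x) h)) (at x)" for x
      using diff_chain_at[OF C_infinity_differentiable[OF assms, unfolded frechet_derivative_works]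
          has_field_derivative_flat_exp[unfolded has_field_derivative_def]]
      by (simp add: o_def)
    have "pd i (\<lambda>x. flat_exp m (f x)) = (\<lambda>x. pd i f x * (flat_exp (m + 2) (f x) + (- real m) * flat_exp (m + 1) (f x)))" for i
      using pd_eqI[OF hd] by (auto simp: pd_def algebra_simps)
    moreover have "C_k k (pd i f)" for i
      using C_infinity_pd[OF assms] by (simp add: C_infinity_def)
    moreover have "C_k k (\<lambda>x. pd i f x * (flat_exp (m + 2) (f x) + (- real m) * flat_exp (m + 1) (f x)))" for i
      by (intro C_k_add C_k_bilinear[OF bounded_bilinear_mult] C_k_const Suc.IH \<open>C_k k (pd i f)\<close>)
    moreover have "(\<lambda>x. flat_exp m (f x)) differentiable (at x)" for x
      using hd by (rule differentiableI)
    ultimately show ?case by simp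
  qed
  then show ?thesis by (simp add: C_infinity_def)
qed

lemma flat_exp_0_nonneg: "flat_exp 0 t \<ge> 0"
  and flat_exp_0_pos_iff: "flat_exp 0 t > 0 \<longleftrightarrow> t > 0"
  and flat_exp_0_eq_0_iff: "flat_exp 0 t = 0 \<longleftrightarrow> t \<le> 0"
  by (auto simp: flat_exp_def)

definition smooth_step :: "real \<Rightarrow> real" where
  "smooth_step t = flat_exp 0 t / (flat_exp 0 t + flat_exp 0 (1 - t))"

lemma smooth_step_denom: "flat_exp 0 t + flat_exp 0 (1 - t) > 0"
  using flat_exp_0_nonneg[of t] flat_exp_0_nonneg[of "1 - t"]
    flat_exp_0_pos_iff[of t] flat_exp_0_pos_iff[of "1 - t"]
  by (cases "t > 0") auto

lemma smooth_step_0: "t \<le> 0 \<Longrightarrow> smooth_step t = 0"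
  and smooth_step_1: "t \<ge> 1 \<Longrightarrow> smooth_step t = 1"
  and smooth_step_bounds: "0 \<le> smooth_step t" "smooth_step t \<le> 1"
  using smooth_step_denom[of t] flat_exp_0_nonneg[of t] flat_exp_0_nonneg[of "1 - t"]
    flat_exp_0_eq_0_iff[of t] flat_exp_0_eq_0_iff[of "1 - t"]
  by (auto simp: smooth_step_def)

lemma C_infinity_smooth_step:
  assumes "C_infinity f"
  shows "C_infinity (\<lambda>x. smooth_step (f x))"
  unfolding smooth_step_def divide_inverse
  by (intro C_infinity_intros C_infinity_inverse C_infinity_flat_exp assms)
    (metis less_irrefl smooth_step_denom)

subsection \<open>Square integrable functions\<close>

lemma integrable_dominated:
  fixes f :: "'a \<Rightarrow> 'b::{banach, second_countable_topology}" and g :: "'a \<Rightarrow> real"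
  assumes "integrable M g" "f \<in> borel_measurable M" "AE x in M. norm (f x) \<le> g x"
  shows "integrable M f"
proof (rule Bochner_Integration.integrable_bound[OF assms(1,2)])
  show "AE x in M. norm (f x) \<le> norm (g x)"
    using assms(3) by eventually_elim auto
qed

lemma L2_Cauchy_Schwarz:
  fixes f :: "'a \<Rightarrow> 'b::euclidean_space" and g :: "'a \<Rightarrow> 'c::euclidean_space"
  assumes f: "L2_mem M f" and g: "L2_mem M g"
  shows "integrable M (\<lambda>x. norm (f x) * norm (g x))"
    and "(LINT x|M. norm (f x) * norm (g x)) \<le> L2_norm M f * L2_norm M g"
proof -
  have [measurable]: "f \<in> borel_measurable M" "g \<in> borel_measurable M"
    and int: "integrable M (\<lambda>x. (norm (f x))\<^sup>2)" "integrable M (\<lambda>x. (norm (g x))\<^sup>2)"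
    using f g by (auto simp: L2_mem_def)
  have le: "norm (f x) * norm (g x) \<le> (norm (f x))\<^sup>2 + (norm (g x))\<^sup>2" for x
  proof -
    have "0 \<le> norm (f x) * norm (g x)" by simp
    moreover have "2 * norm (f x) * norm (g x) \<le> (norm (f x))\<^sup>2 + (norm (g x))\<^sup>2"
      by (rule sum_squares_bound)
    ultimately show ?thesis by linarith
  qed
  show I: "integrable M (\<lambda>x. norm (f x) * norm (g x))"
    using le by (intro integrable_dominated[OF Bochner_Integration.integrable_add[OF int]]) (simp_all add: abs_mult)
  let ?I = "LINT x|M. norm (f x) * norm (g x)"
  have "(\<integral>\<^sup>+x. ennreal (norm (f x)) * ennreal (norm (g x)) \<partial>M)\<^sup>2
      \<le> (\<integral>\<^sup>+x. ennreal (norm (f x)) ^ 2 \<partial>M) * (\<integral>\<^sup>+x. ennreal (norm (g x)) ^ 2 \<partial>M)"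
    by (rule Cauchy_Schwarz_nn_integral) measurable
  then have "(ennreal ?I)\<^sup>2 \<le> ennreal (LINT x|M. (norm (f x))\<^sup>2) * ennreal (LINT x|M. (norm (g x))\<^sup>2)"
    using I int by (simp add: ennreal_mult[symmetric] ennreal_power nn_integral_eq_integral)
  then have "?I\<^sup>2 \<le> (LINT x|M. (norm (f x))\<^sup>2) * (LINT x|M. (norm (g x))\<^sup>2)"
    by (simp add: ennreal_power ennreal_mult[symmetric])
  then have "sqrt (?I\<^sup>2) \<le> sqrt ((LINT x|M. (norm (f x))\<^sup>2) * (LINT x|M. (norm (g x))\<^sup>2))"
    by (rule real_sqrt_le_mono)
  then show "?I \<le> L2_norm M f * L2_norm M g"
    by (simp add: L2_norm_def real_sqrt_mult)
qed

lemma L2_norm_nonneg: "L2_norm M f \<ge> 0"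
  by (simp add: L2_norm_def)

lemma L2_mem_bounded:
  fixes f :: "'a \<Rightarrow> 'b::euclidean_space"
  assumes "finite_measure M" "f \<in> borel_measurable M" "\<And>x. x \<in> space M \<Longrightarrow> norm (f x) \<le> B"
  shows "L2_mem M f"
proof -
  interpret finite_measure M by fact
  note [measurable] = assms(2)
  have "integrable M (\<lambda>x. (norm (f x))\<^sup>2)"
    by (rule integrable_const_bound[of _ "B\<^sup>2"]) (auto intro!: power_mono assms(3))
  then show ?thesis using assms(2) by (simp add: L2_mem_def)
qed

lemma L2_mem_L1:
  fixes f :: "'a \<Rightarrow> 'b::euclidean_space"
  assumes M: "finite_measure M" and f: "L2_mem M f"
  shows "integrable M f"
    and "(LINT x|M. norm (f x)) \<le> sqrt (measure M (space M)) * L2_norm M f"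
proof -
  interpret finite_measure M by fact
  have 1: "L2_mem M (\<lambda>x. 1::real)"
    by (rule L2_mem_bounded[OF M, of _ 1]) auto
  show "integrable M f"
    using L2_Cauchy_Schwarz(1)[OF 1 f] f
    by (simp add: L2_mem_def integrable_norm_iff)
  show "(LINT x|M. norm (f x)) \<le> sqrt (measure M (space M)) * L2_norm M f"
    using L2_Cauchy_Schwarz(2)[OF 1 f] by (simp add: L2_norm_def)
qed

lemma L2_mem_add:
  fixes f g :: "'a \<Rightarrow> 'b::euclidean_space"
  assumes f: "L2_mem M f" and g: "L2_mem M g"
  shows "L2_mem M (\<lambda>x. f x + g x)"
proof -
  have [measurable]: "f \<in> borel_measurable M" "g \<in> borel_measurable M"
    and int: "integrable M (\<lambda>x. (norm (f x))\<^sup>2)" "integrable M (\<lambda>x. (norm (g x))\<^sup>2)"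
    using f g by (auto simp: L2_mem_def)
  have le: "(norm (f x + g x))\<^sup>2 \<le> 2 * (norm (f x))\<^sup>2 + 2 * (norm (g x))\<^sup>2" for x
  proof -
    have "(norm (f x + g x))\<^sup>2 \<le> (norm (f x) + norm (g x))\<^sup>2"
      by (intro power_mono norm_triangle_ineq) simp
    also have "\<dots> \<le> 2 * (norm (f x))\<^sup>2 + 2 * (norm (g x))\<^sup>2"
      using sum_squares_bound[of "norm (f x)" "norm (g x)"] by (simp add: power2_sum)
    finally show ?thesis .
  qed
  have "integrable M (\<lambda>x. 2 * (norm (f x))\<^sup>2 + 2 * (norm (g x))\<^sup>2)"
    using int by simp
  then have "integrable M (\<lambda>x. (norm (f x + g x))\<^sup>2)"
    by (rule integrable_dominated) (measurable, use le in simp)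
  then show ?thesis by (simp add: L2_mem_def)
qed

lemma L2_mem_bounded_mult:
  fixes f :: "'a \<Rightarrow> 'b::euclidean_space" and g :: "'a \<Rightarrow> 'c::euclidean_space"
  assumes f: "L2_mem M f" and g: "g \<in> borel_measurable M" "AE x in M. norm (g x) \<le> C * norm (f x)"
  shows "L2_mem M g"
proof -
  have [measurable]: "f \<in> borel_measurable M" "g \<in> borel_measurable M"
    and int: "integrable M (\<lambda>x. (norm (f x))\<^sup>2)"
    using f g by (auto simp: L2_mem_def)
  have "AE x in M. (norm (g x))\<^sup>2 \<le> C\<^sup>2 * (norm (f x))\<^sup>2"
    using g(2) by eventually_elim (simp only: power_mult_distrib[symmetric] power_mono norm_ge_zero)
  then have "integrable M (\<lambda>x. (norm (g x))\<^sup>2)"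
    using int by (intro integrable_dominated[OF integrable_mult_right[OF int], of _ "C\<^sup>2"]) simp_all
  then show ?thesis by (simp add: L2_mem_def)
qed

lemma L2_mem_bounded_linear:
  fixes f :: "'a \<Rightarrow> 'b::euclidean_space" and T :: "'b \<Rightarrow> 'c::euclidean_space"
  assumes "bounded_linear T" "L2_mem M f"
  shows "L2_mem M (\<lambda>x. T (f x))"
proof -
  obtain C where C: "\<And>x. norm (T x) \<le> norm x * C"
    using bounded_linear.bounded[OF assms(1)] by blast
  have "T \<in> borel_measurable borel"
    using assms(1) by (intro borel_measurable_continuous_onI linear_continuous_on)
  then show ?thesis using assms(2) C
    by (intro L2_mem_bounded_mult[OF assms(2), of _ C]) (auto simp: L2_mem_def mult.commute)
qed

lemma L2_mem_diff:
  fixes f g :: "'a \<Rightarrow> 'b::euclidean_space"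
  assumes f: "L2_mem M f" and g: "L2_mem M g"
  shows "L2_mem M (\<lambda>x. f x - g x)"
  using L2_mem_add[OF f L2_mem_bounded_linear[OF bounded_linear_minus[OF bounded_linear_ident] g]] by simp

lemma L2_mem_subset:
  assumes "L2_mem (lebesgue_on A) f" "B \<subseteq> A" "A \<in> sets lebesgue" "B \<in> sets lebesgue"
  shows "L2_mem (lebesgue_on B) f"
proof -
  have "set_integrable lebesgue A (\<lambda>x. (norm (f x))\<^sup>2)"
    using assms by (simp add: L2_mem_def integrable_restrict_space set_integrable_def)
  then have "set_integrable lebesgue B (\<lambda>x. (norm (f x))\<^sup>2)"
    using assms by (auto intro: set_integrable_subset)
  then have "integrable (lebesgue_on B) (\<lambda>x. (norm (f x))\<^sup>2)"
    using assms(4) by (simp add: integrable_restrict_space set_integrable_def)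
  moreover have "f \<in> borel_measurable (lebesgue_on B)"
    using assms(1,2) unfolding L2_mem_def by (blast intro: measurable_restrict_mono)
  ultimately show ?thesis
    unfolding L2_mem_def by blast
qed

lemma L2_norm_subset:
  assumes "L2_mem (lebesgue_on A) f" "B \<subseteq> A" "A \<in> sets lebesgue" "B \<in> sets lebesgue"
  shows "L2_norm (lebesgue_on B) f \<le> L2_norm (lebesgue_on A) f"
  unfolding L2_norm_def
proof (rule real_sqrt_le_mono)
  have A: "integrable lebesgue (\<lambda>x. indicator A x *\<^sub>R (norm (f x))\<^sup>2)"
    using assms by (simp add: L2_mem_def integrable_restrict_space)
  have B: "integrable lebesgue (\<lambda>x. indicator B x *\<^sub>R (norm (f x))\<^sup>2)"
    using L2_mem_subset[OF assms] assms by (simp add: L2_mem_def integrable_restrict_space)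
  have "(LINT x|lebesgue. indicator B x *\<^sub>R (norm (f x))\<^sup>2) \<le> (LINT x|lebesgue. indicator A x *\<^sub>R (norm (f x))\<^sup>2)"
    using assms(2) by (intro integral_mono B A) (auto split: split_indicator)
  then show "(LINT x|lebesgue_on B. (norm (f x))\<^sup>2) \<le> (LINT x|lebesgue_on A. (norm (f x))\<^sup>2)"
    using assms by (simp add: integral_restrict_space)
qed

text \<open>Absolute continuity of the integral gains a decay rate over Cauchy--Schwarz.\<close>

lemma L2_scaled_average_tendsto:
  fixes f :: "plane \<Rightarrow> 'b::euclidean_space"
  assumes f: "L2_mem (lebesgue_on A) f" and A: "A \<in> sets lebesgue"
  shows "((\<lambda>\<rho>. (LINT x|lebesgue_on (A \<inter> ball 0 \<rho>). norm (f x)) / \<rho>) \<longlongrightarrow> 0) (at_right 0)"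
proof -
  let ?N = "\<lambda>\<rho>. LINT x|lebesgue_on (A \<inter> ball 0 \<rho>). (norm (f x))\<^sup>2"
  let ?g = "\<lambda>x. indicator A x *\<^sub>R (norm (f x))\<^sup>2"
  have int: "integrable lebesgue ?g"
    using f A by (simp add: L2_mem_def integrable_restrict_space)
  have N: "?N \<rho> = (LINT x|lebesgue. indicator (ball 0 \<rho>) x *\<^sub>R ?g x)" for \<rho>
    using A sets.Int[OF A fmeasurableD[OF lmeasurable_ball[of 0 \<rho>]]]
    by (simp add: integral_restrict_space indicator_inter_arith mult_ac)
  \<comment> \<open>Dominated convergence along decreasing radii: each point other than the vertex
    eventually leaves the disc, and the vertex is a null set.\<close>
  have "((\<lambda>\<rho>. LINT x|lebesgue. indicator (ball 0 \<rho>) x *\<^sub>R ?g x) \<longlongrightarrow> (LINT x::plane|lebesgue. (0::real))) (at_right 0)"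
  proof (rule tendsto_at_right_sequentially[of 0 1])
    fix S :: "nat \<Rightarrow> real"
    assume S: "\<And>n. 0 < S n" "\<And>n. S n < 1" "decseq S" "S \<longlonglongrightarrow> 0"
    show "(\<lambda>n. LINT x|lebesgue. indicator (ball 0 (S n)) x *\<^sub>R ?g x) \<longlonglongrightarrow> (LINT x::plane|lebesgue. (0::real))"
    proof (rule integral_dominated_convergence[where w = ?g])
      show "AE x in lebesgue. (\<lambda>n. indicator (ball 0 (S n)) x *\<^sub>R ?g x) \<longlonglongrightarrow> 0"
      proof (rule AE_mp[OF AE_not_in[of "{0::plane}"]])
        show "AE x in lebesgue. x \<notin> {0} \<longrightarrow> (\<lambda>n. indicator (ball 0 (S n)) x *\<^sub>R ?g x) \<longlonglongrightarrow> 0"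
        proof (intro AE_I2 impI)
          fix x :: plane assume "x \<notin> {0}"
          then have "norm x > 0" by simp
          with S(4) have "\<forall>\<^sub>F n in sequentially. S n < norm x"
            by (rule order_tendstoD)
          then have "\<forall>\<^sub>F n in sequentially. indicator (ball 0 (S n)) x *\<^sub>R ?g x = 0"
            by eventually_elim simp
          then show "(\<lambda>n. indicator (ball 0 (S n)) x *\<^sub>R ?g x) \<longlonglongrightarrow> 0"
            by (rule tendsto_eventually)
        qed
      qed (simp add: negligible_iff_null_sets[symmetric])
    next
      show "(\<lambda>x. indicator (ball 0 (S n)) x *\<^sub>R ?g x) \<in> borel_measurable lebesgue" for n
        by (intro borel_measurable_scaleR borel_measurable_indicator
            fmeasurableD[OF lmeasurable_ball] borel_measurable_integrable[OF int])
    qed (use int in \<open>auto simp: indicator_def\<close>)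
  qed simp
  then have N0: "(?N \<longlongrightarrow> 0) (at_right 0)"
    by (simp add: N)
  \<comment> \<open>Cauchy-Schwarz against the area pi \<rho>^2 of the disc uses up the division by
    \<rho>. What is left is the L2 norm over the shrinking disc, which tends to 0.\<close>
  have bound: "(LINT x|lebesgue_on (A \<inter> ball 0 \<rho>). norm (f x)) / \<rho> \<le> sqrt pi * sqrt (?N \<rho>)" if "\<rho> > 0" for \<rho>
  proof -
    have sub: "A \<inter> ball 0 \<rho> \<in> lmeasurable"
      using fmeasurable_Int_fmeasurable[OF lmeasurable_ball A] by (simp add: Int_commute)
    have "L2_mem (lebesgue_on (A \<inter> ball 0 \<rho>)) f"
      using L2_mem_subset[OF f _ A] sub by (simp add: fmeasurableD)
    from L2_mem_L1(2)[OF finite_measure_lebesgue_on[OF sub] this]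
    have 1: "(LINT x|lebesgue_on (A \<inter> ball 0 \<rho>). norm (f x)) \<le> sqrt (measure lebesgue (A \<inter> ball 0 \<rho>)) * sqrt (?N \<rho>)"
      using sub by (simp add: L2_norm_def measure_restrict_space fmeasurableD)
    have "measure lebesgue (A \<inter> ball 0 \<rho>) \<le> measure lebesgue (ball (0::plane) \<rho>)"
      using sub by (intro measure_mono_fmeasurable) auto
    also have "\<dots> = pi * \<rho>\<^sup>2"
      using that content_ball[of \<rho> "0::plane"] by (simp add: unit_ball_vol_2)
    finally have "sqrt (measure lebesgue (A \<inter> ball 0 \<rho>)) \<le> sqrt pi * \<rho>"
      using that by (metis abs_of_pos real_sqrt_abs real_sqrt_le_iff real_sqrt_mult)
    then have "sqrt (measure lebesgue (A \<inter> ball 0 \<rho>)) * sqrt (?N \<rho>) \<le> (sqrt pi * \<rho>) * sqrt (?N \<rho>)"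
      by (rule mult_right_mono) simp
    with 1 have "(LINT x|lebesgue_on (A \<inter> ball 0 \<rho>). norm (f x)) \<le> (sqrt pi * \<rho>) * sqrt (?N \<rho>)"
      by linarith
    then show ?thesis using that by (simp add: field_simps)
  qed
  show ?thesis
  proof (rule tendsto_sandwich[where f = "\<lambda>_. 0" and h = "\<lambda>\<rho>. sqrt pi * sqrt (?N \<rho>)"])
    show "\<forall>\<^sub>F \<rho> in at_right 0. 0 \<le> (LINT x|lebesgue_on (A \<inter> ball 0 \<rho>). norm (f x)) / \<rho>"
      by (auto simp: eventually_at_filter)
    show "\<forall>\<^sub>F \<rho> in at_right 0. (LINT x|lebesgue_on (A \<inter> ball 0 \<rho>). norm (f x)) / \<rho> \<le> sqrt pi * sqrt (?N \<rho>)"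
      using bound by (auto simp: eventually_at_filter)
    show "((\<lambda>\<rho>. sqrt pi * sqrt (?N \<rho>)) \<longlongrightarrow> 0) (at_right 0)"
      using tendsto_mult[OF tendsto_const tendsto_real_sqrt[OF N0], of "sqrt pi"] by simp
  qed simp
qed

subsection \<open>Test functions\<close>

lemma pd_cong_open:
  assumes "open U" "x \<in> U" "\<And>y. y \<in> U \<Longrightarrow> f y = g y"
  shows "pd i f x = pd i g x"
proof -
  have "(f has_derivative D) (at x) \<longleftrightarrow> (g has_derivative D) (at x)" for D
    using assms has_derivative_transform_within_open[of f D x UNIV U g]
      has_derivative_transform_within_open[of g D x UNIV U f] by auto
  then show ?thesis by (simp add: pd_def frechet_derivative_def)
qed

lemma not_in_supp: "x \<notin> supp \<phi> \<Longrightarrow> \<phi> x = 0"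
  unfolding supp_def using closure_subset[of "{x. \<phi> x \<noteq> 0}"] by auto

lemma supp_subset:
  assumes "closed K" "\<And>x. x \<notin> K \<Longrightarrow> \<phi> x = 0"
  shows "supp \<phi> \<subseteq> K"
  unfolding supp_def using assms by (intro closure_minimal) auto

lemma closed_supp: "closed (supp \<phi>)"
  by (simp add: supp_def)

lemma pd_const: "pd i (\<lambda>x. c) x = 0"
  using pd_eqI[of "\<lambda>x. c" "\<lambda>x. 0"] by auto

lemma pd_eq_0_outside:
  assumes "closed K" "\<And>x. x \<notin> K \<Longrightarrow> f x = 0" "x \<notin> K"
  shows "pd i f x = 0"
  using pd_cong_open[of "- K" x f "\<lambda>x. 0" i] assms by (simp add: pd_const open_Compl)

lemma supp_pd: "supp (pd i \<phi>) \<subseteq> supp \<phi>"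
  by (rule supp_subset[OF closed_supp]) (rule pd_eq_0_outside[OF closed_supp not_in_supp])

lemma supp_mult: "supp (\<lambda>x. \<phi> x * f x) \<subseteq> supp \<phi>"
  by (rule supp_subset[OF closed_supp]) (simp add: not_in_supp)

lemma test_functionD:
  assumes "test_function \<Omega> \<phi>"
  shows "C_infinity \<phi>" "compact (supp \<phi>)" "supp \<phi> \<subseteq> \<Omega>" "x \<notin> \<Omega> \<Longrightarrow> \<phi> x = 0"
  using assms not_in_supp by (auto simp: test_function_def)

lemma test_function_pd: "test_function \<Omega> \<phi> \<Longrightarrow> test_function \<Omega> (pd i \<phi>)"
  unfolding test_function_def using supp_pd[of i \<phi>] C_infinity_pd[of \<phi> i]
    compact_Int_closed[of "supp \<phi>", OF _ closed_supp[of "pd i \<phi>"]]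
  by (auto simp: Int_absorb1)

lemma test_function_mult:
  "test_function \<Omega> \<phi> \<Longrightarrow> C_infinity f \<Longrightarrow> test_function \<Omega> (\<lambda>x. \<phi> x * f x)"
  unfolding test_function_def using supp_mult[of \<phi> f] C_infinity_mult[of \<phi> f]
    compact_Int_closed[of "supp \<phi>", OF _ closed_supp[of "\<lambda>x. \<phi> x * f x"]]
  by (auto simp: Int_absorb1)

lemma test_function_subset: "test_function A \<phi> \<Longrightarrow> A \<subseteq> B \<Longrightarrow> test_function B \<phi>"
  by (auto simp: test_function_def)

lemma has_vector_derivative_line:
  assumes "f differentiable (at (x + s *\<^sub>R axis i 1))"
  shows "((\<lambda>t. f (x + t *\<^sub>R axis i 1)) has_vector_derivative pd i f (x + s *\<^sub>R axis i 1)) (at s)"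
proof -
  let ?D = "frechet_derivative f (at (x + s *\<^sub>R axis i 1))"
  have D: "(f has_derivative ?D) (at (x + s *\<^sub>R axis i 1))"
    using assms by (simp add: frechet_derivative_works)
  interpret bounded_linear ?D using D by (rule has_derivative_bounded_linear)
  have "((\<lambda>t. x + t *\<^sub>R axis i 1) has_derivative (\<lambda>t. t *\<^sub>R axis i 1)) (at s)"
    by (auto intro!: derivative_eq_intros)
  from diff_chain_at[OF this D] show ?thesis
    by (simp add: o_def has_vector_derivative_def pd_def scaleR)
qed

text \<open>The mean value theorem twice: in direction \<open>i\<close> for the difference of
  \<open>f\<close> between two parallel segments, then in direction \<open>j\<close>. The second
  difference is symmetric in \<open>i\<close> and \<open>j\<close>, which is what yields the
  symmetry of second derivatives.\<close>

lemma mixed_difference: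
  fixes f :: "plane \<Rightarrow> real"
  assumes f: "C_infinity f" and t: "t > 0"
  shows "\<exists>y. norm (y - x) \<le> 2 * t \<and>
    f (x + t *\<^sub>R axis i 1 + t *\<^sub>R axis j 1) - f (x + t *\<^sub>R axis i 1) - f (x + t *\<^sub>R axis j 1) + f x
      = t\<^sup>2 * pd j (pd i f) y"
proof -
  let ?g = "\<lambda>s. f (x + t *\<^sub>R axis j 1 + s *\<^sub>R axis i 1) - f (x + s *\<^sub>R axis i 1)"
  have "DERIV ?g s :> pd i f (x + t *\<^sub>R axis j 1 + s *\<^sub>R axis i 1) - pd i f (x + s *\<^sub>R axis i 1)" for s
    using f by (intro DERIV_diff; simp only: has_real_derivative_iff_has_vector_derivative)
      (rule has_vector_derivative_line, rule C_infinity_differentiable, assumption)+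
  from MVT2[OF t this] obtain s where s: "0 < s" "s < t"
    and 1: "?g t - ?g 0 = (t - 0) * (pd i f (x + t *\<^sub>R axis j 1 + s *\<^sub>R axis i 1) - pd i f (x + s *\<^sub>R axis i 1))"
    by blast
  let ?h = "\<lambda>r. pd i f (x + s *\<^sub>R axis i 1 + r *\<^sub>R axis j 1)"
  have "DERIV ?h r :> pd j (pd i f) (x + s *\<^sub>R axis i 1 + r *\<^sub>R axis j 1)" for r
    using f unfolding has_real_derivative_iff_has_vector_derivative
    by (intro has_vector_derivative_line C_infinity_differentiable C_infinity_pd)
  from MVT2[OF t this] obtain r where r: "0 < r" "r < t"
    and 2: "?h t - ?h 0 = (t - 0) * pd j (pd i f) (x + s *\<^sub>R axis i 1 + r *\<^sub>R axis j 1)"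
    by blast
  have "norm (s *\<^sub>R axis i (1::real) + r *\<^sub>R axis j (1::real)) \<le> s + r"
    by (rule norm_triangle_le) (use s r in simp)
  then have "norm (x + s *\<^sub>R axis i 1 + r *\<^sub>R axis j 1 - x) \<le> 2 * t"
    using s r by (simp add: add.assoc)
  moreover have "?g t - ?g 0 = t\<^sup>2 * pd j (pd i f) (x + s *\<^sub>R axis i 1 + r *\<^sub>R axis j 1)"
    using 2 unfolding 1 by (simp add: power2_eq_square algebra_simps)
  ultimately show ?thesis
    by (intro exI[of _ "x + s *\<^sub>R axis i 1 + r *\<^sub>R axis j 1"]) (simp add: algebra_simps)
qed

lemma pd_commute:
  fixes f :: "plane \<Rightarrow> real"
  assumes f: "C_infinity f"
  shows "pd i (pd j f) x = pd j (pd i f) x"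
proof -
  define t where "t n = inverse (real (Suc n))" for n
  have t: "t n > 0" for n by (simp add: t_def)
  have t0: "t \<longlonglongrightarrow> 0" unfolding t_def by (rule LIMSEQ_inverse_real_of_nat)
  obtain y where y: "\<And>n. norm (y n - x) \<le> 2 * t n" and
    y': "\<And>n. f (x + t n *\<^sub>R axis i 1 + t n *\<^sub>R axis j 1) - f (x + t n *\<^sub>R axis i 1)
         - f (x + t n *\<^sub>R axis j 1) + f x = (t n)\<^sup>2 * pd j (pd i f) (y n)"
    using mixed_difference[where x = x and i = i and j = j, OF f t] by metis
  obtain z where z: "\<And>n. norm (z n - x) \<le> 2 * t n" and
    z': "\<And>n. f (x + t n *\<^sub>R axis j 1 + t n *\<^sub>R axis i 1) - f (x + t n *\<^sub>R axis j 1)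
         - f (x + t n *\<^sub>R axis i 1) + f x = (t n)\<^sup>2 * pd i (pd j f) (z n)"
    using mixed_difference[where x = x and i = j and j = i, OF f t] by metis
  have lim: "w \<longlonglongrightarrow> x" if "\<And>n. norm (w n - x) \<le> 2 * t n" for w
    by (rule metric_tendsto_imp_tendsto[OF tendsto_mult[OF tendsto_const t0, of 2]])
      (simp add: dist_norm order_trans[OF that abs_ge_self])
  have cont: "continuous_on UNIV (pd j (pd i f))" "continuous_on UNIV (pd i (pd j f))"
    using f by (auto intro!: C_infinity_continuous C_infinity_pd)
  have eq: "pd j (pd i f) (y n) = pd i (pd j f) (z n)" for n
  proof -
    have "(t n)\<^sup>2 * pd j (pd i f) (y n) = (t n)\<^sup>2 * pd i (pd j f) (z n)"
      unfolding y'[symmetric] z'[symmetric] by (simp add: algebra_simps)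
    then show ?thesis using t[of n] by simp
  qed
  have "(\<lambda>n. pd j (pd i f) (y n)) \<longlonglongrightarrow> pd j (pd i f) x"
    "(\<lambda>n. pd i (pd j f) (z n)) \<longlonglongrightarrow> pd i (pd j f) x"
    using continuous_on_tendsto_compose[OF cont(1) lim[OF y]] continuous_on_tendsto_compose[OF cont(2) lim[OF z]]
    by auto
  then show ?thesis unfolding eq by (metis LIMSEQ_unique)
qed

lemma C_infinity_borel_measurable: "C_infinity f \<Longrightarrow> f \<in> borel_measurable borel"
  by (intro borel_measurable_continuous_onI C_infinity_continuous)

lemma C_infinity_Lipschitz:
  fixes f :: "plane \<Rightarrow> 'b::real_normed_vector"
  assumes f: "C_infinity f" and B: "\<And>i x. norm (pd i f x) \<le> B"
  shows "norm (f x - f y) \<le> 2 * B * norm (x - y)"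
proof (rule differentiable_bound[of UNIV])
  show "(f has_derivative (\<lambda>h. \<Sum>i\<in>UNIV. h $ i *\<^sub>R pd i f x)) (at x within UNIV)" for x
    using has_derivative_pd[OF C_infinity_differentiable[OF f]] by simp
  show "onorm (\<lambda>h. \<Sum>i\<in>UNIV. h $ i *\<^sub>R pd i f x) \<le> 2 * B" for x
  proof (rule onorm_le)
    fix h :: plane
    have "norm (\<Sum>i\<in>UNIV. h $ i *\<^sub>R pd i f x) \<le> (\<Sum>i\<in>(UNIV :: 2 set). norm h * B)"
      by (intro sum_norm_le) (simp add: mult_mono component_le_norm_cart B)
    then show "norm (\<Sum>i\<in>UNIV. h $ i *\<^sub>R pd i f x) \<le> 2 * B * norm h" by (simp add: mult_ac)
  qed
qed auto

lemma C_infinity_compact_support_bounded: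
  fixes f :: "plane \<Rightarrow> 'b::real_normed_vector"
  assumes f: "C_infinity f" and K: "compact K" "\<forall>x. x \<notin> K \<longrightarrow> f x = 0"
  obtains B where "B \<ge> 0" "\<And>x. norm (f x) \<le> B" "\<And>i x. norm (pd i f x) \<le> B"
proof -
  have b: "\<exists>B. \<forall>x. norm (g x) \<le> B" if "C_infinity g" "\<And>x. x \<notin> K \<Longrightarrow> g x = 0" for g :: "plane \<Rightarrow> 'b"
  proof -
    have "bounded (g ` K)"
      by (intro compact_imp_bounded compact_continuous_image C_infinity_continuous that K)
    then obtain B where "\<forall>x\<in>K. norm (g x) \<le> B" by (auto simp: bounded_iff)
    then have "norm (g x) \<le> max B 0" for x
      using that(2)[of x] by (cases "x \<in> K") auto
    then show ?thesis by blast
  qed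
  obtain B where "\<And>x. norm (f x) \<le> B" using b[OF f] K(2) by blast
  moreover have "\<exists>B. \<forall>x. norm (pd i f x) \<le> B" for i
    using K by (intro b C_infinity_pd f pd_eq_0_outside[of K]) (auto intro: compact_imp_closed)
  then obtain B' where "\<And>i x. norm (pd i f x) \<le> B' i" by metis
  then have "norm (pd i f x) \<le> max (B' 1) (B' 2)" for i x
    using exhaust_2[of i] by (metis max.coboundedI1 max.coboundedI2)
  ultimately show ?thesis
    by (intro that[of "max (max B 0) (max (B' 1) (B' 2))"]) (auto intro: order_trans simp: le_max_iff_disj)
qed

text \<open>Dominated convergence runs along sequences, so the derivative is read off along the
  steps 1 / (n + 1).\<close>

lemma has_vector_derivative_seq:
  assumes "(f has_vector_derivative d) (at 0)"
  shows "(\<lambda>n. real (Suc n) *\<^sub>R (f (inverse (real (Suc n))) - f 0)) \<longlonglongrightarrow> d"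
proof -
  have "((\<lambda>h. norm (f (0 + h) - f 0 - h *\<^sub>R d) / norm h) \<longlongrightarrow> 0) (at 0)"
    using assms by (simp add: has_vector_derivative_def has_derivative_at)
  moreover have "filterlim (\<lambda>n. inverse (real (Suc n))) (at 0) sequentially"
    using LIMSEQ_inverse_real_of_nat by (simp add: filterlim_at)
  ultimately have "(\<lambda>n. norm (f (0 + inverse (real (Suc n))) - f 0 - inverse (real (Suc n)) *\<^sub>R d)
      / norm (inverse (real (Suc n)))) \<longlonglongrightarrow> 0"
    by (rule filterlim_compose)
  moreover have "norm (f (0 + inverse (real (Suc n))) - f 0 - inverse (real (Suc n)) *\<^sub>R d)
      / norm (inverse (real (Suc n))) = norm (real (Suc n) *\<^sub>R (f (inverse (real (Suc n))) - f 0) - d)" for n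
  proof -
    have "real (Suc n) *\<^sub>R (f (inverse (real (Suc n))) - f 0) - d
        = real (Suc n) *\<^sub>R (f (0 + inverse (real (Suc n))) - f 0 - inverse (real (Suc n)) *\<^sub>R d)"
      by (simp add: scaleR_diff_right del: of_nat_Suc)
    then show ?thesis
      by (simp only: norm_scaleR real_norm_def abs_of_nat abs_inverse divide_inverse inverse_inverse_eq mult.commute)
  qed
  ultimately have "(\<lambda>n. norm (real (Suc n) *\<^sub>R (f (inverse (real (Suc n))) - f 0) - d)) \<longlonglongrightarrow> 0"
    by simp
  then show ?thesis by (rule LIM_zero_cancel[OF tendsto_norm_zero_cancel])
qed

text \<open>Translation invariance of the Lebesgue measure makes the integrals of all difference
  quotients vanish.\<close>

lemma integral_pd_eq_0:
  fixes f :: "plane \<Rightarrow> 'b::euclidean_space"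
  assumes f: "C_infinity f" and K: "compact K" "\<forall>x. x \<notin> K \<longrightarrow> f x = 0"
  shows "(LINT x|lborel. pd i f x) = 0"
proof -
  obtain B where B: "B \<ge> 0" "\<And>x. norm (f x) \<le> B" "\<And>i x. norm (pd i f x) \<le> B"
    by (rule C_infinity_compact_support_bounded[OF f K]) (rule that)
  obtain R where R: "\<And>x. x \<in> K \<Longrightarrow> norm x \<le> R"
    using compact_imp_bounded[OF K(1)] unfolding bounded_iff by auto
  let ?e = "\<lambda>n. inverse (real (Suc n)) *\<^sub>R axis i 1 :: plane"
  let ?q = "\<lambda>n x. real (Suc n) *\<^sub>R (f (?e n + x) - f x)"
  have [measurable]: "f \<in> borel_measurable borel" "pd i f \<in> borel_measurable borel"
    using f by (auto intro!: C_infinity_borel_measurable C_infinity_pd)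
  have int: "integrable lborel f"
  proof -
    have "integrable lborel (\<lambda>x. indicator K x *\<^sub>R f x)"
      using K(1) C_infinity_continuous[OF f] by (rule borel_integrable_compact)
    moreover have "(\<lambda>x. indicator K x *\<^sub>R f x) = f" using K(2) by (auto simp: indicator_def)
    ultimately show ?thesis by simp
  qed
  have int_e: "integrable lborel (\<lambda>x. f (e + x))" and "(LINT x|lborel. f (e + x)) = (LINT x|lborel. f x)" for e
  proof -
    have "integrable (distr lborel borel ((+) e)) f" using int by (simp add: lborel_distr_plus)
    then show "integrable lborel (\<lambda>x. f (e + x))" by (simp add: integrable_distr_eq)
    have "(LINT x|distr lborel borel ((+) e). f x) = (LINT x|lborel. f (e + x))"
      by (rule integral_distr) auto
    then show "(LINT x|lborel. f (e + x)) = (LINT x|lborel. f x)" by (simp add: lborel_distr_plus)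
  qed
  then have q0: "(LINT x|lborel. ?q n x) = 0" for n
    using int int_e by simp
  have "(\<lambda>n. LINT x|lborel. ?q n x) \<longlonglongrightarrow> (LINT x|lborel. pd i f x)"
  \<comment> \<open>The Lipschitz bound 2 B |e| cancels the factor \<open>Suc n\<close>. The steps
    have length at most 1, so all quotients vanish outside the ball of radius
    \<open>R + 1\<close>.\<close>
  proof (rule integral_dominated_convergence[where w = "\<lambda>x. 2 * B * indicator (cball 0 (R + 1)) x"])
    show "AE x in lborel. (\<lambda>n. ?q n x) \<longlonglongrightarrow> pd i f x"
    proof (rule AE_I2)
      fix x
      have "((\<lambda>t. f (x + t *\<^sub>R axis i 1)) has_vector_derivative pd i f x) (at 0)"
        using has_vector_derivative_line[of f x 0 i] C_infinity_differentiable[OF f] by simp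
      from has_vector_derivative_seq[OF this] show "(\<lambda>n. ?q n x) \<longlonglongrightarrow> pd i f x"
        by (simp add: add.commute)
    qed
    show "AE x in lborel. norm (?q n x) \<le> 2 * B * indicator (cball 0 (R + 1)) x" for n
    proof (rule AE_I2)
      fix x
      have e1: "norm (?e n) \<le> 1" by (simp add: inverse_le_1_iff)
      show "norm (?q n x) \<le> 2 * B * indicator (cball 0 (R + 1)) x"
      proof (cases "x \<in> cball 0 (R + 1)")
        case True
        have "norm (f (?e n + x) - f x) \<le> 2 * B * norm (?e n)"
          using C_infinity_Lipschitz[OF f B(3), of "?e n + x" x] by simp
        then have "norm (f (?e n + x) - f x) \<le> 2 * B * inverse (real (Suc n))"
          by (simp del: of_nat_Suc)
        then have "real (Suc n) * norm (f (?e n + x) - f x) \<le> real (Suc n) * (2 * B * inverse (real (Suc n)))"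
          by (rule mult_left_mono) simp
        also have "\<dots> = 2 * B" by (simp del: of_nat_Suc)
        finally show ?thesis using True by (simp del: of_nat_Suc)
      next
        case False
        then have "norm x > R + 1" by simp
        moreover have "norm x \<le> norm (?e n + x) + norm (?e n)"
          by (metis add_diff_cancel_left' norm_triangle_ineq4 add.commute)
        ultimately have "x \<notin> K" "?e n + x \<notin> K" using R e1 by force+
        then show ?thesis using K(2) B(1) by simp
      qed
    qed
    show "integrable lborel (\<lambda>x. 2 * B * indicator (cball (0::plane) (R + 1)) x)"
      using emeasure_bounded_finite[OF bounded_cball, of "0::plane" "R + 1"]
      by (intro integrable_mult_right integrable_real_indicator) simp_all
  qed auto
  then show ?thesis unfolding q0 by (simp add: LIMSEQ_const_iff)
qed

subsection \<open>The fundamental lemma of the calculus of variations\<close>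

lemma integral_lebesgue_on_eq_lborel:
  fixes f :: "plane \<Rightarrow> 'b::{banach, second_countable_topology}"
  assumes "f \<in> borel_measurable borel" "A \<in> sets lebesgue" "\<And>x. x \<notin> A \<Longrightarrow> f x = 0"
  shows "(LINT x|lebesgue_on A. f x) = (LINT x|lborel. f x)"
proof -
  have "(\<lambda>x. indicator A x *\<^sub>R f x) = f"
    using assms(3) by (auto simp: indicator_def)
  then show ?thesis
    using assms(1,2) by (simp add: integral_restrict_space integral_completion)
qed

lemma isCont_flat_exp: "isCont (flat_exp m) t"
  using has_field_derivative_flat_exp by (rule DERIV_isCont)

text \<open>\<open>\<beta> s\<close> is a smooth bump that is nonzero exactly on the box shrunk by
  \<open>s\<close>. Shrinking by \<open>r n\<close> makes the support compact inside the box; the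
  map a |-> N a / (1 + N a) with growing N lifts positive values towards 1 and keeps 0 and the
  bounds.\<close>

lemma box_cutoff:
  fixes c d :: plane
  obtains \<phi> :: "nat \<Rightarrow> plane \<Rightarrow> real"
  where "\<And>n. test_function (box c d) (\<phi> n)" "\<And>n x. 0 \<le> \<phi> n x \<and> \<phi> n x \<le> 1"
    "\<And>x. (\<lambda>n. \<phi> n x) \<longlonglongrightarrow> indicator (box c d) x"
proof -
  define r where "r n = inverse (real (Suc n))" for n
  have r: "r n > 0" for n by (simp add: r_def)
  have r0: "r \<longlonglongrightarrow> 0" unfolding r_def by (rule LIMSEQ_inverse_real_of_nat)
  define E where "E i s x = flat_exp 0 (x $ i - c $ i - s) * flat_exp 0 (d $ i - s - x $ i)"
    for i s and x :: plane
  define \<beta> where "\<beta> s x = E 1 s x * E 2 s x" for s and x :: plane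
  have E_nonneg: "E i s x \<ge> 0" for i s x
    by (simp add: E_def flat_exp_0_nonneg)
  then have \<beta>_nonneg: "\<beta> s x \<ge> 0" for s x by (simp add: \<beta>_def)
  have E_pos: "E i s x \<noteq> 0 \<longleftrightarrow> c $ i + s < x $ i \<and> x $ i < d $ i - s" for i s x
    by (auto simp: E_def flat_exp_0_eq_0_iff)
  have smooth: "C_infinity (\<beta> s)" for s
    unfolding \<beta>_def E_def by (intro C_infinity_intros C_infinity_flat_exp)
  have lim: "(\<lambda>n. \<beta> (r n) x) \<longlonglongrightarrow> \<beta> 0 x" for x
    unfolding \<beta>_def E_def
    by (intro tendsto_mult isCont_tendsto_compose[OF isCont_flat_exp] tendsto_diff tendsto_const r0)
  define \<phi> where "\<phi> n x = (real (Suc n) * \<beta> (r n) x) * inverse (1 + real (Suc n) * \<beta> (r n) x)" for n x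
  have pos: "1 + real (Suc n) * \<beta> (r n) x > 0" for n x
    using \<beta>_nonneg[of "r n" x] by (smt (verit) mult_nonneg_nonneg of_nat_0_le_iff)
  have in_box: "x \<in> box c d \<longleftrightarrow> (\<forall>i. c $ i < x $ i \<and> x $ i < d $ i)" for x
    by (rule mem_box_cart)
  have nz: "c $ i + r n < x $ i \<and> x $ i < d $ i - r n" if "\<phi> n x \<noteq> 0" for n x i
    using that E_pos[of _ "r n" x] exhaust_2[of i] by (auto simp: \<phi>_def \<beta>_def)
  have test: "test_function (box c d) (\<phi> n)" for n
  proof -
    let ?K = "cbox (\<chi> i. c $ i + r n) (\<chi> i. d $ i - r n)"
    have "C_infinity (\<phi> n)"
      unfolding \<phi>_def using pos
      by (intro C_infinity_mult C_infinity_inverse C_infinity_add C_infinity_const smooth) (metis less_irrefl)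
    moreover have K: "supp (\<phi> n) \<subseteq> ?K"
    proof (rule supp_subset[OF closed_cbox])
      fix x assume x: "x \<notin> ?K"
      show "\<phi> n x = 0"
      proof (rule ccontr)
        assume "\<phi> n x \<noteq> 0"
        then have "x \<in> ?K" using nz[of n x] by (simp add: mem_box_cart less_imp_le)
        with x show False by simp
      qed
    qed
    moreover have "compact (supp (\<phi> n))"
      using compact_Int_closed[OF compact_cbox closed_supp, of "\<chi> i. c $ i + r n" "\<chi> i. d $ i - r n" "\<phi> n"] K
      by (simp add: Int_absorb1)
    moreover have "?K \<subseteq> box c d"
    proof
      fix x assume x: "x \<in> ?K"
      have "c $ i < x $ i \<and> x $ i < d $ i" for i
      proof -
        have "c $ i + r n \<le> x $ i \<and> x $ i \<le> d $ i - r n" using x by (simp add: mem_box_cart)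
        then show ?thesis using r[of n] by linarith
      qed
      then show "x \<in> box c d" by (simp add: in_box)
    qed
    ultimately show ?thesis by (auto simp: test_function_def)
  qed
  moreover have "0 \<le> \<phi> n x \<and> \<phi> n x \<le> 1" for n x
  proof -
    have "\<phi> n x = (real (Suc n) * \<beta> (r n) x) / (1 + real (Suc n) * \<beta> (r n) x)"
      by (simp add: \<phi>_def divide_inverse)
    moreover have "real (Suc n) * \<beta> (r n) x \<ge> 0" using \<beta>_nonneg by simp
    ultimately show ?thesis using pos[of n x] by simp
  qed
  moreover have "(\<lambda>n. \<phi> n x) \<longlonglongrightarrow> indicator (box c d) x" for x
  proof (cases "x \<in> box c d")
    case True
    then have "\<beta> 0 x \<noteq> 0"
      unfolding \<beta>_def using E_pos[of _ 0 x] by (simp add: in_box)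
    then have p: "\<beta> 0 x > 0" using \<beta>_nonneg[of 0 x] by linarith
    have "filterlim (\<lambda>n. \<beta> (r n) x * real (Suc n)) at_top sequentially"
      by (rule filterlim_tendsto_pos_mult_at_top[OF lim p])
        (rule filterlim_compose[OF filterlim_real_sequentially filterlim_Suc])
    then have "filterlim (\<lambda>n. 1 + \<beta> (r n) x * real (Suc n)) at_top sequentially"
      by (rule filterlim_tendsto_add_at_top[OF tendsto_const])
    then have "(\<lambda>n. 1 - inverse (1 + \<beta> (r n) x * real (Suc n))) \<longlonglongrightarrow> 1 - 0"
      by (intro tendsto_diff tendsto_const tendsto_inverse_0_at_top)
    moreover have "\<phi> n x = 1 - inverse (1 + \<beta> (r n) x * real (Suc n))" for n
    proof -
      have "a * inverse (1 + a) = 1 - inverse (1 + a)" if "1 + a > 0" for a :: real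
        using that by (simp add: field_simps)
      from this[OF pos[of n x]] show ?thesis by (simp add: \<phi>_def mult.commute)
    qed
    ultimately show ?thesis using True by simp
  next
    case False
    have "\<phi> n x = 0" for n
    proof (rule ccontr)
      assume "\<phi> n x \<noteq> 0"
      have "c $ i < x $ i \<and> x $ i < d $ i" for i
        using nz[OF \<open>\<phi> n x \<noteq> 0\<close>, of i] r[of n] by linarith
      then have "x \<in> box c d" by (simp add: in_box)
      with False show False by simp
    qed
    then show ?thesis using False by simp
  qed
  ultimately show thesis by (rule that)
qed

text \<open>Test functions approximate indicators of boxes, so the integral over every box in
  \<Omega> vanishes. Boxes are stable under intersection and generate the Borel sets, hence all
  integrals over measurable subsets of a box vanish and \<open>density_zero\<close> applies;
  countably many boxes exhaust \<Omega>.\<close>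

lemma du_bois_reymond:
  fixes f :: "plane \<Rightarrow> 'b::euclidean_space"
  assumes \<Omega>: "open \<Omega>" and f: "integrable (lebesgue_on \<Omega>) f"
    and test: "\<And>\<phi>. test_function \<Omega> \<phi> \<Longrightarrow> regular_distribution \<Omega> f \<phi> = 0"
  shows "AE x in lebesgue_on \<Omega>. f x = 0"
proof -
  define g where "g x = indicator \<Omega> x *\<^sub>R f x" for x
  have \<Omega>': "\<Omega> \<in> sets lebesgue" using \<Omega> by simp
  have g: "integrable lebesgue g"
    using f \<Omega>' by (simp add: g_def[abs_def] integrable_restrict_space)
  have set_g: "set_integrable lebesgue A g" if "A \<in> sets lebesgue" for A
    unfolding set_integrable_def using that g by (rule integrable_mult_indicator)
  have box: "(LINT x:box c d|lebesgue. g x) = 0" if "box c d \<subseteq> \<Omega>" for c d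
  proof -
    obtain \<phi> :: "nat \<Rightarrow> plane \<Rightarrow> real" where \<phi>: "\<And>n. test_function (box c d) (\<phi> n)"
      "\<And>n x. 0 \<le> \<phi> n x \<and> \<phi> n x \<le> 1" "\<And>x. (\<lambda>n. \<phi> n x) \<longlonglongrightarrow> indicator (box c d) x"
      using box_cutoff by blast
    have "(\<lambda>n. LINT x|lebesgue. \<phi> n x *\<^sub>R g x) \<longlonglongrightarrow> (LINT x|lebesgue. indicator (box c d) x *\<^sub>R g x)"
    proof (rule integral_dominated_convergence[where w = "\<lambda>x. norm (g x)"])
      show "(\<lambda>x. indicator (box c d) x *\<^sub>R g x) \<in> borel_measurable lebesgue"
        using set_g[of "box c d"] unfolding set_integrable_def by (auto dest: borel_measurable_integrable)
      show "(\<lambda>x. \<phi> n x *\<^sub>R g x) \<in> borel_measurable lebesgue" for n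
        by (intro borel_measurable_scaleR measurable_completion borel_measurable_integrable[OF g])
          (simp add: C_infinity_borel_measurable test_functionD(1)[OF \<phi>(1)])
      show "AE x in lebesgue. (\<lambda>n. \<phi> n x *\<^sub>R g x) \<longlonglongrightarrow> indicator (box c d) x *\<^sub>R g x"
        by (intro AE_I2 tendsto_scaleR \<phi>(3) tendsto_const)
      show "AE x in lebesgue. norm (\<phi> n x *\<^sub>R g x) \<le> norm (g x)" for n
        using \<phi>(2) by (intro AE_I2) (simp add: mult_left_le_one_le)
    qed (use g in simp)
    moreover have "(LINT x|lebesgue. \<phi> n x *\<^sub>R g x) = 0" for n
      using test[OF test_function_subset[OF \<phi>(1) that], of n] \<Omega>'
      by (simp add: regular_distribution_def integral_restrict_space g_def mult.commute)
    ultimately show ?thesis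
      by (simp add: set_lebesgue_integral_def LIMSEQ_const_iff)
  qed
  have borel: "(LINT x:A \<inter> box c d|lebesgue. g x) = 0" if cd: "box c d \<subseteq> \<Omega>" and A: "A \<in> sets borel" for A c d
  proof -
    have "Int_stable (range (\<lambda>(a, b). box a b :: plane set))"
      by (auto simp: Int_stable_def box_Int_box)
    moreover have "range (\<lambda>(a, b). box a b :: plane set) \<subseteq> Pow UNIV" by simp
    moreover have "A \<in> sigma_sets UNIV (range (\<lambda>(a, b). box a b :: plane set))"
      using A unfolding borel_eq_box by (subst (asm) sets_measure_of) auto
    ultimately show ?thesis
    proof (induction rule: sigma_sets_induct_disjoint)
      case (basic A)
      then obtain a b where "A = box a b" by auto
      then have "A \<inter> box c d = box (\<Sum>i\<in>Basis. max (a \<bullet> i) (c \<bullet> i) *\<^sub>R i) (\<Sum>i\<in>Basis. min (b \<bullet> i) (d \<bullet> i) *\<^sub>R i)"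
        by (simp add: Int_interval box_Int_box)
      moreover have "A \<inter> box c d \<subseteq> \<Omega>" using cd by auto
      ultimately show ?case using box by simp
    next
      case empty
      show ?case by (simp add: set_lebesgue_integral_def)
    next
      case (compl A)
      then have "A \<in> sets borel" unfolding borel_eq_box by simp
      then have m: "A \<inter> box c d \<in> sets lebesgue" "(UNIV - A) \<inter> box c d \<in> sets lebesgue" by auto
      have "(LINT x:(A \<inter> box c d) \<union> ((UNIV - A) \<inter> box c d)|lebesgue. g x)
          = (LINT x:A \<inter> box c d|lebesgue. g x) + (LINT x:(UNIV - A) \<inter> box c d|lebesgue. g x)"
        by (rule set_integral_Un) (use set_g m in auto)
      moreover have "(A \<inter> box c d) \<union> ((UNIV - A) \<inter> box c d) = box c d" by auto
      ultimately show ?case using compl box[OF cd] by simp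
    next
      case (union F)
      then have F: "F i \<in> sets borel" for i unfolding borel_eq_box by auto
      have "(LINT x:(\<Union>i. F i \<inter> box c d)|lebesgue. g x) = (\<Sum>i. LINT x:F i \<inter> box c d|lebesgue. g x)"
      proof (rule lebesgue_integral_countable_add)
        show "F i \<inter> box c d \<in> sets lebesgue" for i using F by auto
        show "i \<noteq> j \<Longrightarrow> F i \<inter> box c d \<inter> (F j \<inter> box c d) = {}" for i j
          using union(1) by (auto simp: disjoint_family_on_def)
        show "set_integrable lebesgue (\<Union>i. F i \<inter> box c d) g"
          using F by (intro set_g sets.countable_UN) auto
      qed
      then show ?case using union(3) by (simp add: Int_UN_distrib2)
    qed
  qed
  have zero: "AE x in lebesgue. x \<in> box c d \<longrightarrow> g x = 0" if cd: "box c d \<subseteq> \<Omega>" for c d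
  proof -
    let ?M = "lebesgue_on (box c d)"
    have B: "box c d \<in> sets lebesgue" by simp
    interpret finite_measure ?M by (intro finite_measure_lebesgue_on) simp
    have "AE x in ?M. g x = 0"
    proof (rule density_zero)
      show "integrable ?M g" using set_g[OF B] B by (simp add: integrable_restrict_space set_integrable_def)
      fix A assume "A \<in> sets ?M"
      then have A: "A \<in> sets lebesgue" "A \<subseteq> box c d" by (auto simp: sets_restrict_space_iff)
      \<comment> \<open>A Lebesgue measurable set is a Borel set up to a subset of a null set, so
        the Borel case suffices.\<close>
      from A(1) obtain S N N' where S: "A = S \<union> N" "N \<subseteq> N'" "N' \<in> null_sets lborel" "S \<in> sets lborel"
        by (rule sets_completionE)
      have N': "AE x in lebesgue. x \<notin> N'"
        using S(3) by (intro AE_not_in null_sets_completionI)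
      have e: "(LINT x:A|?M. g x) = (LINT x:A|lebesgue. g x)"
        unfolding set_lebesgue_integral_def using A B
        by (subst integral_restrict_space)
          (auto intro!: Bochner_Integration.integral_cong simp: indicator_def)
      have "(LINT x:A|lebesgue. g x) = (LINT x:S \<inter> box c d|lebesgue. g x)"
        unfolding set_lebesgue_integral_def
      proof (rule integral_cong_AE)
        show "(\<lambda>x. indicator A x *\<^sub>R g x) \<in> borel_measurable lebesgue"
          "(\<lambda>x. indicator (S \<inter> box c d) x *\<^sub>R g x) \<in> borel_measurable lebesgue"
          using set_g[OF A(1)] set_g[of "S \<inter> box c d"] S(4) unfolding set_integrable_def
          by (auto dest: borel_measurable_integrable)
        show "AE x in lebesgue. indicator A x *\<^sub>R g x = indicator (S \<inter> box c d) x *\<^sub>R g x"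
          using N' by eventually_elim (use S(1,2) A(2) in \<open>auto simp: indicator_def\<close>)
      qed
      with e borel[OF cd, of S] S(4) show "(LINT x:A|?M. g x) = 0" by simp
    qed
    then show ?thesis using B by (simp add: AE_restrict_space_iff)
  qed
  obtain \<D> where \<D>: "countable \<D>" "\<D> \<subseteq> Pow \<Omega>" "\<And>X. X \<in> \<D> \<Longrightarrow> \<exists>a b. X = box a b" "\<Union>\<D> = \<Omega>"
    by (rule open_countable_Union_open_box[OF \<Omega>]) (rule that)
  have "AE x in lebesgue. x \<in> X \<longrightarrow> g x = 0" if X: "X \<in> \<D>" for X
  proof -
    obtain a b where "X = box a b" using \<D>(3)[OF X] by auto
    moreover have "X \<subseteq> \<Omega>" using \<D>(2) X by auto
    ultimately show ?thesis using zero by simp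
  qed
  then have "AE x in lebesgue. \<forall>X\<in>\<D>. x \<in> X \<longrightarrow> g x = 0"
    unfolding AE_ball_countable[OF \<D>(1)] by (intro ballI)
  then have "AE x in lebesgue. x \<in> \<Omega> \<longrightarrow> f x = 0"
  proof eventually_elim
    case (elim x)
    then have "x \<in> \<Omega> \<Longrightarrow> g x = 0" using \<D>(4) by blast
    then show ?case by (simp add: g_def)
  qed
  then show ?thesis using \<Omega>' by (simp add: AE_restrict_space_iff)
qed

subsection \<open>Weak derivatives\<close>

lemma bounded_open_lmeasurable: "open \<Omega> \<Longrightarrow> bounded \<Omega> \<Longrightarrow> \<Omega> \<in> lmeasurable"
  for \<Omega> :: "plane set"
  by (simp add: bounded_set_imp_lmeasurable)

lemma continuous_bounded_on:
  fixes f :: "plane \<Rightarrow> 'b::real_normed_vector"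
  assumes "bounded \<Omega>" "continuous_on UNIV f"
  obtains B where "B \<ge> 0" "\<And>x. x \<in> \<Omega> \<Longrightarrow> norm (f x) \<le> B"
proof -
  have "bounded (f ` closure \<Omega>)"
    using assms by (intro compact_imp_bounded compact_continuous_image)
      (auto intro: continuous_on_subset)
  then obtain B where B: "\<forall>x\<in>closure \<Omega>. norm (f x) \<le> B" by (auto simp: bounded_iff)
  show thesis
    using B closure_subset[of \<Omega>] by (intro that[of "max 0 B"]) (auto simp: le_max_iff_disj)
qed

lemma L2_mem_continuous:
  fixes f :: "plane \<Rightarrow> 'b::euclidean_space"
  assumes "bounded \<Omega>" "open \<Omega>" "continuous_on UNIV f"
  shows "L2_mem (lebesgue_on \<Omega>) f"
proof -
  obtain B where "B \<ge> 0" "\<And>x. x \<in> \<Omega> \<Longrightarrow> norm (f x) \<le> B"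
    by (rule continuous_bounded_on[OF assms(1,3)]) (rule that)
  moreover have "f \<in> borel_measurable (lebesgue_on \<Omega>)"
    using assms(3) by (intro measurable_restrict_space1 measurable_completion)
      (simp add: borel_measurable_continuous_onI)
  ultimately show ?thesis
    using finite_measure_lebesgue_on[OF bounded_open_lmeasurable[OF assms(2,1)]]
    by (intro L2_mem_bounded[of _ _ B]) auto
qed

lemma integrable_continuous_scaleR:
  fixes f :: "plane \<Rightarrow> 'b::euclidean_space" and \<phi> :: "plane \<Rightarrow> real"
  assumes \<Omega>: "bounded \<Omega>" "open \<Omega>" and \<phi>: "continuous_on UNIV \<phi>" and f: "integrable (lebesgue_on \<Omega>) f"
  shows "integrable (lebesgue_on \<Omega>) (\<lambda>x. \<phi> x *\<^sub>R f x)"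
proof -
  obtain B where B: "B \<ge> 0" "\<And>x. x \<in> \<Omega> \<Longrightarrow> norm (\<phi> x) \<le> B"
    by (rule continuous_bounded_on[OF \<Omega>(1) \<phi>]) (rule that)
  have "\<phi> \<in> borel_measurable (lebesgue_on \<Omega>)"
    using \<phi> by (intro measurable_restrict_space1 measurable_completion)
      (simp add: borel_measurable_continuous_onI)
  moreover have "integrable (lebesgue_on \<Omega>) (\<lambda>x. B * norm (f x))" using f by simp
  ultimately show ?thesis
    by (elim integrable_dominated) (use f B in \<open>auto intro!: mult_right_mono\<close>)
qed

lemma L2_lebesgue_on_integrable:
  fixes f :: "plane \<Rightarrow> 'b::euclidean_space"
  assumes "bounded \<Omega>" "open \<Omega>" "L2_mem (lebesgue_on \<Omega>) f"
  shows "integrable (lebesgue_on \<Omega>) f"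
  using L2_mem_L1(1)[OF finite_measure_lebesgue_on[OF bounded_open_lmeasurable[OF assms(2,1)]] assms(3)] .

text \<open>The product of \<open>f\<close> with a test function is smooth with compact support, so
  the integral of its derivative is 0; the product rule turns this into the weak identity.\<close>

lemma is_weak_pd_smooth:
  fixes f :: "plane \<Rightarrow> 'b::euclidean_space"
  assumes \<Omega>: "bounded \<Omega>" "open \<Omega>" and f: "C_infinity f"
  shows "is_weak_pd \<Omega> i f (pd i f)"
  unfolding is_weak_pd_def
proof (intro conjI allI impI)
  show "L2_mem (lebesgue_on \<Omega>) (pd i f)"
    using f by (intro L2_mem_continuous[OF \<Omega>] C_infinity_continuous C_infinity_pd)
  fix \<phi> assume \<phi>: "test_function \<Omega> \<phi>"
  note \<phi>' = test_functionD[OF \<phi>] and p = test_functionD[OF test_function_pd[OF \<phi>]]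
  have \<Omega>': "\<Omega> \<in> sets lebesgue" using \<Omega> by simp
  have pd: "pd i (\<lambda>x. \<phi> x *\<^sub>R f x) = (\<lambda>x. \<phi> x *\<^sub>R pd i f x + pd i \<phi> x *\<^sub>R f x)"
    using C_infinity_differentiable[OF \<phi>'(1)] C_infinity_differentiable[OF f]
    by (intro ext pd_scaleR)
  have "(LINT x|lborel. pd i (\<lambda>x. \<phi> x *\<^sub>R f x) x) = 0"
    by (rule integral_pd_eq_0[OF C_infinity_scaleR[OF \<phi>'(1) f] \<phi>'(2)]) (simp add: not_in_supp)
  then have "0 = (LINT x|lebesgue_on \<Omega>. \<phi> x *\<^sub>R pd i f x + pd i \<phi> x *\<^sub>R f x)"
    unfolding pd using \<phi>' p f \<Omega>'
    by (subst integral_lebesgue_on_eq_lborel)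
      (auto intro!: C_infinity_borel_measurable C_infinity_add C_infinity_scaleR C_infinity_pd)
  also have "\<dots> = (LINT x|lebesgue_on \<Omega>. \<phi> x *\<^sub>R pd i f x) + (LINT x|lebesgue_on \<Omega>. pd i \<phi> x *\<^sub>R f x)"
    using \<phi>'(1) f
    by (intro Bochner_Integration.integral_add integrable_continuous_scaleR[OF \<Omega>]
        L2_lebesgue_on_integrable[OF \<Omega> L2_mem_continuous[OF \<Omega>]] C_infinity_continuous C_infinity_pd)
  finally show "dpd i (regular_distribution \<Omega> f) \<phi> = regular_distribution \<Omega> (pd i f) \<phi>"
    by (simp add: dpd_def regular_distribution_def neg_eq_iff_add_eq_0 add.commute)
qed

lemma regular_distribution_diff:
  fixes f :: "plane \<Rightarrow> 'b::euclidean_space"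
  assumes \<Omega>: "bounded \<Omega>" "open \<Omega>" and "L2_mem (lebesgue_on \<Omega>) f" "L2_mem (lebesgue_on \<Omega>) g"
    and \<phi>: "C_infinity \<phi>"
  shows "regular_distribution \<Omega> (\<lambda>x. f x - g x) \<phi> = regular_distribution \<Omega> f \<phi> - regular_distribution \<Omega> g \<phi>"
  unfolding regular_distribution_def scaleR_diff_right
  by (intro Bochner_Integration.integral_diff integrable_continuous_scaleR L2_lebesgue_on_integrable
      C_infinity_continuous assms)

lemma is_weak_pd_diff:
  fixes f :: "plane \<Rightarrow> 'b::euclidean_space"
  assumes \<Omega>: "bounded \<Omega>" "open \<Omega>" and f: "L2_mem (lebesgue_on \<Omega>) f" "L2_mem (lebesgue_on \<Omega>) f'"
    and g: "is_weak_pd \<Omega> i f g" "is_weak_pd \<Omega> i f' g'"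
  shows "is_weak_pd \<Omega> i (\<lambda>x. f x - f' x) (\<lambda>x. g x - g' x)"
proof -
  have g': "L2_mem (lebesgue_on \<Omega>) g" "L2_mem (lebesgue_on \<Omega>) g'"
    using g by (auto simp: is_weak_pd_def)
  have "dpd i (regular_distribution \<Omega> (\<lambda>x. f x - f' x)) \<phi> = regular_distribution \<Omega> (\<lambda>x. g x - g' x) \<phi>"
    if "test_function \<Omega> \<phi>" for \<phi>
  proof -
    have "regular_distribution \<Omega> g \<phi> = - regular_distribution \<Omega> f (pd i \<phi>)"
      "regular_distribution \<Omega> g' \<phi> = - regular_distribution \<Omega> f' (pd i \<phi>)"
      using g that by (auto simp: is_weak_pd_def dpd_def)
    moreover have "C_infinity \<phi>" "C_infinity (pd i \<phi>)"
      using that by (auto intro: test_functionD C_infinity_pd)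
    ultimately show ?thesis
      using regular_distribution_diff[OF \<Omega> f, of "pd i \<phi>"] regular_distribution_diff[OF \<Omega> g', of \<phi>]
      by (simp add: dpd_def)
  qed
  then show ?thesis
    using L2_mem_diff[OF g'] by (simp add: is_weak_pd_def)
qed

lemma eq_of_regular_distribution:
  fixes f :: "plane \<Rightarrow> 'b::euclidean_space"
  assumes \<Omega>: "bounded \<Omega>" "open \<Omega>" and f: "L2_mem (lebesgue_on \<Omega>) f" "L2_mem (lebesgue_on \<Omega>) g"
    and eq: "\<And>\<phi>. test_function \<Omega> \<phi> \<Longrightarrow> regular_distribution \<Omega> f \<phi> = regular_distribution \<Omega> g \<phi>"
  shows "AE x in lebesgue_on \<Omega>. f x = g x"
proof -
  have "AE x in lebesgue_on \<Omega>. f x - g x = 0"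
    by (rule du_bois_reymond[OF \<Omega>(2)])
      (use L2_lebesgue_on_integrable[OF \<Omega> L2_mem_diff[OF f]] regular_distribution_diff[OF \<Omega> f] eq
        in \<open>auto simp: test_functionD\<close>)
  then show ?thesis by simp
qed

lemma is_weak_pd_unique:
  fixes f :: "plane \<Rightarrow> 'b::euclidean_space"
  assumes \<Omega>: "bounded \<Omega>" "open \<Omega>" and g: "is_weak_pd \<Omega> i f g" "is_weak_pd \<Omega> i f g'"
  shows "AE x in lebesgue_on \<Omega>. g x = g' x"
  by (rule eq_of_regular_distribution[OF \<Omega>]) (use g in \<open>auto simp: is_weak_pd_def\<close>)

lemma is_weak_pd_weak_pd: "H1_mem \<Omega> f \<Longrightarrow> is_weak_pd \<Omega> i f (weak_pd \<Omega> i f)"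
  unfolding weak_pd_def H1_mem_def using someI_ex[of "is_weak_pd \<Omega> i f"] by blast

lemma L2_mem_weak_pd: "H1_mem \<Omega> f \<Longrightarrow> L2_mem (lebesgue_on \<Omega>) (weak_pd \<Omega> i f)"
  using is_weak_pd_weak_pd by (auto simp: is_weak_pd_def)

lemma H1_memD: "H1_mem \<Omega> f \<Longrightarrow> L2_mem (lebesgue_on \<Omega>) f"
  by (simp add: H1_mem_def)

lemma L2_norm_cong_AE:
  assumes "AE x in M. f x = g x" "L2_mem M f" "L2_mem M g"
  shows "L2_norm M f = L2_norm M g"
proof -
  have [measurable]: "f \<in> borel_measurable M" "g \<in> borel_measurable M"
    using assms(2,3) by (auto simp: L2_mem_def)
  have "(LINT x|M. (norm (f x))\<^sup>2) = (LINT x|M. (norm (g x))\<^sup>2)"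
    using assms(1) by (intro integral_cong_AE) auto
  then show ?thesis by (simp add: L2_norm_def)
qed

lemma H1_norm_ge:
  "L2_norm (lebesgue_on \<Omega>) f \<le> H1_norm \<Omega> f"
  "L2_norm (lebesgue_on \<Omega>) (weak_pd \<Omega> i f) \<le> H1_norm \<Omega> f"
proof -
  have n: "0 \<le> (L2_norm (lebesgue_on \<Omega>) (weak_pd \<Omega> i f))\<^sup>2" for i by simp
  have s: "(\<Sum>i\<in>UNIV. (L2_norm (lebesgue_on \<Omega>) (weak_pd \<Omega> i f))\<^sup>2) \<ge> (L2_norm (lebesgue_on \<Omega>) (weak_pd \<Omega> i f))\<^sup>2" for i
    by (rule member_le_sum) auto
  show "L2_norm (lebesgue_on \<Omega>) f \<le> H1_norm \<Omega> f"
    unfolding H1_norm_def by (intro real_le_rsqrt) (use order_trans[OF n s] in auto)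
  show "L2_norm (lebesgue_on \<Omega>) (weak_pd \<Omega> i f) \<le> H1_norm \<Omega> f"
    unfolding H1_norm_def by (intro real_le_rsqrt) (use s[of i] in \<open>auto intro: add_increasing\<close>)
qed

text \<open>The norm in H^1 measures an arbitrary representative \<open>weak_pd\<close> of the
  derivative of the difference; almost everywhere uniqueness identifies it with the difference of
  the derivatives. On a bounded set Cauchy-Schwarz then gives convergence in L1, the mode in which
  all later limits are taken.\<close>

lemma H1_approx_L1:
  fixes u :: "plane \<Rightarrow> 'b::euclidean_space"
  assumes \<Omega>: "bounded \<Omega>" "open \<Omega>" and u: "H1_mem \<Omega> u" and \<Phi>: "\<And>n. C_infinity (\<Phi> n)"
    and lim: "(\<lambda>n. H1_norm \<Omega> (\<lambda>x. \<Phi> n x - u x)) \<longlonglongrightarrow> 0"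
  shows "(\<lambda>n. LINT x|lebesgue_on \<Omega>. norm (\<Phi> n x - u x)) \<longlonglongrightarrow> 0"
    and "(\<lambda>n. LINT x|lebesgue_on \<Omega>. norm (pd i (\<Phi> n) x - weak_pd \<Omega> i u x)) \<longlonglongrightarrow> 0"
proof -
  let ?c = "sqrt (measure (lebesgue_on \<Omega>) (space (lebesgue_on \<Omega>)))"
  note fin = finite_measure_lebesgue_on[OF bounded_open_lmeasurable[OF \<Omega>(2,1)]]
  have c0: "(\<lambda>n. ?c * H1_norm \<Omega> (\<lambda>x. \<Phi> n x - u x)) \<longlonglongrightarrow> 0"
    using tendsto_mult[OF tendsto_const lim, of ?c] by simp
  have \<Phi>2: "L2_mem (lebesgue_on \<Omega>) (\<Phi> n)" for n
    using \<Phi> by (intro L2_mem_continuous[OF \<Omega>] C_infinity_continuous)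
  have w: "is_weak_pd \<Omega> i (\<lambda>x. \<Phi> n x - u x) (\<lambda>x. pd i (\<Phi> n) x - weak_pd \<Omega> i u x)" for i n
    by (intro is_weak_pd_diff[OF \<Omega> \<Phi>2] H1_memD u is_weak_pd_smooth[OF \<Omega>] \<Phi> is_weak_pd_weak_pd)
  have H: "H1_mem \<Omega> (\<lambda>x. \<Phi> n x - u x)" for n
    using L2_mem_diff[OF \<Phi>2 H1_memD[OF u]] w unfolding H1_mem_def by blast
  have "L2_norm (lebesgue_on \<Omega>) (\<lambda>x. pd i (\<Phi> n) x - weak_pd \<Omega> i u x) \<le> H1_norm \<Omega> (\<lambda>x. \<Phi> n x - u x)" for n
  proof -
    have "L2_norm (lebesgue_on \<Omega>) (\<lambda>x. pd i (\<Phi> n) x - weak_pd \<Omega> i u x)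
        = L2_norm (lebesgue_on \<Omega>) (weak_pd \<Omega> i (\<lambda>x. \<Phi> n x - u x))"
      by (intro L2_norm_cong_AE is_weak_pd_unique[OF \<Omega> w] is_weak_pd_weak_pd L2_mem_weak_pd H)
        (use w in \<open>simp add: is_weak_pd_def\<close>)
    then show ?thesis using H1_norm_ge(2) by metis
  qed
  then have 1: "(LINT x|lebesgue_on \<Omega>. norm (pd i (\<Phi> n) x - weak_pd \<Omega> i u x)) \<le> ?c * H1_norm \<Omega> (\<lambda>x. \<Phi> n x - u x)" for n
    using L2_mem_L1(2)[OF fin, of "\<lambda>x. pd i (\<Phi> n) x - weak_pd \<Omega> i u x"] w[of i n]
    by (meson is_weak_pd_def mult_left_mono order_trans real_sqrt_ge_zero measure_nonneg)
  have 2: "(LINT x|lebesgue_on \<Omega>. norm (\<Phi> n x - u x)) \<le> ?c * H1_norm \<Omega> (\<lambda>x. \<Phi> n x - u x)" for n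
    using L2_mem_L1(2)[OF fin H1_memD[OF H]] H1_norm_ge(1)
    by (meson mult_left_mono order_trans real_sqrt_ge_zero measure_nonneg)
  show "(\<lambda>n. LINT x|lebesgue_on \<Omega>. norm (\<Phi> n x - u x)) \<longlonglongrightarrow> 0"
    by (rule tendsto_sandwich[OF _ _ tendsto_const c0]) (use 2 in auto)
  show "(\<lambda>n. LINT x|lebesgue_on \<Omega>. norm (pd i (\<Phi> n) x - weak_pd \<Omega> i u x)) \<longlonglongrightarrow> 0"
    by (rule tendsto_sandwich[OF _ _ tendsto_const c0]) (use 1 in auto)
qed

subsection \<open>One-dimensional Hausdorff measure\<close>

text \<open>Caratheodory's criterion: an outer measure that is additive on sets at positive distance
  is additive on the two sides of a closed set.\<close>

lemma metric_outer_measure_closed: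
  fixes H :: "'a::metric_space set \<Rightarrow> ennreal"
  assumes empty: "H {} = 0"
    and mono: "\<And>A B. A \<subseteq> B \<Longrightarrow> H A \<le> H B"
    and sub: "\<And>A :: nat \<Rightarrow> 'a set. H (\<Union>i. A i) \<le> (\<Sum>i. H (A i))"
    and metric: "\<And>A B d. d > 0 \<Longrightarrow> (\<And>x y. x \<in> A \<Longrightarrow> y \<in> B \<Longrightarrow> d \<le> dist x y) \<Longrightarrow> H A + H B \<le> H (A \<union> B)"
    and F: "closed F"
  shows "H (A \<inter> F) + H (A - F) \<le> H A"
proof (cases "F = {} \<or> H A = \<infinity>")
  case True
  then show ?thesis using empty by auto
next
  case False
  then have F0: "F \<noteq> {}" and fin: "H A \<noteq> \<infinity>" by auto
  let ?d = "\<lambda>x. infdist x F"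
  have lip: "?d x \<le> ?d y + dist x y" for x y by (rule infdist_triangle)
  have pos: "?d x > 0" if "x \<notin> F" for x
    using in_closed_iff_infdist_zero[OF F F0, of x] that infdist_nonneg[of x F] by linarith
  have sub2: "H (B \<union> C) \<le> H B + H C" for B C
    using sub[of "binaryset B C"] suminf_binaryset_eq[of H B C, OF empty]
    by (simp add: UN_binaryset_eq)
  \<comment> \<open>Shells of \<open>A\<close> around \<open>F\<close>. Shells whose indices differ
    by at least 2 are at positive distance, so the even ones and the odd ones contribute at most
    \<open>H A\<close> each, and the series over all shells is finite.\<close>
  define R where "R k = {x \<in> A. inverse (real k + 2) < ?d x \<and> ?d x \<le> inverse (real k + 1)}" for k :: nat
  have alt: "(\<Sum>k<m. H (R (2 * k + p))) \<le> H (\<Union>k<m. R (2 * k + p))" for m p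
  proof (induction m)
    case 0
    then show ?case by (simp add: empty)
  next
    case (Suc m)
    have "H (\<Union>k<m. R (2 * k + p)) + H (R (2 * m + p)) \<le> H ((\<Union>k<m. R (2 * k + p)) \<union> R (2 * m + p))"
    proof (cases "m = 0")
      case True
      then show ?thesis by (simp add: empty)
    next
      case False
      let ?a = "inverse (real (2 * m + p))" and ?b = "inverse (real (2 * m + p) + 1)"
      have "?b < ?a" using False by (intro less_imp_inverse_less) auto
      then have ab: "?a - ?b > 0" by simp
      show ?thesis
      proof (rule metric[OF ab])
        fix x y assume "x \<in> (\<Union>k<m. R (2 * k + p))" and y: "y \<in> R (2 * m + p)"
        then obtain k where k: "k < m" "x \<in> R (2 * k + p)" by auto
        have "real (2 * k + p) + 2 \<le> real (2 * m + p)" using k(1) by simp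
        then have "?a \<le> inverse (real (2 * k + p) + 2)" by (intro le_imp_inverse_le) auto
        also have "\<dots> < ?d x" using k(2) by (simp add: R_def)
        finally have "?a < ?d x" .
        moreover have "?d y \<le> ?b" using y by (simp add: R_def)
        ultimately show "?a - ?b \<le> dist x y" using lip[of x y] by linarith
      qed
    qed
    moreover have "(\<Union>k<m. R (2 * k + p)) \<union> R (2 * m + p) = (\<Union>k<Suc m. R (2 * k + p))"
      by (auto simp: lessThan_Suc)
    ultimately have *: "H (\<Union>k<m. R (2 * k + p)) + H (R (2 * m + p)) \<le> H (\<Union>k<Suc m. R (2 * k + p))"
      by simp
    have "(\<Sum>k<Suc m. H (R (2 * k + p))) = (\<Sum>k<m. H (R (2 * k + p))) + H (R (2 * m + p))"
      by simp
    also have "\<dots> \<le> H (\<Union>k<m. R (2 * k + p)) + H (R (2 * m + p))"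
      using Suc.IH by (rule add_right_mono)
    finally show ?case using * by (rule order_trans)
  qed
  have R_le: "H (\<Union>k<m. R (2 * k + p)) \<le> H A" for m p
    by (rule mono) (auto simp: R_def)
  have "(\<Sum>k<m. H (R k)) \<le> H A + H A" for m
  proof -
    have "(\<Sum>k<2 * m. H (R k)) = (\<Sum>k<m. H (R (2 * k + 0))) + (\<Sum>k<m. H (R (2 * k + 1)))" for m
      by (induction m) (simp_all add: algebra_simps)
    note split = this
    have "(\<Sum>k<m. H (R k)) \<le> (\<Sum>k<2 * m. H (R k))"
      by (rule sum_mono2) auto
    also have "\<dots> \<le> H A + H A"
      unfolding split by (rule add_mono[OF order_trans[OF alt R_le] order_trans[OF alt R_le]])
    finally show ?thesis .
  qed
  then have "(\<Sum>k. H (R k)) \<le> H A + H A"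
    by (intro suminf_le_const) auto
  also have "\<dots> < \<infinity>" using fin by (simp add: less_top[symmetric])
  finally have S: "(\<Sum>k. H (R k)) \<noteq> \<infinity>" by auto
  \<comment> \<open>The tail of the shell series is the error to be removed. In
    \<open>ennreal\<close> the head is added to both sides instead of subtracting the tail, so that
    the full finite sum can be cancelled after \<open>n\<close> has grown.\<close>
  have main: "H (A \<inter> F) + H (A - F) + (\<Sum>k<n. H (R k)) \<le> H A + (\<Sum>k. H (R k))" for n
  proof -
    let ?A = "{x \<in> A. inverse (real n + 1) < ?d x}"
    have "A - F \<subseteq> ?A \<union> (\<Union>k. R (k + n))"
    proof
      fix x assume x: "x \<in> A - F"
      show "x \<in> ?A \<union> (\<Union>k. R (k + n))"
      proof (cases "x \<in> ?A")
        case False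
        then have le: "?d x \<le> inverse (real n + 1)" using x by auto
        obtain m where "inverse (real (Suc m)) < ?d x" using reals_Archimedean pos x by blast
        then have "inverse (real m + 2) < ?d x"
          by (smt (verit) le_imp_inverse_le of_nat_0_le_iff of_nat_Suc)
        then have ex: "\<exists>m. inverse (real m + 2) < ?d x" ..
        define k where "k = (LEAST m. inverse (real m + 2) < ?d x)"
        have k1: "inverse (real k + 2) < ?d x" unfolding k_def using ex by (rule LeastI_ex)
        have "n \<le> k"
        proof (rule ccontr)
          assume "\<not> n \<le> k"
          then have "real k + 2 \<le> real n + 1" by linarith
          then have "inverse (real n + 1) \<le> inverse (real k + 2)" by (intro le_imp_inverse_le) auto
          with le k1 show False by linarith
        qed
        moreover have "?d x \<le> inverse (real k + 1)"
        \<comment> \<open>For the first shell there is no predecessor to appeal to; its upper bound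
          1 holds because the distance is at most 1 / (n + 1).\<close>
        proof (cases k)
          case 0
          have "inverse (real n + 1) \<le> 1" by (simp add: inverse_le_1_iff)
          then show ?thesis using 0 le by simp
        next
          case (Suc k')
          then have "\<not> inverse (real k' + 2) < ?d x"
            unfolding k_def by (metis lessI not_less_Least)
          then show ?thesis using Suc by (simp add: algebra_simps)
        qed
        ultimately have "x \<in> R ((k - n) + n)" using x k1 by (simp add: R_def)
        then show ?thesis by blast
      qed auto
    qed
    then have "H (A - F) \<le> H ?A + H (\<Union>k. R (k + n))"
      by (rule order_trans[OF mono sub2])
    also have "\<dots> \<le> H ?A + (\<Sum>k. H (R (k + n)))"
      by (intro add_left_mono sub)
    finally have 1: "H (A - F) \<le> H ?A + (\<Sum>k. H (R (k + n)))" .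
    have "H (A \<inter> F) + H ?A \<le> H (A \<inter> F \<union> ?A)"
    proof (rule metric[of "inverse (real n + 1)"])
      fix x y assume x: "x \<in> A \<inter> F" and y: "y \<in> ?A"
      have "?d x = 0" using x by simp
      then show "inverse (real n + 1) \<le> dist x y"
        using y lip[of y x] by (simp add: dist_commute)
    qed simp
    also have "\<dots> \<le> H A" by (rule mono) auto
    finally have 2: "H (A \<inter> F) + H ?A \<le> H A" .
    have "H (A \<inter> F) + H (A - F) + (\<Sum>k<n. H (R k))
        \<le> H (A \<inter> F) + (H ?A + (\<Sum>k. H (R (k + n)))) + (\<Sum>k<n. H (R k))"
      using 1 by (intro add_mono) auto
    also have "\<dots> = (H (A \<inter> F) + H ?A) + ((\<Sum>k. H (R (k + n))) + (\<Sum>k<n. H (R k)))"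
      by (simp add: algebra_simps)
    also have "\<dots> = (H (A \<inter> F) + H ?A) + (\<Sum>k. H (R k))"
      using suminf_offset[of "\<lambda>k. H (R k)" n] by (simp add: add.commute)
    also have "\<dots> \<le> H A + (\<Sum>k. H (R k))"
      using 2 by (rule add_right_mono)
    finally show ?thesis .
  qed
  have "(\<lambda>n. H (A \<inter> F) + H (A - F) + (\<Sum>k<n. H (R k))) \<longlonglongrightarrow> H (A \<inter> F) + H (A - F) + (\<Sum>k. H (R k))"
    by (intro tendsto_add tendsto_const summable_LIMSEQ summableI)
  then have "H (A \<inter> F) + H (A - F) + (\<Sum>k. H (R k)) \<le> H A + (\<Sum>k. H (R k))"
    by (rule LIMSEQ_le_const2) (use main in auto)
  then show ?thesis using S by (simp add: ennreal_add_left_cancel_le add.commute[of _ "\<Sum>k. H (R k)"])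
qed

section \<open>Coverings at a fixed scale\<close>

lemma hausdorff1_delta_le:
  assumes "A \<subseteq> (\<Union>i. C i)" "\<And>i. bounded (C i)" "\<And>i. diameter (C i) \<le> \<delta>"
  shows "hausdorff1_delta \<delta> A \<le> (\<Sum>i. ennreal (diameter (C i)))"
  unfolding hausdorff1_delta_def using assms by (intro INF_lower) auto

lemma hausdorff1_delta_greatest:
  assumes "\<And>C. A \<subseteq> (\<Union>i. C i) \<Longrightarrow> (\<And>i. bounded (C i)) \<Longrightarrow> (\<And>i. diameter (C i) \<le> \<delta>)
    \<Longrightarrow> b \<le> (\<Sum>i. ennreal (diameter (C i)))"
  shows "b \<le> hausdorff1_delta \<delta> A"
  unfolding hausdorff1_delta_def using assms by (intro INF_greatest) auto

lemma hausdorff1_delta_antimono: "\<delta> \<le> \<delta>' \<Longrightarrow> A \<subseteq> B \<Longrightarrow> hausdorff1_delta \<delta>' A \<le> hausdorff1_delta \<delta> B"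
  by (rule hausdorff1_delta_greatest) (rule hausdorff1_delta_le, auto intro: order_trans[of _ \<delta> \<delta>'])

lemma hausdorff1_delta_empty: "\<delta> > 0 \<Longrightarrow> hausdorff1_delta \<delta> {} = 0"
  using hausdorff1_delta_le[of "{}" "\<lambda>_. {}" \<delta>] by simp

lemma hausdorff1_delta_subadditive:
  fixes A :: "nat \<Rightarrow> plane set"
  shows "hausdorff1_delta \<delta> (\<Union>i. A i) \<le> (\<Sum>i. hausdorff1_delta \<delta> (A i))"
proof (rule ennreal_le_epsilon)
  fix e :: real assume top: "(\<Sum>i. hausdorff1_delta \<delta> (A i)) < top" and e: "0 < e"
  have "\<exists>C. A i \<subseteq> (\<Union>j. C j) \<and> (\<forall>j. bounded (C j) \<and> diameter (C j) \<le> \<delta>) \<and>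
      (\<Sum>j. ennreal (diameter (C j))) \<le> hausdorff1_delta \<delta> (A i) + ennreal (e * (1/2) ^ Suc i)" for i
  proof -
    have "hausdorff1_delta \<delta> (A i) \<noteq> top"
      using ennreal_suminf_lessD[OF top] by (auto simp: less_top)
    then have "hausdorff1_delta \<delta> (A i) < hausdorff1_delta \<delta> (A i) + ennreal (e * (1/2) ^ Suc i)"
      using e by (cases "hausdorff1_delta \<delta> (A i)") (auto simp: ennreal_plus[symmetric] ennreal_less_iff simp del: ennreal_plus)
    then show ?thesis
      unfolding hausdorff1_delta_def[of \<delta> "A i"] INF_less_iff by (auto intro: less_imp_le)
  qed
  then obtain C where C: "\<And>i. A i \<subseteq> (\<Union>j. C i j)" "\<And>i j. bounded (C i j)" "\<And>i j. diameter (C i j) \<le> \<delta>"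
    and le: "\<And>i. (\<Sum>j. ennreal (diameter (C i j))) \<le> hausdorff1_delta \<delta> (A i) + ennreal (e * (1/2) ^ Suc i)"
    by metis
  define D where "D n = case_prod C (prod_decode n)" for n
  have "hausdorff1_delta \<delta> (\<Union>i. A i) \<le> (\<Sum>n. ennreal (diameter (D n)))"
  proof (rule hausdorff1_delta_le)
    show "(\<Union>i. A i) \<subseteq> (\<Union>n. D n)"
    proof
      fix x assume "x \<in> (\<Union>i. A i)"
      then obtain i j where "x \<in> C i j" using C(1) by blast
      then have "x \<in> D (prod_encode (i, j))" by (simp add: D_def)
      then show "x \<in> (\<Union>n. D n)" by blast
    qed
  qed (simp_all add: D_def C split: prod.split)
  also have "\<dots> = (\<Sum>i. \<Sum>j. ennreal (diameter (C i j)))"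
    using suminf_ennreal_2dimen[of "\<lambda>i. \<Sum>j. ennreal (diameter (C i j))" "\<lambda>(i, j). ennreal (diameter (C i j))"]
    by (simp add: D_def case_prod_beta)
  also have "\<dots> \<le> (\<Sum>i. hausdorff1_delta \<delta> (A i) + ennreal (e * (1/2) ^ Suc i))"
    by (intro suminf_le le) auto
  also have "\<dots> = (\<Sum>i. hausdorff1_delta \<delta> (A i)) + (\<Sum>i. ennreal (e * (1/2) ^ Suc i))"
    by (rule suminf_add[symmetric]) auto
  also have "(\<Sum>i. ennreal (e * (1/2) ^ Suc i)) = ennreal e"
    using e power_half_series[THEN sums_mult, of e] by (intro suminf_ennreal_eq) auto
  finally show "hausdorff1_delta \<delta> (\<Union>i. A i) \<le> (\<Sum>i. hausdorff1_delta \<delta> (A i)) + ennreal e" .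
qed

text \<open>A covering set of diameter at most \<open>\<delta>\<close> is too small to meet both
  sets, so a cover of the union splits into separate covers of \<open>A\<close> and
  \<open>B\<close>, padded by empty sets, and no diameter is counted twice.\<close>

lemma hausdorff1_delta_metric:
  assumes "\<delta> < d" "\<And>x y. x \<in> A \<Longrightarrow> y \<in> B \<Longrightarrow> d \<le> dist x y"
  shows "hausdorff1_delta \<delta> A + hausdorff1_delta \<delta> B \<le> hausdorff1_delta \<delta> (A \<union> B)"
proof (rule hausdorff1_delta_greatest)
  fix C :: "nat \<Rightarrow> plane set"
  assume C: "A \<union> B \<subseteq> (\<Union>i. C i)" "\<And>i. bounded (C i)" "\<And>i. diameter (C i) \<le> \<delta>"
  \<comment> \<open>The empty padding sets have diameter 0, which must not exceed
    \<open>\<delta>\<close>.\<close>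
  have "0 \<le> \<delta>" using C(3)[of 0] diameter_ge_0[OF C(2), of 0] by linarith
  define D where "D X i = (if C i \<inter> X = {} then {} else C i)" for X i
  have D: "hausdorff1_delta \<delta> X \<le> (\<Sum>i. ennreal (diameter (D X i)))" if X: "X \<subseteq> A \<union> B" for X
  proof (rule hausdorff1_delta_le)
    show "X \<subseteq> (\<Union>i. D X i)"
    proof
      fix x assume x: "x \<in> X"
      then have "x \<in> (\<Union>i. C i)" using X C(1) by blast
      then obtain i where "x \<in> C i" by blast
      then have "x \<in> D X i" using x by (auto simp: D_def)
      then show "x \<in> (\<Union>i. D X i)" by blast
    qed
  qed (use C \<open>0 \<le> \<delta>\<close> in \<open>auto simp: D_def\<close>)
  have "ennreal (diameter (D A i)) + ennreal (diameter (D B i)) \<le> ennreal (diameter (C i))" for i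
  proof -
    have "C i \<inter> A = {} \<or> C i \<inter> B = {}"
    proof (rule ccontr)
      assume "\<not> (C i \<inter> A = {} \<or> C i \<inter> B = {})"
      then obtain x y where "x \<in> C i" "x \<in> A" "y \<in> C i" "y \<in> B" by blast
      with assms C(3)[of i] diameter_bounded_bound[OF C(2), of x i y] show False by fastforce
    qed
    then show ?thesis by (auto simp: D_def)
  qed
  then have "(\<Sum>i. ennreal (diameter (D A i)) + ennreal (diameter (D B i))) \<le> (\<Sum>i. ennreal (diameter (C i)))"
    by (intro suminf_le) auto
  moreover have "(\<Sum>i. ennreal (diameter (D A i)) + ennreal (diameter (D B i)))
      = (\<Sum>i. ennreal (diameter (D A i))) + (\<Sum>i. ennreal (diameter (D B i)))"
    by (rule suminf_add[symmetric]) auto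
  ultimately show "hausdorff1_delta \<delta> A + hausdorff1_delta \<delta> B \<le> (\<Sum>i. ennreal (diameter (C i)))"
    using add_mono[OF D[of A] D[of B]] by simp
qed

text \<open>This is the set function from which \<open>hausdorff1\<close> is built.
  \<open>measure_of\<close> returns it as \<open>emeasure\<close> only once countable additivity on
  the Borel sets is known.\<close>

definition hausdorff1_outer :: "plane set \<Rightarrow> ennreal" where
  "hausdorff1_outer A = (SUP \<delta>\<in>{0<..}. hausdorff1_delta \<delta> A)"

lemma hausdorff1_outer_ge: "\<delta> > 0 \<Longrightarrow> hausdorff1_delta \<delta> A \<le> hausdorff1_outer A"
  unfolding hausdorff1_outer_def by (rule SUP_upper) simp

lemma hausdorff1_outer_least:
  "(\<And>\<delta>. \<delta> > 0 \<Longrightarrow> hausdorff1_delta \<delta> A \<le> b) \<Longrightarrow> hausdorff1_outer A \<le> b"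
  unfolding hausdorff1_outer_def by (rule SUP_least) simp

lemma hausdorff1_outer_empty: "hausdorff1_outer {} = 0"
  using hausdorff1_outer_least[of "{}" 0] hausdorff1_delta_empty by simp

lemma hausdorff1_outer_mono: "A \<subseteq> B \<Longrightarrow> hausdorff1_outer A \<le> hausdorff1_outer B"
  by (rule hausdorff1_outer_least) (rule order_trans[OF hausdorff1_delta_antimono[OF order_refl] hausdorff1_outer_ge])

lemma hausdorff1_outer_subadditive: "hausdorff1_outer (\<Union>i. A i) \<le> (\<Sum>i. hausdorff1_outer (A i))"
  for A :: "nat \<Rightarrow> plane set"
proof (rule hausdorff1_outer_least)
  fix \<delta> :: real assume "\<delta> > 0"
  then have "(\<Sum>i. hausdorff1_delta \<delta> (A i)) \<le> (\<Sum>i. hausdorff1_outer (A i))"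
    by (intro suminf_le hausdorff1_outer_ge) auto
  with hausdorff1_delta_subadditive show "hausdorff1_delta \<delta> (\<Union>i. A i) \<le> (\<Sum>i. hausdorff1_outer (A i))"
    by (rule order_trans)
qed

lemma hausdorff1_outer_metric:
  assumes d: "d > 0" "\<And>x y. x \<in> A \<Longrightarrow> y \<in> B \<Longrightarrow> d \<le> dist x y"
  shows "hausdorff1_outer A + hausdorff1_outer B \<le> hausdorff1_outer (A \<union> B)"
proof -
  have *: "hausdorff1_delta \<delta> A + hausdorff1_delta \<delta>' B \<le> hausdorff1_outer (A \<union> B)" if "\<delta> > 0" "\<delta>' > 0" for \<delta> \<delta>'
  proof -
    define e where "e = min (d / 2) (min \<delta> \<delta>')"
    have e: "e > 0" "e < d" "e \<le> \<delta>" "e \<le> \<delta>'" using d(1) that by (auto simp: e_def)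
    have "hausdorff1_delta \<delta> A + hausdorff1_delta \<delta>' B \<le> hausdorff1_delta e A + hausdorff1_delta e B"
      by (intro add_mono hausdorff1_delta_antimono e) auto
    also have "\<dots> \<le> hausdorff1_delta e (A \<union> B)"
      by (rule hausdorff1_delta_metric[OF e(2) d(2)])
    also have "\<dots> \<le> hausdorff1_outer (A \<union> B)" by (rule hausdorff1_outer_ge[OF e(1)])
    finally show ?thesis .
  qed
  have "hausdorff1_delta \<delta> A + hausdorff1_outer B \<le> hausdorff1_outer (A \<union> B)" if "\<delta> > 0" for \<delta>
  proof -
    have "hausdorff1_delta \<delta> A + hausdorff1_outer B = (SUP \<delta>'\<in>{0<..}. hausdorff1_delta \<delta> A + hausdorff1_delta \<delta>' B)"
      unfolding hausdorff1_outer_def by (rule ennreal_SUP_add_right) (auto intro: exI[of _ 1])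
    then show ?thesis using *[OF that] by (auto intro!: SUP_least)
  qed
  moreover have "hausdorff1_outer A + hausdorff1_outer B = (SUP \<delta>\<in>{0<..}. hausdorff1_delta \<delta> A + hausdorff1_outer B)"
    unfolding hausdorff1_outer_def[of A] by (rule ennreal_SUP_add_left[symmetric]) (auto intro: exI[of _ 1])
  ultimately show ?thesis by (auto intro!: SUP_least)
qed

lemma sets_hausdorff1 [simp, measurable_cong]: "sets hausdorff1 = sets borel"
  unfolding hausdorff1_def using sets.sigma_sets_eq[of "borel :: plane measure"]
  by (simp add: sets_measure_of_conv)

text \<open>Caratheodory: the outer measure is a measure on the sets that split every set
  additively. By additivity at positive distance these include the closed sets, hence all Borel
  sets.\<close>

lemma emeasure_hausdorff1:
  assumes "A \<in> sets borel"
  shows "emeasure hausdorff1 A = hausdorff1_outer A"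
proof -
  interpret sigma_algebra UNIV "UNIV :: plane set set"
    using sigma_algebra_Pow[of "UNIV :: plane set"] by simp
  let ?L = "lambda_system UNIV (UNIV :: plane set set) hausdorff1_outer"
  have oms: "outer_measure_space (UNIV :: plane set set) hausdorff1_outer"
    unfolding outer_measure_space_def positive_def increasing_def countably_subadditive_def
    using hausdorff1_outer_empty hausdorff1_outer_mono hausdorff1_outer_subadditive by auto
  have ms: "measure_space UNIV ?L hausdorff1_outer"
    by (rule caratheodory_lemma[OF oms])
  have closed: "F \<in> ?L" if "closed F" for F :: "plane set"
    unfolding lambda_system_eq
  proof (intro CollectI conjI ballI UNIV_I antisym)
    fix X :: "plane set"
    show "hausdorff1_outer (X \<inter> F) + hausdorff1_outer (X - F) \<le> hausdorff1_outer X"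
      by (rule metric_outer_measure_closed[OF hausdorff1_outer_empty hausdorff1_outer_mono
            hausdorff1_outer_subadditive hausdorff1_outer_metric that])
    have "hausdorff1_outer (\<Union>i. binaryset (X \<inter> F) (X - F) i) \<le> (\<Sum>i. hausdorff1_outer (binaryset (X \<inter> F) (X - F) i))"
      by (rule hausdorff1_outer_subadditive)
    moreover have "(X \<inter> F) \<union> (X - F) = X" by auto
    ultimately show "hausdorff1_outer X \<le> hausdorff1_outer (X \<inter> F) + hausdorff1_outer (X - F)"
      by (simp add: UN_binaryset_eq suminf_binaryset_eq hausdorff1_outer_empty)
  qed
  have "sigma_sets UNIV {S :: plane set. closed S} \<subseteq> ?L"
    using ms closed unfolding measure_space_def
    by (intro sigma_algebra.sigma_sets_subset) auto
  then have "sets (borel :: plane measure) \<subseteq> ?L"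
    unfolding borel_eq_closed by (simp add: sets_measure_of_conv)
  from measure_down[OF ms sets.sigma_algebra_axioms[of "borel :: plane measure", simplified] this]
  have "measure_space UNIV (sets borel) hausdorff1_outer" .
  then show ?thesis
    using assms unfolding hausdorff1_def hausdorff1_outer_def[symmetric]
    by (intro emeasure_measure_of_sigma) (auto simp: measure_space_def)
qed

text \<open>A set of a given diameter meets a line in a set that fits into an interval of that
  length. This direction transfers smallness of boundary integrals in \<open>hausdorff1\<close> to
  line integrals along the sides of the sector.\<close>

lemma hausdorff1_ge_length:
  fixes e :: plane
  assumes e: "norm e = 1" and A: "A \<in> sets borel"
  shows "emeasure lborel {r. r *\<^sub>R e \<in> A} \<le> emeasure hausdorff1 A"
proof -
  have "emeasure lborel {r. r *\<^sub>R e \<in> A} \<le> hausdorff1_delta 1 A"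
  proof (rule hausdorff1_delta_greatest)
    fix C :: "nat \<Rightarrow> plane set"
    assume C: "A \<subseteq> (\<Union>i. C i)" "\<And>i. bounded (C i)" "\<And>i. diameter (C i) \<le> 1"
    define I where "I i = {r. r *\<^sub>R e \<in> C i}" for i
    \<comment> \<open>The part of a covering set on the line need not be measurable; it is enclosed
      in the interval that starts at its infimum and has the diameter as its length.\<close>
    define J where "J i = (if I i = {} then {} else {Inf (I i)..Inf (I i) + diameter (C i)})" for i
    have dist: "\<bar>r - s\<bar> \<le> diameter (C i)" if "r \<in> I i" "s \<in> I i" for r s i
    proof -
      have "dist (r *\<^sub>R e) (s *\<^sub>R e) \<le> diameter (C i)"
        using that C(2) by (intro diameter_bounded_bound) (auto simp: I_def)
      then show ?thesis using e by (simp add: dist_norm scaleR_diff_left[symmetric])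
    qed
    have sub: "I i \<subseteq> J i" for i
    proof
      fix r assume r: "r \<in> I i"
      have bdd: "bdd_below (I i)"
        using dist[OF r] by (intro bdd_belowI[of _ "r - diameter (C i)"]) (simp add: abs_le_iff algebra_simps)
      have "Inf (I i) \<le> r" using r bdd by (rule cInf_lower)
      moreover have "r - diameter (C i) \<le> Inf (I i)"
        using r dist[OF r] by (intro cInf_greatest) (auto simp: abs_le_iff algebra_simps)
      ultimately show "r \<in> J i" using r by (auto simp: J_def)
    qed
    have "{r. r *\<^sub>R e \<in> A} \<subseteq> (\<Union>i. J i)"
      using C(1) sub by (force simp: I_def)
    then have "emeasure lborel {r. r *\<^sub>R e \<in> A} \<le> emeasure lborel (\<Union>i. J i)"
      by (rule emeasure_mono) (auto simp: J_def)
    also have "\<dots> \<le> (\<Sum>i. emeasure lborel (J i))"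
      by (rule emeasure_subadditive_countably) (auto simp: J_def)
    also have "\<dots> \<le> (\<Sum>i. ennreal (diameter (C i)))"
      using diameter_ge_0[OF C(2)] by (intro suminf_le) (auto simp: J_def)
    finally show "emeasure lborel {r. r *\<^sub>R e \<in> A} \<le> (\<Sum>i. ennreal (diameter (C i)))" .
  qed
  also have "\<dots> \<le> hausdorff1_outer A" by (rule hausdorff1_outer_ge) simp
  finally show ?thesis using A by (simp add: emeasure_hausdorff1)
qed

text \<open>By \<open>hausdorff1_ge_length\<close> the image of Lebesgue measure under r |-> r e
  lies below \<open>hausdorff1\<close> as a measure, and integrals are monotone in the
  measure.\<close>

lemma nn_integral_segment_le_hausdorff1:
  fixes F :: "plane \<Rightarrow> ennreal"
  assumes e: "norm e = 1" and F: "F \<in> borel_measurable borel" and S: "S \<in> sets borel"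
    and sub: "\<And>r. r \<in> {0<..<h} \<Longrightarrow> r *\<^sub>R e \<in> S"
  shows "(\<integral>\<^sup>+r\<in>{0<..<h}. F (r *\<^sub>R e) \<partial>lborel) \<le> (\<integral>\<^sup>+x\<in>S. F x \<partial>hausdorff1)"
proof -
  let ?g = "\<lambda>r. r *\<^sub>R e"
  note [measurable] = F S
  have g [measurable]: "?g \<in> borel_measurable borel"
    by (intro borel_measurable_continuous_onI continuous_intros)
  have "distr lborel borel ?g \<le> hausdorff1"
    by (subst le_measure) (auto simp: emeasure_distr vimage_def intro!: hausdorff1_ge_length[OF e])
  then have "(\<integral>\<^sup>+x. F x * indicator S x \<partial>distr lborel borel ?g) \<le> (\<integral>\<^sup>+x. F x * indicator S x \<partial>hausdorff1)"
    by (intro nn_integral_mono_measure) auto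
  also have "(\<integral>\<^sup>+x. F x * indicator S x \<partial>distr lborel borel ?g) = (\<integral>\<^sup>+r. F (?g r) * indicator S (?g r) \<partial>lborel)"
    by (rule nn_integral_distr) measurable
  finally have "(\<integral>\<^sup>+r. F (?g r) * indicator S (?g r) \<partial>lborel) \<le> (\<integral>\<^sup>+x. F x * indicator S x \<partial>hausdorff1)" .
  moreover have "(\<integral>\<^sup>+r. F (?g r) * indicator {0<..<h} r \<partial>lborel) \<le> (\<integral>\<^sup>+r. F (?g r) * indicator S (?g r) \<partial>lborel)"
    using sub by (intro nn_integral_mono) (auto split: split_indicator)
  ultimately show ?thesis by (rule order_trans[rotated])
qed

subsection \<open>Polar coordinates\<close>

definition polar :: "real \<Rightarrow> real \<Rightarrow> plane" where
  "polar r \<theta> = (r * cos \<theta>) *\<^sub>R axis 1 1 + (r * sin \<theta>) *\<^sub>R axis 2 1"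

lemma polar_nth [simp]: "polar r \<theta> $ 1 = r * cos \<theta>" "polar r \<theta> $ 2 = r * sin \<theta>"
  by (simp_all add: polar_def axis_def)

lemma norm_plane: "norm (x :: plane) = sqrt ((x $ 1)\<^sup>2 + (x $ 2)\<^sup>2)"
  by (simp add: norm_vec_def L2_set_def UNIV_2)

lemma norm_polar: "norm (polar r \<theta>) = \<bar>r\<bar>"
proof -
  have "(r * cos \<theta>)\<^sup>2 + (r * sin \<theta>)\<^sup>2 = r\<^sup>2 * ((cos \<theta>)\<^sup>2 + (sin \<theta>)\<^sup>2)"
    by (simp only: power_mult_distrib distrib_left)
  then show ?thesis by (simp add: norm_plane)
qed

lemma polar_scaleR: "polar r \<theta> = r *\<^sub>R polar 1 \<theta>"
  by (simp add: polar_def scaleR_add_right)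

lemma plane_eqI: "x $ 1 = y $ 1 \<Longrightarrow> x $ 2 = y $ 2 \<Longrightarrow> x = y" for x y :: plane
  by (simp add: vec_eq_iff forall_2)

lemma polar_angle_polar: "r > 0 \<Longrightarrow> - pi < \<theta> \<Longrightarrow> \<theta> \<le> pi \<Longrightarrow> polar_angle (polar r \<theta>) = \<theta>"
proof -
  assume *: "r > 0" "- pi < \<theta>" "\<theta> \<le> pi"
  have "Complex (r * cos \<theta>) (r * sin \<theta>) = rcis r \<theta>" by (simp add: complex_eq_iff)
  then show ?thesis using * by (simp add: polar_angle_def Arg_rcis)
qed

lemma polar_norm_polar_angle: "polar (norm x) (polar_angle x) = x"
proof -
  have "rcis (cmod (Complex (x $ 1) (x $ 2))) (polar_angle x) = Complex (x $ 1) (x $ 2)"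
    unfolding polar_angle_def by (rule rcis_cmod_Arg)
  then show ?thesis
    by (intro plane_eqI) (simp_all add: complex_eq_iff norm_plane complex_norm)
qed

lemma sector_polar: "- pi \<le> \<theta>m \<Longrightarrow> \<theta>M \<le> pi \<Longrightarrow> r > 0 \<Longrightarrow> \<theta>m < \<theta> \<Longrightarrow> \<theta> < \<theta>M \<Longrightarrow> polar r \<theta> \<in> sector \<theta>m \<theta>M"
  using norm_polar[of r \<theta>] by (auto simp: sector_def polar_angle_polar)

lemma truncated_sector_polar:
  assumes "- pi \<le> \<theta>m" "\<theta>M \<le> pi"
  shows "truncated_sector \<theta>m \<theta>M h = (\<lambda>(r, \<theta>). polar r \<theta>) ` ({0<..<h} \<times> {\<theta>m<..<\<theta>M})"
proof (intro equalityI subsetI)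
  fix x assume x: "x \<in> truncated_sector \<theta>m \<theta>M h"
  then have "x = (\<lambda>(r, \<theta>). polar r \<theta>) (norm x, polar_angle x)" by (simp add: polar_norm_polar_angle)
  moreover have "(norm x, polar_angle x) \<in> {0<..<h} \<times> {\<theta>m<..<\<theta>M}"
    using x by (auto simp: truncated_sector_def sector_def)
  ultimately show "x \<in> (\<lambda>(r, \<theta>). polar r \<theta>) ` ({0<..<h} \<times> {\<theta>m<..<\<theta>M})" by (rule image_eqI)
next
  fix x assume "x \<in> (\<lambda>(r, \<theta>). polar r \<theta>) ` ({0<..<h} \<times> {\<theta>m<..<\<theta>M})"
  then show "x \<in> truncated_sector \<theta>m \<theta>M h"
    using sector_polar[OF assms] by (auto simp: truncated_sector_def norm_polar)
qed

text \<open>\<open>Arg\<close> is continuous only off the nonpositive reals. Away from 0 it equals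
  pi on this cut, so the strict upper bound on the angle keeps the sector off it, and the vertex is
  removed explicitly.\<close>

lemma open_sector:
  assumes "\<theta>M \<le> pi"
  shows "open (sector \<theta>m \<theta>M)"
proof -
  let ?c = "\<lambda>x::plane. Complex (x $ 1) (x $ 2)"
  have c: "continuous_on UNIV ?c"
    unfolding Complex_eq by (intro continuous_intros)
  have "open (- \<real>\<^sub>\<le>\<^sub>0 :: complex set)" by (simp add: open_Compl)
  moreover have "continuous_on (- \<real>\<^sub>\<le>\<^sub>0) Arg"
    by (intro continuous_at_imp_continuous_on ballI continuous_at_Arg) auto
  ultimately have "open (Arg -` {\<theta>m<..<\<theta>M} \<inter> - \<real>\<^sub>\<le>\<^sub>0)"
    by (rule continuous_on_open_vimage[THEN iffD1, rule_format]) (rule open_greaterThanLessThan)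
  then have "open (?c -` (Arg -` {\<theta>m<..<\<theta>M} \<inter> - \<real>\<^sub>\<le>\<^sub>0))"
    using c by (rule open_vimage)
  moreover have "?c -` (Arg -` {\<theta>m<..<\<theta>M} \<inter> - \<real>\<^sub>\<le>\<^sub>0) = sector \<theta>m \<theta>M"
  proof -
    have a: "z \<notin> \<real>\<^sub>\<le>\<^sub>0 \<longleftrightarrow> z \<noteq> 0 \<and> Arg z \<noteq> pi" for z
      unfolding Arg_eq_pi complex_nonpos_Reals_iff by (auto simp: complex_eq_iff)
    have b: "?c x \<noteq> 0 \<longleftrightarrow> x \<noteq> 0" for x
      by (auto simp: complex_eq_iff vec_eq_iff forall_2)
    have "x \<in> ?c -` (Arg -` {\<theta>m<..<\<theta>M} \<inter> - \<real>\<^sub>\<le>\<^sub>0) \<longleftrightarrow> x \<in> sector \<theta>m \<theta>M" for x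
    proof -
      have "x \<in> ?c -` (Arg -` {\<theta>m<..<\<theta>M} \<inter> - \<real>\<^sub>\<le>\<^sub>0)
          \<longleftrightarrow> polar_angle x \<in> {\<theta>m<..<\<theta>M} \<and> ?c x \<notin> \<real>\<^sub>\<le>\<^sub>0"
        by (simp only: vimage_eq Int_iff Compl_iff polar_angle_def)
      also have "\<dots> \<longleftrightarrow> polar_angle x \<in> {\<theta>m<..<\<theta>M} \<and> x \<noteq> 0 \<and> polar_angle x \<noteq> pi"
        by (simp only: a b polar_angle_def)
      also have "\<dots> \<longleftrightarrow> x \<in> sector \<theta>m \<theta>M"
        using assms by (auto simp: sector_def)
      finally show ?thesis .
    qed
    then show ?thesis by blast
  qed
  ultimately show ?thesis by simp
qed

lemma open_truncated_sector: "\<theta>M \<le> pi \<Longrightarrow> open (truncated_sector \<theta>m \<theta>M h)"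
  unfolding truncated_sector_def by (intro open_Int open_sector open_ball)

lemma bounded_truncated_sector: "bounded (truncated_sector \<theta>m \<theta>M h)"
  unfolding truncated_sector_def by (simp add: bounded_Int)

lemma continuous_on_polar [continuous_intros]:
  fixes f g :: "'a::t2_space \<Rightarrow> real"
  assumes "continuous_on S f" "continuous_on S g"
  shows "continuous_on S (\<lambda>x. polar (f x) (g x))"
  unfolding polar_def by (intro continuous_intros assms)

lemma box_real_pair: "box (a, c) (b, d) = {a<..<b} \<times> {c<..<d :: real}" for a b :: real
  by (auto simp: box_def Basis_prod_def)

text \<open>The change of variables formula is available on \<open>real^2\<close>, iterated
  integrals on pairs of reals; identifying the two Lebesgue measures connects them.\<close>

lemma lborel_plane: "distr (lborel :: (real \<times> real) measure) borel (\<lambda>(a, b). vector [a, b]) = (lborel :: plane measure)"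
proof (rule lborel_eqI[symmetric])
  let ?v = "\<lambda>(a, b). vector [a, b] :: plane"
  have v: "?v = (\<lambda>p. fst p *\<^sub>R axis 1 1 + snd p *\<^sub>R axis 2 1)"
    by (auto simp: fun_eq_iff vec_eq_iff forall_2 axis_def)
  have [measurable]: "?v \<in> borel_measurable borel"
    unfolding v by (intro borel_measurable_continuous_onI continuous_intros)
  fix l u :: plane assume le: "\<And>b. b \<in> Basis \<Longrightarrow> l \<bullet> b \<le> u \<bullet> b"
  have B: "(Basis :: plane set) = {axis 1 1, axis 2 1}"
    by (auto simp: Basis_vec_def UNIV_2)
  have lu: "l $ 1 \<le> u $ 1" "l $ 2 \<le> u $ 2"
    using le[of "axis 1 1"] le[of "axis 2 1"] by (simp_all add: B inner_axis)
  have "?v -` box l u = box (l $ 1, l $ 2) (u $ 1, u $ 2)"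
    by (auto simp: mem_box_cart forall_2 box_real_pair)
  then have "emeasure (distr lborel borel ?v) (box l u) = emeasure lborel (box (l $ 1, l $ 2) (u $ 1, u $ 2))"
    by (subst emeasure_distr) auto
  also have "\<dots> = ennreal (\<Prod>b\<in>Basis. ((u $ 1, u $ 2) - (l $ 1, l $ 2)) \<bullet> b)"
    using lu by (intro emeasure_lborel_box) (auto simp: Basis_prod_def)
  also have "(\<Prod>b\<in>Basis. ((u $ 1, u $ 2) - (l $ 1, l $ 2)) \<bullet> b) = (u $ 1 - l $ 1) * (u $ 2 - l $ 2)"
    by (simp add: Basis_prod_def)
  also have "\<dots> = (\<Prod>b\<in>Basis. (u - l) \<bullet> b)"
    unfolding B by (subst prod.insert) (auto simp: axis_eq_axis inner_axis)
  finally show "emeasure (distr lborel borel ?v) (box l u) = ennreal (\<Prod>b\<in>Basis. (u - l) \<bullet> b)" .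
qed simp

lemma polar_has_derivative:
  "((\<lambda>q::plane. polar (q $ 1) (q $ 2)) has_derivative
    (\<lambda>k. (k $ 1 * cos (q $ 2) - k $ 2 * (q $ 1 * sin (q $ 2))) *\<^sub>R axis 1 1
       + (k $ 1 * sin (q $ 2) + k $ 2 * (q $ 1 * cos (q $ 2))) *\<^sub>R axis 2 1)) (at q within S)"
proof -
  have [derivative_intros]: "((\<lambda>q::plane. q $ i) has_derivative (\<lambda>k. k $ i)) (at q within S)" for i
    by (rule bounded_linear_imp_has_derivative[OF bounded_linear_vec_nth])
  show ?thesis
    unfolding polar_def by (auto intro!: derivative_eq_intros simp: fun_eq_iff algebra_simps)
qed

text \<open>The polar map is injective on the open rectangle because norm and angle recover r and
  \<theta> as long as the angles stay within (-pi, pi), and its Jacobian determinant is r. The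
  formula is first proved for sets, as an equality of measures.\<close>

lemma emeasure_polar:
  assumes \<theta>: "- pi \<le> \<theta>m" "\<theta>M \<le> pi" and A: "A \<in> sets borel"
  shows "emeasure lborel (A \<inter> truncated_sector \<theta>m \<theta>M h)
    = (\<integral>\<^sup>+p. ennreal (indicator ({0<..<h} \<times> {\<theta>m<..<\<theta>M}) p * fst p) * indicator A (polar (fst p) (snd p)) \<partial>lborel)"
proof -
  note [measurable] = A
  let ?P = "\<lambda>q::plane. polar (q $ 1) (q $ 2)"
  let ?D = "\<lambda>q k. (k $ 1 * cos (q $ 2) - k $ 2 * (q $ 1 * sin (q $ 2))) *\<^sub>R axis 1 1
       + (k $ 1 * sin (q $ 2) + k $ 2 * (q $ 1 * cos (q $ 2))) *\<^sub>R axis 2 1 :: plane"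
  define w :: "real \<times> real \<Rightarrow> plane" where "w = (\<lambda>(a, b). vector [a, b])"
  have P [measurable]: "?P \<in> borel_measurable borel"
    by (intro borel_measurable_continuous_onI continuous_intros)
  define B where "B = {q::plane. q $ 1 \<in> {0<..<h} \<and> q $ 2 \<in> {\<theta>m<..<\<theta>M} \<and> ?P q \<in> A}"
  have [measurable]: "(\<lambda>q::plane. q $ i) \<in> borel_measurable borel" for i
    by (intro borel_measurable_continuous_onI continuous_intros)
  have B [measurable]: "B \<in> sets borel"
    unfolding B_def by measurable
  have sub: "B \<subseteq> cbox (vector [0, \<theta>m]) (vector [h, \<theta>M])"
    by (auto simp: B_def mem_box_cart forall_2)
  have int: "set_integrable lborel B (\<lambda>q. q $ 1)"
    unfolding set_integrable_def
  proof (rule integrable_dominated[of lborel "\<lambda>q. \<bar>h\<bar> * indicator (cbox (vector [0, \<theta>m]) (vector [h, \<theta>M])) q"])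
    show "AE q in lborel. norm (indicator B q *\<^sub>R q $ 1) \<le> \<bar>h\<bar> * indicator (cbox (vector [0, \<theta>m]) (vector [h, \<theta>M])) q"
      using sub by (intro AE_I2) (auto simp: B_def split: split_indicator)
    show "integrable lborel (\<lambda>q. \<bar>h\<bar> * indicator (cbox (vector [0, \<theta>m]) (vector [h, \<theta>M] :: plane)) q)"
      using emeasure_bounded_finite[OF bounded_cbox, of "vector [0, \<theta>m] :: plane" "vector [h, \<theta>M]"]
      by (intro integrable_mult_right integrable_real_indicator) simp_all
  qed measurable
  have inj: "inj_on ?P B"
  proof (rule inj_onI)
    fix q q' assume q: "q \<in> B" and q': "q' \<in> B" and eq: "?P q = ?P q'"
    have "polar_angle (?P q) = q $ 2" "polar_angle (?P q') = q' $ 2"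
      using q q' \<theta> by (auto simp: B_def intro!: polar_angle_polar)
    moreover have "norm (?P q) = q $ 1" "norm (?P q') = q' $ 1"
      using q q' by (auto simp: B_def norm_polar)
    ultimately show "q = q'" using eq by (intro plane_eqI) auto
  qed
  have im: "?P ` B = A \<inter> truncated_sector \<theta>m \<theta>M h"
  proof (intro equalityI subsetI)
    fix x assume "x \<in> A \<inter> truncated_sector \<theta>m \<theta>M h"
    then obtain r t where "x = polar r t" "r \<in> {0<..<h}" "t \<in> {\<theta>m<..<\<theta>M}" "x \<in> A"
      unfolding truncated_sector_polar[OF \<theta>] by auto
    then show "x \<in> ?P ` B"
      by (intro image_eqI[of _ _ "vector [r, t]"]) (auto simp: B_def)
  qed (auto simp: B_def truncated_sector_polar[OF \<theta>])
  have det: "\<bar>det (matrix (?D q))\<bar> = q $ 1" if "q \<in> B" for q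
  proof -
    have "det (matrix (?D q)) = q $ 1 * (cos (q $ 2) * cos (q $ 2)) + q $ 1 * (sin (q $ 2) * sin (q $ 2))"
      by (simp add: det_2 matrix_def axis_def algebra_simps)
    also have "\<dots> = q $ 1"
      unfolding distrib_left[symmetric] by simp
    finally show ?thesis using that by (simp add: B_def)
  qed
  have int': "(\<lambda>q. \<bar>det (matrix (?D q))\<bar>) integrable_on B"
    using set_borel_integral_eq_integral(1)[OF int] det by (simp cong: integrable_cong)
  have "measure lebesgue (?P ` B) = integral B (\<lambda>q. \<bar>det (matrix (?D q))\<bar>)"
    using B by (intro measure_differentiable_image_eq polar_has_derivative inj int') auto
  also have "\<dots> = integral B (\<lambda>q. q $ 1)"
    using det by (rule integral_cong)
  also have "\<dots> = (LINT q:B|lborel. q $ 1)"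
    using set_borel_integral_eq_integral(2)[OF int] by simp
  finally have m: "measure lebesgue (A \<inter> truncated_sector \<theta>m \<theta>M h) = (LINT q:B|lborel. q $ 1)"
    unfolding im .
  have S: "A \<inter> truncated_sector \<theta>m \<theta>M h \<in> sets borel"
    using A open_truncated_sector[OF \<theta>(2)] by auto
  have "emeasure lborel (A \<inter> truncated_sector \<theta>m \<theta>M h) = ennreal (measure lborel (A \<inter> truncated_sector \<theta>m \<theta>M h))"
    using emeasure_bounded_finite[of "A \<inter> truncated_sector \<theta>m \<theta>M h"] bounded_truncated_sector
    by (intro emeasure_eq_ennreal_measure) (auto simp: bounded_Int)
  also have "\<dots> = ennreal (LINT q:B|lborel. q $ 1)"
    using m S by (simp add: measure_completion)
  also have "\<dots> = (\<integral>\<^sup>+q. ennreal (indicator B q *\<^sub>R q $ 1) \<partial>lborel)"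
    unfolding set_lebesgue_integral_def using int unfolding set_integrable_def
    by (intro nn_integral_eq_integral[symmetric]) (auto simp: B_def split: split_indicator)
  also have "\<dots> = (\<integral>\<^sup>+q. ennreal (indicator B q *\<^sub>R q $ 1) \<partial>distr lborel borel w)"
    by (simp add: w_def lborel_plane)
  also have "\<dots> = (\<integral>\<^sup>+p. ennreal (indicator B (w p) *\<^sub>R w p $ 1) \<partial>lborel)"
  proof (rule nn_integral_distr)
    have "w = (\<lambda>p. fst p *\<^sub>R axis 1 1 + snd p *\<^sub>R axis 2 1)"
      by (auto simp: w_def fun_eq_iff vec_eq_iff forall_2 axis_def)
    then show "w \<in> lborel \<rightarrow>\<^sub>M borel"
      by (simp add: borel_measurable_continuous_onI continuous_intros)
  qed measurable
  also have "\<dots> = (\<integral>\<^sup>+p. ennreal (indicator ({0<..<h} \<times> {\<theta>m<..<\<theta>M}) p * fst p) * indicator A (polar (fst p) (snd p)) \<partial>lborel)"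
    by (intro nn_integral_cong) (auto simp: B_def w_def split: split_indicator)
  finally show ?thesis .
qed

text \<open>By \<open>emeasure_polar\<close> the Lebesgue measure restricted to the sector is the
  image under the polar map of the measure with density r on the rectangle; integrals against image
  and density measures do the rest.\<close>

lemma integral_polar:
  fixes f :: "plane \<Rightarrow> 'b::{banach, second_countable_topology}"
  assumes \<theta>: "- pi \<le> \<theta>m" "\<theta>M \<le> pi" and f: "f \<in> borel_measurable borel"
  shows "(LINT x|lebesgue_on (truncated_sector \<theta>m \<theta>M h). f x)
    = (LINT p:({0<..<h} \<times> {\<theta>m<..<\<theta>M})|lborel. fst p *\<^sub>R f (polar (fst p) (snd p)))"
proof -
  note [measurable] = f
  let ?S = "truncated_sector \<theta>m \<theta>M h" and ?R = "{0<..<h} \<times> {\<theta>m<..<\<theta>M}"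
  let ?Q = "\<lambda>p::real \<times> real. polar (fst p) (snd p)" and ?g = "\<lambda>p. indicator ?R p * fst p :: real"
  have S [measurable]: "?S \<in> sets borel"
    using open_truncated_sector[OF \<theta>(2)] by auto
  have R [measurable]: "?R \<in> sets borel"
    by (intro borel_open open_Times) auto
  have Q [measurable]: "?Q \<in> borel_measurable borel"
    by (intro borel_measurable_continuous_onI continuous_intros)
  have g [measurable]: "?g \<in> borel_measurable borel"
    by (intro borel_measurable_times borel_measurable_indicator R borel_measurable_continuous_onI continuous_intros)
  have eq: "density lborel (\<lambda>x. ennreal (indicator ?S x)) = distr (density lborel (\<lambda>p. ennreal (?g p))) borel ?Q"
  proof (rule measure_eqI)
    fix A assume "A \<in> sets (density lborel (\<lambda>x. ennreal (indicator ?S x)))"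
    then have A [measurable]: "A \<in> sets borel" by simp
    have "emeasure (density lborel (\<lambda>x. ennreal (indicator ?S x))) A = (\<integral>\<^sup>+x. indicator (A \<inter> ?S) x \<partial>lborel)"
    proof -
      have "emeasure (density lborel (\<lambda>x. ennreal (indicator ?S x))) A
          = (\<integral>\<^sup>+x. ennreal (indicator ?S x) * indicator A x \<partial>lborel)"
        by (rule emeasure_density) auto
      also have "\<dots> = (\<integral>\<^sup>+x. indicator (A \<inter> ?S) x \<partial>lborel)"
        by (rule nn_integral_cong) (simp split: split_indicator)
      finally show ?thesis .
    qed
    also have "\<dots> = emeasure lborel (A \<inter> ?S)" by (rule nn_integral_indicator) measurable
    also have "\<dots> = (\<integral>\<^sup>+p. ennreal (?g p) * indicator (?Q -` A) p \<partial>lborel)"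
      unfolding emeasure_polar[OF \<theta> A] by (intro nn_integral_cong) (auto split: split_indicator)
    also have "\<dots> = emeasure (density lborel (\<lambda>p. ennreal (?g p))) (?Q -` A)"
      using measurable_sets[OF Q A] by (subst emeasure_density) auto
    also have "\<dots> = emeasure (distr (density lborel (\<lambda>p. ennreal (?g p))) borel ?Q) A"
      by (subst emeasure_distr) auto
    finally show "emeasure (density lborel (\<lambda>x. ennreal (indicator ?S x))) A
        = emeasure (distr (density lborel (\<lambda>p. ennreal (?g p))) borel ?Q) A" .
  qed simp
  have "(LINT x|lebesgue_on ?S. f x) = (LINT x|lborel. indicator ?S x *\<^sub>R f x)"
    using S by (simp add: integral_restrict_space integral_completion)
  also have "\<dots> = (LINT x|density lborel (\<lambda>x. ennreal (indicator ?S x)). f x)"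
    by (subst integral_density) auto
  also have "\<dots> = (LINT x|distr (density lborel (\<lambda>p. ennreal (?g p))) borel ?Q. f x)"
    unfolding eq ..
  also have "\<dots> = (LINT p|density lborel (\<lambda>p. ennreal (?g p)). f (?Q p))"
    by (rule integral_distr) auto
  also have "\<dots> = (LINT p|lborel. ?g p *\<^sub>R f (?Q p))"
    by (rule integral_density) (auto split: split_indicator)
  finally show ?thesis by (simp add: set_lebesgue_integral_def)
qed

lemma integral_polar_iterated:
  fixes f :: "plane \<Rightarrow> 'b::euclidean_space"
  assumes \<theta>: "- pi \<le> \<theta>m" "\<theta>M \<le> pi" and f: "continuous_on UNIV f"
  shows "(LINT x|lebesgue_on (truncated_sector \<theta>m \<theta>M h). f x)
      = integral {0..h} (\<lambda>r. integral {\<theta>m..\<theta>M} (\<lambda>\<theta>. r *\<^sub>R f (polar r \<theta>)))" (is "?L = ?A")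
    and "(LINT x|lebesgue_on (truncated_sector \<theta>m \<theta>M h). f x)
      = integral {\<theta>m..\<theta>M} (\<lambda>\<theta>. integral {0..h} (\<lambda>r. r *\<^sub>R f (polar r \<theta>)))" (is "?L = ?B")
proof -
  let ?F = "\<lambda>p::real \<times> real. fst p *\<^sub>R f (polar (fst p) (snd p))"
  have cont: "continuous_on S ?F" for S
    by (intro continuous_intros continuous_on_compose2[OF f]) auto
  have R: "{0<..<h} \<times> {\<theta>m<..<\<theta>M} = box (0, \<theta>m) (h, \<theta>M)"
    by (simp add: box_real_pair)
  have "integrable lborel (\<lambda>p. indicator (cbox (0, \<theta>m) (h, \<theta>M)) p *\<^sub>R ?F p)"
    using cont by (intro borel_integrable_compact compact_cbox)
  then have int: "set_integrable lborel (box (0, \<theta>m) (h, \<theta>M)) ?F"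
    unfolding set_integrable_def[symmetric]
    by (rule set_integrable_subset) (auto simp: box_subset_cbox)
  have "?L = (LINT p:box (0, \<theta>m) (h, \<theta>M)|lborel. ?F p)"
    using integral_polar[OF \<theta>, of f h] f R by (simp add: borel_measurable_continuous_onI)
  also have "\<dots> = integral (box (0, \<theta>m) (h, \<theta>M)) ?F"
    by (rule set_borel_integral_eq_integral(2)[OF int])
  also have "\<dots> = integral (cbox (0, \<theta>m) (h, \<theta>M)) ?F"
    by (rule integral_open_interval)
  also have "\<dots> = ?A"
    using integral_prod_continuous[OF cont, of 0 \<theta>m h \<theta>M] by simp
  finally show A: "?L = ?A" .
  have "continuous_on (cbox (0, \<theta>m) (h, \<theta>M)) (\<lambda>(r, \<theta>). r *\<^sub>R f (polar r \<theta>))"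
    using cont[of "cbox (0, \<theta>m) (h, \<theta>M)"] by (simp add: case_prod_beta')
  from integral_swap_continuous[OF this] have "?A = ?B" by simp
  with A show "?L = ?B" by simp
qed

subsection \<open>Integrals over sectors\<close>

lemma has_derivative_pd_2:
  fixes f :: "plane \<Rightarrow> 'b::real_normed_vector"
  assumes "C_infinity f"
  shows "(f has_derivative (\<lambda>h. h $ 1 *\<^sub>R pd 1 f x + h $ 2 *\<^sub>R pd 2 f x)) (at x within S)"
  using has_derivative_at_withinI[OF has_derivative_pd[OF C_infinity_differentiable[OF assms]]]
  by (simp add: UNIV_2)

lemma polar_radial_derivative:
  fixes f :: "plane \<Rightarrow> 'b::real_normed_vector"
  assumes "C_infinity f"
  shows "((\<lambda>r. f (polar r \<theta>)) has_vector_derivative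
    cos \<theta> *\<^sub>R pd 1 f (polar r \<theta>) + sin \<theta> *\<^sub>R pd 2 f (polar r \<theta>)) (at r within S)"
proof -
  have "((\<lambda>r. polar r \<theta>) has_derivative (\<lambda>k. (k * cos \<theta>) *\<^sub>R axis 1 1 + (k * sin \<theta>) *\<^sub>R axis 2 1)) (at r within S)"
    unfolding polar_def by (auto intro!: derivative_eq_intros)
  from has_derivative_compose[OF this has_derivative_pd_2[OF assms, where S = UNIV]]
  show ?thesis
    by (simp add: has_vector_derivative_def axis_def scaleR_add_right)
qed

lemma polar_angular_derivative:
  fixes f :: "plane \<Rightarrow> 'b::real_normed_vector"
  assumes "C_infinity f"
  shows "((\<lambda>\<theta>. f (polar r \<theta>)) has_vector_derivative
    r *\<^sub>R (cos \<theta> *\<^sub>R pd 2 f (polar r \<theta>) - sin \<theta> *\<^sub>R pd 1 f (polar r \<theta>))) (at \<theta> within S)"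
proof -
  have "((\<lambda>\<theta>. polar r \<theta>) has_derivative
      (\<lambda>k. - (k * (r * sin \<theta>)) *\<^sub>R axis 1 1 + (k * (r * cos \<theta>)) *\<^sub>R axis 2 1)) (at \<theta> within S)"
    unfolding polar_def by (auto intro!: derivative_eq_intros simp: fun_eq_iff algebra_simps)
  from has_derivative_compose[OF this has_derivative_pd_2[OF assms, where S = UNIV]]
  show ?thesis
    by (simp add: has_vector_derivative_def axis_def scaleR_diff_right algebra_simps)
qed

lemma C_infinity_continuous_polar:
  fixes f :: "plane \<Rightarrow> 'b::real_normed_vector" and S :: "'a::t2_space set"
  assumes "C_infinity f" "continuous_on S a" "continuous_on S b"
  shows "continuous_on S (\<lambda>x. f (polar (a x) (b x)))"
  by (rule continuous_on_compose2[OF C_infinity_continuous[OF assms(1), of UNIV] continuous_on_polar[OF assms(2,3)]]) simp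

lemma continuous_on_integral_param:
  fixes f :: "real \<Rightarrow> real \<Rightarrow> 'b::banach"
  assumes "\<And>S. continuous_on S (\<lambda>p. f (fst p) (snd p))"
  shows "continuous_on U (\<lambda>x. integral {a..b} (f x))"
  using integral_continuous_on_param[of U a b f] assms[of "U \<times> {a..b}"]
  by (simp add: case_prod_beta')

text \<open>In polar coordinates r \<partial>f splits exactly into \<partial>/\<partial>r of r u f
  plus \<partial>/\<partial>\<theta> of w f, with (u, w) = (cos, -sin) for the first and (sin, cos)
  for the second derivative; this uses w' = -u. The radial part vanishes at r = 0 through the factor
  r and at r = h through \<open>zero\<close>, so only the two sides contribute.\<close>

lemma sector_divergence:
  fixes f :: "plane \<Rightarrow> 'b::euclidean_space"
  assumes \<theta>: "- pi \<le> \<theta>m" "\<theta>m \<le> \<theta>M" "\<theta>M \<le> pi" and h: "h > 0" and f: "C_infinity f"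
    and zero: "\<And>x. norm x = h \<Longrightarrow> f x = 0"
  shows "norm (LINT x|lebesgue_on (truncated_sector \<theta>m \<theta>M h). pd k f x)
    \<le> integral {0..h} (\<lambda>r. norm (f (polar r \<theta>M)) + norm (f (polar r \<theta>m)))"
proof -
  define u where "u = (\<lambda>\<theta>. if k = 1 then cos \<theta> else sin \<theta> :: real)"
  define w where "w = (\<lambda>\<theta>. if k = 1 then - sin \<theta> else cos \<theta> :: real)"
  have u: "continuous_on S (\<lambda>x. u (a x))" and w: "continuous_on S (\<lambda>x. w (a x))"
    if "continuous_on S a" for S :: "'c::t2_space set" and a
    unfolding u_def w_def using that by (cases "k = 1"; simp; intro continuous_intros)+
  have dw: "(w has_real_derivative - u t) (at t within S)" for t S
    unfolding u_def w_def by (cases "k = 1") (auto intro!: derivative_eq_intros)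
  have w1: "\<bar>w t\<bar> \<le> 1" for t unfolding w_def by simp
  define A where "A r t = u t *\<^sub>R f (polar r t)
      + (r * u t) *\<^sub>R (cos t *\<^sub>R pd 1 f (polar r t) + sin t *\<^sub>R pd 2 f (polar r t))" for r t
  define B where "B r t = w t *\<^sub>R (r *\<^sub>R (cos t *\<^sub>R pd 2 f (polar r t) - sin t *\<^sub>R pd 1 f (polar r t)))
      + (- u t) *\<^sub>R f (polar r t)" for r t
  have AB: "r *\<^sub>R pd k f (polar r t) = A r t + B r t" for r t
  proof -
    have "A r t + B r t = (r * (u t * cos t - w t * sin t)) *\<^sub>R pd 1 f (polar r t)
        + (r * (u t * sin t + w t * cos t)) *\<^sub>R pd 2 f (polar r t)"
      by (simp add: A_def B_def algebra_simps)
    moreover have "k = 1 \<or> k = 2" by (rule exhaust_2)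
    moreover have "sin t * sin t + cos t * cos t = 1"
      using sin_cos_squared_add[of t] unfolding power2_eq_square .
    ultimately show ?thesis
      by (auto simp: u_def w_def add.commute)
  qed
  have cA: "continuous_on S (\<lambda>p. A (fst p) (snd p))" and cB: "continuous_on S (\<lambda>p. B (fst p) (snd p))"
    for S :: "(real \<times> real) set"
    unfolding A_def B_def
    by (intro continuous_intros u w C_infinity_continuous_polar C_infinity_pd f)+
  have cA1: "continuous_on S (A r)" and cB1: "continuous_on S (B r)" for S r
    unfolding A_def B_def
    by (intro continuous_intros u w C_infinity_continuous_polar C_infinity_pd f)+
  have "integral {0..h} (\<lambda>r. A r t) = (h * u t) *\<^sub>R f (polar h t) - (0 * u t) *\<^sub>R f (polar 0 t)" for t
  proof (rule integral_unique[OF fundamental_theorem_of_calculus])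
    fix r
    have "((\<lambda>r. r * u t) has_real_derivative u t) (at r within {0..h})"
      by (auto intro!: derivative_eq_intros)
    from has_vector_derivative_scaleR[OF this polar_radial_derivative[OF f]]
    show "((\<lambda>r. (r * u t) *\<^sub>R f (polar r t)) has_vector_derivative A r t) (at r within {0..h})"
      by (simp add: A_def add.commute)
  qed (use h in simp)
  then have A0: "integral {0..h} (\<lambda>r. A r t) = 0" for t
    using zero[of "polar h t"] h by (simp add: norm_polar)
  have Bt: "integral {\<theta>m..\<theta>M} (B r) = w \<theta>M *\<^sub>R f (polar r \<theta>M) - w \<theta>m *\<^sub>R f (polar r \<theta>m)" for r
  proof (rule integral_unique[OF fundamental_theorem_of_calculus[OF \<theta>(2)]])
    fix t
    show "((\<lambda>t. w t *\<^sub>R f (polar r t)) has_vector_derivative B r t) (at t within {\<theta>m..\<theta>M})"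
      using has_vector_derivative_scaleR[OF dw polar_angular_derivative[OF f]]
      by (simp add: B_def add.commute)
  qed
  have sw: "integral {0..h} (\<lambda>r. integral {\<theta>m..\<theta>M} (A r)) = integral {\<theta>m..\<theta>M} (\<lambda>t. integral {0..h} (\<lambda>r. A r t))"
    using integral_swap_continuous[of 0 \<theta>m h \<theta>M A] cA[of "cbox (0, \<theta>m) (h, \<theta>M)"]
    by (simp add: case_prod_beta')
  have "(LINT x|lebesgue_on (truncated_sector \<theta>m \<theta>M h). pd k f x)
      = integral {0..h} (\<lambda>r. integral {\<theta>m..\<theta>M} (\<lambda>t. A r t + B r t))"
    using integral_polar_iterated(1)[OF \<theta>(1,3) C_infinity_continuous[OF C_infinity_pd[OF f]], of h k]
    by (simp add: AB)
  also have "\<dots> = integral {0..h} (\<lambda>r. integral {\<theta>m..\<theta>M} (A r) + integral {\<theta>m..\<theta>M} (B r))"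
    by (intro integral_cong Henstock_Kurzweil_Integration.integral_add integrable_continuous_real cA1 cB1)
  also have "\<dots> = integral {0..h} (\<lambda>r. integral {\<theta>m..\<theta>M} (A r)) + integral {0..h} (\<lambda>r. integral {\<theta>m..\<theta>M} (B r))"
    by (intro Henstock_Kurzweil_Integration.integral_add integrable_continuous_real continuous_on_integral_param cA cB)
  also have "\<dots> = integral {0..h} (\<lambda>r. w \<theta>M *\<^sub>R f (polar r \<theta>M) - w \<theta>m *\<^sub>R f (polar r \<theta>m))"
    by (simp add: sw A0 Bt)
  also have "norm \<dots> \<le> integral {0..h} (\<lambda>r. norm (f (polar r \<theta>M)) + norm (f (polar r \<theta>m)))"
  proof (rule integral_norm_bound_integral)
    show "norm (w \<theta>M *\<^sub>R f (polar r \<theta>M) - w \<theta>m *\<^sub>R f (polar r \<theta>m))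
        \<le> norm (f (polar r \<theta>M)) + norm (f (polar r \<theta>m))" for r
      by (rule order_trans[OF norm_triangle_ineq4]) (intro add_mono; simp add: w1 mult_left_le_one_le)
  qed (intro integrable_continuous_real continuous_intros C_infinity_continuous_polar f)+
  finally show ?thesis .
qed

text \<open>Along the arc of radius r, \<open>f\<close> differs from its value on the side \<theta>m
  by at most the integral of r (|\<partial>1 f| + |\<partial>2 f|) over the angle, called
  \<open>J r\<close>. This bound does not depend on the angle; integrating it over the sector costs
  the opening and, from the weight r, a factor \<rho>.\<close>

lemma sector_Poincare:
  fixes f :: "plane \<Rightarrow> 'b::euclidean_space"
  assumes \<theta>: "- pi \<le> \<theta>m" "\<theta>m \<le> \<theta>M" "\<theta>M \<le> pi" and \<rho>: "\<rho> > 0" and f: "C_infinity f"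
  shows "(LINT x|lebesgue_on (truncated_sector \<theta>m \<theta>M \<rho>). norm (f x))
    \<le> (\<theta>M - \<theta>m) * \<rho> * (integral {0..\<rho>} (\<lambda>r. norm (f (polar r \<theta>m)))
      + (LINT x|lebesgue_on (truncated_sector \<theta>m \<theta>M \<rho>). norm (pd 1 f x) + norm (pd 2 f x)))"
proof -
  define g where "g x = norm (pd 1 f x) + norm (pd 2 f x)" for x
  have cg: "continuous_on UNIV g"
    unfolding g_def by (intro continuous_intros C_infinity_continuous C_infinity_pd f)
  have cg': "continuous_on S (\<lambda>x. g (polar (a x) (b x)))"
    if "continuous_on S a" "continuous_on S b" for S :: "'c::t2_space set" and a b
    unfolding g_def by (intro continuous_intros C_infinity_continuous_polar C_infinity_pd f that)
  define J where "J r = integral {\<theta>m..\<theta>M} (\<lambda>t. r * g (polar r t))" for r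
  have pw: "norm (f (polar r t)) \<le> norm (f (polar r \<theta>m)) + J r" if r: "r \<ge> 0" and t: "t \<in> {\<theta>m..\<theta>M}" for r t
  proof -
    let ?d = "\<lambda>s. r *\<^sub>R (cos s *\<^sub>R pd 2 f (polar r s) - sin s *\<^sub>R pd 1 f (polar r s))"
    have "(?d has_integral f (polar r t) - f (polar r \<theta>m)) {\<theta>m..t}"
      using t by (intro fundamental_theorem_of_calculus polar_angular_derivative f) simp
    then have "f (polar r t) - f (polar r \<theta>m) = integral {\<theta>m..t} ?d" by (rule integral_unique[symmetric])
    also have "norm \<dots> \<le> integral {\<theta>m..t} (\<lambda>s. r * g (polar r s))"
    proof (rule integral_norm_bound_integral)
      fix s
      have "norm (cos s *\<^sub>R pd 2 f (polar r s) - sin s *\<^sub>R pd 1 f (polar r s)) \<le> g (polar r s)"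
        unfolding g_def add.commute[of "norm (pd 1 f _)"]
        by (rule order_trans[OF norm_triangle_ineq4]) (intro add_mono; simp add: mult_left_le_one_le)
      then show "norm (?d s) \<le> r * g (polar r s)" using r by (simp add: mult_left_mono)
    qed (intro integrable_continuous_real continuous_intros C_infinity_continuous_polar cg' C_infinity_pd f)+
    also have "\<dots> \<le> J r"
      unfolding J_def using t r
      by (intro integral_subset_le integrable_continuous_real continuous_intros cg')
        (auto simp: g_def)
    finally have "norm (f (polar r t) - f (polar r \<theta>m)) \<le> J r" .
    then show ?thesis using norm_triangle_sub[of "f (polar r t)" "f (polar r \<theta>m)"] by linarith
  qed
  have J0: "J r \<ge> 0" if "r \<ge> 0" for r
    unfolding J_def using that by (intro integral_nonneg integrable_continuous_real continuous_intros cg') (auto simp: g_def)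
  have cJ: "continuous_on S J" for S
    unfolding J_def by (intro continuous_on_integral_param continuous_intros cg')
  have "(LINT x|lebesgue_on (truncated_sector \<theta>m \<theta>M \<rho>). norm (f x))
      = integral {0..\<rho>} (\<lambda>r. integral {\<theta>m..\<theta>M} (\<lambda>t. r * norm (f (polar r t))))"
    using integral_polar_iterated(1)[OF \<theta>(1,3), of "\<lambda>x. norm (f x)" \<rho>] f
    by (simp add: continuous_intros C_infinity_continuous)
  also have "\<dots> \<le> integral {0..\<rho>} (\<lambda>r. (\<theta>M - \<theta>m) * \<rho> * (norm (f (polar r \<theta>m)) + J r))"
  proof (rule integral_le)
    fix r assume r: "r \<in> {0..\<rho>}"
    have "integral {\<theta>m..\<theta>M} (\<lambda>t. r * norm (f (polar r t)))
        \<le> integral {\<theta>m..\<theta>M} (\<lambda>t. \<rho> * (norm (f (polar r \<theta>m)) + J r))"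
    proof (rule integral_le)
      fix t assume "t \<in> {\<theta>m..\<theta>M}"
      then show "r * norm (f (polar r t)) \<le> \<rho> * (norm (f (polar r \<theta>m)) + J r)"
        using r \<rho> pw[of r t] by (intro mult_mono) auto
    qed (intro integrable_continuous_real continuous_intros C_infinity_continuous_polar f)+
    also have "\<dots> = (\<theta>M - \<theta>m) * \<rho> * (norm (f (polar r \<theta>m)) + J r)"
      using \<theta>(2) by simp
    finally show "integral {\<theta>m..\<theta>M} (\<lambda>t. r * norm (f (polar r t))) \<le> (\<theta>M - \<theta>m) * \<rho> * (norm (f (polar r \<theta>m)) + J r)" .
  qed (intro integrable_continuous_real continuous_on_integral_param continuous_intros C_infinity_continuous_polar f cJ)+
  also have "\<dots> = (\<theta>M - \<theta>m) * \<rho> * integral {0..\<rho>} (\<lambda>r. norm (f (polar r \<theta>m)) + J r)"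
    by (rule integral_mult_right)
  also have "integral {0..\<rho>} (\<lambda>r. norm (f (polar r \<theta>m)) + J r) = integral {0..\<rho>} (\<lambda>r. norm (f (polar r \<theta>m))) + integral {0..\<rho>} J"
    by (intro Henstock_Kurzweil_Integration.integral_add integrable_continuous_real continuous_intros C_infinity_continuous_polar f cJ)
  also have "integral {0..\<rho>} J = (LINT x|lebesgue_on (truncated_sector \<theta>m \<theta>M \<rho>). g x)"
    using integral_polar_iterated(1)[OF \<theta>(1,3) cg, of \<rho>] by (simp add: J_def[abs_def])
  finally show ?thesis by (simp add: g_def)
qed

lemma measure_truncated_sector:
  assumes \<theta>: "- pi \<le> \<theta>m" "\<theta>m \<le> \<theta>M" "\<theta>M \<le> pi" and \<rho>: "\<rho> > 0"
  shows "measure lebesgue (truncated_sector \<theta>m \<theta>M \<rho>) = (\<theta>M - \<theta>m) * \<rho>\<^sup>2 / 2"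
proof -
  have S: "truncated_sector \<theta>m \<theta>M \<rho> \<in> lmeasurable"
    by (intro bounded_open_lmeasurable open_truncated_sector bounded_truncated_sector \<theta>)
  have "measure lebesgue (truncated_sector \<theta>m \<theta>M \<rho>) = (LINT x|lebesgue_on (truncated_sector \<theta>m \<theta>M \<rho>). 1)"
    using S by (simp add: measure_restrict_space fmeasurableD)
  also have "\<dots> = integral {\<theta>m..\<theta>M} (\<lambda>\<theta>. integral {0..\<rho>} (\<lambda>r. r))"
    using integral_polar_iterated(2)[OF \<theta>(1,3), of "\<lambda>x. 1::real" \<rho>] by simp
  also have "\<dots> = (\<theta>M - \<theta>m) * \<rho>\<^sup>2 / 2"
    using \<theta>(2) \<rho> by simp
  finally show ?thesis .
qed

text \<open>Since r / (\<epsilon> + r) is at most 1, the radial integrand is below \<epsilon>^3 /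
  (\<epsilon> + r)^2, the derivative of -\<epsilon>^3 / (\<epsilon> + r). Three is the least integer
  power for which the bound does not grow with \<open>h\<close>.\<close>

lemma sector_radial_bound:
  assumes \<theta>: "- pi \<le> \<theta>m" "\<theta>m \<le> \<theta>M" "\<theta>M \<le> pi" and h: "h > 0" and \<epsilon>: "\<epsilon> > 0"
  shows "(LINT x|lebesgue_on (truncated_sector \<theta>m \<theta>M h). (\<epsilon> / (\<epsilon> + norm x)) ^ 3) \<le> (\<theta>M - \<theta>m) * \<epsilon>\<^sup>2"
proof -
  have pos: "\<epsilon> + norm x > 0" for x :: plane using \<epsilon> by (simp add: add_pos_nonneg)
  have c: "continuous_on UNIV (\<lambda>x::plane. (\<epsilon> / (\<epsilon> + norm x)) ^ 3)"
    using pos by (intro continuous_intros) (metis less_irrefl)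
  have "integral {0..h} (\<lambda>r. r * (\<epsilon> / (\<epsilon> + \<bar>r\<bar>)) ^ 3) \<le> \<epsilon>\<^sup>2"
  proof -
    have 1: "((\<lambda>r. \<epsilon> ^ 3 / (\<epsilon> + r)\<^sup>2) has_integral (- (\<epsilon> ^ 3) / (\<epsilon> + h) - (- (\<epsilon> ^ 3) / (\<epsilon> + 0)))) {0..h}"
      using \<epsilon> h by (intro fundamental_theorem_of_calculus)
        (auto intro!: derivative_eq_intros simp: has_real_derivative_iff_has_vector_derivative[symmetric] power2_eq_square)
    have "integral {0..h} (\<lambda>r. r * (\<epsilon> / (\<epsilon> + \<bar>r\<bar>)) ^ 3) \<le> integral {0..h} (\<lambda>r. \<epsilon> ^ 3 / (\<epsilon> + r)\<^sup>2)"
    proof (rule integral_le)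
      show "(\<lambda>r. r * (\<epsilon> / (\<epsilon> + \<bar>r\<bar>)) ^ 3) integrable_on {0..h}"
        using \<epsilon> by (intro integrable_continuous_real continuous_intros) (auto simp: add_pos_nonneg)
      show "(\<lambda>r. \<epsilon> ^ 3 / (\<epsilon> + r)\<^sup>2) integrable_on {0..h}" using 1 by blast
      fix r assume "r \<in> {0..h}"
      then have r: "r \<ge> 0" "\<epsilon> + r > 0" using \<epsilon> by auto
      have "r * (\<epsilon> / (\<epsilon> + \<bar>r\<bar>)) ^ 3 = (\<epsilon> ^ 3 / (\<epsilon> + r)\<^sup>2) * (r / (\<epsilon> + r))"
        using r by (simp add: power_divide power2_eq_square power3_eq_cube)
      also have "\<dots> \<le> (\<epsilon> ^ 3 / (\<epsilon> + r)\<^sup>2) * 1"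
        using r \<epsilon> by (intro mult_left_mono) auto
      finally show "r * (\<epsilon> / (\<epsilon> + \<bar>r\<bar>)) ^ 3 \<le> \<epsilon> ^ 3 / (\<epsilon> + r)\<^sup>2" by simp
    qed
    also have "\<dots> = \<epsilon>\<^sup>2 - \<epsilon> ^ 3 / (\<epsilon> + h)"
      using integral_unique[OF 1] \<epsilon> by (simp add: power2_eq_square power3_eq_cube)
    also have "\<dots> \<le> \<epsilon>\<^sup>2" using \<epsilon> h by simp
    finally show ?thesis .
  qed
  then have "integral {\<theta>m..\<theta>M} (\<lambda>\<theta>. integral {0..h} (\<lambda>r. r * (\<epsilon> / (\<epsilon> + \<bar>r\<bar>)) ^ 3)) \<le> (\<theta>M - \<theta>m) * \<epsilon>\<^sup>2"
    using \<theta>(2) by (simp add: mult_left_mono)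
  then show ?thesis
    using integral_polar_iterated(2)[OF \<theta>(1,3) c, of h] by (simp add: norm_polar)
qed

subsection \<open>Holomorphic kernels concentrating at the vertex\<close>

text \<open>The parameter \<open>\<sigma> = \<plusminus>i\<close> selects holomorphic or antiholomorphic functions of the point.\<close>

definition zcoord :: "complex \<Rightarrow> plane \<Rightarrow> complex" where
  "zcoord \<sigma> x = of_real (x $ 1) + \<sigma> * of_real (x $ 2)"

definition unit_dir :: "complex \<Rightarrow> real \<Rightarrow> complex" where
  "unit_dir \<sigma> \<theta> = of_real (cos \<theta>) + \<sigma> * of_real (sin \<theta>)"

lemma zcoord_polar: "zcoord \<sigma> (polar r \<theta>) = of_real r * unit_dir \<sigma> \<theta>"
  by (simp add: zcoord_def unit_dir_def algebra_simps)

lemma bounded_linear_zcoord: "bounded_linear (zcoord \<sigma>)"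
  unfolding zcoord_def
  by (intro bounded_linear_add bounded_linear_const_mult bounded_linear_of_real
      bounded_linear_compose[OF bounded_linear_of_real] bounded_linear_vec_nth)

lemma unit_dir_mult:
  assumes "\<sigma>\<^sup>2 = -1"
  shows "unit_dir \<sigma> \<theta> * (of_real (cos \<theta>) - \<sigma> * of_real (sin \<theta>)) = 1"
proof -
  have "unit_dir \<sigma> \<theta> * (of_real (cos \<theta>) - \<sigma> * of_real (sin \<theta>))
      = (of_real (cos \<theta>))\<^sup>2 - \<sigma>\<^sup>2 * (of_real (sin \<theta>))\<^sup>2"
    by (simp add: unit_dir_def power2_eq_square algebra_simps)
  also have "\<dots> = of_real ((cos \<theta>)\<^sup>2 + (sin \<theta>)\<^sup>2)" unfolding assms of_real_add of_real_power by simp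
  finally show ?thesis by simp
qed

lemma sigma_cases: "\<sigma>\<^sup>2 = -1 \<Longrightarrow> \<sigma> = \<i> \<or> \<sigma> = - \<i>" for \<sigma> :: complex
  using power2_eq_iff[of \<sigma> \<i>] by simp

lemma norm_zcoord: "\<sigma>\<^sup>2 = -1 \<Longrightarrow> norm (zcoord \<sigma> x) = norm x"
  using sigma_cases[of \<sigma>] by (auto simp: zcoord_def norm_plane cmod_def)

lemma norm_unit_dir: "\<sigma>\<^sup>2 = -1 \<Longrightarrow> norm (unit_dir \<sigma> \<theta>) = 1"
  using norm_zcoord[of \<sigma> "polar 1 \<theta>"] by (simp add: zcoord_polar norm_polar)

lemma norm_add_zcoord:
  "\<sigma>\<^sup>2 = -1 \<Longrightarrow> (norm (of_real \<epsilon> + zcoord \<sigma> x))\<^sup>2 = (\<epsilon> + x $ 1)\<^sup>2 + (x $ 2)\<^sup>2"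
  using sigma_cases[of \<sigma>] by (auto simp: zcoord_def cmod_power2)

text \<open>The right-hand side is \<epsilon>^2 + 2 \<epsilon> r cos \<theta> + r^2. Let k > -1 be
  the cosine of the largest |\<theta>|. Replacing cos \<theta> by k gives (1 + k)/2 (\<epsilon> +
  r)^2 plus a nonnegative multiple of (\<epsilon> - r)^2, hence c^2 = (1 + k)/2, the same for all
  \<epsilon>.\<close>

lemma sector_cone:
  assumes \<theta>: "- pi < \<theta>m" "\<theta>m \<le> \<theta>M" "\<theta>M < pi"
  obtains c where "c > 0" "c \<le> 1"
    "\<And>\<epsilon> r \<theta>. \<epsilon> > 0 \<Longrightarrow> r \<ge> 0 \<Longrightarrow> \<theta> \<in> {\<theta>m..\<theta>M} \<Longrightarrow>
      (c * (\<epsilon> + r))\<^sup>2 \<le> (\<epsilon> + r * cos \<theta>)\<^sup>2 + (r * sin \<theta>)\<^sup>2"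
proof -
  define \<theta>0 where "\<theta>0 = max \<bar>\<theta>m\<bar> \<bar>\<theta>M\<bar>"
  define k where "k = cos \<theta>0"
  have \<theta>0: "0 \<le> \<theta>0" "\<theta>0 < pi" using \<theta> by (auto simp: \<theta>0_def)
  have k: "k > -1" "k \<le> 1"
    unfolding k_def using cos_monotone_0_pi[OF \<theta>0(1,2)] by simp_all
  let ?c = "sqrt ((1 + k) / 2)"
  have "?c > 0" "?c \<le> 1" using k by auto
  moreover have "(?c * (\<epsilon> + r))\<^sup>2 \<le> (\<epsilon> + r * cos \<theta>)\<^sup>2 + (r * sin \<theta>)\<^sup>2"
    if "\<epsilon> > 0" "r \<ge> 0" "\<theta> \<in> {\<theta>m..\<theta>M}" for \<epsilon> r \<theta>
  proof -
    have "\<bar>\<theta>\<bar> \<le> \<theta>0" using that(3) by (auto simp: \<theta>0_def)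
    then have "cos \<theta>0 \<le> cos \<bar>\<theta>\<bar>" using \<theta>0 by (intro cos_monotone_0_pi_le) auto
    then have kc: "k \<le> cos \<theta>" by (simp add: k_def abs_if split: if_splits)
    have "(\<epsilon> + r * cos \<theta>)\<^sup>2 + (r * sin \<theta>)\<^sup>2 = \<epsilon>\<^sup>2 + 2 * \<epsilon> * r * cos \<theta> + r\<^sup>2 * ((cos \<theta>)\<^sup>2 + (sin \<theta>)\<^sup>2)"
      unfolding power2_eq_square by (simp only: algebra_simps)
    then have "(\<epsilon> + r * cos \<theta>)\<^sup>2 + (r * sin \<theta>)\<^sup>2 = \<epsilon>\<^sup>2 + 2 * \<epsilon> * r * cos \<theta> + r\<^sup>2" by simp
    moreover have "2 * \<epsilon> * r * k \<le> 2 * \<epsilon> * r * cos \<theta>"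
      using that kc by (intro mult_left_mono) auto
    moreover have "\<epsilon>\<^sup>2 + 2 * \<epsilon> * r * k + r\<^sup>2 = (1 + k) / 2 * (\<epsilon> + r)\<^sup>2 + (1 - k) / 2 * (\<epsilon> - r)\<^sup>2"
      by (simp add: power2_eq_square field_simps)
    moreover have "(1 - k) / 2 * (\<epsilon> - r)\<^sup>2 \<ge> 0" using k by simp
    moreover have "(?c * (\<epsilon> + r))\<^sup>2 = (1 + k) / 2 * (\<epsilon> + r)\<^sup>2"
      using k by (simp add: power_mult_distrib)
    ultimately show ?thesis by linarith
  qed
  ultimately show thesis by (rule that)
qed

text \<open>\<open>\<epsilon>\<^sup>4 / (\<epsilon> + z)\<^sup>4\<close> has its pole at \<open>- \<epsilon>\<close>, outside the closed sector; writing it as a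
  conjugate over a squared modulus allows to remove the pole by a bump without affecting the sector.\<close>

lemma sector_kernel:
  assumes \<sigma>: "\<sigma>\<^sup>2 = -1" and \<theta>: "- pi < \<theta>m" "\<theta>M < pi" and c: "c > 0" and \<epsilon>: "\<epsilon> > 0"
    and cone: "\<And>r \<theta>. r \<ge> 0 \<Longrightarrow> \<theta> \<in> {\<theta>m..\<theta>M} \<Longrightarrow>
      (c * (\<epsilon> + r))\<^sup>2 \<le> (\<epsilon> + r * cos \<theta>)\<^sup>2 + (r * sin \<theta>)\<^sup>2"
  obtains f :: "plane \<Rightarrow> complex" where "C_infinity f"
    "\<And>x. x \<in> sector \<theta>m \<theta>M \<Longrightarrow> pd 1 f x + \<sigma> * pd 2 f x = 0"
    "\<And>r \<theta>. r \<ge> 0 \<Longrightarrow> \<theta> \<in> {\<theta>m..\<theta>M} \<Longrightarrow> f (polar r \<theta>) = (of_real \<epsilon> / (of_real \<epsilon> + of_real r * unit_dir \<sigma> \<theta>)) ^ 4"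
    "\<And>x. x \<in> sector \<theta>m \<theta>M \<Longrightarrow> norm (f x) \<le> (\<epsilon> / (c * (\<epsilon> + norm x))) ^ 4"
proof -
  define t where "t x = (\<epsilon> + x $ 1) * (\<epsilon> + x $ 1) + x $ 2 * x $ 2" for x :: plane
  \<comment> \<open>\<open>t\<close> is the squared distance to the pole. On the sector it is at
    least (c \<epsilon>)^2, so the bump vanishes there, while at the pole the bump is positive and
    keeps the denominator away from 0.\<close>
  define \<rho> where "\<rho> x = t x + flat_exp 0 ((c * \<epsilon>)\<^sup>2 - t x)" for x
  have t_nonneg: "t x \<ge> 0" for x by (simp add: t_def)
  have \<rho>_pos: "\<rho> x > 0" for x
  proof (cases "t x = 0")
    case True
    then show ?thesis using c \<epsilon> by (simp add: \<rho>_def flat_exp_0_pos_iff)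
  next
    case False
    then show ?thesis using t_nonneg[of x] flat_exp_0_nonneg[of "(c * \<epsilon>)\<^sup>2 - t x"] by (simp add: \<rho>_def)
  qed
  \<comment> \<open>As \<sigma> is i or -i, the factor after \<open>\<epsilon>\<close> is the
    conjugate of \<epsilon> + z divided by \<open>\<rho>\<close>; where \<open>\<rho>\<close> is the
    squared modulus this is 1 / (\<epsilon> + z).\<close>
  define f where "f x = (of_real \<epsilon> * ((of_real (\<epsilon> + x $ 1) - \<sigma> * of_real (x $ 2)) * of_real (inverse (\<rho> x)))) ^ 4"
    for x :: plane
  have "C_infinity t" unfolding t_def by (intro C_infinity_intros)
  then have "C_infinity \<rho>" unfolding \<rho>_def by (intro C_infinity_intros C_infinity_flat_exp)
  moreover have "\<rho> x \<noteq> 0" for x using \<rho>_pos[of x] by simp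
  ultimately have inv: "C_infinity (\<lambda>x. inverse (\<rho> x))" by (rule C_infinity_inverse)
  have smooth: "C_infinity f"
    unfolding f_def
    by (intro C_infinity_intros C_infinity_bounded_linear[OF bounded_linear_of_real] inv)
  have f_eq: "f x = (of_real \<epsilon> / (of_real \<epsilon> + zcoord \<sigma> x)) ^ 4"
    and nz: "of_real \<epsilon> + zcoord \<sigma> x \<noteq> 0"
    if "(c * \<epsilon>)\<^sup>2 \<le> t x" for x
  proof -
    have "\<rho> x = t x" using that by (simp add: \<rho>_def flat_exp_0_eq_0_iff)
    have "0 < (c * \<epsilon>)\<^sup>2" using c \<epsilon> by simp
    then have t0: "t x \<noteq> 0" using that by linarith
    let ?a = "of_real \<epsilon> + zcoord \<sigma> x" and ?b = "of_real (\<epsilon> + x $ 1) - \<sigma> * of_real (x $ 2)"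
    have "?a * ?b = of_real ((\<epsilon> + x $ 1)\<^sup>2) - \<sigma>\<^sup>2 * of_real ((x $ 2)\<^sup>2)"
      by (simp add: zcoord_def power2_eq_square algebra_simps)
    also have "\<dots> = of_real (t x)" using \<sigma> by (simp add: t_def power2_eq_square)
    finally have ab: "?a * ?b = of_real (t x)" .
    then show "?a \<noteq> 0" using t0 by auto
    then have "?b * of_real (inverse (t x)) = 1 / ?a"
      using ab t0 by (simp add: field_simps)
    then show "f x = (of_real \<epsilon> / ?a) ^ 4"
      unfolding f_def \<open>\<rho> x = t x\<close> by (simp only: mult_1_right times_divide_eq_right)
  qed
  have t_polar: "(c * (\<epsilon> + r))\<^sup>2 \<le> t (polar r \<theta>)" "(c * \<epsilon>)\<^sup>2 \<le> t (polar r \<theta>)"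
    if "r \<ge> 0" "\<theta> \<in> {\<theta>m..\<theta>M}" for r \<theta>
  proof -
    show 1: "(c * (\<epsilon> + r))\<^sup>2 \<le> t (polar r \<theta>)"
      using cone[OF that] by (simp add: t_def power2_eq_square)
    have "(c * \<epsilon>)\<^sup>2 \<le> (c * (\<epsilon> + r))\<^sup>2" using c \<epsilon> that by (intro power_mono mult_left_mono) auto
    with 1 show "(c * \<epsilon>)\<^sup>2 \<le> t (polar r \<theta>)" by linarith
  qed
  have sec: "(c * (\<epsilon> + norm x))\<^sup>2 \<le> t x" "(c * \<epsilon>)\<^sup>2 \<le> t x" if "x \<in> sector \<theta>m \<theta>M" for x
    using t_polar[of "norm x" "polar_angle x"] that by (auto simp: sector_def polar_norm_polar_angle)
  show thesis
  proof (rule that[OF smooth])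
    show "f (polar r \<theta>) = (of_real \<epsilon> / (of_real \<epsilon> + of_real r * unit_dir \<sigma> \<theta>)) ^ 4"
      if "r \<ge> 0" "\<theta> \<in> {\<theta>m..\<theta>M}" for r \<theta>
      using f_eq[OF t_polar(2)[OF that]] by (simp add: zcoord_polar)
    fix x assume x: "x \<in> sector \<theta>m \<theta>M"
    let ?g = "\<lambda>x. (of_real \<epsilon> / (of_real \<epsilon> + zcoord \<sigma> x)) ^ 4"
    have "((\<lambda>w. (of_real \<epsilon> / (of_real \<epsilon> + w)) ^ 4) has_field_derivative
        deriv (\<lambda>w. (of_real \<epsilon> / (of_real \<epsilon> + w)) ^ 4) (zcoord \<sigma> x)) (at (zcoord \<sigma> x))"
      using nz[OF sec(2)[OF x]]
      by (intro field_differentiable_derivI field_differentiable_power field_differentiable_divide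
          field_differentiable_add field_differentiable_const field_differentiable_ident) auto
    then obtain D where D: "((\<lambda>w. (of_real \<epsilon> / (of_real \<epsilon> + w)) ^ 4) has_field_derivative D) (at (zcoord \<sigma> x))" ..
    have "(?g has_derivative (\<lambda>h. D * zcoord \<sigma> h)) (at x)"
      using has_derivative_compose[OF bounded_linear_imp_has_derivative[OF bounded_linear_zcoord]
          D[unfolded has_field_derivative_def]] by simp
    then have "pd i ?g x = D * zcoord \<sigma> (axis i 1)" for i
      by (rule pd_eqI)
    moreover have "pd i f x = pd i ?g x" for i
      using open_sector x sec(2) f_eq \<theta> by (intro pd_cong_open[of "sector \<theta>m \<theta>M"]) auto
    \<comment> \<open>Cauchy-Riemann: the partial derivatives are the complex derivative times 1 and
      \<sigma>, so the combination carries the factor 1 + \<sigma>^2 = 0.\<close>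
    moreover have "zcoord \<sigma> (axis 1 1) + \<sigma> * zcoord \<sigma> (axis 2 1) = 1 + \<sigma>\<^sup>2"
      by (simp add: zcoord_def axis_def power2_eq_square)
    ultimately show "pd 1 f x + \<sigma> * pd 2 f x = 0"
      using \<sigma> by (metis add.right_inverse distrib_left mult.left_commute mult_zero_right)
    have "(c * (\<epsilon> + norm x))\<^sup>2 \<le> (norm (of_real \<epsilon> + zcoord \<sigma> x))\<^sup>2"
      unfolding norm_add_zcoord[OF \<sigma>] using sec(1)[OF x] by (simp add: t_def power2_eq_square)
    then have le: "c * (\<epsilon> + norm x) \<le> norm (of_real \<epsilon> + zcoord \<sigma> x)"
      by (rule power2_le_imp_le) simp
    have pos: "c * (\<epsilon> + norm x) > 0" using c \<epsilon> by (simp add: add_pos_nonneg)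
    have "norm (f x) = (\<epsilon> / norm (of_real \<epsilon> + zcoord \<sigma> x)) ^ 4"
      using f_eq[OF sec(2)[OF x]] \<epsilon> by (simp add: norm_power norm_divide)
    also have "\<dots> \<le> (\<epsilon> / (c * (\<epsilon> + norm x))) ^ 4"
      using le pos \<epsilon> by (intro power_mono frac_le) auto
    finally show "norm (f x) \<le> (\<epsilon> / (c * (\<epsilon> + norm x))) ^ 4" .
  qed
qed

text \<open>The leading coefficient of the mass of the kernel: with e =
  \<open>unit_dir \<sigma> \<theta>\<close>, the integral of r \<epsilon>^4 / (\<epsilon> + r e)^4
  over all r > 0 is \<epsilon>^2 / (6 e^2).\<close>

definition vertex_moment :: "complex \<Rightarrow> real \<Rightarrow> real \<Rightarrow> complex" where
  "vertex_moment \<sigma> \<theta>m \<theta>M = integral {\<theta>m..\<theta>M} (\<lambda>\<theta>. (inverse (unit_dir \<sigma> \<theta>))\<^sup>2 / 6)"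

lemma inverse_unit_dir:
  "\<sigma>\<^sup>2 = -1 \<Longrightarrow> inverse (unit_dir \<sigma> \<theta>) = of_real (cos \<theta>) - \<sigma> * of_real (sin \<theta>)"
  using unit_dir_mult[of \<sigma> \<theta>] by (metis inverse_unique)

text \<open>The primitive \<open>G\<close> of the integrand depends on the double angle only and
  determines it modulo 2 pi. If the moment vanished, the opening would be a multiple of pi strictly
  between 0 and 2 pi, hence pi itself.\<close>

lemma vertex_moment_nonzero:
  assumes \<sigma>: "\<sigma>\<^sup>2 = -1" and \<theta>: "- pi < \<theta>m" "\<theta>m < \<theta>M" "\<theta>M < pi" "\<theta>M - \<theta>m \<noteq> pi"
  shows "vertex_moment \<sigma> \<theta>m \<theta>M \<noteq> 0"
proof
  assume 0: "vertex_moment \<sigma> \<theta>m \<theta>M = 0"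
  define G where "G \<theta> = (of_real (sin (2 * \<theta>)) + \<sigma> * of_real (cos (2 * \<theta>))) / 12" for \<theta> :: real
  have sq: "(inverse (unit_dir \<sigma> \<theta>))\<^sup>2 = of_real (cos (2 * \<theta>)) - \<sigma> * of_real (sin (2 * \<theta>))" for \<theta>
  proof -
    have "(of_real (cos \<theta>) - \<sigma> * of_real (sin \<theta>))\<^sup>2
      = of_real ((cos \<theta>)\<^sup>2) + \<sigma>\<^sup>2 * of_real ((sin \<theta>)\<^sup>2) - \<sigma> * of_real (2 * sin \<theta> * cos \<theta>)"
      by (simp add: power2_eq_square algebra_simps)
    then show ?thesis using \<sigma> by (simp add: inverse_unit_dir cos_double sin_double)
  qed
  have "((\<lambda>\<theta>. (inverse (unit_dir \<sigma> \<theta>))\<^sup>2 / 6) has_integral G \<theta>M - G \<theta>m) {\<theta>m..\<theta>M}"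
  proof (rule fundamental_theorem_of_calculus)
    fix \<theta>
    have "(G has_vector_derivative (of_real (2 * cos (2 * \<theta>)) + \<sigma> * of_real (- 2 * sin (2 * \<theta>))) / 12) (at \<theta> within {\<theta>m..\<theta>M})"
      unfolding G_def
      by (intro has_vector_derivative_divide has_vector_derivative_add has_vector_derivative_mult_right
          has_vector_derivative_of_real) (auto intro!: derivative_eq_intros)
    then show "(G has_vector_derivative (inverse (unit_dir \<sigma> \<theta>))\<^sup>2 / 6) (at \<theta> within {\<theta>m..\<theta>M})"
      by (simp add: sq algebra_simps diff_divide_distrib)
  qed (use \<theta> in simp)
  from integral_unique[OF this] have "G \<theta>M - G \<theta>m = 0" using 0 by (simp only: vertex_moment_def)
  then have "G \<theta>M = G \<theta>m" by simp
  then have eq: "of_real (sin (2 * \<theta>M)) + \<sigma> * of_real (cos (2 * \<theta>M)) = of_real (sin (2 * \<theta>m)) + \<sigma> * of_real (cos (2 * \<theta>m))"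
    unfolding G_def divide_cancel_right by simp
  have "sin (2 * \<theta>M) = sin (2 * \<theta>m) \<and> cos (2 * \<theta>M) = cos (2 * \<theta>m)"
    using sigma_cases[OF \<sigma>] eq by (auto simp: complex_eq_iff)
  then obtain n :: int where n: "2 * \<theta>M = 2 * \<theta>m + 2 * pi * n"
    using sin_cos_eq_iff by metis
  then have d: "\<theta>M - \<theta>m = pi * of_int n" by (simp add: algebra_simps)
  have "0 < pi * of_int n" "pi * of_int n < pi * 2" using \<theta> d by linarith+
  then have "0 < n" "n < 2" by (auto simp: zero_less_mult_iff)
  then have "n = 1" by linarith
  with d \<theta>(4) show False by simp
qed

text \<open>The radial integral has an explicit primitive. Its value at 0 produces the moment
  exactly, so the whole error is its value at r = h, where the denominator is at least of order h
  and the factor \<epsilon>^4 remains.\<close>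

lemma kernel_integral:
  assumes \<sigma>: "\<sigma>\<^sup>2 = -1" and \<theta>: "- pi \<le> \<theta>m" "\<theta>m \<le> \<theta>M" "\<theta>M \<le> pi" and c: "c > 0" and \<epsilon>: "\<epsilon> > 0" and h: "h > 0"
    and cone: "\<And>r \<theta>. r \<ge> 0 \<Longrightarrow> \<theta> \<in> {\<theta>m..\<theta>M} \<Longrightarrow>
      (c * (\<epsilon> + r))\<^sup>2 \<le> (\<epsilon> + r * cos \<theta>)\<^sup>2 + (r * sin \<theta>)\<^sup>2"
    and f: "continuous_on UNIV f"
      "\<And>r \<theta>. r \<ge> 0 \<Longrightarrow> \<theta> \<in> {\<theta>m..\<theta>M} \<Longrightarrow> f (polar r \<theta>) = (of_real \<epsilon> / (of_real \<epsilon> + of_real r * unit_dir \<sigma> \<theta>)) ^ 4"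
  shows "norm ((LINT x|lebesgue_on (truncated_sector \<theta>m \<theta>M h). f x) - of_real (\<epsilon>\<^sup>2) * vertex_moment \<sigma> \<theta>m \<theta>M)
    \<le> (\<theta>M - \<theta>m) * (1 / (2 * c\<^sup>2 * h\<^sup>2) + 1 / (3 * c ^ 3 * h\<^sup>2)) * \<epsilon> ^ 4"
proof -
  let ?e = "unit_dir \<sigma>" and ?\<epsilon> = "of_real \<epsilon> :: complex"
  have e1: "norm (?e \<theta>) = 1" for \<theta> by (rule norm_unit_dir[OF \<sigma>])
  then have e0: "?e \<theta> \<noteq> 0" for \<theta> by (metis norm_zero zero_neq_one)
  define D where "D \<theta> w = ?\<epsilon> + w * ?e \<theta>" for \<theta> w
  have D_ge: "norm (D \<theta> (of_real r)) \<ge> c * (\<epsilon> + r)" if "r \<ge> 0" "\<theta> \<in> {\<theta>m..\<theta>M}" for r \<theta>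
  proof -
    have "(c * (\<epsilon> + r))\<^sup>2 \<le> (norm (D \<theta> (of_real r)))\<^sup>2"
      using cone[OF that] norm_add_zcoord[OF \<sigma>, of \<epsilon> "polar r \<theta>"] by (simp add: D_def zcoord_polar)
    then show ?thesis by (rule power2_le_imp_le) simp
  qed
  have D0: "D \<theta> (of_real r) \<noteq> 0" if "r \<ge> 0" "\<theta> \<in> {\<theta>m..\<theta>M}" for r \<theta>
  proof -
    have "0 < c * (\<epsilon> + r)" using c \<epsilon> that by (simp add: add_pos_nonneg)
    then show ?thesis using D_ge[OF that] by (metis norm_zero linorder_not_less)
  qed
  \<comment> \<open>With D = \<epsilon> + r e one has r e = D - \<epsilon>, so r / D^4 = (1/D^3 -
    \<epsilon>/D^4) / e; integrating in D with dD = e dr gives this primitive. At r = 0 the bracket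
    is (-1/2 + 1/3) / \<epsilon>^2, whence the 1/6.\<close>
  define G where "G \<theta> w = ?\<epsilon> ^ 4 * (inverse (?e \<theta>))\<^sup>2 *
      (- (1 / 2) * inverse (D \<theta> w) ^ 2 + (?\<epsilon> / 3) * inverse (D \<theta> w) ^ 3)" for \<theta> w
  define R where "R = \<epsilon> ^ 4 * (1 / (2 * c\<^sup>2 * h\<^sup>2) + 1 / (3 * c ^ 3 * h\<^sup>2))"
  have inner: "integral {0..h} (\<lambda>r. r *\<^sub>R f (polar r \<theta>)) = G \<theta> (of_real h) + ?\<epsilon>\<^sup>2 * ((inverse (?e \<theta>))\<^sup>2 / 6)"
    if \<theta>': "\<theta> \<in> {\<theta>m..\<theta>M}" for \<theta>
  proof -
    have "((\<lambda>r. r *\<^sub>R f (polar r \<theta>)) has_integral G \<theta> (of_real h) - G \<theta> (of_real 0)) {0..h}"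
    proof (rule fundamental_theorem_of_calculus)
      fix r assume r: "r \<in> {0..h}"
      let ?D = "D \<theta> (of_real r)"
      have nz: "?D \<noteq> 0" using D0[of r \<theta>] r \<theta>' by simp
      have d: "((\<lambda>w. inverse (D \<theta> w) ^ n) has_field_derivative - of_nat n * ?e \<theta> * inverse ?D ^ (n + 1)) (at (of_real r))" for n
      proof -
        have De: "(D \<theta> has_field_derivative ?e \<theta>) (at (of_real r))"
          unfolding D_def by (auto intro!: derivative_eq_intros)
        show ?thesis
          by (rule DERIV_cong[OF DERIV_power[OF DERIV_inverse_fun[OF De nz], of n]]) (cases n; simp add: algebra_simps)
      qed
      have "(G \<theta> has_field_derivative ?\<epsilon> ^ 4 * (inverse (?e \<theta>))\<^sup>2 *
          (- (1 / 2) * (- of_nat 2 * ?e \<theta> * inverse ?D ^ (2 + 1))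
           + (?\<epsilon> / 3) * (- of_nat 3 * ?e \<theta> * inverse ?D ^ (3 + 1)))) (at (of_real r))"
        unfolding G_def by (intro DERIV_cmult DERIV_add d)
      also have "?\<epsilon> ^ 4 * (inverse (?e \<theta>))\<^sup>2 *
          (- (1 / 2) * (- of_nat 2 * ?e \<theta> * inverse ?D ^ (2 + 1))
           + (?\<epsilon> / 3) * (- of_nat 3 * ?e \<theta> * inverse ?D ^ (3 + 1)))
         = ?\<epsilon> ^ 4 * (inverse (?e \<theta>))\<^sup>2 * (?e \<theta> * inverse ?D ^ 3 - ?\<epsilon> * ?e \<theta> * inverse ?D ^ 4)"
        by (simp add: algebra_simps power3_eq_cube)
      also have "inverse ?D ^ 3 = ?D * inverse ?D ^ 4"
        using nz by (simp add: power_inverse numeral_3_eq_3 numeral_eq_Suc)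
      also have "?e \<theta> * (?D * inverse ?D ^ 4) - ?\<epsilon> * ?e \<theta> * inverse ?D ^ 4 = of_real r * (?e \<theta>)\<^sup>2 * inverse ?D ^ 4"
        by (simp add: D_def power2_eq_square algebra_simps)
      also have "?\<epsilon> ^ 4 * (inverse (?e \<theta>))\<^sup>2 * (of_real r * (?e \<theta>)\<^sup>2 * inverse ?D ^ 4)
          = of_real r * (?\<epsilon> ^ 4 * inverse ?D ^ 4) * (inverse (?e \<theta>) * ?e \<theta>)\<^sup>2"
        by (simp only: power_mult_distrib mult_ac)
      also have "\<dots> = r *\<^sub>R f (polar r \<theta>)"
        using f(2)[of r \<theta>] r \<theta>' e0[of \<theta>]
        by (simp add: D_def divide_inverse power_mult_distrib scaleR_conv_of_real)
      finally show "((\<lambda>r. G \<theta> (of_real r)) has_vector_derivative r *\<^sub>R f (polar r \<theta>)) (at r within {0..h})"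
        by (rule has_vector_derivative_real_field)
    qed (use h in simp)
    moreover have "G \<theta> (of_real 0) = - (?\<epsilon>\<^sup>2 * ((inverse (?e \<theta>))\<^sup>2 / 6))"
      using \<epsilon> by (simp add: G_def D_def field_simps numeral_eq_Suc)
    ultimately show ?thesis by (simp add: integral_unique)
  qed
  have Gh: "norm (G \<theta> (of_real h)) \<le> R" if "\<theta> \<in> {\<theta>m..\<theta>M}" for \<theta>
  proof -
    let ?n = "norm (D \<theta> (of_real h))"
    have n: "c * (\<epsilon> + h) \<le> ?n" using D_ge[OF _ that] h by simp
    have p: "c * (\<epsilon> + h) > 0" "c * h > 0" using c \<epsilon> h by auto
    have "inverse ?n ^ 2 \<le> inverse (c * h) ^ 2"
      using n p c \<epsilon> h by (intro power_mono le_imp_inverse_le) (auto simp: algebra_simps intro: order_trans[rotated])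
    moreover have "\<epsilon> * inverse ?n ^ 3 \<le> inverse (c ^ 3 * h\<^sup>2)"
    proof -
      \<comment> \<open>Enlarging \<epsilon> to \<epsilon> + h cancels one power of the denominator
        and leaves a bound free of \<epsilon>.\<close>
      have "\<epsilon> * inverse ?n ^ 3 \<le> (\<epsilon> + h) * inverse (c * (\<epsilon> + h)) ^ 3"
        using n p \<epsilon> h by (intro mult_mono power_mono le_imp_inverse_le) auto
      also have "\<dots> = inverse (c ^ 3) * inverse ((\<epsilon> + h)\<^sup>2)"
      proof -
        have "s * inverse (c * s) ^ 3 = inverse (c ^ 3) * inverse (s\<^sup>2)" if "s \<noteq> 0" for s
          using that c by (simp add: power3_eq_cube power2_eq_square field_simps)
        then show ?thesis using \<epsilon> h by simp
      qed
      also have "\<dots> \<le> inverse (c ^ 3) * inverse (h\<^sup>2)"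
        using c \<epsilon> h by (intro mult_left_mono le_imp_inverse_le power_mono) auto
      finally show ?thesis by simp
    qed
    ultimately have b: "inverse ?n ^ 2 / 2 + \<epsilon> * inverse ?n ^ 3 / 3 \<le> inverse (c * h) ^ 2 / 2 + inverse (c ^ 3 * h\<^sup>2) / 3"
      by linarith
    let ?N = "norm (- (1 / 2) * inverse (D \<theta> (of_real h)) ^ 2 + (?\<epsilon> / 3) * inverse (D \<theta> (of_real h)) ^ 3)"
    have "?N \<le> inverse ?n ^ 2 / 2 + \<epsilon> * inverse ?n ^ 3 / 3"
      by (rule order_trans[OF norm_triangle_ineq]) (use \<epsilon> in \<open>simp add: norm_mult norm_power norm_inverse norm_divide\<close>)
    also note b
    also have "inverse (c * h) ^ 2 / 2 + inverse (c ^ 3 * h\<^sup>2) / 3 = 1 / (2 * c\<^sup>2 * h\<^sup>2) + 1 / (3 * c ^ 3 * h\<^sup>2)"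
      using c h by (simp add: power2_eq_square power3_eq_cube field_simps)
    finally have "\<epsilon> ^ 4 * ?N \<le> R"
      unfolding R_def using \<epsilon> by (intro mult_left_mono) auto
    moreover have "norm (G \<theta> (of_real h)) = \<epsilon> ^ 4 * ?N"
      using \<epsilon> by (simp add: G_def norm_mult norm_power norm_inverse e1)
    ultimately show ?thesis by simp
  qed
  have cont: "continuous_on {\<theta>m..\<theta>M} (\<lambda>\<theta>. G \<theta> (of_real h))" "continuous_on {\<theta>m..\<theta>M} (\<lambda>\<theta>. ?\<epsilon>\<^sup>2 * ((inverse (?e \<theta>))\<^sup>2 / 6))"
    unfolding G_def D_def
    using e0 D0[of h] h
    by (auto intro!: continuous_intros simp: unit_dir_def D_def)
  have "(LINT x|lebesgue_on (truncated_sector \<theta>m \<theta>M h). f x)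
      = integral {\<theta>m..\<theta>M} (\<lambda>\<theta>. G \<theta> (of_real h) + ?\<epsilon>\<^sup>2 * ((inverse (?e \<theta>))\<^sup>2 / 6))"
    unfolding integral_polar_iterated(2)[OF \<theta>(1,3) f(1)] by (intro integral_cong inner)
  also have "\<dots> = integral {\<theta>m..\<theta>M} (\<lambda>\<theta>. G \<theta> (of_real h)) + of_real (\<epsilon>\<^sup>2) * vertex_moment \<sigma> \<theta>m \<theta>M"
    unfolding vertex_moment_def of_real_power integral_mult_right[symmetric]
    by (intro Henstock_Kurzweil_Integration.integral_add integrable_continuous_real cont)
  finally have "norm ((LINT x|lebesgue_on (truncated_sector \<theta>m \<theta>M h). f x) - of_real (\<epsilon>\<^sup>2) * vertex_moment \<sigma> \<theta>m \<theta>M)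
      = norm (integral {\<theta>m..\<theta>M} (\<lambda>\<theta>. G \<theta> (of_real h)))" by simp
  also have "\<dots> \<le> R * (\<theta>M - \<theta>m)"
    using \<theta>(2) cont(1) Gh by (intro integral_bound) auto
  finally show ?thesis by (simp add: R_def mult_ac)
qed

subsection \<open>Functions with vanishing trace on the sides of the sector\<close>

lemma tendsto_0_le:
  fixes f h :: "'a \<Rightarrow> 'b::{linorder_topology, zero}"
  assumes "(h \<longlongrightarrow> 0) F" "\<And>x. 0 \<le> f x" "\<And>x. f x \<le> h x"
  shows "(f \<longlongrightarrow> 0) F"
  by (rule tendsto_sandwich[OF _ _ tendsto_const assms(1)]) (use assms(2,3) in auto)

lemma integral_lebesgue_on_subset:
  fixes f :: "plane \<Rightarrow> 'b::{banach, second_countable_topology}"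
  assumes "A \<in> sets lebesgue" "B \<in> sets lebesgue" "B \<subseteq> A" "\<And>x. x \<in> A \<Longrightarrow> x \<notin> B \<Longrightarrow> f x = 0"
  shows "(LINT x|lebesgue_on A. f x) = (LINT x|lebesgue_on B. f x)"
proof -
  have "(\<lambda>x. indicator A x *\<^sub>R f x) = (\<lambda>x. indicator B x *\<^sub>R f x)"
    using assms(3,4) by (auto simp: indicator_def fun_eq_iff)
  then show ?thesis using assms(1,2) by (simp add: integral_restrict_space)
qed

lemma integrable_lebesgue_on_subset:
  fixes f :: "plane \<Rightarrow> 'b::{banach, second_countable_topology}"
  assumes "integrable (lebesgue_on A) f" "A \<in> sets lebesgue" "B \<in> sets lebesgue" "B \<subseteq> A"
  shows "integrable (lebesgue_on B) f"
proof -
  have "set_integrable lebesgue A f" using assms by (simp add: integrable_restrict_space set_integrable_def)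
  then have "set_integrable lebesgue B f" by (rule set_integrable_subset) (use assms in auto)
  then show ?thesis using assms by (simp add: integrable_restrict_space set_integrable_def)
qed

lemma integral_norm_lebesgue_on_mono:
  fixes f :: "plane \<Rightarrow> 'b::{banach, second_countable_topology}"
  assumes "integrable (lebesgue_on A) f" "A \<in> sets lebesgue" "B \<in> sets lebesgue" "B \<subseteq> A"
  shows "(LINT x|lebesgue_on B. norm (f x)) \<le> (LINT x|lebesgue_on A. norm (f x))"
proof -
  have "integrable lebesgue (\<lambda>x. indicator B x *\<^sub>R norm (f x))" "integrable lebesgue (\<lambda>x. indicator A x *\<^sub>R norm (f x))"
    using integrable_norm[OF integrable_lebesgue_on_subset[OF assms]] integrable_norm[OF assms(1)] assms(2,3)
    by (simp_all add: integrable_restrict_space)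
  then have "(LINT x|lebesgue. indicator B x *\<^sub>R norm (f x)) \<le> (LINT x|lebesgue. indicator A x *\<^sub>R norm (f x))"
    using assms(4) by (intro integral_mono) (auto split: split_indicator)
  then show ?thesis using assms by (simp add: integral_restrict_space)
qed

lemma tendsto_integral_L1:
  fixes F :: "nat \<Rightarrow> 'a \<Rightarrow> 'b::{banach, second_countable_topology}"
  assumes "\<And>n. integrable M (F n)" "integrable M G" "(\<lambda>n. LINT x|M. norm (F n x - G x)) \<longlonglongrightarrow> 0"
  shows "(\<lambda>n. LINT x|M. F n x) \<longlonglongrightarrow> (LINT x|M. G x)"
proof (rule LIM_zero_cancel, rule tendsto_norm_zero_cancel, rule tendsto_sandwich[OF _ _ tendsto_const assms(3)])
  show "\<forall>\<^sub>F n in sequentially. norm ((LINT x|M. F n x) - (LINT x|M. G x)) \<le> (LINT x|M. norm (F n x - G x))"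
    using assms(1,2) by (intro always_eventually allI)
      (simp add: Bochner_Integration.integral_diff[symmetric] integral_norm_bound del: Bochner_Integration.integral_diff)
qed simp

lemma tendsto_integral_scaleR_L1:
  fixes F :: "nat \<Rightarrow> plane \<Rightarrow> 'b::euclidean_space" and \<phi> :: "plane \<Rightarrow> real"
  assumes \<Omega>: "bounded \<Omega>" "open \<Omega>" and \<phi>: "continuous_on UNIV \<phi>"
    and F: "\<And>n. integrable (lebesgue_on \<Omega>) (F n)" "integrable (lebesgue_on \<Omega>) G"
    and lim: "(\<lambda>n. LINT x|lebesgue_on \<Omega>. norm (F n x - G x)) \<longlonglongrightarrow> 0"
  shows "(\<lambda>n. LINT x|lebesgue_on \<Omega>. \<phi> x *\<^sub>R F n x) \<longlonglongrightarrow> (LINT x|lebesgue_on \<Omega>. \<phi> x *\<^sub>R G x)"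
proof (rule tendsto_integral_L1)
  note i = integrable_continuous_scaleR[OF \<Omega> \<phi>]
  show "integrable (lebesgue_on \<Omega>) (\<lambda>x. \<phi> x *\<^sub>R F n x)" "integrable (lebesgue_on \<Omega>) (\<lambda>x. \<phi> x *\<^sub>R G x)" for n
    by (intro i F)+
  obtain B where B: "B \<ge> 0" "\<And>x. x \<in> \<Omega> \<Longrightarrow> norm (\<phi> x) \<le> B"
    by (rule continuous_bounded_on[OF \<Omega>(1) \<phi>]) (rule that)
  have d: "integrable (lebesgue_on \<Omega>) (\<lambda>x. F n x - G x)" for n
    using F by simp
  have "(LINT x|lebesgue_on \<Omega>. norm (\<phi> x *\<^sub>R F n x - \<phi> x *\<^sub>R G x)) \<le> (LINT x|lebesgue_on \<Omega>. B * norm (F n x - G x))" for n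
  proof (rule integral_mono)
    show "integrable (lebesgue_on \<Omega>) (\<lambda>x. norm (\<phi> x *\<^sub>R F n x - \<phi> x *\<^sub>R G x))"
      using i[OF d[of n]] by (simp add: scaleR_diff_right integrable_norm)
    show "integrable (lebesgue_on \<Omega>) (\<lambda>x. B * norm (F n x - G x))" using d[of n] by (simp add: integrable_norm)
    show "norm (\<phi> x *\<^sub>R F n x - \<phi> x *\<^sub>R G x) \<le> B * norm (F n x - G x)" if "x \<in> space (lebesgue_on \<Omega>)" for x
      using B(2)[of x] that by (simp add: scaleR_diff_right[symmetric] mult_right_mono)
  qed
  then have le: "(LINT x|lebesgue_on \<Omega>. norm (\<phi> x *\<^sub>R F n x - \<phi> x *\<^sub>R G x)) \<le> B * (LINT x|lebesgue_on \<Omega>. norm (F n x - G x))" for n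
    by simp
  have "(\<lambda>n. B * (LINT x|lebesgue_on \<Omega>. norm (F n x - G x))) \<longlonglongrightarrow> B * 0"
    by (intro tendsto_mult tendsto_const lim)
  then have "(\<lambda>n. B * (LINT x|lebesgue_on \<Omega>. norm (F n x - G x))) \<longlonglongrightarrow> 0" by simp
  then show "(\<lambda>n. LINT x|lebesgue_on \<Omega>. norm (\<phi> x *\<^sub>R F n x - \<phi> x *\<^sub>R G x)) \<longlonglongrightarrow> 0"
    by (rule tendsto_0_le) (use le in auto)
qed

lemma AE_hausdorff1_segment:
  fixes e :: plane
  assumes "norm e = 1" "AE x in hausdorff1. P x"
  shows "AE r in lborel. P (r *\<^sub>R e)"
proof -
  from assms(2) obtain N where N: "{x \<in> space hausdorff1. \<not> P x} \<subseteq> N" "emeasure hausdorff1 N = 0" "N \<in> sets hausdorff1"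
    by (rule AE_E)
  have sp: "space hausdorff1 = UNIV"
    using sets_eq_imp_space_eq[OF sets_hausdorff1] by simp
  have b: "N \<in> sets borel" using N(3) by simp
  have "(\<lambda>r. r *\<^sub>R e) \<in> borel_measurable borel"
    by (intro borel_measurable_continuous_onI continuous_intros)
  then have "{r. r *\<^sub>R e \<in> N} \<in> sets borel"
    using measurable_sets[OF _ b, of "\<lambda>r. r *\<^sub>R e" borel] by (simp add: vimage_def)
  moreover have "emeasure lborel {r. r *\<^sub>R e \<in> N} = 0"
    using hausdorff1_ge_length[OF assms(1) b] N(2) by simp
  ultimately show ?thesis
    using N(1) sp by (intro AE_I[of _ _ "{r. r *\<^sub>R e \<in> N}"]) auto
qed

text \<open>Cauchy-Schwarz against the constant 1 on the interval: traces converge in the mean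
  square, while \<open>sector_divergence\<close> asks for first powers.\<close>

lemma nn_integral_segment_tendsto_0:
  fixes f :: "nat \<Rightarrow> real \<Rightarrow> 'b::euclidean_space"
  assumes h: "h > 0" and f: "\<And>n. continuous_on UNIV (f n)"
    and lim: "(\<lambda>n. \<integral>\<^sup>+r\<in>{0<..<h}. ennreal ((norm (f n r))\<^sup>2) \<partial>lborel) \<longlonglongrightarrow> 0"
  shows "(\<lambda>n. integral {0..h} (\<lambda>r. norm (f n r))) \<longlonglongrightarrow> 0"
proof -
  let ?I = "\<lambda>n. integral {0..h} (\<lambda>r. norm (f n r))"
  have I0: "?I n \<ge> 0" for n
    by (intro integral_nonneg integrable_continuous_real continuous_intros continuous_on_subset[OF f]) auto
  have le: "ennreal ((?I n)\<^sup>2) \<le> (\<integral>\<^sup>+r\<in>{0<..<h}. ennreal ((norm (f n r))\<^sup>2) \<partial>lborel) * ennreal h" for n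
  proof -
    have m [measurable]: "f n \<in> borel_measurable borel" using f by (rule borel_measurable_continuous_onI)
    have "integrable lborel (\<lambda>r. indicator {0..h} r *\<^sub>R norm (f n r))"
      by (intro borel_integrable_compact continuous_intros continuous_on_subset[OF f]) auto
    then have s: "set_integrable lborel {0<..<h} (\<lambda>r. norm (f n r))"
      unfolding set_integrable_def[symmetric] by (rule set_integrable_subset) auto
    have "?I n = (LINT r:{0<..<h}|lborel. norm (f n r))"
      using set_borel_integral_eq_integral(2)[OF s] by (simp add: integral_open_interval_real)
    also have "ennreal \<dots> = (\<integral>\<^sup>+r. ennreal (indicator {0<..<h} r *\<^sub>R norm (f n r)) \<partial>lborel)"
      using s unfolding set_integrable_def set_lebesgue_integral_def
      by (intro nn_integral_eq_integral[symmetric]) auto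
    also have "\<dots> = (\<integral>\<^sup>+r. ennreal (norm (f n r)) * indicator {0<..<h} r * indicator {0<..<h} r \<partial>lborel)"
      by (intro nn_integral_cong) (auto split: split_indicator)
    finally have "ennreal (?I n) = (\<integral>\<^sup>+r. ennreal (norm (f n r)) * indicator {0<..<h} r * indicator {0<..<h} r \<partial>lborel)" .
    then have "(ennreal (?I n))\<^sup>2 \<le> (\<integral>\<^sup>+r. (ennreal (norm (f n r)) * indicator {0<..<h} r)\<^sup>2 \<partial>lborel) * (\<integral>\<^sup>+r. (indicator {0<..<h} r)\<^sup>2 \<partial>lborel)"
      using Cauchy_Schwarz_nn_integral[of "\<lambda>r. ennreal (norm (f n r)) * indicator {0<..<h} r" lborel "indicator {0<..<h}"]
      by simp
    also have "(\<integral>\<^sup>+r. (ennreal (norm (f n r)) * indicator {0<..<h} r)\<^sup>2 \<partial>lborel) = (\<integral>\<^sup>+r\<in>{0<..<h}. ennreal ((norm (f n r))\<^sup>2) \<partial>lborel)"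
      by (intro nn_integral_cong) (auto simp: ennreal_power split: split_indicator)
    also have "(\<integral>\<^sup>+r. (indicator {0<..<h} r)\<^sup>2 \<partial>lborel) = (\<integral>\<^sup>+r. indicator {0<..<h} r \<partial>lborel)"
      by (intro nn_integral_cong) (auto split: split_indicator)
    also have "\<dots> = ennreal h" using h by simp
    finally show ?thesis using I0 by (simp add: ennreal_power)
  qed
  have "(\<lambda>n. (\<integral>\<^sup>+r\<in>{0<..<h}. ennreal ((norm (f n r))\<^sup>2) \<partial>lborel) * ennreal h) \<longlonglongrightarrow> 0 * ennreal h"
    unfolding mult.commute[of _ "ennreal h"] using lim by (intro ennreal_tendsto_cmult) auto
  then have "(\<lambda>n. (\<integral>\<^sup>+r\<in>{0<..<h}. ennreal ((norm (f n r))\<^sup>2) \<partial>lborel) * ennreal h) \<longlonglongrightarrow> 0" by simp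
  then have "(\<lambda>n. ennreal ((?I n)\<^sup>2)) \<longlonglongrightarrow> 0"
    by (rule tendsto_0_le) (use le in auto)
  then have "(\<lambda>n. (?I n)\<^sup>2) \<longlonglongrightarrow> 0"
    by (subst (asm) ennreal_tendsto_0_iff) auto
  from tendsto_real_sqrt[OF this] show ?thesis using I0 by simp
qed

text \<open>The approximants are differences of smooth approximants of \<open>u\<close> and
  \<open>v\<close>. They need not vanish on \<Gamma>, but both traces agree there, so their
  restrictions to segments in \<Gamma> tend to 0 in the mean. Vanishing boundary values are used
  below only in this asymptotic form.\<close>

lemma trace_eq_approx:
  fixes u v :: "plane \<Rightarrow> 'b::euclidean_space"
  assumes \<Omega>: "bounded \<Omega>" "open \<Omega>" and eq: "trace_eq_on \<Omega> \<Gamma> u v" and \<Gamma>: "\<Gamma> \<subseteq> frontier \<Omega>" and h: "h > 0"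
  obtains \<Phi> :: "nat \<Rightarrow> plane \<Rightarrow> 'b" where "\<And>n. C_infinity (\<Phi> n)"
    "(\<lambda>n. LINT x|lebesgue_on \<Omega>. norm (\<Phi> n x - (u x - v x))) \<longlonglongrightarrow> 0"
    "\<And>i. (\<lambda>n. LINT x|lebesgue_on \<Omega>. norm (pd i (\<Phi> n) x - (weak_pd \<Omega> i u x - weak_pd \<Omega> i v x))) \<longlonglongrightarrow> 0"
    "\<And>e. norm e = 1 \<Longrightarrow> (\<And>r. r \<in> {0<..<h} \<Longrightarrow> r *\<^sub>R e \<in> \<Gamma>) \<Longrightarrow>
      (\<lambda>n. integral {0..h} (\<lambda>r. norm (\<Phi> n (r *\<^sub>R e)))) \<longlonglongrightarrow> 0"
proof -
  from eq obtain g g' where tu: "has_trace \<Omega> u g" and tv: "has_trace \<Omega> v g'"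
    and gg: "AE x in hausdorff1. x \<in> \<Gamma> \<longrightarrow> g x = g' x"
    by (auto simp: trace_eq_on_def)
  from tu obtain \<Phi>u where U: "H1_mem \<Omega> u" "g \<in> borel_measurable borel" "\<And>n. C_infinity (\<Phi>u n)"
    "(\<lambda>n. H1_norm \<Omega> (\<lambda>x. \<Phi>u n x - u x)) \<longlonglongrightarrow> 0"
    "(\<lambda>n. \<integral>\<^sup>+x\<in>frontier \<Omega>. ennreal ((norm (\<Phi>u n x - g x))\<^sup>2) \<partial>hausdorff1) \<longlonglongrightarrow> 0"
    by (auto simp: has_trace_def)
  from tv obtain \<Phi>v where V: "H1_mem \<Omega> v" "g' \<in> borel_measurable borel" "\<And>n. C_infinity (\<Phi>v n)"
    "(\<lambda>n. H1_norm \<Omega> (\<lambda>x. \<Phi>v n x - v x)) \<longlonglongrightarrow> 0"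
    "(\<lambda>n. \<integral>\<^sup>+x\<in>frontier \<Omega>. ennreal ((norm (\<Phi>v n x - g' x))\<^sup>2) \<partial>hausdorff1) \<longlonglongrightarrow> 0"
    by (auto simp: has_trace_def)
  define \<Phi> where "\<Phi> n x = \<Phi>u n x - \<Phi>v n x" for n x
  have smooth: "C_infinity (\<Phi> n)" for n
    unfolding \<Phi>_def by (intro C_infinity_diff U V)
  have L1_diff: "(\<lambda>n. LINT x|lebesgue_on \<Omega>. norm (a n x - b n x - (a' x - b' x))) \<longlonglongrightarrow> 0"
    if l: "(\<lambda>n. LINT x|lebesgue_on \<Omega>. norm (a n x - a' x)) \<longlonglongrightarrow> 0" "(\<lambda>n. LINT x|lebesgue_on \<Omega>. norm (b n x - b' x)) \<longlonglongrightarrow> 0"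
      and i: "\<And>n. integrable (lebesgue_on \<Omega>) (a n)" "\<And>n. integrable (lebesgue_on \<Omega>) (b n)"
        "integrable (lebesgue_on \<Omega>) a'" "integrable (lebesgue_on \<Omega>) b'"
    for a b :: "nat \<Rightarrow> plane \<Rightarrow> 'b" and a' b'
  proof (rule tendsto_sandwich[OF _ _ tendsto_const])
    show "(\<lambda>n. (LINT x|lebesgue_on \<Omega>. norm (a n x - a' x)) + (LINT x|lebesgue_on \<Omega>. norm (b n x - b' x))) \<longlonglongrightarrow> 0"
      using tendsto_add[OF l] by simp
    have "(LINT x|lebesgue_on \<Omega>. norm (a n x - b n x - (a' x - b' x)))
        \<le> (LINT x|lebesgue_on \<Omega>. norm (a n x - a' x) + norm (b n x - b' x))" for n
    proof (rule integral_mono)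
      fix x
      have "a n x - b n x - (a' x - b' x) = (a n x - a' x) - (b n x - b' x)" by simp
      then show "norm (a n x - b n x - (a' x - b' x)) \<le> norm (a n x - a' x) + norm (b n x - b' x)"
        by (metis norm_triangle_ineq4)
    qed (use i in auto)
    also have "\<And>n. \<dots> n = (LINT x|lebesgue_on \<Omega>. norm (a n x - a' x)) + (LINT x|lebesgue_on \<Omega>. norm (b n x - b' x))"
      using i by (intro Bochner_Integration.integral_add) auto
    finally show "\<forall>\<^sub>F n in sequentially. (LINT x|lebesgue_on \<Omega>. norm (a n x - b n x - (a' x - b' x)))
        \<le> (LINT x|lebesgue_on \<Omega>. norm (a n x - a' x)) + (LINT x|lebesgue_on \<Omega>. norm (b n x - b' x))" by simp
  qed simp
  have int: "integrable (lebesgue_on \<Omega>) f" if "C_infinity f" for f :: "plane \<Rightarrow> 'b"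
    by (intro L2_lebesgue_on_integrable[OF \<Omega>] L2_mem_continuous[OF \<Omega>] C_infinity_continuous that)
  have int': "integrable (lebesgue_on \<Omega>) u" "integrable (lebesgue_on \<Omega>) v"
    "integrable (lebesgue_on \<Omega>) (weak_pd \<Omega> i u)" "integrable (lebesgue_on \<Omega>) (weak_pd \<Omega> i v)" for i
    by (intro L2_lebesgue_on_integrable[OF \<Omega>] H1_memD L2_mem_weak_pd U V)+
  have pd\<Phi>: "pd i (\<Phi> n) x = pd i (\<Phi>u n) x - pd i (\<Phi>v n) x" for i n x
    unfolding \<Phi>_def using U V by (intro pd_diff C_infinity_differentiable)
  show thesis
  proof (rule that[OF smooth])
    show "(\<lambda>n. LINT x|lebesgue_on \<Omega>. norm (\<Phi> n x - (u x - v x))) \<longlonglongrightarrow> 0"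
      unfolding \<Phi>_def
      by (rule L1_diff[OF H1_approx_L1(1)[OF \<Omega> U(1,3,4)] H1_approx_L1(1)[OF \<Omega> V(1,3,4)] int[OF U(3)] int[OF V(3)] int'(1,2)])
    show "(\<lambda>n. LINT x|lebesgue_on \<Omega>. norm (pd i (\<Phi> n) x - (weak_pd \<Omega> i u x - weak_pd \<Omega> i v x))) \<longlonglongrightarrow> 0" for i
      unfolding pd\<Phi>
      by (rule L1_diff[OF H1_approx_L1(2)[OF \<Omega> U(1,3,4)] H1_approx_L1(2)[OF \<Omega> V(1,3,4)]
            int[OF C_infinity_pd[OF U(3)]] int[OF C_infinity_pd[OF V(3)]] int'(3,4)])
    fix e :: plane assume e: "norm e = 1" and ray: "\<And>r. r \<in> {0<..<h} \<Longrightarrow> r *\<^sub>R e \<in> \<Gamma>"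
    have fr: "frontier \<Omega> \<in> sets borel" by simp
    have ray': "r *\<^sub>R e \<in> frontier \<Omega>" if "r \<in> {0<..<h}" for r using ray[OF that] \<Gamma> by auto
    have ae: "AE r in lborel. r *\<^sub>R e \<in> \<Gamma> \<longrightarrow> g (r *\<^sub>R e) = g' (r *\<^sub>R e)"
      by (rule AE_hausdorff1_segment[OF e gg])
    let ?A = "\<lambda>n. \<integral>\<^sup>+x\<in>frontier \<Omega>. ennreal ((norm (\<Phi>u n x - g x))\<^sup>2) \<partial>hausdorff1"
    let ?B = "\<lambda>n. \<integral>\<^sup>+x\<in>frontier \<Omega>. ennreal ((norm (\<Phi>v n x - g' x))\<^sup>2) \<partial>hausdorff1"
    have [measurable]: "\<Phi>u n \<in> borel_measurable borel" "\<Phi>v n \<in> borel_measurable borel"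
      "g \<in> borel_measurable borel" "g' \<in> borel_measurable borel" for n
      using U V by (auto intro: C_infinity_borel_measurable)
    have [measurable]: "(\<lambda>r. r *\<^sub>R e) \<in> borel_measurable borel"
      by (intro borel_measurable_continuous_onI continuous_intros)
    have le: "(\<integral>\<^sup>+r\<in>{0<..<h}. ennreal ((norm (\<Phi> n (r *\<^sub>R e)))\<^sup>2) \<partial>lborel) \<le> 2 * ?A n + 2 * ?B n" for n
    proof -
      let ?a = "\<lambda>r. ennreal ((norm (\<Phi>u n (r *\<^sub>R e) - g (r *\<^sub>R e)))\<^sup>2) * indicator {0<..<h} r"
      let ?b = "\<lambda>r. ennreal ((norm (\<Phi>v n (r *\<^sub>R e) - g' (r *\<^sub>R e)))\<^sup>2) * indicator {0<..<h} r"
      have "(\<integral>\<^sup>+r\<in>{0<..<h}. ennreal ((norm (\<Phi> n (r *\<^sub>R e)))\<^sup>2) \<partial>lborel) \<le> (\<integral>\<^sup>+r. 2 * ?a r + 2 * ?b r \<partial>lborel)"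
      proof (rule nn_integral_mono_AE)
        show "AE r in lborel. ennreal ((norm (\<Phi> n (r *\<^sub>R e)))\<^sup>2) * indicator {0<..<h} r \<le> 2 * ?a r + 2 * ?b r"
          using ae
        proof eventually_elim
          case (elim r)
          show ?case
          proof (cases "r \<in> {0<..<h}")
            case True
            then have eq: "g (r *\<^sub>R e) = g' (r *\<^sub>R e)" using elim ray by blast
            let ?p = "\<Phi>u n (r *\<^sub>R e) - g (r *\<^sub>R e)" and ?q = "\<Phi>v n (r *\<^sub>R e) - g' (r *\<^sub>R e)"
            have "(norm (\<Phi> n (r *\<^sub>R e)))\<^sup>2 = (norm (?p - ?q))\<^sup>2" by (simp add: \<Phi>_def eq)
            also have "\<dots> \<le> (norm ?p + norm ?q)\<^sup>2" by (intro power_mono norm_triangle_ineq4) simp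
            also have "\<dots> \<le> 2 * (norm ?p)\<^sup>2 + 2 * (norm ?q)\<^sup>2"
              using sum_squares_bound[of "norm ?p" "norm ?q"] by (simp add: power2_sum)
            finally have "ennreal ((norm (\<Phi> n (r *\<^sub>R e)))\<^sup>2) \<le> ennreal (2 * (norm ?p)\<^sup>2 + 2 * (norm ?q)\<^sup>2)"
              by (rule ennreal_leI)
            then show ?thesis using True by (simp add: ennreal_mult)
          qed simp
        qed
      qed
      also have "\<dots> = 2 * (\<integral>\<^sup>+r. ?a r \<partial>lborel) + 2 * (\<integral>\<^sup>+r. ?b r \<partial>lborel)"
        by (subst nn_integral_add) (auto simp: nn_integral_cmult)
      also have "\<dots> \<le> 2 * ?A n + 2 * ?B n"
        by (intro add_mono mult_left_mono nn_integral_segment_le_hausdorff1[OF e _ fr ray']) auto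
      finally show ?thesis .
    qed
    have "(\<lambda>n. 2 * ?A n + 2 * ?B n) \<longlonglongrightarrow> 2 * 0 + 2 * 0"
      by (intro tendsto_add ennreal_tendsto_cmult U V) auto
    then have "(\<lambda>n. 2 * ?A n + 2 * ?B n) \<longlonglongrightarrow> 0" by simp
    then have "(\<lambda>n. \<integral>\<^sup>+r\<in>{0<..<h}. ennreal ((norm (\<Phi> n (r *\<^sub>R e)))\<^sup>2) \<partial>lborel) \<longlonglongrightarrow> 0"
      by (rule tendsto_0_le) (use le in auto)
    moreover have "continuous_on UNIV (\<lambda>r. \<Phi> n (r *\<^sub>R e))" for n
      by (rule continuous_on_compose2[OF C_infinity_continuous[OF smooth, where S = UNIV]])
        (auto intro!: continuous_intros)
    ultimately show "(\<lambda>n. integral {0..h} (\<lambda>r. norm (\<Phi> n (r *\<^sub>R e)))) \<longlonglongrightarrow> 0"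
      by (intro nn_integral_segment_tendsto_0[OF h])
  qed
qed

lemma integrable_C_infinity:
  fixes f :: "plane \<Rightarrow> 'b::euclidean_space"
  assumes "bounded \<Omega>" "open \<Omega>" "C_infinity f"
  shows "integrable (lebesgue_on \<Omega>) f"
  by (intro L2_lebesgue_on_integrable[OF assms(1,2)] L2_mem_continuous[OF assms(1,2)] C_infinity_continuous assms(3))

section \<open>Integration by parts and the Poincare inequality near the corner\<close>

locale corner =
  fixes \<Omega> :: "plane set" and \<theta>m \<theta>M h :: real
  assumes \<Omega>: "bounded \<Omega>" "open \<Omega>" and \<theta>: "- pi < \<theta>m" "\<theta>m < \<theta>M" "\<theta>M < pi"
    and h: "h > 0" and corner: "\<Omega> \<inter> ball 0 h = truncated_sector \<theta>m \<theta>M h"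
begin

lemma \<theta>': "- pi \<le> \<theta>m" "\<theta>m \<le> \<theta>M" "\<theta>M \<le> pi"
  using \<theta> by auto

lemma sets_\<Omega>: "\<Omega> \<in> sets lebesgue"
  using \<Omega> by simp

lemma sector_eq: "\<rho> \<le> h \<Longrightarrow> truncated_sector \<theta>m \<theta>M \<rho> = \<Omega> \<inter> ball 0 \<rho>"
proof -
  assume *: "\<rho> \<le> h"
  then have "truncated_sector \<theta>m \<theta>M \<rho> = truncated_sector \<theta>m \<theta>M h \<inter> ball 0 \<rho>"
    by (auto simp: truncated_sector_def)
  also have "\<dots> = \<Omega> \<inter> (ball 0 h \<inter> ball 0 \<rho>)" unfolding corner[symmetric] by (rule Int_assoc)
  also have "ball 0 h \<inter> ball 0 \<rho> = (ball 0 \<rho> :: plane set)" using * by auto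
  finally show ?thesis .
qed

lemma sector_subset: "\<rho> \<le> h \<Longrightarrow> truncated_sector \<theta>m \<theta>M \<rho> \<subseteq> \<Omega>"
  using sector_eq by auto

lemma sets_sector: "truncated_sector \<theta>m \<theta>M \<rho> \<in> sets lebesgue"
  using open_truncated_sector[OF \<theta>'(3)] by simp

lemma integral_\<Omega>_eq_sector:
  fixes f :: "plane \<Rightarrow> 'b::{banach, second_countable_topology}"
  assumes "\<And>x. x \<in> \<Omega> \<Longrightarrow> x \<notin> ball 0 h \<Longrightarrow> f x = 0"
  shows "(LINT x|lebesgue_on \<Omega>. f x) = (LINT x|lebesgue_on (truncated_sector \<theta>m \<theta>M h). f x)"
proof (rule integral_lebesgue_on_subset[OF sets_\<Omega> sets_sector sector_subset[OF order_refl]])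
  fix x assume x: "x \<in> \<Omega>" "x \<notin> truncated_sector \<theta>m \<theta>M h"
  then have "x \<notin> ball 0 h" using corner by blast
  with x(1) show "f x = 0" by (rule assms)
qed

end

text \<open>\<open>D\<close> plays the role of the weak gradient of \<open>U\<close>, and zero trace
  on the sides is encoded by the approximants. This is the form in which
  \<open>trace_eq_approx\<close> delivers it, and the lemmas below become limits of statements about
  smooth functions.\<close>

locale corner_zero_trace = corner +
  fixes U :: "plane \<Rightarrow> 'b::euclidean_space" and D :: "2 \<Rightarrow> plane \<Rightarrow> 'b" and \<Phi> :: "nat \<Rightarrow> plane \<Rightarrow> 'b"
  assumes U: "integrable (lebesgue_on \<Omega>) U" and D: "\<And>i. integrable (lebesgue_on \<Omega>) (D i)"
    and \<Phi>: "\<And>n. C_infinity (\<Phi> n)"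
    and U_lim: "(\<lambda>n. LINT x|lebesgue_on \<Omega>. norm (\<Phi> n x - U x)) \<longlonglongrightarrow> 0"
    and D_lim: "\<And>i. (\<lambda>n. LINT x|lebesgue_on \<Omega>. norm (pd i (\<Phi> n) x - D i x)) \<longlonglongrightarrow> 0"
    and side_lim: "(\<lambda>n. integral {0..h} (\<lambda>r. norm (\<Phi> n (polar r \<theta>m)))) \<longlonglongrightarrow> 0"
      "(\<lambda>n. integral {0..h} (\<lambda>r. norm (\<Phi> n (polar r \<theta>M)))) \<longlonglongrightarrow> 0"
begin

text \<open>The test function may be nonzero on the sides and at the vertex. For the smooth
  approximants the side terms are bounded by \<open>sector_divergence\<close> and tend to 0; the arc
  |x| = h gives nothing because \<open>\<phi>\<close> vanishes there.\<close>

lemma integration_by_parts: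
  assumes \<phi>: "test_function (ball 0 h) \<phi>"
  shows "(LINT x|lebesgue_on \<Omega>. \<phi> x *\<^sub>R D k x) = - (LINT x|lebesgue_on \<Omega>. pd k \<phi> x *\<^sub>R U x)"
proof -
  note \<phi>' = test_functionD[OF \<phi>]
  have p\<phi>: "C_infinity (pd k \<phi>)" by (intro C_infinity_pd \<phi>')
  define f where "f n x = \<phi> x *\<^sub>R \<Phi> n x" for n x
  have f: "C_infinity (f n)" for n unfolding f_def by (intro C_infinity_scaleR \<phi>' \<Phi>)
  have pf: "pd k (f n) x = \<phi> x *\<^sub>R pd k (\<Phi> n) x + pd k \<phi> x *\<^sub>R \<Phi> n x" for n x
    unfolding f_def by (intro pd_scaleR C_infinity_differentiable \<phi>' \<Phi>)
  have pf0: "pd k (f n) x = 0" if "x \<notin> ball 0 h" for n x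
  proof -
    have "pd k \<phi> x = 0" using test_functionD(4)[OF test_function_pd[OF \<phi>] that] .
    then show ?thesis using \<phi>'(4)[OF that] by (simp add: pf)
  qed
  have supp0: "\<forall>x. x \<notin> supp \<phi> \<longrightarrow> \<phi> x = 0" by (simp add: not_in_supp)
  obtain B where B: "B \<ge> 0" "\<And>x. norm (\<phi> x) \<le> B" "\<And>i x. norm (pd i \<phi> x) \<le> B"
    by (rule C_infinity_compact_support_bounded[OF \<phi>'(1,2) supp0]) (rule that)
  let ?I = "\<lambda>n \<theta>. integral {0..h} (\<lambda>r. norm (\<Phi> n (polar r \<theta>)))"
  have le: "norm (LINT x|lebesgue_on \<Omega>. pd k (f n) x) \<le> B * (?I n \<theta>M + ?I n \<theta>m)" for n
  proof -
    have "(LINT x|lebesgue_on \<Omega>. pd k (f n) x) = (LINT x|lebesgue_on (truncated_sector \<theta>m \<theta>M h). pd k (f n) x)"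
      by (intro integral_\<Omega>_eq_sector pf0)
    also have "norm \<dots> \<le> integral {0..h} (\<lambda>r. norm (f n (polar r \<theta>M)) + norm (f n (polar r \<theta>m)))"
      using \<phi>'(4) by (intro sector_divergence[OF \<theta>' h f]) (simp add: f_def)
    also have "\<dots> \<le> integral {0..h} (\<lambda>r. B * (norm (\<Phi> n (polar r \<theta>M)) + norm (\<Phi> n (polar r \<theta>m))))"
    proof (rule integral_le)
      fix r
      show "norm (f n (polar r \<theta>M)) + norm (f n (polar r \<theta>m)) \<le> B * (norm (\<Phi> n (polar r \<theta>M)) + norm (\<Phi> n (polar r \<theta>m)))"
        using B(2) unfolding f_def norm_scaleR distrib_left real_norm_def by (intro add_mono mult_right_mono) auto
    qed (intro integrable_continuous_real continuous_intros C_infinity_continuous_polar f \<Phi>)+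
    also have "\<dots> = B * (?I n \<theta>M + ?I n \<theta>m)"
      by (subst integral_mult_right, subst Henstock_Kurzweil_Integration.integral_add)
        (intro integrable_continuous_real continuous_intros C_infinity_continuous_polar \<Phi> refl)+
    finally show ?thesis .
  qed
  have "(\<lambda>n. B * (?I n \<theta>M + ?I n \<theta>m)) \<longlonglongrightarrow> 0"
    using tendsto_mult[OF tendsto_const[of B] tendsto_add[OF side_lim(2,1)]] by simp
  then have "(\<lambda>n. norm (LINT x|lebesgue_on \<Omega>. pd k (f n) x)) \<longlonglongrightarrow> 0"
    by (rule tendsto_0_le) (use le in auto)
  then have 1: "(\<lambda>n. LINT x|lebesgue_on \<Omega>. pd k (f n) x) \<longlonglongrightarrow> 0" by (rule tendsto_norm_zero_cancel)
  have c: "continuous_on UNIV \<phi>" "continuous_on UNIV (pd k \<phi>)" by (intro C_infinity_continuous \<phi>' p\<phi>)+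
  have i: "integrable (lebesgue_on \<Omega>) (\<Phi> n)" "integrable (lebesgue_on \<Omega>) (pd k (\<Phi> n))" for n
    by (intro integrable_C_infinity \<Omega> C_infinity_pd \<Phi>)+
  have "(LINT x|lebesgue_on \<Omega>. pd k (f n) x)
      = (LINT x|lebesgue_on \<Omega>. \<phi> x *\<^sub>R pd k (\<Phi> n) x) + (LINT x|lebesgue_on \<Omega>. pd k \<phi> x *\<^sub>R \<Phi> n x)" for n
    unfolding pf by (intro Bochner_Integration.integral_add integrable_continuous_scaleR \<Omega> c i)
  moreover have "(\<lambda>n. (LINT x|lebesgue_on \<Omega>. \<phi> x *\<^sub>R pd k (\<Phi> n) x) + (LINT x|lebesgue_on \<Omega>. pd k \<phi> x *\<^sub>R \<Phi> n x))
      \<longlonglongrightarrow> (LINT x|lebesgue_on \<Omega>. \<phi> x *\<^sub>R D k x) + (LINT x|lebesgue_on \<Omega>. pd k \<phi> x *\<^sub>R U x)"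
    by (intro tendsto_add tendsto_integral_scaleR_L1 \<Omega> c i U D U_lim D_lim)
  ultimately have "(\<lambda>n. LINT x|lebesgue_on \<Omega>. pd k (f n) x)
      \<longlonglongrightarrow> (LINT x|lebesgue_on \<Omega>. \<phi> x *\<^sub>R D k x) + (LINT x|lebesgue_on \<Omega>. pd k \<phi> x *\<^sub>R U x)"
    by simp
  from LIMSEQ_unique[OF this 1]
  have "(LINT x|lebesgue_on \<Omega>. \<phi> x *\<^sub>R D k x) + (LINT x|lebesgue_on \<Omega>. pd k \<phi> x *\<^sub>R U x) = 0" .
  then show ?thesis by (simp add: eq_neg_iff_add_eq_0)
qed

text \<open>The limit of \<open>sector_Poincare\<close>, in which the integral over the side
  disappears.\<close>

lemma Poincare:
  assumes \<rho>: "0 < \<rho>" "\<rho> \<le> h"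
  shows "(LINT x|lebesgue_on (truncated_sector \<theta>m \<theta>M \<rho>). norm (U x))
    \<le> (\<theta>M - \<theta>m) * \<rho> * ((LINT x|lebesgue_on (truncated_sector \<theta>m \<theta>M \<rho>). norm (D 1 x))
        + (LINT x|lebesgue_on (truncated_sector \<theta>m \<theta>M \<rho>). norm (D 2 x)))"
proof -
  let ?S = "truncated_sector \<theta>m \<theta>M \<rho>"
  note sub = sets_\<Omega> sets_sector[of \<rho>] sector_subset[OF \<rho>(2)]
  have lim: "(\<lambda>n. LINT x|lebesgue_on ?S. norm (F n x)) \<longlonglongrightarrow> (LINT x|lebesgue_on ?S. norm (G x))"
    if F: "\<And>n. integrable (lebesgue_on \<Omega>) (F n)" and G: "integrable (lebesgue_on \<Omega>) G"
      and l: "(\<lambda>n. LINT x|lebesgue_on \<Omega>. norm (F n x - G x)) \<longlonglongrightarrow> 0" for F :: "nat \<Rightarrow> plane \<Rightarrow> 'b" and G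
  proof (rule tendsto_integral_L1)
    note FS = integrable_lebesgue_on_subset[OF F sub] and GS = integrable_lebesgue_on_subset[OF G sub]
    show "integrable (lebesgue_on ?S) (\<lambda>x. norm (F n x))" "integrable (lebesgue_on ?S) (\<lambda>x. norm (G x))" for n
      using FS GS by simp_all
    show "(\<lambda>n. LINT x|lebesgue_on ?S. norm (norm (F n x) - norm (G x))) \<longlonglongrightarrow> 0"
    proof (rule tendsto_0_le[OF l])
      fix n
      have "(LINT x|lebesgue_on ?S. norm (norm (F n x) - norm (G x))) \<le> (LINT x|lebesgue_on ?S. norm (F n x - G x))"
        using FS[of n] GS by (intro integral_mono) (auto simp: norm_triangle_ineq3)
      also have "\<dots> \<le> (LINT x|lebesgue_on \<Omega>. norm (F n x - G x))"
        using F G by (intro integral_norm_lebesgue_on_mono sub) simp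
      finally show "(LINT x|lebesgue_on ?S. norm (norm (F n x) - norm (G x))) \<le> (LINT x|lebesgue_on \<Omega>. norm (F n x - G x))" .
    qed simp
  qed
  have i: "integrable (lebesgue_on \<Omega>) (\<Phi> n)" "integrable (lebesgue_on \<Omega>) (pd k (\<Phi> n))" for n k
    by (intro integrable_C_infinity \<Omega> C_infinity_pd \<Phi>)+
  let ?I = "\<lambda>n. integral {0..h} (\<lambda>r. norm (\<Phi> n (polar r \<theta>m)))"
  show ?thesis
  proof (rule LIMSEQ_le)
    show "(\<lambda>n. LINT x|lebesgue_on ?S. norm (\<Phi> n x)) \<longlonglongrightarrow> (LINT x|lebesgue_on ?S. norm (U x))"
      by (rule lim[OF i(1) U U_lim])
    have "(\<lambda>n. (\<theta>M - \<theta>m) * \<rho> * (?I n + ((LINT x|lebesgue_on ?S. norm (pd 1 (\<Phi> n) x))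
        + (LINT x|lebesgue_on ?S. norm (pd 2 (\<Phi> n) x))))) \<longlonglongrightarrow> (\<theta>M - \<theta>m) * \<rho> * (0 + ((LINT x|lebesgue_on ?S. norm (D 1 x))
        + (LINT x|lebesgue_on ?S. norm (D 2 x))))"
      by (intro tendsto_mult tendsto_add tendsto_const side_lim lim i D D_lim)
    then show "(\<lambda>n. (\<theta>M - \<theta>m) * \<rho> * (?I n + ((LINT x|lebesgue_on ?S. norm (pd 1 (\<Phi> n) x))
        + (LINT x|lebesgue_on ?S. norm (pd 2 (\<Phi> n) x))))) \<longlonglongrightarrow> (\<theta>M - \<theta>m) * \<rho> * ((LINT x|lebesgue_on ?S. norm (D 1 x))
        + (LINT x|lebesgue_on ?S. norm (D 2 x)))" by simp
    have "(LINT x|lebesgue_on ?S. norm (\<Phi> n x)) \<le> (\<theta>M - \<theta>m) * \<rho> * (?I n + ((LINT x|lebesgue_on ?S. norm (pd 1 (\<Phi> n) x))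
        + (LINT x|lebesgue_on ?S. norm (pd 2 (\<Phi> n) x))))" for n
    proof -
      have "(LINT x|lebesgue_on ?S. norm (pd 1 (\<Phi> n) x) + norm (pd 2 (\<Phi> n) x))
          = (LINT x|lebesgue_on ?S. norm (pd 1 (\<Phi> n) x)) + (LINT x|lebesgue_on ?S. norm (pd 2 (\<Phi> n) x))"
        using integrable_lebesgue_on_subset[OF i(2) sub]
        by (intro Bochner_Integration.integral_add) simp_all
      moreover have "integral {0..\<rho>} (\<lambda>r. norm (\<Phi> n (polar r \<theta>m))) \<le> ?I n"
        using \<rho> by (intro integral_subset_le integrable_continuous_real continuous_intros C_infinity_continuous_polar \<Phi>) auto
      moreover have "0 \<le> (\<theta>M - \<theta>m) * \<rho>" using \<theta> \<rho> by simp
      ultimately show ?thesis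
        using sector_Poincare[OF \<theta>' \<rho>(1) \<Phi>, of n]
        by (intro order_trans[OF sector_Poincare[OF \<theta>' \<rho>(1) \<Phi>]] mult_left_mono) auto
    qed
    then show "\<exists>N. \<forall>n\<ge>N. (LINT x|lebesgue_on ?S. norm (\<Phi> n x)) \<le> (\<theta>M - \<theta>m) * \<rho> * (?I n + ((LINT x|lebesgue_on ?S. norm (pd 1 (\<Phi> n) x))
        + (LINT x|lebesgue_on ?S. norm (pd 2 (\<Phi> n) x))))" by blast
  qed
qed

end

subsection \<open>The divergence of the traction field\<close>

text \<open>The rotation term turns both off-diagonal entries into
  \<open>mu * (J $ 1 $ 2 + J $ 2 $ 1)\<close>: together the two directions form the symmetric stress
  tensor.\<close>

lemma traction_formula_axis:
  "traction_formula la mu J (axis 1 1) $ 1 = of_real (2 * mu) * J $ 1 $ 1 + of_real la * (J $ 1 $ 1 + J $ 2 $ 2)"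
  "traction_formula la mu J (axis 1 1) $ 2 = of_real (2 * mu) * J $ 2 $ 1 + of_real mu * (J $ 1 $ 2 - J $ 2 $ 1)"
  "traction_formula la mu J (axis 2 1) $ 1 = of_real (2 * mu) * J $ 1 $ 2 - of_real mu * (J $ 1 $ 2 - J $ 2 $ 1)"
  "traction_formula la mu J (axis 2 1) $ 2 = of_real (2 * mu) * J $ 2 $ 2 + of_real la * (J $ 1 $ 1 + J $ 2 $ 2)"
  by (simp_all add: traction_formula_def cvec_def perp_def matrix_vector_mult_def axis_def UNIV_2 scaleR_conv_of_real[where 'a = complex] algebra_simps)

text \<open>The divergence of the stress and the Lame operator arrange the mixed second derivatives
  of \<open>u\<close> differently. They agree as distributions because second derivatives of a test
  function commute; the equation then identifies the divergence.\<close>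

lemma is_weak_div_traction:
  assumes \<Omega>: "bounded \<Omega>" "open \<Omega>" and u: "H1_mem \<Omega> u" and g: "L2_mem (lebesgue_on \<Omega>) g"
    and eq: "\<And>\<phi>. test_function \<Omega> \<phi> \<Longrightarrow>
      lame la mu (regular_distribution \<Omega> u) \<phi> + \<omega>\<^sup>2 *\<^sub>R regular_distribution \<Omega> g \<phi> = 0"
  shows "is_weak_div \<Omega> (\<lambda>i x. traction_formula la mu (weak_jacobian \<Omega> u x) (axis i 1)) (\<lambda>x. - (\<omega>\<^sup>2) *\<^sub>R g x)"
  unfolding is_weak_div_def
proof (intro conjI allI impI)
  show "L2_mem (lebesgue_on \<Omega>) (\<lambda>x. - (\<omega>\<^sup>2) *\<^sub>R g x)"
    by (intro L2_mem_bounded_linear[OF _ g] bounded_linear_scaleR_right)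
  fix \<phi> assume \<phi>: "test_function \<Omega> \<phi>"
  let ?R = "regular_distribution \<Omega>"
  let ?F = "\<lambda>i x. traction_formula la mu (weak_jacobian \<Omega> u x) (axis i 1)"
  define A where "A j l i = (LINT x|lebesgue_on \<Omega>. pd i \<phi> x *\<^sub>R (weak_pd \<Omega> j u x $ l))" for i j l :: 2
  have test: "test_function \<Omega> (pd i \<phi>)" for i by (rule test_function_pd[OF \<phi>])
  have cont: "continuous_on UNIV (pd i \<phi>)" for i
    by (intro C_infinity_continuous test_functionD[OF test])
  have wint: "integrable (lebesgue_on \<Omega>) (weak_pd \<Omega> j u)" for j
    by (intro L2_lebesgue_on_integrable \<Omega> L2_mem_weak_pd u)
  have vint: "integrable (lebesgue_on \<Omega>) (\<lambda>x. pd i \<phi> x *\<^sub>R weak_pd \<Omega> j u x)" for i j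
    by (intro integrable_continuous_scaleR \<Omega> cont wint)
  have Rw: "?R (weak_pd \<Omega> j u) (pd i \<phi>) $ l = A j l i" for i j l
    unfolding regular_distribution_def A_def
    using integral_bounded_linear[OF bounded_linear_vec_nth[of l] vint[of i j]] by simp
  have Ai: "integrable (lebesgue_on \<Omega>) (\<lambda>x. pd i \<phi> x *\<^sub>R (weak_pd \<Omega> j u x $ l))" for i j l
    using integrable_bounded_linear[OF bounded_linear_vec_nth[of l] vint[of i j]] by simp
  have w: "dpd j (?R u) (pd i \<phi>) = ?R (weak_pd \<Omega> j u) (pd i \<phi>)" for i j
    using is_weak_pd_weak_pd[OF u] test by (auto simp: is_weak_pd_def)
  \<comment> \<open>Moving both derivatives onto the test function makes \<open>A\<close> symmetric
    in the index of the derivative on \<open>u\<close> and the one on \<open>\<phi>\<close>.\<close>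
  have sym: "A j l i = A i l j" for i j l
  proof -
    have "A j l i = - ?R u (pd j (pd i \<phi>)) $ l" by (simp add: Rw[symmetric] w[symmetric] dpd_def)
    also have "pd j (pd i \<phi>) = pd i (pd j \<phi>)"
      using pd_commute[OF test_functionD(1)[OF \<phi>]] by blast
    also have "- ?R u (pd i (pd j \<phi>)) $ l = A i l j" by (simp add: Rw[symmetric] w[symmetric] dpd_def)
    finally show ?thesis .
  qed
  have lame_nth: "lame la mu (?R u) \<phi> $ l = - of_real mu * (A 1 l 1 + A 2 l 2) - of_real (la + mu) * (A 1 1 l + A 2 2 l)" for l
  proof -
    have d1: "dpd i (dpd i (?R u)) \<phi> = - ?R (weak_pd \<Omega> i u) (pd i \<phi>)" for i
      unfolding dpd_def[of i "dpd i (?R u)"] w ..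
    have d2: "dpd l (ddiv (?R u)) \<phi> = - (A 1 1 l + A 2 2 l)"
      unfolding dpd_def[of l "ddiv (?R u)"] ddiv_def w Rw UNIV_2 by simp
    have "lame la mu (?R u) \<phi> $ l = of_real mu * (- A 1 l 1 - A 2 l 2) + of_real (la + mu) * (- (A 1 1 l + A 2 2 l))"
      by (simp add: lame_def UNIV_2 d1 d2 Rw scaleR_conv_of_real[where 'a = complex])
    also have "\<dots> = - of_real mu * (A 1 l 1 + A 2 l 2) - of_real (la + mu) * (A 1 1 l + A 2 2 l)"
      by (simp add: algebra_simps)
    finally show ?thesis .
  qed
  have J: "weak_jacobian \<Omega> u x $ k $ j = weak_pd \<Omega> j u x $ k" for x k j
    by (simp add: weak_jacobian_def)
  have lin: "(LINT x|lebesgue_on \<Omega>. pd i \<phi> x *\<^sub>R (a * (weak_pd \<Omega> j u x $ l) + b * (weak_pd \<Omega> j' u x $ l') + c * (weak_pd \<Omega> j'' u x $ l'')))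
      = a * A j l i + b * A j' l' i + c * A j'' l'' i"
    "integrable (lebesgue_on \<Omega>) (\<lambda>x. pd i \<phi> x *\<^sub>R (a * (weak_pd \<Omega> j u x $ l) + b * (weak_pd \<Omega> j' u x $ l') + c * (weak_pd \<Omega> j'' u x $ l'')))"
    for a b c :: complex and i j j' j'' l l' l''
  proof -
    define P where "P j l x = pd i \<phi> x *\<^sub>R (weak_pd \<Omega> j u x $ l)" for j l x
    have P: "integrable (lebesgue_on \<Omega>) (P j l)" "A j l i = (LINT x|lebesgue_on \<Omega>. P j l x)" for j l
      using Ai by (simp_all add: P_def[abs_def] A_def)
    have e: "(\<lambda>x. pd i \<phi> x *\<^sub>R (a * (weak_pd \<Omega> j u x $ l) + b * (weak_pd \<Omega> j' u x $ l') + c * (weak_pd \<Omega> j'' u x $ l'')))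
        = (\<lambda>x. a * P j l x + b * P j' l' x + c * P j'' l'' x)"
      by (simp add: fun_eq_iff P_def scaleR_add_right)
    show "(LINT x|lebesgue_on \<Omega>. pd i \<phi> x *\<^sub>R (a * (weak_pd \<Omega> j u x $ l) + b * (weak_pd \<Omega> j' u x $ l') + c * (weak_pd \<Omega> j'' u x $ l'')))
        = a * A j l i + b * A j' l' i + c * A j'' l'' i"
      "integrable (lebesgue_on \<Omega>) (\<lambda>x. pd i \<phi> x *\<^sub>R (a * (weak_pd \<Omega> j u x $ l) + b * (weak_pd \<Omega> j' u x $ l') + c * (weak_pd \<Omega> j'' u x $ l'')))"
      unfolding e using P by simp_all
  qed
  have nth_int: "?R f \<psi> $ k = (LINT x|lebesgue_on \<Omega>. \<psi> x *\<^sub>R (f x $ k))"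
    if "integrable (lebesgue_on \<Omega>) (\<lambda>x. \<psi> x *\<^sub>R f x)" for f :: "plane \<Rightarrow> complex^2" and \<psi> k
    unfolding regular_distribution_def using integral_bounded_linear[OF bounded_linear_vec_nth that, of k] by simp
  \<comment> \<open>The summands with coefficient 0 bring every entry to the three-term shape that
    \<open>lin\<close> integrates.\<close>
  define C where "C i k = (if i = 1 then (if k = 1 then (of_real (2 * mu + la) * A 1 1 1 + of_real la * A 2 2 1 + 0 * A 1 1 1)
      else (of_real mu * A 1 2 1 + of_real mu * A 2 1 1 + 0 * A 1 1 1))
    else (if k = 1 then (of_real mu * A 2 1 2 + of_real mu * A 1 2 2 + 0 * A 1 1 2)
      else (of_real (2 * mu + la) * A 2 2 2 + of_real la * A 1 1 2 + 0 * A 1 1 2)))" for i k :: 2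
  have F_nth: "?F i x $ k = (if i = 1 then (if k = 1 then (of_real (2 * mu + la) * weak_pd \<Omega> 1 u x $ 1 + of_real la * weak_pd \<Omega> 2 u x $ 2 + 0 * weak_pd \<Omega> 1 u x $ 1)
      else (of_real mu * weak_pd \<Omega> 1 u x $ 2 + of_real mu * weak_pd \<Omega> 2 u x $ 1 + 0 * weak_pd \<Omega> 1 u x $ 1))
    else (if k = 1 then (of_real mu * weak_pd \<Omega> 2 u x $ 1 + of_real mu * weak_pd \<Omega> 1 u x $ 2 + 0 * weak_pd \<Omega> 1 u x $ 1)
      else (of_real (2 * mu + la) * weak_pd \<Omega> 2 u x $ 2 + of_real la * weak_pd \<Omega> 1 u x $ 1 + 0 * weak_pd \<Omega> 1 u x $ 1)))" for i k :: 2 and x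
    using exhaust_2[of i] exhaust_2[of k] by (auto simp: traction_formula_axis J algebra_simps)
  have Fi: "integrable (lebesgue_on \<Omega>) (\<lambda>x. pd i \<phi> x *\<^sub>R (?F i x $ k))" for i k
    unfolding F_nth by (cases "i = 1"; cases "k = 1"; simp only: if_True if_False lin(2) refl)
  have vec_int: "integrable M f" if "\<And>k. integrable M (\<lambda>x. f x $ k)" for f :: "plane \<Rightarrow> complex^2" and M
  proof -
    have "bounded_linear (axis k :: complex \<Rightarrow> complex^2)" for k
      by (intro linear_conv_bounded_linear[THEN iffD1] linearI) (auto simp: vec_eq_iff axis_def)
    then have i: "integrable M (\<lambda>x. axis k (f x $ k) :: complex^2)" for k
      using that by (rule integrable_bounded_linear)
    have "(\<lambda>x. axis 1 (f x $ 1) + axis 2 (f x $ 2)) = f"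
      by (auto simp: fun_eq_iff vec_eq_iff forall_2 axis_def)
    with Bochner_Integration.integrable_add[OF i[of 1] i[of 2]] show ?thesis by simp
  qed
  have RF: "?R (?F i) (pd i \<phi>) $ k = C i k" for i k
  proof -
    have "integrable (lebesgue_on \<Omega>) (\<lambda>x. pd i \<phi> x *\<^sub>R ?F i x)"
      by (rule vec_int) (simp add: Fi)
    from nth_int[OF this, of k]
    have "?R (?F i) (pd i \<phi>) $ k = (LINT x|lebesgue_on \<Omega>. pd i \<phi> x *\<^sub>R (?F i x $ k))" .
    also have "\<dots> = C i k"
      unfolding F_nth C_def
      using exhaust_2[of i] by (cases "i = 1"; cases "k = 1"; simp only: if_True if_False lin(1) refl)
        (auto simp: lin(1))
    finally show ?thesis .
  qed
  have "(\<Sum>i\<in>UNIV. dpd i (?R (?F i)) \<phi>) = lame la mu (?R u) \<phi>"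
  proof (subst vec_eq_iff, rule allI)
    fix k
    have "(\<Sum>i\<in>UNIV. dpd i (?R (?F i)) \<phi>) $ k = - (C 1 k + C 2 k)"
      by (simp add: UNIV_2 dpd_def RF)
    also have "\<dots> = lame la mu (?R u) \<phi> $ k"
      unfolding lame_nth C_def using exhaust_2[of k] sym[of 1 _ 2] sym[of 2 _ 1]
      by (auto simp: algebra_simps)
    finally show "(\<Sum>i\<in>UNIV. dpd i (?R (?F i)) \<phi>) $ k = lame la mu (?R u) \<phi> $ k" .
  qed
  also have "\<dots> = - (\<omega>\<^sup>2 *\<^sub>R ?R g \<phi>)"
    using eq[OF \<phi>] by (simp add: eq_neg_iff_add_eq_0)
  also have "\<dots> = ?R (\<lambda>x. - (\<omega>\<^sup>2) *\<^sub>R g x) \<phi>"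
  proof -
    have "?R (\<lambda>x. - (\<omega>\<^sup>2) *\<^sub>R g x) \<phi> = (LINT x|lebesgue_on \<Omega>. - (\<omega>\<^sup>2) *\<^sub>R (\<phi> x *\<^sub>R g x))"
      unfolding regular_distribution_def by (simp add: mult.commute)
    also have "\<dots> = - (\<omega>\<^sup>2) *\<^sub>R ?R g \<phi>"
      unfolding regular_distribution_def by (rule integral_scaleR_right)
    finally show ?thesis by simp
  qed
  finally show "(\<Sum>i\<in>UNIV. dpd i (?R (?F i)) \<phi>) = ?R (\<lambda>x. - (\<omega>\<^sup>2) *\<^sub>R g x) \<phi>" .
qed

subsection \<open>The integral identity at the vertex\<close>

text \<open>The bilinear pairing of \<open>y\<close> with the vector (1, \<sigma>). Testing with the
  field (f, \<sigma> f) thus becomes scalar testing of the spinor with f.\<close>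

definition spinor :: "complex \<Rightarrow> complex^2 \<Rightarrow> complex" where
  "spinor \<sigma> y = y $ 1 + \<sigma> * y $ 2"

lemma bounded_linear_spinor: "bounded_linear (spinor \<sigma>)"
  unfolding spinor_def
  by (intro bounded_linear_add bounded_linear_const_mult bounded_linear_vec_nth)

text \<open>One fixed radial cutoff, rescaled: its derivatives are bounded, and the chain rule
  contributes the factor 1/\<delta>. It serves both at scales tending to 0 and, at a fixed scale, to
  cut the kernels off.\<close>

lemma vertex_cutoff:
  obtains C and \<kappa> :: "real \<Rightarrow> plane \<Rightarrow> real" where "C \<ge> 0"
    "\<And>\<delta>. \<delta> > 0 \<Longrightarrow> C_infinity (\<kappa> \<delta>)"
    "\<And>\<delta> x. 0 \<le> \<kappa> \<delta> x" "\<And>\<delta> x. \<kappa> \<delta> x \<le> 1"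
    "\<And>\<delta> x. \<delta> > 0 \<Longrightarrow> norm x \<le> \<delta> \<Longrightarrow> \<kappa> \<delta> x = 0"
    "\<And>\<delta> x. \<delta> > 0 \<Longrightarrow> 2 * \<delta> \<le> norm x \<Longrightarrow> \<kappa> \<delta> x = 1"
    "\<And>\<delta> i x. \<delta> > 0 \<Longrightarrow> \<bar>pd i (\<kappa> \<delta>) x\<bar> \<le> C / \<delta>"
    "\<And>\<delta> i x. \<delta> > 0 \<Longrightarrow> 2 * \<delta> \<le> norm x \<Longrightarrow> pd i (\<kappa> \<delta>) x = 0"
proof -
  define \<kappa>1 :: "plane \<Rightarrow> real" where "\<kappa>1 x = smooth_step (x $ 1 * x $ 1 + x $ 2 * x $ 2 - 1)" for x
  have nsq: "x $ 1 * x $ 1 + x $ 2 * x $ 2 = (norm x)\<^sup>2" for x :: plane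
    by (simp add: norm_plane power2_eq_square)
  have s1: "C_infinity \<kappa>1"
    unfolding \<kappa>1_def by (intro C_infinity_smooth_step C_infinity_intros)
  have z1: "\<kappa>1 x = 0" if "norm x \<le> 1" for x
  proof -
    have "(norm x)\<^sup>2 \<le> 1" using that by (simp add: power_le_one)
    then show ?thesis by (simp add: \<kappa>1_def nsq smooth_step_0)
  qed
  \<comment> \<open>The transition is complete where |x|^2 = 2, which is before 3/2. The gap up to 2
    makes the derivative vanish on the closed region |x| >= 2.\<close>
  have o1: "\<kappa>1 x = 1" if "3/2 \<le> norm x" for x
  proof -
    have "(3/2)\<^sup>2 \<le> (norm x)\<^sup>2" using that by (intro power_mono) auto
    then show ?thesis by (simp add: \<kappa>1_def nsq smooth_step_1 power2_eq_square)
  qed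
  have sm: "C_infinity (\<lambda>x. \<kappa>1 x - 1)" by (intro C_infinity_diff s1 C_infinity_const)
  have out: "\<forall>x. x \<notin> cball 0 (3/2) \<longrightarrow> \<kappa>1 x - 1 = 0" using o1 by auto
  obtain B where B: "B \<ge> 0" "\<And>x. norm (\<kappa>1 x - 1) \<le> B" "\<And>i x. norm (pd i (\<lambda>x. \<kappa>1 x - 1) x) \<le> B"
    by (rule C_infinity_compact_support_bounded[OF sm compact_cball out]) (rule that)
  have pd1: "pd i (\<lambda>x. \<kappa>1 x - 1) x = pd i \<kappa>1 x" for i x
  proof -
    have "pd i (\<lambda>x. \<kappa>1 x - 1) x = pd i \<kappa>1 x - pd i (\<lambda>x. 1) x"
      by (intro pd_diff C_infinity_differentiable s1 C_infinity_const)
    then show ?thesis by (simp add: pd_const)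
  qed
  have pd0: "pd i \<kappa>1 x = 0" if "2 \<le> norm x" for i x
  proof -
    have "pd i (\<lambda>x. \<kappa>1 x - 1) x = 0"
      by (rule pd_eq_0_outside[where K = "cball 0 (3/2)"]) (use out that in auto)
    then show ?thesis by (simp add: pd1)
  qed
  define \<kappa> where "\<kappa> \<delta> x = \<kappa>1 (inverse \<delta> *\<^sub>R x)" for \<delta> x
  have der: "(\<kappa> \<delta> has_derivative (\<lambda>k. (inverse \<delta> *\<^sub>R k) $ 1 *\<^sub>R pd 1 \<kappa>1 (inverse \<delta> *\<^sub>R x) + (inverse \<delta> *\<^sub>R k) $ 2 *\<^sub>R pd 2 \<kappa>1 (inverse \<delta> *\<^sub>R x))) (at x)" for \<delta> x
    unfolding \<kappa>_def
    by (rule has_derivative_compose[OF _ has_derivative_pd_2[OF s1, where S = UNIV]]) (auto intro!: derivative_eq_intros)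
  have pd: "pd i (\<kappa> \<delta>) x = inverse \<delta> * pd i \<kappa>1 (inverse \<delta> *\<^sub>R x)" for \<delta> i x
    using pd_eqI[OF der] exhaust_2[of i] by (auto simp: axis_def)
  show thesis
  proof (rule that[of B \<kappa>])
    show "C_infinity (\<kappa> \<delta>)" if "\<delta> > 0" for \<delta>
      unfolding \<kappa>_def \<kappa>1_def vector_scaleR_component real_scaleR_def
      by (intro C_infinity_smooth_step C_infinity_intros)
    fix \<delta> :: real and x :: plane and i
    show "0 \<le> \<kappa> \<delta> x" "\<kappa> \<delta> x \<le> 1" by (simp_all add: \<kappa>_def \<kappa>1_def smooth_step_bounds)
    assume \<delta>: "\<delta> > 0"
    have n: "norm (inverse \<delta> *\<^sub>R x) = norm x / \<delta>" using \<delta> by (simp add: divide_inverse mult.commute)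
    have n1: "norm x \<le> \<delta> \<Longrightarrow> norm (inverse \<delta> *\<^sub>R x) \<le> 1" and n2: "2 * \<delta> \<le> norm x \<Longrightarrow> 2 \<le> norm (inverse \<delta> *\<^sub>R x)"
      unfolding n using \<delta> by (simp_all add: field_simps)
    show "norm x \<le> \<delta> \<Longrightarrow> \<kappa> \<delta> x = 0"
      unfolding \<kappa>_def by (rule z1[OF n1])
    show "2 * \<delta> \<le> norm x \<Longrightarrow> \<kappa> \<delta> x = 1"
      unfolding \<kappa>_def by (rule o1) (use n2 in linarith)
    show "\<bar>pd i (\<kappa> \<delta>) x\<bar> \<le> B / \<delta>"
      using B(3)[unfolded pd1, of i "inverse \<delta> *\<^sub>R x"] \<delta> by (simp add: pd abs_mult divide_inverse mult.commute)
    show "2 * \<delta> \<le> norm x \<Longrightarrow> pd i (\<kappa> \<delta>) x = 0"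
      unfolding pd using pd0[OF n2] by simp
  qed (rule B(1))
qed

text \<open>The closure of the truncated sector lies in the compact polar image of the closed
  rectangle, so the angle of a nearby frontier point is between \<theta>m and \<theta>M; strictly
  between would put it into the open set \<Omega>. The vertex itself has to be excluded, as the rays
  do not contain it.\<close>

lemma (in corner) frontier_near_vertex:
  assumes x: "x \<in> frontier \<Omega>" "norm x < h" "x \<noteq> 0"
  shows "x \<in> (ray \<theta>M \<union> ray \<theta>m) \<inter> ball 0 h"
proof -
  let ?Q = "\<lambda>p::real \<times> real. polar (fst p) (snd p)"
  let ?K = "?Q ` ({0..h} \<times> {\<theta>m..\<theta>M})"
  have "compact ?K"
    by (intro compact_continuous_image compact_Times compact_Icc continuous_intros)
  moreover have "truncated_sector \<theta>m \<theta>M h \<subseteq> ?K"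
    unfolding truncated_sector_polar[OF \<theta>'(1,3)] by force
  ultimately have cl: "closure (truncated_sector \<theta>m \<theta>M h) \<subseteq> ?K"
    by (intro closure_minimal compact_imp_closed)
  have "x \<in> ball 0 h \<inter> closure \<Omega>" using x by (auto simp: frontier_def)
  also have "\<dots> \<subseteq> closure (ball 0 h \<inter> \<Omega>)" by (rule open_Int_closure_subset) simp
  also have "ball 0 h \<inter> \<Omega> = truncated_sector \<theta>m \<theta>M h" using corner by (simp add: Int_commute)
  finally obtain r t where rt: "x = polar r t" "r \<in> {0..h}" "t \<in> {\<theta>m..\<theta>M}" using cl by auto
  then have nr: "norm x = r" by (simp add: norm_polar)
  have r: "r > 0" "r < h" using x(2,3) unfolding nr[symmetric] by simp_all
  have ang: "polar_angle x = t" using rt r \<theta> by (simp add: polar_angle_polar)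
  have "x \<notin> \<Omega>" using x(1) \<Omega>(2) by (simp add: frontier_def interior_open)
  then have "x \<notin> truncated_sector \<theta>m \<theta>M h" using corner by blast
  then have "t = \<theta>m \<or> t = \<theta>M"
    using x ang rt(3) by (auto simp: truncated_sector_def sector_def)
  then show ?thesis using ang x by (auto simp: ray_def)
qed

text \<open>\<open>weak_div\<close> is a choice among representatives; almost everywhere uniqueness
  allows a known divergence in its place.\<close>

lemma normal_trace_eq:
  fixes F :: "2 \<Rightarrow> plane \<Rightarrow> 'b::euclidean_space"
  assumes \<Omega>: "bounded \<Omega>" "open \<Omega>" and D: "is_weak_div \<Omega> F D" and F: "\<And>i. integrable (lebesgue_on \<Omega>) (F i)"
    and \<psi>: "C_infinity \<psi>"
  shows "normal_trace \<Omega> F \<psi> = (LINT x|lebesgue_on \<Omega>. (\<Sum>i\<in>UNIV. pd i \<psi> x *\<^sub>R F i x) + \<psi> x *\<^sub>R D x)"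
proof -
  have w: "is_weak_div \<Omega> F (weak_div \<Omega> F)"
    unfolding weak_div_def using someI[of "is_weak_div \<Omega> F", OF D] .
  have L: "L2_mem (lebesgue_on \<Omega>) D" "L2_mem (lebesgue_on \<Omega>) (weak_div \<Omega> F)"
    using D w by (auto simp: is_weak_div_def)
  have ae: "AE x in lebesgue_on \<Omega>. weak_div \<Omega> F x = D x"
    by (rule eq_of_regular_distribution[OF \<Omega> L(2,1)]) (use D w in \<open>auto simp: is_weak_div_def\<close>)
  have S: "integrable (lebesgue_on \<Omega>) (\<lambda>x. \<Sum>i\<in>UNIV. pd i \<psi> x *\<^sub>R F i x)"
    by (intro Bochner_Integration.integrable_sum integrable_continuous_scaleR \<Omega> F C_infinity_continuous C_infinity_pd \<psi>)
  have T: "integrable (lebesgue_on \<Omega>) (\<lambda>x. \<psi> x *\<^sub>R D x)" "integrable (lebesgue_on \<Omega>) (\<lambda>x. \<psi> x *\<^sub>R weak_div \<Omega> F x)"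
    by (intro integrable_continuous_scaleR L2_lebesgue_on_integrable \<Omega> L C_infinity_continuous \<psi>)+
  show ?thesis
    unfolding normal_trace_def
  proof (rule integral_cong_AE)
    show "AE x in lebesgue_on \<Omega>. (\<Sum>i\<in>UNIV. pd i \<psi> x *\<^sub>R F i x) + \<psi> x *\<^sub>R weak_div \<Omega> F x
        = (\<Sum>i\<in>UNIV. pd i \<psi> x *\<^sub>R F i x) + \<psi> x *\<^sub>R D x"
      using ae by eventually_elim simp
  qed (intro borel_measurable_integrable Bochner_Integration.integrable_add S T)+
qed

lemma bounded_linear_traction_formula: "linear (\<lambda>J. traction_formula la mu J n)"
  by (intro linearI) (simp_all add: traction_formula_def vec_eq_iff forall_2 matrix_vector_mult_def UNIV_2
      scaleR_conv_of_real[where 'a = complex] algebra_simps)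

text \<open>\<open>Q\<close> stands for the source (1 + V) w. The two equations enter through the
  divergences of the traction fields, as supplied by \<open>is_weak_div_traction\<close>.\<close>

locale transmission =
  corner_zero_trace \<Omega> \<theta>m \<theta>M h "\<lambda>x. w x - v x" "\<lambda>i x. weak_pd \<Omega> i w x - weak_pd \<Omega> i v x" \<Phi>
  for \<Omega> \<theta>m \<theta>M h and v w :: "plane \<Rightarrow> complex^2" and \<Phi> :: "nat \<Rightarrow> plane \<Rightarrow> complex^2" +
  fixes la mu \<omega> :: real and Q :: "plane \<Rightarrow> complex^2" and \<Gamma> :: "plane set"
  assumes v: "H1_mem \<Omega> v" and w: "H1_mem \<Omega> w" and Q: "L2_mem (lebesgue_on \<Omega>) Q"
    and v_div: "is_weak_div \<Omega> (\<lambda>i x. traction_formula la mu (weak_jacobian \<Omega> v x) (axis i 1)) (\<lambda>x. - (\<omega>\<^sup>2) *\<^sub>R v x)"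
    and w_div: "is_weak_div \<Omega> (\<lambda>i x. traction_formula la mu (weak_jacobian \<Omega> w x) (axis i 1)) (\<lambda>x. - (\<omega>\<^sup>2) *\<^sub>R Q x)"
    and sides: "(ray \<theta>M \<union> ray \<theta>m) \<inter> ball 0 h \<subseteq> \<Gamma>"
    and tractions: "traction_eq_on la mu \<Omega> \<Gamma> v w"
begin

abbreviation "DU i x \<equiv> weak_pd \<Omega> i w x - weak_pd \<Omega> i v x"

text \<open>What remains of the stress of w - v, paired with (1, \<sigma>), after a rotated gradient
  has been split off; see \<open>spinor_traction\<close>. The split is chosen so that the second row
  becomes \<sigma> times the first. The derivatives of a test function then enter as \<partial>1
  \<psi> + \<sigma> \<partial>2 \<psi>, which is 0 for the kernels.\<close>

definition flux :: "complex \<Rightarrow> plane \<Rightarrow> complex" where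
  "flux \<sigma> x = of_real mu * (spinor \<sigma> (DU 1 x) - \<sigma> * spinor \<sigma> (DU 2 x))
     + of_real (la + mu) * (DU 1 x $ 1 + DU 2 x $ 2)"

lemma L2_flux: "L2_mem (lebesgue_on \<Omega>) (flux \<sigma>)"
proof -
  have DU: "L2_mem (lebesgue_on \<Omega>) (DU i)" for i
    by (intro L2_mem_diff L2_mem_weak_pd v w)
  have s: "L2_mem (lebesgue_on \<Omega>) (\<lambda>x. spinor \<sigma> (DU i x))" for i
    by (rule L2_mem_bounded_linear[OF bounded_linear_spinor DU])
  have c: "L2_mem (lebesgue_on \<Omega>) (\<lambda>x. DU i x $ k)" for i k
    by (rule L2_mem_bounded_linear[OF bounded_linear_vec_nth DU])
  have m: "L2_mem (lebesgue_on \<Omega>) (\<lambda>x. a * f x)" if "L2_mem (lebesgue_on \<Omega>) f" for a and f :: "plane \<Rightarrow> complex"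
    by (rule L2_mem_bounded_linear[OF bounded_linear_mult_right that])
  show ?thesis unfolding flux_def
    by (intro L2_mem_add L2_mem_diff m s c)
qed

lemma integrable_flux: "integrable (lebesgue_on \<Omega>) (flux \<sigma>)"
  by (intro L2_lebesgue_on_integrable \<Omega> L2_flux)

lemma integrable_source: "integrable (lebesgue_on \<Omega>) (\<lambda>x. spinor \<sigma> (Q x - v x))"
  by (intro L2_lebesgue_on_integrable \<Omega> L2_mem_bounded_linear[OF bounded_linear_spinor] L2_mem_diff Q H1_memD v)

lemma integrable_traction:
  assumes "H1_mem \<Omega> u"
  shows "integrable (lebesgue_on \<Omega>) (\<lambda>x. traction_formula la mu (weak_jacobian \<Omega> u x) n)"
proof -
  let ?c = "\<lambda>k i. \<lambda>J::complex^2^2. J $ k $ i"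
  have J: "L2_mem (lebesgue_on \<Omega>) (\<lambda>x. weak_jacobian \<Omega> u x)"
  proof -
    let ?A = "\<lambda>i y. (\<chi> k j. if j = i then y $ k else 0) :: complex^2^2"
    have "bounded_linear (?A i)" for i
      by (intro linear_conv_bounded_linear[THEN iffD1] linearI) (auto simp: vec_eq_iff)
    then have "L2_mem (lebesgue_on \<Omega>) (\<lambda>x. ?A i (weak_pd \<Omega> i u x))" for i
      by (rule L2_mem_bounded_linear) (intro L2_mem_weak_pd assms)
    from L2_mem_add[OF this[of 1] this[of 2]]
    have "L2_mem (lebesgue_on \<Omega>) (\<lambda>x. ?A 1 (weak_pd \<Omega> 1 u x) + ?A 2 (weak_pd \<Omega> 2 u x))" .
    moreover have "(\<lambda>x. ?A 1 (weak_pd \<Omega> 1 u x) + ?A 2 (weak_pd \<Omega> 2 u x)) = weak_jacobian \<Omega> u"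
      by (auto simp: fun_eq_iff weak_jacobian_def vec_eq_iff forall_2)
    ultimately show ?thesis by simp
  qed
  have "bounded_linear (\<lambda>J. traction_formula la mu J n)"
    by (rule linear_conv_bounded_linear[THEN iffD1, OF bounded_linear_traction_formula])
  from L2_mem_bounded_linear[OF this J] show ?thesis
    by (intro L2_lebesgue_on_integrable \<Omega>)
qed

lemma spinor_traction:
  assumes \<sigma>: "\<sigma>\<^sup>2 = -1"
  defines "F \<equiv> \<lambda>i x. traction_formula la mu (weak_jacobian \<Omega> w x) (axis i 1) - traction_formula la mu (weak_jacobian \<Omega> v x) (axis i 1)"
  shows "spinor \<sigma> (F 1 x) = flux \<sigma> x + of_real (2 * mu) * \<sigma> * spinor \<sigma> (DU 2 x)"
    "spinor \<sigma> (F 2 x) = \<sigma> * flux \<sigma> x - of_real (2 * mu) * \<sigma> * spinor \<sigma> (DU 1 x)"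
proof -
  have s: "\<sigma> * \<sigma> = -1" using \<sigma> by (simp add: power2_eq_square)
  have ss: "\<sigma> * (\<sigma> * z) = - z" for z using s by (simp add: mult.assoc[symmetric])
  have J: "weak_jacobian \<Omega> u x $ k $ j = weak_pd \<Omega> j u x $ k" for u k j
    by (simp add: weak_jacobian_def)
  show "spinor \<sigma> (F 1 x) = flux \<sigma> x + of_real (2 * mu) * \<sigma> * spinor \<sigma> (DU 2 x)"
    by (simp add: F_def spinor_def flux_def traction_formula_axis J algebra_simps s ss)
  show "spinor \<sigma> (F 2 x) = \<sigma> * flux \<sigma> x - of_real (2 * mu) * \<sigma> * spinor \<sigma> (DU 1 x)"
    by (simp add: F_def spinor_def flux_def traction_formula_axis J algebra_simps s ss)
qed

text \<open>As \<psi> vanishes near the vertex, its support meets the frontier on the open sides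
  only, so the tractions can be equated. The rotated gradient drops out: integrating by parts, which
  the zero trace permits, moves its derivatives onto \<psi>, where they cancel by symmetry of the
  second derivatives.\<close>

lemma vertex_identity_away:
  assumes \<sigma>: "\<sigma>\<^sup>2 = -1" and \<psi>: "test_function (ball 0 h) \<psi>" "0 \<notin> supp \<psi>"
  shows "(LINT x|lebesgue_on \<Omega>. pd 1 \<psi> x *\<^sub>R flux \<sigma> x + pd 2 \<psi> x *\<^sub>R (\<sigma> * flux \<sigma> x))
    = of_real (\<omega>\<^sup>2) * (LINT x|lebesgue_on \<Omega>. \<psi> x *\<^sub>R spinor \<sigma> (Q x - v x))"
proof -
  let ?F = "\<lambda>u i x. traction_formula la mu (weak_jacobian \<Omega> u x) (axis i 1)"
  note \<psi>' = test_functionD[OF \<psi>(1)]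
  have "supp \<psi> \<inter> frontier \<Omega> \<subseteq> \<Gamma>"
  proof
    fix x assume x: "x \<in> supp \<psi> \<inter> frontier \<Omega>"
    then have "norm x < h" "x \<noteq> 0" using \<psi>'(3) \<psi>(2) by auto
    then show "x \<in> \<Gamma>" using frontier_near_vertex[of x] x sides by auto
  qed
  moreover have "test_function UNIV \<psi>" using \<psi>(1) by (rule test_function_subset) simp
  ultimately have eq: "traction la mu \<Omega> v \<psi> = traction la mu \<Omega> w \<psi>"
    using tractions by (auto simp: traction_eq_on_def)
  note Fi = integrable_traction[OF v] integrable_traction[OF w]
  have cp: "continuous_on UNIV (pd i \<psi>)" "continuous_on UNIV \<psi>" for i
    by (intro C_infinity_continuous C_infinity_pd \<psi>')+
  note iv = L2_lebesgue_on_integrable[OF \<Omega> H1_memD[OF v]] and iQ = L2_lebesgue_on_integrable[OF \<Omega> Q]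
  define hv where "hv x = (\<Sum>i\<in>UNIV. pd i \<psi> x *\<^sub>R ?F v i x) + \<psi> x *\<^sub>R (- (\<omega>\<^sup>2) *\<^sub>R v x)" for x
  define hw where "hw x = (\<Sum>i\<in>UNIV. pd i \<psi> x *\<^sub>R ?F w i x) + \<psi> x *\<^sub>R (- (\<omega>\<^sup>2) *\<^sub>R Q x)" for x
  have int_h: "integrable (lebesgue_on \<Omega>) hv" "integrable (lebesgue_on \<Omega>) hw"
    unfolding hv_def hw_def
    by (intro Bochner_Integration.integrable_add Bochner_Integration.integrable_sum integrable_continuous_scaleR \<Omega> cp Fi
        integrable_scaleR_right iv iQ)+
  have "(LINT x|lebesgue_on \<Omega>. hv x) = (LINT x|lebesgue_on \<Omega>. hw x)"
    using eq unfolding traction_def normal_trace_eq[OF \<Omega> v_div Fi(1) \<psi>'(1)] normal_trace_eq[OF \<Omega> w_div Fi(2) \<psi>'(1)]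
    by (simp add: hv_def hw_def)
  then have "(LINT x|lebesgue_on \<Omega>. hw x - hv x) = 0"
    using int_h by simp
  moreover have "(LINT x|lebesgue_on \<Omega>. spinor \<sigma> (hw x - hv x)) = spinor \<sigma> (LINT x|lebesgue_on \<Omega>. hw x - hv x)"
    using int_h by (intro integral_bounded_linear[OF bounded_linear_spinor]) simp
  ultimately have z: "(LINT x|lebesgue_on \<Omega>. spinor \<sigma> (hw x - hv x)) = 0"
    by (simp add: spinor_def)
  have DUi: "integrable (lebesgue_on \<Omega>) (\<lambda>x. spinor \<sigma> (DU i x))" for i
    using integrable_bounded_linear[OF bounded_linear_spinor D] .
  define a where "a x = pd 1 \<psi> x *\<^sub>R flux \<sigma> x + pd 2 \<psi> x *\<^sub>R (\<sigma> * flux \<sigma> x)" for x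
  define b where "b i j x = pd i \<psi> x *\<^sub>R spinor \<sigma> (DU j x)" for i j x
  define c where "c x = \<psi> x *\<^sub>R spinor \<sigma> (Q x - v x)" for x
  have lin: "spinor \<sigma> (y + z) = spinor \<sigma> y + spinor \<sigma> z" "spinor \<sigma> (r *\<^sub>R y) = r *\<^sub>R spinor \<sigma> y"
    "spinor \<sigma> (y - z) = spinor \<sigma> y - spinor \<sigma> z" for y z r
    by (simp_all add: spinor_def algebra_simps)
  have pw: "spinor \<sigma> (hw x - hv x) = a x + of_real (2 * mu) * \<sigma> * (b 1 2 x - b 2 1 x) - of_real (\<omega>\<^sup>2) * c x" for x
  proof -
    have "hw x - hv x = pd 1 \<psi> x *\<^sub>R (?F w 1 x - ?F v 1 x) + pd 2 \<psi> x *\<^sub>R (?F w 2 x - ?F v 2 x)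
        - (\<psi> x * \<omega>\<^sup>2) *\<^sub>R (Q x - v x)"
      by (simp add: hw_def hv_def UNIV_2 algebra_simps)
    then have "spinor \<sigma> (hw x - hv x) = pd 1 \<psi> x *\<^sub>R (flux \<sigma> x + of_real (2 * mu) * \<sigma> * spinor \<sigma> (DU 2 x))
        + pd 2 \<psi> x *\<^sub>R (\<sigma> * flux \<sigma> x - of_real (2 * mu) * \<sigma> * spinor \<sigma> (DU 1 x))
        - (\<psi> x * \<omega>\<^sup>2) *\<^sub>R spinor \<sigma> (Q x - v x)"
      by (simp only: lin(1,2) lin(3)[of "_ + _"] spinor_traction[OF \<sigma>])
    then show ?thesis
      by (simp add: a_def b_def c_def scaleR_conv_of_real algebra_simps)
  qed
  have ints: "integrable (lebesgue_on \<Omega>) a" "integrable (lebesgue_on \<Omega>) (b i j)" "integrable (lebesgue_on \<Omega>) c" for i j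
    unfolding a_def b_def c_def
    by (intro Bochner_Integration.integrable_add integrable_continuous_scaleR \<Omega> cp integrable_mult_right integrable_flux DUi integrable_source)+
  have b_int: "(LINT x|lebesgue_on \<Omega>. b i j x) = spinor \<sigma> (- (LINT x|lebesgue_on \<Omega>. pd j (pd i \<psi>) x *\<^sub>R (w x - v x)))" for i j
  proof -
    have "(LINT x|lebesgue_on \<Omega>. b i j x) = (LINT x|lebesgue_on \<Omega>. spinor \<sigma> (pd i \<psi> x *\<^sub>R DU j x))"
      by (simp add: b_def lin(2))
    also have "\<dots> = spinor \<sigma> (LINT x|lebesgue_on \<Omega>. pd i \<psi> x *\<^sub>R DU j x)"
      by (intro integral_bounded_linear[OF bounded_linear_spinor] integrable_continuous_scaleR \<Omega> cp D)
    finally show ?thesis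
      by (simp only: integration_by_parts[OF test_function_pd[OF \<psi>(1)]])
  qed
  have "pd 2 (pd 1 \<psi>) = pd 1 (pd 2 \<psi>)" using pd_commute[OF \<psi>'(1)] by blast
  then have b0: "(LINT x|lebesgue_on \<Omega>. b 1 2 x) = (LINT x|lebesgue_on \<Omega>. b 2 1 x)"
    by (simp only: b_int)
  have "(LINT x|lebesgue_on \<Omega>. spinor \<sigma> (hw x - hv x))
      = (LINT x|lebesgue_on \<Omega>. a x) + of_real (2 * mu) * \<sigma> * ((LINT x|lebesgue_on \<Omega>. b 1 2 x) - (LINT x|lebesgue_on \<Omega>. b 2 1 x))
        - of_real (\<omega>\<^sup>2) * (LINT x|lebesgue_on \<Omega>. c x)"
    unfolding pw using ints by simp
  then show ?thesis using z b0 by (simp add: a_def c_def)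
qed

lemma vertex_identity:
  assumes \<sigma>: "\<sigma>\<^sup>2 = -1" and \<psi>: "test_function (ball 0 h) \<psi>"
  shows "(LINT x|lebesgue_on \<Omega>. pd 1 \<psi> x *\<^sub>R flux \<sigma> x + pd 2 \<psi> x *\<^sub>R (\<sigma> * flux \<sigma> x))
    = of_real (\<omega>\<^sup>2) * (LINT x|lebesgue_on \<Omega>. \<psi> x *\<^sub>R spinor \<sigma> (Q x - v x))"
proof -
  note \<psi>' = test_functionD[OF \<psi>]
  obtain C \<kappa> where \<kappa>: "C \<ge> 0" "\<And>\<delta>. \<delta> > 0 \<Longrightarrow> C_infinity (\<kappa> \<delta>)"
    "\<And>\<delta> x. 0 \<le> \<kappa> \<delta> x" "\<And>\<delta> x. \<kappa> \<delta> x \<le> (1::real)"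
    "\<And>\<delta> x. \<delta> > 0 \<Longrightarrow> norm x \<le> \<delta> \<Longrightarrow> \<kappa> \<delta> x = 0"
    "\<And>\<delta> x. \<delta> > 0 \<Longrightarrow> 2 * \<delta> \<le> norm x \<Longrightarrow> \<kappa> \<delta> x = 1"
    "\<And>\<delta> i x. \<delta> > 0 \<Longrightarrow> \<bar>pd i (\<kappa> \<delta>) x\<bar> \<le> C / \<delta>"
    "\<And>\<delta> i x. \<delta> > 0 \<Longrightarrow> 2 * \<delta> \<le> norm x \<Longrightarrow> pd i (\<kappa> \<delta>) x = 0"
    by (rule vertex_cutoff) (rule that; assumption)
  have supp0: "\<forall>x. x \<notin> supp \<psi> \<longrightarrow> \<psi> x = 0" by (simp add: not_in_supp)
  obtain B where B: "B \<ge> 0" "\<And>x. norm (\<psi> x) \<le> B" "\<And>i x. norm (pd i \<psi> x) \<le> B"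
    by (rule C_infinity_compact_support_bounded[OF \<psi>'(1,2) supp0]) (rule that)
  define \<delta> where "\<delta> n = inverse (real (Suc n))" for n
  have \<delta>: "\<delta> n > 0" for n by (simp add: \<delta>_def)
  have \<delta>0: "\<delta> \<longlonglongrightarrow> 0" unfolding \<delta>_def by (rule LIMSEQ_inverse_real_of_nat)
  define \<psi>n where "\<psi>n n x = \<psi> x * \<kappa> (\<delta> n) x" for n x
  have test: "test_function (ball 0 h) (\<psi>n n)" for n
    unfolding \<psi>n_def by (rule test_function_mult[OF \<psi> \<kappa>(2)[OF \<delta>]])
  have away: "0 \<notin> supp (\<psi>n n)" for n
  proof -
    have "supp (\<psi>n n) \<subseteq> - ball 0 (\<delta> n)"
      by (rule supp_subset) (auto simp: \<psi>n_def \<kappa>(5)[OF \<delta>])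
    then show ?thesis using \<delta>[of n] by auto
  qed
  have pd: "pd i (\<psi>n n) x = \<kappa> (\<delta> n) x * pd i \<psi> x + \<psi> x * pd i (\<kappa> (\<delta> n)) x" for i n x
    unfolding \<psi>n_def using pd_mult[OF C_infinity_differentiable[OF \<psi>'(1)] C_infinity_differentiable[OF \<kappa>(2)[OF \<delta>]]]
    by (simp add: mult.commute)
  define a where "a x = pd 1 \<psi> x *\<^sub>R flux \<sigma> x + pd 2 \<psi> x *\<^sub>R (\<sigma> * flux \<sigma> x)" for x
  define c where "c x = \<psi> x *\<^sub>R spinor \<sigma> (Q x - v x)" for x
  \<comment> \<open>The error caused by the gradient of the cutoff, which lives in the disc of
    radius \<open>2 * \<delta> n\<close>.\<close>
  define e where "e n x = \<psi> x *\<^sub>R (pd 1 (\<kappa> (\<delta> n)) x *\<^sub>R flux \<sigma> x + pd 2 (\<kappa> (\<delta> n)) x *\<^sub>R (\<sigma> * flux \<sigma> x))" for n x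
  have cp: "continuous_on UNIV (pd i \<psi>)" "continuous_on UNIV \<psi>" "continuous_on UNIV (\<kappa> (\<delta> n))" "continuous_on UNIV (pd i (\<kappa> (\<delta> n)))" for i n
    by (intro C_infinity_continuous C_infinity_pd \<psi>' \<kappa>(2)[OF \<delta>])+
  have ia: "integrable (lebesgue_on \<Omega>) a" and ic: "integrable (lebesgue_on \<Omega>) c" and ie: "integrable (lebesgue_on \<Omega>) (e n)" for n
    unfolding a_def c_def e_def
    by (intro Bochner_Integration.integrable_add integrable_continuous_scaleR \<Omega> cp integrable_mult_right integrable_flux integrable_source)+
  have \<kappa>_lim: "(\<lambda>n. LINT x|lebesgue_on \<Omega>. \<kappa> (\<delta> n) x *\<^sub>R f x) \<longlonglongrightarrow> (LINT x|lebesgue_on \<Omega>. f x)"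
    if f: "integrable (lebesgue_on \<Omega>) f" for f :: "plane \<Rightarrow> complex"
  proof (rule integral_dominated_convergence[where w = "\<lambda>x. norm (f x)"])
    show "(\<lambda>x. \<kappa> (\<delta> n) x *\<^sub>R f x) \<in> borel_measurable (lebesgue_on \<Omega>)" for n
      by (intro borel_measurable_integrable integrable_continuous_scaleR \<Omega> cp f)
    have z: "AE x in lebesgue_on \<Omega>. x \<noteq> 0"
    proof -
      have "AE x in lebesgue. x \<notin> {0::plane}"
        by (rule AE_not_in) (simp add: negligible_iff_null_sets[symmetric])
      then have "AE x in lebesgue. x \<in> \<Omega> \<longrightarrow> x \<noteq> 0" by eventually_elim simp
      then show ?thesis using sets_\<Omega> by (simp add: AE_restrict_space_iff)
    qed
    show "AE x in lebesgue_on \<Omega>. (\<lambda>n. \<kappa> (\<delta> n) x *\<^sub>R f x) \<longlonglongrightarrow> f x"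
      using z
    proof eventually_elim
      case (elim x)
      have "(\<lambda>n. 2 * \<delta> n) \<longlonglongrightarrow> 0" using tendsto_mult[OF tendsto_const \<delta>0, of 2] by simp
      then have "\<forall>\<^sub>F n in sequentially. 2 * \<delta> n < norm x"
        by (rule order_tendstoD(2)) (use elim in simp)
      then have "\<forall>\<^sub>F n in sequentially. \<kappa> (\<delta> n) x *\<^sub>R f x = f x"
        by eventually_elim (simp add: \<kappa>(6)[OF \<delta>])
      then show ?case by (rule tendsto_eventually)
    qed
    show "AE x in lebesgue_on \<Omega>. norm (\<kappa> (\<delta> n) x *\<^sub>R f x) \<le> norm (f x)" for n
      using \<kappa>(3,4) by (intro AE_I2) (simp add: mult_left_le_one_le)
  qed (use f in auto)
  have e_lim: "(\<lambda>n. LINT x|lebesgue_on \<Omega>. e n x) \<longlonglongrightarrow> 0"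
  proof (rule tendsto_norm_zero_cancel)
    let ?I = "\<lambda>\<rho>. (LINT x|lebesgue_on (\<Omega> \<inter> ball 0 \<rho>). norm (flux \<sigma> x)) / \<rho>"
    have I0: "(?I \<longlongrightarrow> 0) (at_right 0)" by (rule L2_scaled_average_tendsto[OF L2_flux sets_\<Omega>])
    have "filterlim (\<lambda>n. 2 * \<delta> n) (at_right 0) sequentially"
      using \<delta> tendsto_mult[OF tendsto_const \<delta>0, of 2] by (intro filterlim_at_withinI) (auto simp: less_imp_neq[symmetric])
    from filterlim_compose[OF I0 this] have "(\<lambda>n. ?I (2 * \<delta> n)) \<longlonglongrightarrow> 0" .
    from tendsto_mult[OF tendsto_const this, of "4 * B * C"]
    have lim: "(\<lambda>n. 4 * B * C * ?I (2 * \<delta> n)) \<longlonglongrightarrow> 0" by simp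
    have \<sigma>1: "norm \<sigma> = 1" using sigma_cases[OF \<sigma>] by auto
    \<comment> \<open>Each of the two partial derivatives of the cutoff is at most
      \<open>C / \<delta> n\<close>, which gives a factor 2; dividing the integral by the radius
      \<open>2 * \<delta> n\<close> makes it 4.\<close>
    have "norm (LINT x|lebesgue_on \<Omega>. e n x) \<le> 4 * B * C * ?I (2 * \<delta> n)" for n
    proof -
      let ?S = "\<Omega> \<inter> ball 0 (2 * \<delta> n)"
      have S: "?S \<in> sets lebesgue" using sets.Int[OF sets_\<Omega> fmeasurableD[OF lmeasurable_ball]] .
      have "(LINT x|lebesgue_on \<Omega>. e n x) = (LINT x|lebesgue_on ?S. e n x)"
        by (rule integral_lebesgue_on_subset[OF sets_\<Omega> S]) (auto simp: e_def \<kappa>(8)[OF \<delta>])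
      also have "norm \<dots> \<le> (LINT x|lebesgue_on ?S. norm (e n x))" by (rule integral_norm_bound)
      also have "\<dots> \<le> (LINT x|lebesgue_on ?S. (2 * B * (C / \<delta> n)) * norm (flux \<sigma> x))"
      proof (rule integral_mono)
        show "integrable (lebesgue_on ?S) (\<lambda>x. norm (e n x))"
          "integrable (lebesgue_on ?S) (\<lambda>x. (2 * B * (C / \<delta> n)) * norm (flux \<sigma> x))"
          using integrable_lebesgue_on_subset[OF ie sets_\<Omega> S] integrable_lebesgue_on_subset[OF integrable_flux sets_\<Omega> S]
          by simp_all
        fix x
        have "norm (pd 1 (\<kappa> (\<delta> n)) x *\<^sub>R flux \<sigma> x + pd 2 (\<kappa> (\<delta> n)) x *\<^sub>R (\<sigma> * flux \<sigma> x))
            \<le> (C / \<delta> n) * norm (flux \<sigma> x) + (C / \<delta> n) * norm (flux \<sigma> x)"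
        proof -
          have k: "norm (pd i (\<kappa> (\<delta> n)) x *\<^sub>R z) \<le> (C / \<delta> n) * norm z" for i and z :: complex
            using mult_right_mono[OF \<kappa>(7)[OF \<delta>], of "norm z" i n x] by simp
          show ?thesis
            using k[of 1 "flux \<sigma> x"] k[of 2 "\<sigma> * flux \<sigma> x"]
            by (intro norm_triangle_le add_mono) (simp_all add: norm_mult \<sigma>1)
        qed
        then have "norm (e n x) \<le> B * ((C / \<delta> n) * norm (flux \<sigma> x) + (C / \<delta> n) * norm (flux \<sigma> x))"
          unfolding e_def norm_scaleR[of "\<psi> x"] using B(1,2) by (intro mult_mono) auto
        then show "norm (e n x) \<le> (2 * B * (C / \<delta> n)) * norm (flux \<sigma> x)" by (simp add: algebra_simps)
      qed
      also have "\<dots> = 4 * B * C * ?I (2 * \<delta> n)" using \<delta>[of n] by simp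
      finally show ?thesis .
    qed
    with lim show "(\<lambda>n. norm (LINT x|lebesgue_on \<Omega>. e n x)) \<longlonglongrightarrow> 0"
      by (rule_tac tendsto_0_le) auto
  qed
  have id: "(LINT x|lebesgue_on \<Omega>. \<kappa> (\<delta> n) x *\<^sub>R a x) + (LINT x|lebesgue_on \<Omega>. e n x)
      = of_real (\<omega>\<^sup>2) * (LINT x|lebesgue_on \<Omega>. \<kappa> (\<delta> n) x *\<^sub>R c x)" for n
  proof -
    have "pd 1 (\<psi>n n) x *\<^sub>R flux \<sigma> x + pd 2 (\<psi>n n) x *\<^sub>R (\<sigma> * flux \<sigma> x) = \<kappa> (\<delta> n) x *\<^sub>R a x + e n x" for x
      by (simp add: pd a_def e_def scaleR_add_left scaleR_add_right)
    moreover have "\<psi>n n x *\<^sub>R spinor \<sigma> (Q x - v x) = \<kappa> (\<delta> n) x *\<^sub>R c x" for x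
      by (simp add: \<psi>n_def c_def mult.commute)
    ultimately have "(LINT x|lebesgue_on \<Omega>. \<kappa> (\<delta> n) x *\<^sub>R a x + e n x) = of_real (\<omega>\<^sup>2) * (LINT x|lebesgue_on \<Omega>. \<kappa> (\<delta> n) x *\<^sub>R c x)"
      using vertex_identity_away[OF \<sigma> test away, of n] by simp
    moreover have "integrable (lebesgue_on \<Omega>) (\<lambda>x. \<kappa> (\<delta> n) x *\<^sub>R a x)"
      by (intro integrable_continuous_scaleR \<Omega> cp ia)
    ultimately show ?thesis using ie by simp
  qed
  have "(\<lambda>n. (LINT x|lebesgue_on \<Omega>. \<kappa> (\<delta> n) x *\<^sub>R a x) + (LINT x|lebesgue_on \<Omega>. e n x)) \<longlonglongrightarrow> (LINT x|lebesgue_on \<Omega>. a x) + 0"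
    by (intro tendsto_add \<kappa>_lim ia e_lim)
  moreover have "(\<lambda>n. (LINT x|lebesgue_on \<Omega>. \<kappa> (\<delta> n) x *\<^sub>R a x) + (LINT x|lebesgue_on \<Omega>. e n x)) \<longlonglongrightarrow> of_real (\<omega>\<^sup>2) * (LINT x|lebesgue_on \<Omega>. c x)"
    unfolding id by (intro tendsto_mult tendsto_const \<kappa>_lim ic)
  ultimately have "(LINT x|lebesgue_on \<Omega>. a x) + 0 = of_real (\<omega>\<^sup>2) * (LINT x|lebesgue_on \<Omega>. c x)"
    by (rule LIMSEQ_unique)
  then show ?thesis by (simp add: a_def c_def)
qed

end

subsection \<open>Herglotz waves\<close>

lemma norm_exp_i_diff_le: "norm (exp (\<i> * of_real s) - exp (\<i> * of_real t)) \<le> \<bar>s - t\<bar>"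
proof -
  have "exp (\<i> * of_real s) - exp (\<i> * of_real t) = exp (\<i> * of_real t) * (exp (\<i> * of_real (s - t)) - 1)"
    by (simp add: right_diff_distrib exp_add[symmetric] algebra_simps)
  then have "norm (exp (\<i> * of_real s) - exp (\<i> * of_real t)) = norm (exp (\<i> * of_real (s - t)) - 1)"
    by (simp only: norm_mult norm_exp_i_times mult_1_left)
  also have "\<dots> = 2 * \<bar>sin ((s - t) / 2)\<bar>" by (rule dist_exp_i_1)
  also have "\<dots> \<le> 2 * \<bar>(s - t) / 2\<bar>" by (intro mult_left_mono abs_sin_x_le_abs_x) simp
  finally show ?thesis by simp
qed

lemma circle_map_borel: "(\<lambda>t. vector [cos t, sin t] :: plane) \<in> borel_measurable borel"
proof -
  have "(\<lambda>t. vector [cos t, sin t] :: plane) = (\<lambda>t. polar 1 t)"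
    by (auto simp: fun_eq_iff intro!: plane_eqI)
  then show ?thesis by (simp add: borel_measurable_continuous_onI continuous_intros)
qed

lemma circle_map_measurable:
  "(\<lambda>t. vector [cos t, sin t] :: plane) \<in> restrict_space lborel {0..<2 * pi} \<rightarrow>\<^sub>M borel"
  using circle_map_borel by (intro measurable_restrict_space1) simp

lemma sets_circle_measure [simp, measurable_cong]: "sets circle_measure = sets borel"
  by (simp add: circle_measure_def)

lemma finite_circle_measure: "finite_measure circle_measure"
proof -
  have "emeasure (restrict_space lborel {0..<2 * pi}) (space (restrict_space lborel {0..<2 * pi})) \<noteq> \<infinity>"
    by (simp add: emeasure_restrict_space space_restrict_space)
  then interpret finite_measure "restrict_space lborel {0..<2 * pi}" by (rule finite_measureI)
  show ?thesis unfolding circle_measure_def by (rule finite_measure_distr[OF circle_map_measurable])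
qed

lemma AE_circle_measure: "AE d in circle_measure. norm d = 1"
  unfolding circle_measure_def
proof (subst AE_distr_iff[OF circle_map_measurable])
  show "{x \<in> space borel. norm x = 1} \<in> sets (borel :: plane measure)" by measurable
  have "norm (vector [cos t, sin t] :: plane) = 1" for t by (simp add: norm_plane)
  then show "AE t in restrict_space lborel {0..<2 * pi}. norm (vector [cos t, sin t] :: plane) = 1" by simp
qed

lemma borel_measurable_complex_vec:
  fixes f :: "'a \<Rightarrow> complex^2"
  assumes "\<And>k. (\<lambda>x. f x $ k) \<in> borel_measurable M"
  shows "f \<in> borel_measurable M"
proof -
  have "bounded_linear (axis k :: complex \<Rightarrow> complex^2)" for k
    by (intro linear_conv_bounded_linear[THEN iffD1] linearI) (auto simp: vec_eq_iff axis_def)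
  then have "(axis k :: complex \<Rightarrow> complex^2) \<in> borel_measurable borel" for k
    by (intro borel_measurable_continuous_onI linear_continuous_on)
  then have "(\<lambda>x. axis k (f x $ k) :: complex^2) \<in> borel_measurable M" for k
    using measurable_compose[OF assms] by blast
  from borel_measurable_add[OF this[of 1] this[of 2]]
  have "(\<lambda>x. axis 1 (f x $ 1) + axis 2 (f x $ 2) :: complex^2) \<in> borel_measurable M" .
  moreover have "(\<lambda>x. axis 1 (f x $ 1) + axis 2 (f x $ 2)) = f"
    by (auto simp: fun_eq_iff vec_eq_iff forall_2 axis_def)
  ultimately show ?thesis by simp
qed

lemma norm_complex_vec: "norm (y :: complex^2) = sqrt ((norm (y $ 1))\<^sup>2 + (norm (y $ 2))\<^sup>2)"
  by (simp add: norm_vec_def L2_set_def UNIV_2)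

lemma norm_vector_scalar_mult: "norm (c *s y) = norm c * norm (y :: complex^2)"
proof -
  have "(norm (c * y $ 1))\<^sup>2 + (norm (c * y $ 2))\<^sup>2 = (norm c)\<^sup>2 * ((norm (y $ 1))\<^sup>2 + (norm (y $ 2))\<^sup>2)"
    by (simp add: norm_mult power_mult_distrib distrib_left)
  then show ?thesis by (simp add: norm_complex_vec real_sqrt_mult)
qed

lemma norm_cvec: "norm (cvec d) = norm d"
  by (simp add: norm_complex_vec cvec_def norm_plane)

lemma norm_perp: "norm (perp d) = norm d"
  by (simp add: norm_plane perp_def add.commute)

text \<open>The directions are unit vectors, so each exponential is Lipschitz in x with its wave
  number as constant. Cauchy-Schwarz on the circle replaces the L1 norms of the kernels by L2 norms,
  with a constant that is the same for all kernels.\<close>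

lemma herglotz_Lipschitz:
  assumes "mu > 0" "la + 2 * mu > 0" "\<omega> > 0"
  obtains K where "K \<ge> 0"
    "\<And>gp gs x y. L2_mem circle_measure gp \<Longrightarrow> L2_mem circle_measure gs \<Longrightarrow>
      norm (herglotz la mu \<omega> gp gs x - herglotz la mu \<omega> gp gs y)
        \<le> K * (L2_norm circle_measure gp + L2_norm circle_measure gs) * norm (x - y)"
proof -
  let ?M = "circle_measure"
  define a where "a = sqrt (k_p la mu \<omega> / \<omega>)"
  define b where "b = sqrt (k_s mu \<omega> / \<omega>)"
  define kp where "kp = k_p la mu \<omega>"
  define ks where "ks = k_s mu \<omega>"
  define m where "m = sqrt (measure ?M (space ?M))"
  define K where "K = max (\<bar>a\<bar> * \<bar>kp\<bar>) (\<bar>b\<bar> * \<bar>ks\<bar>) * m"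
  show thesis
  proof (rule that[of K])
    show "K \<ge> 0" unfolding K_def m_def by (intro mult_nonneg_nonneg) (auto simp: le_max_iff_disj)
    fix gp gs :: "plane \<Rightarrow> complex" and x y :: plane
    assume gp: "L2_mem ?M gp" and gs: "L2_mem ?M gs"
    note [measurable] = gp[unfolded L2_mem_def, THEN conjunct1] gs[unfolded L2_mem_def, THEN conjunct1]
    note igp = L2_mem_L1[OF finite_circle_measure gp] and igs = L2_mem_L1[OF finite_circle_measure gs]
    define F where "F x d = (complex_of_real a * exp (\<i> * complex_of_real (kp * (d \<bullet> x))) * gp d) *s cvec d
        + (complex_of_real b * exp (\<i> * complex_of_real (ks * (d \<bullet> x))) * gs d) *s cvec (perp d)" for x d
    have H: "herglotz la mu \<omega> gp gs x = exp (- \<i> * complex_of_real (pi / 4)) *s (LINT d|?M. F x d)" for x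
      by (simp add: herglotz_def F_def a_def b_def kp_def ks_def)
    have [measurable]: "(\<lambda>d::plane. d $ k) \<in> borel_measurable borel" "(\<lambda>d::plane. perp d $ k) \<in> borel_measurable borel" for k
    proof -
      show 1: "(\<lambda>d::plane. d $ k) \<in> borel_measurable borel" for k
        by (intro borel_measurable_continuous_onI continuous_intros)
      have "(\<lambda>d::plane. perp d $ k) = (if k = 1 then (\<lambda>d. - (d $ 2)) else (\<lambda>d. d $ 1))"
        using exhaust_2[of k] by (auto simp: perp_def)
      then show "(\<lambda>d::plane. perp d $ k) \<in> borel_measurable borel" using 1 by simp
    qed
    have F_meas: "F x \<in> borel_measurable ?M" for x
    proof (rule borel_measurable_complex_vec)
      fix k
      have "(\<lambda>d. F x d $ k) = (\<lambda>d. complex_of_real a * exp (\<i> * complex_of_real (kp * (d \<bullet> x))) * gp d * complex_of_real (d $ k)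
          + complex_of_real b * exp (\<i> * complex_of_real (ks * (d \<bullet> x))) * gs d * complex_of_real (perp d $ k))"
        by (simp add: F_def cvec_def)
      then show "(\<lambda>d. F x d $ k) \<in> borel_measurable ?M" by simp
    qed
    have F_norm: "AE d in ?M. norm (F x d) \<le> \<bar>a\<bar> * norm (gp d) + \<bar>b\<bar> * norm (gs d)" for x
      using AE_circle_measure
    proof eventually_elim
      case (elim d)
      show ?case unfolding F_def
        by (rule norm_triangle_le) (simp add: norm_vector_scalar_mult norm_cvec norm_perp elim norm_mult norm_exp_i_times del: of_real_mult)
    qed
    have F_int: "integrable ?M (F x)" for x
      by (rule integrable_dominated[OF _ F_meas F_norm]) (use igp igs in simp)
    have diff: "AE d in ?M. norm (F x d - F y d) \<le> (\<bar>a\<bar> * \<bar>kp\<bar> * norm (gp d) + \<bar>b\<bar> * \<bar>ks\<bar> * norm (gs d)) * norm (x - y)"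
      using AE_circle_measure
    proof eventually_elim
      case (elim d)
      have e: "norm (exp (\<i> * complex_of_real (k * (d \<bullet> x))) - exp (\<i> * complex_of_real (k * (d \<bullet> y)))) \<le> \<bar>k\<bar> * norm (x - y)" for k
      proof -
        have "norm (exp (\<i> * complex_of_real (k * (d \<bullet> x))) - exp (\<i> * complex_of_real (k * (d \<bullet> y)))) \<le> \<bar>k * (d \<bullet> x) - k * (d \<bullet> y)\<bar>"
          by (rule norm_exp_i_diff_le)
        also have "\<dots> = \<bar>k\<bar> * \<bar>d \<bullet> (x - y)\<bar>" by (simp add: inner_diff_right abs_mult right_diff_distrib[symmetric])
        also have "\<dots> \<le> \<bar>k\<bar> * norm (x - y)"
          using Cauchy_Schwarz_ineq2[of d "x - y"] elim by (intro mult_left_mono) auto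
        finally show ?thesis .
      qed
      let ?E = "\<lambda>k. exp (\<i> * complex_of_real (k * (d \<bullet> x))) - exp (\<i> * complex_of_real (k * (d \<bullet> y)))"
      have "F x d - F y d = (complex_of_real a * ?E kp * gp d) *s cvec d + (complex_of_real b * ?E ks * gs d) *s cvec (perp d)"
        by (simp add: F_def vec_eq_iff algebra_simps)
      also have "norm \<dots> \<le> norm ((complex_of_real a * ?E kp * gp d) *s cvec d) + norm ((complex_of_real b * ?E ks * gs d) *s cvec (perp d))"
        by (rule norm_triangle_ineq)
      also have "\<dots> = \<bar>a\<bar> * norm (?E kp) * norm (gp d) + \<bar>b\<bar> * norm (?E ks) * norm (gs d)"
        by (simp only: norm_vector_scalar_mult norm_cvec norm_perp elim norm_mult norm_of_real mult_1_right)
      also have "\<dots> \<le> \<bar>a\<bar> * (\<bar>kp\<bar> * norm (x - y)) * norm (gp d) + \<bar>b\<bar> * (\<bar>ks\<bar> * norm (x - y)) * norm (gs d)"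
        by (intro add_mono mult_right_mono mult_left_mono e) auto
      finally show ?case by (simp add: algebra_simps)
    qed
    have "norm (herglotz la mu \<omega> gp gs x - herglotz la mu \<omega> gp gs y) = norm (LINT d|?M. F x d - F y d)"
    proof -
      have "herglotz la mu \<omega> gp gs x - herglotz la mu \<omega> gp gs y
          = exp (- \<i> * complex_of_real (pi / 4)) *s ((LINT d|?M. F x d) - (LINT d|?M. F y d))"
        by (simp add: H vec_eq_iff algebra_simps)
      moreover have "norm (exp (- \<i> * complex_of_real (pi / 4))) = 1"
        using norm_exp_i_times[of "- (pi / 4)"] by simp
      ultimately show ?thesis
        using F_int by (simp only: norm_vector_scalar_mult mult_1_left Bochner_Integration.integral_diff)
    qed
    also have "\<dots> \<le> (LINT d|?M. norm (F x d - F y d))" by (rule integral_norm_bound)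
    also have "\<dots> \<le> (LINT d|?M. (\<bar>a\<bar> * \<bar>kp\<bar> * norm (gp d) + \<bar>b\<bar> * \<bar>ks\<bar> * norm (gs d)) * norm (x - y))"
      using F_int diff igp igs by (intro integral_mono_AE) auto
    also have "\<dots> = (\<bar>a\<bar> * \<bar>kp\<bar> * (LINT d|?M. norm (gp d)) + \<bar>b\<bar> * \<bar>ks\<bar> * (LINT d|?M. norm (gs d))) * norm (x - y)"
      using igp igs by simp
    also have "\<dots> \<le> (K * L2_norm ?M gp + K * L2_norm ?M gs) * norm (x - y)"
    proof (intro mult_right_mono add_mono)
      have "\<bar>a\<bar> * \<bar>kp\<bar> * (LINT d|?M. norm (gp d)) \<le> max (\<bar>a\<bar> * \<bar>kp\<bar>) (\<bar>b\<bar> * \<bar>ks\<bar>) * (m * L2_norm ?M gp)"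
        using igp(2) unfolding m_def by (intro mult_mono) (auto simp: le_max_iff_disj)
      then show "\<bar>a\<bar> * \<bar>kp\<bar> * (LINT d|?M. norm (gp d)) \<le> K * L2_norm ?M gp"
        unfolding K_def mult.assoc .
      have "\<bar>b\<bar> * \<bar>ks\<bar> * (LINT d|?M. norm (gs d)) \<le> max (\<bar>a\<bar> * \<bar>kp\<bar>) (\<bar>b\<bar> * \<bar>ks\<bar>) * (m * L2_norm ?M gs)"
        using igs(2) unfolding m_def by (intro mult_mono) (auto simp: le_max_iff_disj)
      then show "\<bar>b\<bar> * \<bar>ks\<bar> * (LINT d|?M. norm (gs d)) \<le> K * L2_norm ?M gs"
        unfolding K_def mult.assoc .
    qed simp
    finally show "norm (herglotz la mu \<omega> gp gs x - herglotz la mu \<omega> gp gs y)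
        \<le> K * (L2_norm ?M gp + L2_norm ?M gs) * norm (x - y)" by (simp add: distrib_left)
  qed
qed

subsection \<open>The value of the source at the vertex\<close>

lemma norm_spinor_le: "\<sigma>\<^sup>2 = -1 \<Longrightarrow> norm (spinor \<sigma> y) \<le> 2 * norm y"
proof -
  assume "\<sigma>\<^sup>2 = -1"
  then have "norm \<sigma> = 1" using sigma_cases[of \<sigma>] by auto
  then have "norm (spinor \<sigma> y) \<le> norm (y $ 1) + norm (y $ 2)"
    unfolding spinor_def by (intro norm_triangle_le) (simp add: norm_mult)
  also have "\<dots> \<le> norm y + norm y" by (intro add_mono Finite_Cartesian_Product.norm_nth_le)
  finally show ?thesis by simp
qed

context transmission
begin

text \<open>The identity is linear over the reals in the test function, so it holds for the real and
  the imaginary part separately; a complex \<psi> is needed because the kernels are complex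
  valued.\<close>

lemma vertex_identity_complex:
  fixes \<psi> :: "plane \<Rightarrow> complex"
  assumes \<sigma>: "\<sigma>\<^sup>2 = -1" and \<psi>: "C_infinity \<psi>" and K: "compact K" "K \<subseteq> ball 0 h" "\<And>x. x \<notin> K \<Longrightarrow> \<psi> x = 0"
  shows "(LINT x|lebesgue_on \<Omega>. (pd 1 \<psi> x + \<sigma> * pd 2 \<psi> x) * flux \<sigma> x)
    = of_real (\<omega>\<^sup>2) * (LINT x|lebesgue_on \<Omega>. \<psi> x * spinor \<sigma> (Q x - v x))"
proof -
  have sub: "supp (\<lambda>x. T (\<psi> x)) \<subseteq> K" if "T 0 = 0" for T :: "complex \<Rightarrow> real"
    by (rule supp_subset) (use K that in \<open>auto intro: compact_imp_closed\<close>)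
  have test: "test_function (ball 0 h) (\<lambda>x. T (\<psi> x))" if T: "bounded_linear T" for T :: "complex \<Rightarrow> real"
  proof -
    have T0: "T 0 = 0" using bounded_linear.linear[OF T] by (rule linear_0)
    have "compact (supp (\<lambda>x. T (\<psi> x)))"
      using compact_Int_closed[OF K(1) closed_supp[of "\<lambda>x. T (\<psi> x)"]] sub[of T] T0 by (simp add: Int_absorb1)
    then show ?thesis
      using C_infinity_bounded_linear[OF T \<psi>] sub[of T] T0 K(2) by (auto simp: test_function_def)
  qed
  have pdT: "pd i (\<lambda>x. T (\<psi> x)) x = T (pd i \<psi> x)" if "bounded_linear T" for T :: "complex \<Rightarrow> real" and i x
    by (rule pd_bounded_linear[OF that C_infinity_differentiable[OF \<psi>]])
  define a where "a T x = T (pd 1 \<psi> x) *\<^sub>R flux \<sigma> x + T (pd 2 \<psi> x) *\<^sub>R (\<sigma> * flux \<sigma> x)" for T :: "complex \<Rightarrow> real" and x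
  define c where "c T x = T (\<psi> x) *\<^sub>R spinor \<sigma> (Q x - v x)" for T :: "complex \<Rightarrow> real" and x
  have id: "(LINT x|lebesgue_on \<Omega>. a T x) = of_real (\<omega>\<^sup>2) * (LINT x|lebesgue_on \<Omega>. c T x)" if "bounded_linear T" for T
    using vertex_identity[OF \<sigma> test[OF that]] by (simp add: a_def c_def pdT[OF that])
  have cont: "continuous_on UNIV (\<lambda>x. T (g x))" if "bounded_linear T" "C_infinity g" for T :: "complex \<Rightarrow> real" and g :: "plane \<Rightarrow> complex"
    by (rule C_infinity_continuous[OF C_infinity_bounded_linear[OF that]])
  have ints: "integrable (lebesgue_on \<Omega>) (a T)" "integrable (lebesgue_on \<Omega>) (c T)" if T: "bounded_linear T" for T
  proof -
    have "integrable (lebesgue_on \<Omega>) (\<lambda>x. \<sigma> * flux \<sigma> x)" by (rule integrable_mult_right[OF integrable_flux])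
    from Bochner_Integration.integrable_add[OF
        integrable_continuous_scaleR[OF \<Omega> cont[OF T C_infinity_pd[OF \<psi>]] integrable_flux]
        integrable_continuous_scaleR[OF \<Omega> cont[OF T C_infinity_pd[OF \<psi>]] this]]
    show "integrable (lebesgue_on \<Omega>) (a T)" unfolding a_def .
    show "integrable (lebesgue_on \<Omega>) (c T)" unfolding c_def
      by (rule integrable_continuous_scaleR[OF \<Omega> cont[OF T \<psi>] integrable_source])
  qed
  note re = bounded_linear_Re and im = bounded_linear_Im
  have split: "z * y = Re z *\<^sub>R y + \<i> * (Im z *\<^sub>R y)" for z y :: complex
    by (simp add: complex_eq_iff)
  have "(pd 1 \<psi> x + \<sigma> * pd 2 \<psi> x) * flux \<sigma> x = pd 1 \<psi> x * flux \<sigma> x + pd 2 \<psi> x * (\<sigma> * flux \<sigma> x)" for x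
    by (simp add: algebra_simps)
  then have "(pd 1 \<psi> x + \<sigma> * pd 2 \<psi> x) * flux \<sigma> x = a Re x + \<i> * a Im x" for x
    by (simp add: split[of "pd _ _ _"] a_def distrib_left)
  moreover have "\<psi> x * spinor \<sigma> (Q x - v x) = c Re x + \<i> * c Im x" for x
    unfolding c_def by (rule split)
  ultimately show ?thesis
    using ints[OF re] ints[OF im] id[OF re] id[OF im] by (simp add: distrib_left mult.left_commute)
qed

text \<open>As an H^1 function \<open>v\<close> has no value at the vertex, so it is compared with a
  continuous \<open>p\<close>. Testing Q - v = (F0 - a) + (Q - F0) - (p - a) - (v - p) with the
  kernel, the whole is O(\<epsilon>^4) by the vertex identity and the first part carries the moment.
  After division by \<epsilon>^2 the other parts give the Hoelder, Lipschitz and approximation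
  errors. The subtracted \<open>K * \<epsilon>\<^sup>2\<close> comes from cutting the kernel off at
  a distance of order \<open>h\<close>. \<open>K\<close> is uniform in everything quantified after
  it.\<close>

lemma concentration:
  assumes \<sigma>: "\<sigma>\<^sup>2 = -1" and \<omega>: "\<omega> > 0" and \<alpha>: "0 < \<alpha>" "\<alpha> < 1" and Ch: "Ch \<ge> 0"
    and QF: "AE x in lebesgue_on (truncated_sector \<theta>m \<theta>M h). norm (Q x - F0) \<le> Ch * norm x powr \<alpha>"
  obtains K where "\<And>\<epsilon> a A T p. \<epsilon> > 0 \<Longrightarrow> A \<ge> 0 \<Longrightarrow> continuous_on UNIV p \<Longrightarrow>
      (\<And>x. norm (p x - a) \<le> A * norm x) \<Longrightarrow>
      L2_norm (lebesgue_on (truncated_sector \<theta>m \<theta>M h)) (\<lambda>x. v x - p x) \<le> T \<Longrightarrow>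
      norm (spinor \<sigma> (F0 - a)) * (norm (vertex_moment \<sigma> \<theta>m \<theta>M) - K * \<epsilon>\<^sup>2)
        \<le> K * (\<epsilon>\<^sup>2 + \<epsilon> powr \<alpha> + A * \<epsilon> + T / \<epsilon>)"
proof -
  let ?S = "truncated_sector \<theta>m \<theta>M h" and ?V = "vertex_moment \<sigma> \<theta>m \<theta>M"
  let ?M = "lebesgue_on ?S"
  define \<Delta> where "\<Delta> = \<theta>M - \<theta>m"
  have \<Delta>: "\<Delta> > 0" using \<theta> by (simp add: \<Delta>_def)
  have S_open: "open ?S" "bounded ?S" by (intro open_truncated_sector bounded_truncated_sector \<theta>')+
  have finS: "finite_measure ?M" by (intro finite_measure_lebesgue_on bounded_open_lmeasurable S_open)
  interpret S: finite_measure ?M by (rule finS)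
  have S_sub: "?S \<subseteq> \<Omega>" by (rule sector_subset) simp
  have spS: "space ?M = ?S" by simp
  obtain c where c: "c > 0" "c \<le> 1" and cone: "\<And>\<epsilon> r \<theta>. \<epsilon> > 0 \<Longrightarrow> r \<ge> 0 \<Longrightarrow> \<theta> \<in> {\<theta>m..\<theta>M} \<Longrightarrow>
      (c * (\<epsilon> + r))\<^sup>2 \<le> (\<epsilon> + r * cos \<theta>)\<^sup>2 + (r * sin \<theta>)\<^sup>2"
    by (rule sector_cone[OF \<theta>(1) \<theta>'(2) \<theta>(3)]) (rule that; assumption)
  obtain C \<kappa>' where \<kappa>': "C \<ge> 0" "\<And>\<delta>. \<delta> > 0 \<Longrightarrow> C_infinity (\<kappa>' \<delta>)"
    "\<And>\<delta> x. 0 \<le> \<kappa>' \<delta> x" "\<And>\<delta> x. \<kappa>' \<delta> x \<le> (1::real)"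
    "\<And>\<delta> x. \<delta> > 0 \<Longrightarrow> norm x \<le> \<delta> \<Longrightarrow> \<kappa>' \<delta> x = 0"
    "\<And>\<delta> x. \<delta> > 0 \<Longrightarrow> 2 * \<delta> \<le> norm x \<Longrightarrow> \<kappa>' \<delta> x = 1"
    "\<And>\<delta> i x. \<delta> > 0 \<Longrightarrow> \<bar>pd i (\<kappa>' \<delta>) x\<bar> \<le> C / \<delta>"
    "\<And>\<delta> i x. \<delta> > 0 \<Longrightarrow> 2 * \<delta> \<le> norm x \<Longrightarrow> pd i (\<kappa>' \<delta>) x = 0"
    by (rule vertex_cutoff) (rule that; assumption)
  \<comment> \<open>The vertex cutoff used in reverse: 1 - \<kappa> keeps the kernel for |x| <= h/4
    and removes it from h/2 on.\<close>
  define \<kappa> where "\<kappa> = \<kappa>' (h / 4)"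
  have h4: "h / 4 > 0" using h by simp
  have \<kappa>: "C_infinity \<kappa>" "\<And>x. 0 \<le> \<kappa> x" "\<And>x. \<kappa> x \<le> 1" "\<And>x. norm x \<le> h / 4 \<Longrightarrow> \<kappa> x = 0"
    "\<And>x. h / 2 \<le> norm x \<Longrightarrow> \<kappa> x = 1" "\<And>i x. \<bar>pd i \<kappa> x\<bar> \<le> 4 * C / h"
    unfolding \<kappa>_def
    using \<kappa>'(2)[OF h4] \<kappa>'(3,4) \<kappa>'(5)[OF h4] \<kappa>'(6)[OF h4] \<kappa>'(7)[OF h4]
    by (simp_all add: mult.commute)
  have \<kappa>_pd: "pd i \<kappa> x = 0" if "norm x < h / 4" for i x
    using pd_cong_open[of "ball 0 (h / 4)" x \<kappa> "\<lambda>x. 0" i] that \<kappa>(4) by (simp add: pd_const)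
  \<comment> \<open>For |x| >= h/4 the kernel bound of \<open>sector_kernel\<close> is at most (4
    \<epsilon> / (c h))^4.\<close>
  define M0 where "M0 = (4 / (c * h)) ^ 4"
  have M0: "M0 \<ge> 0" using c h by (simp add: M0_def)
  define G where "G = (LINT x|?M. norm (flux \<sigma> x))"
  have iflux: "integrable ?M (flux \<sigma>)"
    by (rule integrable_lebesgue_on_subset[OF integrable_flux sets_\<Omega> sets_sector S_sub])
  have G: "G \<ge> 0" by (simp add: G_def)
  define m where "m = measure ?M ?S"
  have m: "m \<ge> 0" by (simp add: m_def)
  define K1 where "K1 = 8 * C / h * M0 * G / \<omega>\<^sup>2"
  define K2 where "K2 = \<Delta> * (1 / (2 * c\<^sup>2 * h\<^sup>2) + 1 / (3 * c ^ 3 * h\<^sup>2))"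
  define c4 where "c4 = inverse c ^ 4"
  have c4: "c4 \<ge> 0" using c by (simp add: c4_def)
  define K where "K = (K2 + M0 * m) + K1 + 2 * c4 * \<Delta> * Ch + 2 * c4 * \<Delta> + 2 * c4 * sqrt \<Delta>"
  have K1: "K1 \<ge> 0" unfolding K1_def using \<kappa>'(1) h M0 G by simp
  have K2: "K2 \<ge> 0" unfolding K2_def using \<Delta> c h by simp
  have sum_nonneg: "0 \<le> M0 * m" "0 \<le> 2 * c4 * \<Delta> * Ch" "0 \<le> 2 * c4 * \<Delta>" "0 \<le> 2 * c4 * sqrt \<Delta>"
    using M0 m c4 \<Delta> Ch by simp_all
  have K_ge: "K2 + M0 * m \<le> K" "K1 \<le> K" "2 * c4 * \<Delta> * Ch \<le> K" "2 * c4 * \<Delta> \<le> K" "2 * c4 * sqrt \<Delta> \<le> K" "0 \<le> K"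
    unfolding K_def using K1 K2 sum_nonneg by linarith+
  show thesis
  proof (rule that[of K])
    fix \<epsilon> A T :: real and a and p :: "plane \<Rightarrow> complex^2"
    assume \<epsilon>: "\<epsilon> > 0" and A: "A \<ge> 0" and p: "continuous_on UNIV p" "\<And>x. norm (p x - a) \<le> A * norm x"
      and T: "L2_norm ?M (\<lambda>x. v x - p x) \<le> T"
    obtain f :: "plane \<Rightarrow> complex" where f: "C_infinity f"
      "\<And>x. x \<in> sector \<theta>m \<theta>M \<Longrightarrow> pd 1 f x + \<sigma> * pd 2 f x = 0"
      "\<And>r \<theta>. r \<ge> 0 \<Longrightarrow> \<theta> \<in> {\<theta>m..\<theta>M} \<Longrightarrow> f (polar r \<theta>) = (of_real \<epsilon> / (of_real \<epsilon> + of_real r * unit_dir \<sigma> \<theta>)) ^ 4"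
      "\<And>x. x \<in> sector \<theta>m \<theta>M \<Longrightarrow> norm (f x) \<le> (\<epsilon> / (c * (\<epsilon> + norm x))) ^ 4"
      by (rule sector_kernel[OF \<sigma> \<theta>(1,3) c(1) \<epsilon> cone[OF \<epsilon>]]) (assumption, assumption, (rule that; assumption))
    define X where "X = spinor \<sigma> (F0 - a)"
    define g where "g x = \<epsilon> / (\<epsilon> + norm x)" for x :: plane
    have pos: "\<epsilon> + norm x > 0" for x :: plane using \<epsilon> by (simp add: add_pos_nonneg)
    have g01: "0 \<le> g x" "g x \<le> 1" for x using \<epsilon> pos[of x] by (simp_all add: g_def)
    have f_le: "norm (f x) \<le> c4 * g x ^ 4" if "x \<in> ?S" for x
      using f(4)[of x] that c by (simp add: truncated_sector_def c4_def g_def power_divide power_mult_distrib divide_inverse mult_ac power_inverse)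
    have f_far: "norm (f x) \<le> M0 * \<epsilon> ^ 4" if "x \<in> ?S" "h / 4 \<le> norm x" for x
    proof -
      have "norm (f x) \<le> (\<epsilon> / (c * (\<epsilon> + norm x))) ^ 4" using f(4) that by (simp add: truncated_sector_def)
      also have "\<dots> \<le> (\<epsilon> / (c * (h / 4))) ^ 4"
      proof (intro power_mono frac_le)
        show "c * (h / 4) \<le> c * (\<epsilon> + norm x)" using c \<epsilon> that by (intro mult_left_mono) auto
      qed (use c h \<epsilon> pos[of x] in auto)
      also have "\<dots> = M0 * \<epsilon> ^ 4" by (simp add: M0_def power_divide power_mult_distrib)
      finally show ?thesis .
    qed
    define \<psi> where "\<psi> x = complex_of_real (1 - \<kappa> x) * f x" for x
    have \<eta>: "C_infinity (\<lambda>x. complex_of_real (1 - \<kappa> x))"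
      by (intro C_infinity_bounded_linear[OF bounded_linear_of_real] C_infinity_diff C_infinity_const \<kappa>)
    have \<psi>: "C_infinity \<psi>" unfolding \<psi>_def by (intro C_infinity_mult \<eta> f)
    have \<psi>0: "\<psi> x = 0" if "x \<notin> cball 0 (h / 2)" for x
      using \<kappa>(5)[of x] that by (simp add: \<psi>_def)
    have K0: "cball (0::plane) (h / 2) \<subseteq> ball 0 h" using h by auto
    \<comment> \<open>The kernel satisfies the Cauchy-Riemann equation on the sector, so only
      derivatives of the cutoff survive. They vanish for |x| < h/4, and beyond that the kernel is
      O(\<epsilon>^4).\<close>
    have pd\<psi>: "pd 1 \<psi> x + \<sigma> * pd 2 \<psi> x = - ((of_real (pd 1 \<kappa> x) + \<sigma> * of_real (pd 2 \<kappa> x)) * f x)" if "x \<in> ?S" for x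
    proof -
      have "pd i (\<lambda>x. complex_of_real (1 - \<kappa> x)) x = of_real (pd i (\<lambda>x. 1 - \<kappa> x) x)" for i
        by (intro pd_bounded_linear[OF bounded_linear_of_real] C_infinity_differentiable C_infinity_diff C_infinity_const \<kappa>)
      moreover have "pd i (\<lambda>x. 1 - \<kappa> x) x = - pd i \<kappa> x" for i
        using pd_diff[OF C_infinity_differentiable[OF C_infinity_const] C_infinity_differentiable[OF \<kappa>(1)]] by (simp add: pd_const)
      ultimately have e: "pd i \<psi> x = complex_of_real (1 - \<kappa> x) * pd i f x - of_real (pd i \<kappa> x) * f x" for i
        unfolding \<psi>_def using pd_mult[OF C_infinity_differentiable[OF \<eta>] C_infinity_differentiable[OF f(1)]] by simp
      have "pd 1 \<psi> x + \<sigma> * pd 2 \<psi> x = complex_of_real (1 - \<kappa> x) * (pd 1 f x + \<sigma> * pd 2 f x)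
          - (of_real (pd 1 \<kappa> x) + \<sigma> * of_real (pd 2 \<kappa> x)) * f x" unfolding e by (simp only: algebra_simps)
      moreover have "pd 1 f x + \<sigma> * pd 2 f x = 0" using f(2)[of x] that by (simp add: truncated_sector_def)
      ultimately show ?thesis by (simp only: mult_zero_right diff_0)
    qed
    have \<sigma>1: "norm \<sigma> = 1" using sigma_cases[OF \<sigma>] by auto
    define J where "J = (LINT x|?M. \<psi> x * spinor \<sigma> (Q x - v x))"
    have J_le: "norm J \<le> K1 * \<epsilon> ^ 4"
    proof -
      have bL: "norm ((pd 1 \<psi> x + \<sigma> * pd 2 \<psi> x) * flux \<sigma> x) \<le> (8 * C / h * (M0 * \<epsilon> ^ 4)) * norm (flux \<sigma> x)" if x: "x \<in> ?S" for x
      proof -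
        have "norm ((of_real (pd 1 \<kappa> x) + \<sigma> * of_real (pd 2 \<kappa> x)) * f x) \<le> 8 * C / h * (M0 * \<epsilon> ^ 4)"
        proof (cases "norm x < h / 4")
          case True
          then show ?thesis using \<kappa>_pd M0 \<kappa>'(1) h \<epsilon> by simp
        next
          case False
          have "norm (of_real (pd 1 \<kappa> x) + \<sigma> * of_real (pd 2 \<kappa> x)) \<le> 4 * C / h + 4 * C / h"
            using \<kappa>(6) by (intro norm_triangle_le add_mono) (simp_all add: norm_mult \<sigma>1)
          then show ?thesis
            unfolding norm_mult using f_far[OF x] False \<kappa>'(1) h by (intro mult_mono) auto
        qed
        then show ?thesis unfolding pd\<psi>[OF x] norm_mult[of _ "flux \<sigma> x"] by (intro mult_right_mono) auto
      qed
      have iL: "integrable ?M (\<lambda>x. (pd 1 \<psi> x + \<sigma> * pd 2 \<psi> x) * flux \<sigma> x)"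
      proof -
        have "C_infinity (\<lambda>x. pd 1 \<psi> x + \<sigma> * pd 2 \<psi> x)"
          by (intro C_infinity_add C_infinity_mult C_infinity_const C_infinity_pd \<psi>)
        then have "(\<lambda>x. pd 1 \<psi> x + \<sigma> * pd 2 \<psi> x) \<in> borel_measurable ?M"
          using L2_mem_continuous[OF S_open(2,1) C_infinity_continuous] by (auto simp: L2_mem_def)
        then have meas: "(\<lambda>x. (pd 1 \<psi> x + \<sigma> * pd 2 \<psi> x) * flux \<sigma> x) \<in> borel_measurable ?M"
          using iflux by (intro borel_measurable_times) auto
        have maj: "integrable ?M (\<lambda>x. (8 * C / h * (M0 * \<epsilon> ^ 4)) * norm (flux \<sigma> x))" using iflux by simp
        have "AE x in ?M. norm ((pd 1 \<psi> x + \<sigma> * pd 2 \<psi> x) * flux \<sigma> x) \<le> (8 * C / h * (M0 * \<epsilon> ^ 4)) * norm (flux \<sigma> x)"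
          by (rule AE_I2) (use bL in simp)
        then show ?thesis by (rule integrable_dominated[OF maj meas])
      qed
      have out: "pd i \<psi> x = 0" "\<psi> x = 0" if "x \<notin> ball 0 h" for i x
      proof -
        have x: "x \<notin> cball 0 (h / 2)" using that h by auto
        show "pd i \<psi> x = 0" by (rule pd_eq_0_outside[OF closed_cball \<psi>0 x])
        show "\<psi> x = 0" by (rule \<psi>0[OF x])
      qed
      have "of_real (\<omega>\<^sup>2) * J = of_real (\<omega>\<^sup>2) * (LINT x|lebesgue_on \<Omega>. \<psi> x * spinor \<sigma> (Q x - v x))"
        unfolding J_def by (subst integral_\<Omega>_eq_sector) (auto simp: out)
      also have "\<dots> = (LINT x|lebesgue_on \<Omega>. (pd 1 \<psi> x + \<sigma> * pd 2 \<psi> x) * flux \<sigma> x)"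
        by (rule vertex_identity_complex[OF \<sigma> \<psi> compact_cball K0 \<psi>0, symmetric])
      also have "\<dots> = (LINT x|?M. (pd 1 \<psi> x + \<sigma> * pd 2 \<psi> x) * flux \<sigma> x)"
        by (rule integral_\<Omega>_eq_sector) (simp add: out)
      finally have "norm (of_real (\<omega>\<^sup>2) * J) \<le> (LINT x|?M. norm ((pd 1 \<psi> x + \<sigma> * pd 2 \<psi> x) * flux \<sigma> x))"
        by (simp only: integral_norm_bound)
      also have "\<dots> \<le> (LINT x|?M. (8 * C / h * (M0 * \<epsilon> ^ 4)) * norm (flux \<sigma> x))"
        using iL iflux bL by (intro integral_mono) auto
      also have "\<dots> = 8 * C / h * (M0 * \<epsilon> ^ 4) * G" by (simp add: G_def)
      finally have "\<omega>\<^sup>2 * norm J \<le> 8 * C / h * M0 * G * \<epsilon> ^ 4"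
        by (simp add: norm_mult norm_power mult_ac)
      then have "norm J \<le> 8 * C / h * M0 * G * \<epsilon> ^ 4 / \<omega>\<^sup>2"
        using \<omega> by (intro pos_le_divide_eq[THEN iffD2]) (simp_all only: zero_less_power mult.commute[of "norm J"])
      then show ?thesis by (simp add: K1_def)
    qed
    have f2: "L2_mem ?M f" by (intro L2_mem_continuous S_open C_infinity_continuous f)
    have vp2: "L2_mem ?M (\<lambda>x. v x - p x)"
      by (intro L2_mem_diff L2_mem_subset[OF H1_memD[OF v] S_sub sets_\<Omega> sets_sector] L2_mem_continuous S_open p)
    note CS = L2_Cauchy_Schwarz[OF f2 vp2]
    have cg: "continuous_on UNIV (\<lambda>x. g x ^ 3)"
      unfolding g_def using pos by (intro continuous_intros) (metis less_irrefl)
    have ig: "integrable ?M (\<lambda>x. g x ^ 3)"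
      by (intro L2_lebesgue_on_integrable S_open L2_mem_continuous cg)
    have g_int: "(LINT x|?M. g x ^ 3) \<le> \<Delta> * \<epsilon>\<^sup>2"
      using sector_radial_bound[OF \<theta>' h \<epsilon>] by (simp add: g_def \<Delta>_def)
    \<comment> \<open>As g <= 1, the eighth power of g is below the third, whose mass is known. The
      resulting factor \<epsilon> turns an L2 error T into T / \<epsilon> after division by
      \<epsilon>^2.\<close>
    have f_L2: "L2_norm ?M f \<le> c4 * sqrt \<Delta> * \<epsilon>"
    proof -
      have "(LINT x|?M. (norm (f x))\<^sup>2) \<le> (LINT x|?M. c4\<^sup>2 * g x ^ 3)"
      proof (rule integral_mono)
        show "integrable ?M (\<lambda>x. (norm (f x))\<^sup>2)" using f2 by (simp add: L2_mem_def)
        show "integrable ?M (\<lambda>x. c4\<^sup>2 * g x ^ 3)" using ig by simp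
        fix x assume "x \<in> space ?M"
        then have "(norm (f x))\<^sup>2 \<le> (c4 * g x ^ 4)\<^sup>2" using f_le by (intro power_mono) auto
        also have "\<dots> = c4\<^sup>2 * (g x ^ 3 * g x ^ 5)" by (simp add: power_mult_distrib power_mult[symmetric] power_add[symmetric])
        also have "\<dots> \<le> c4\<^sup>2 * (g x ^ 3 * 1)" using g01[of x] by (intro mult_left_mono power_le_one) auto
        finally show "(norm (f x))\<^sup>2 \<le> c4\<^sup>2 * g x ^ 3" by simp
      qed
      also have "\<dots> \<le> c4\<^sup>2 * (\<Delta> * \<epsilon>\<^sup>2)" using g_int by (simp add: mult_left_mono)
      finally have "L2_norm ?M f \<le> sqrt (c4\<^sup>2 * (\<Delta> * \<epsilon>\<^sup>2))" unfolding L2_norm_def by (rule real_sqrt_le_mono)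
      also have "\<dots> = c4 * sqrt \<Delta> * \<epsilon>" using c4 \<epsilon> by (simp add: real_sqrt_mult)
      finally show ?thesis .
    qed
    have T0: "T \<ge> 0" using T L2_norm_nonneg order_trans by blast
    have fvp: "(LINT x|?M. norm (f x) * norm (v x - p x)) \<le> c4 * sqrt \<Delta> * \<epsilon> * T"
      by (rule order_trans[OF CS(2) mult_mono]) (use f_L2 T L2_norm_nonneg c4 \<Delta> \<epsilon> in auto)
    \<comment> \<open>The majorant has three sources: the part of the kernel removed by the cutoff,
      the Hoelder and Lipschitz errors, and the L2 error of \<open>p\<close>. The factors 2 come
      from \<open>norm_spinor_le\<close>.\<close>
    define b where "b x = norm X * (M0 * \<epsilon> ^ 4) + 2 * c4 * (Ch * \<epsilon> powr \<alpha> + A * \<epsilon>) * g x ^ 3 + 2 * (norm (f x) * norm (v x - p x))" for x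
    have ib: "integrable ?M b" unfolding b_def using ig CS(1) by simp
    have b_int: "(LINT x|?M. b x) \<le> norm X * (M0 * \<epsilon> ^ 4) * m + 2 * c4 * (Ch * \<epsilon> powr \<alpha> + A * \<epsilon>) * (\<Delta> * \<epsilon>\<^sup>2) + 2 * (c4 * sqrt \<Delta> * \<epsilon> * T)"
    proof -
      have "(LINT x|?M. b x) = norm X * (M0 * \<epsilon> ^ 4) * m + 2 * c4 * (Ch * \<epsilon> powr \<alpha> + A * \<epsilon>) * (LINT x|?M. g x ^ 3)
          + 2 * (LINT x|?M. norm (f x) * norm (v x - p x))"
        unfolding b_def using ig CS(1) by (simp add: m_def mult.commute)
      also have "\<dots> \<le> norm X * (M0 * \<epsilon> ^ 4) * m + 2 * c4 * (Ch * \<epsilon> powr \<alpha> + A * \<epsilon>) * (\<Delta> * \<epsilon>\<^sup>2) + 2 * (c4 * sqrt \<Delta> * \<epsilon> * T)"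
        using g_int fvp c4 Ch A \<epsilon> M0 by (intro add_mono mult_left_mono) auto
      finally show ?thesis .
    qed
    have pw: "AE x in ?M. norm (f x * X - \<psi> x * spinor \<sigma> (Q x - v x)) \<le> b x"
      using QF AE_space
    proof eventually_elim
      case (elim x)
      then have x: "x \<in> ?S" and QFx: "norm (Q x - F0) \<le> Ch * norm x powr \<alpha>" by auto
      let ?e = "spinor \<sigma> (Q x - F0) - spinor \<sigma> (p x - a) - spinor \<sigma> (v x - p x)"
      have "spinor \<sigma> (Q x - v x) = X + ?e" by (simp add: X_def spinor_def algebra_simps)
      moreover have "f x * X - \<psi> x * (X + e) = of_real (\<kappa> x) * f x * X - of_real (1 - \<kappa> x) * f x * e" for e
        by (simp add: \<psi>_def algebra_simps)
      ultimately have "f x * X - \<psi> x * spinor \<sigma> (Q x - v x) = of_real (\<kappa> x) * f x * X - of_real (1 - \<kappa> x) * f x * ?e"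
        by simp
      also have "norm \<dots> \<le> norm (of_real (\<kappa> x) * f x * X) + norm (of_real (1 - \<kappa> x) * f x * ?e)"
        by (rule norm_triangle_ineq4)
      also have "norm (of_real (\<kappa> x) * f x * X) \<le> norm X * (M0 * \<epsilon> ^ 4)"
      proof (cases "norm x \<le> h / 4")
        case True
        then show ?thesis using \<kappa>(4) M0 \<epsilon> by simp
      next
        case False
        have "\<kappa> x * norm (f x) \<le> 1 * (M0 * \<epsilon> ^ 4)"
          using f_far[OF x] False \<kappa>(2,3) by (intro mult_mono) auto
        then show ?thesis
          using \<kappa>(2)[of x] by (simp add: norm_mult mult.commute mult_left_mono)
      qed
      also have "norm (of_real (1 - \<kappa> x) * f x * ?e) \<le> 2 * c4 * (Ch * \<epsilon> powr \<alpha> + A * \<epsilon>) * g x ^ 3 + 2 * (norm (f x) * norm (v x - p x))"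
      proof -
        have e: "norm ?e \<le> 2 * norm (Q x - F0) + 2 * norm (p x - a) + 2 * norm (v x - p x)"
          using norm_triangle_ineq4[of "spinor \<sigma> (Q x - F0) - spinor \<sigma> (p x - a)" "spinor \<sigma> (v x - p x)"]
            norm_triangle_ineq4[of "spinor \<sigma> (Q x - F0)" "spinor \<sigma> (p x - a)"]
            norm_spinor_le[OF \<sigma>, of "Q x - F0"] norm_spinor_le[OF \<sigma>, of "p x - a"] norm_spinor_le[OF \<sigma>, of "v x - p x"]
          by linarith
        have "norm (of_real (1 - \<kappa> x) * f x * ?e) = \<bar>1 - \<kappa> x\<bar> * (norm (f x) * norm ?e)"
          by (simp only: norm_mult norm_of_real mult.assoc)
        also have "\<dots> \<le> 1 * (norm (f x) * norm ?e)"
          using \<kappa>(2,3) by (intro mult_right_mono) auto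
        also have "\<dots> \<le> norm (f x) * (2 * (Ch * norm x powr \<alpha>) + 2 * (A * norm x) + 2 * norm (v x - p x))"
          using e QFx p(2)[of x] by (simp add: mult_left_mono)
        also have "\<dots> = 2 * Ch * (norm (f x) * norm x powr \<alpha>) + 2 * A * (norm (f x) * norm x) + 2 * (norm (f x) * norm (v x - p x))"
          by (simp add: algebra_simps)
        also have "\<dots> \<le> 2 * Ch * (c4 * (\<epsilon> powr \<alpha> * g x ^ 3)) + 2 * A * (c4 * (\<epsilon> * g x ^ 3)) + 2 * (norm (f x) * norm (v x - p x))"
        \<comment> \<open>One of the four powers of g pays for the growth in x: g |x| <= \<epsilon>
          and g |x|^\<alpha> <= \<epsilon>^\<alpha>. The remaining third power has mass
          O(\<epsilon>^2).\<close>
        proof (intro add_mono mult_left_mono order_refl)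
          have gx: "g x * (\<epsilon> + norm x) = \<epsilon>" using pos[of x] by (simp add: g_def)
          have "g x * norm x \<le> \<epsilon>" using gx g01[of x] mult_left_mono[of "norm x" "\<epsilon> + norm x" "g x"] \<epsilon> by linarith
          then have "c4 * (g x ^ 3 * (g x * norm x)) \<le> c4 * (g x ^ 3 * \<epsilon>)"
            using c4 g01[of x] by (intro mult_left_mono) auto
          moreover have "norm (f x) * norm x \<le> c4 * g x ^ 4 * norm x" using f_le[OF x] by (rule mult_right_mono) simp
          moreover have "c4 * g x ^ 4 * norm x = c4 * (g x ^ 3 * (g x * norm x))" by (simp add: numeral_eq_Suc)
          ultimately show "norm (f x) * norm x \<le> c4 * (\<epsilon> * g x ^ 3)"
            unfolding mult.commute[of \<epsilon>] by linarith
          have "g x * norm x powr \<alpha> \<le> g x * (\<epsilon> + norm x) powr \<alpha>"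
            using g01[of x] \<alpha> \<epsilon> by (intro mult_left_mono powr_mono2) auto
          \<comment> \<open>Of the factors g^(1 - \<alpha>) and g^\<alpha>, the first is at most 1
            since \<alpha> < 1, and the second reduces (\<epsilon> + |x|)^\<alpha> to
            \<epsilon>^\<alpha>.\<close>
          also have "\<dots> = g x powr (1 - \<alpha>) * (g x * (\<epsilon> + norm x)) powr \<alpha>"
          proof -
            have "g x = g x powr (1 - \<alpha>) * g x powr \<alpha>"
              using \<epsilon> pos[of x] by (simp add: powr_add[symmetric] g_def)
            then show ?thesis using g01[of x] pos[of x] by (simp add: powr_mult less_imp_le mult.assoc[symmetric])
          qed
          also have "\<dots> \<le> 1 * \<epsilon> powr \<alpha>"
            unfolding gx using g01[of x] \<alpha> by (intro mult_right_mono powr_le1) auto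
          finally have "g x * norm x powr \<alpha> \<le> \<epsilon> powr \<alpha>" by simp
          then have "c4 * (g x ^ 3 * (g x * norm x powr \<alpha>)) \<le> c4 * (g x ^ 3 * \<epsilon> powr \<alpha>)"
            using c4 g01[of x] by (intro mult_left_mono) auto
          moreover have "norm (f x) * norm x powr \<alpha> \<le> c4 * g x ^ 4 * norm x powr \<alpha>" using f_le[OF x] by (rule mult_right_mono) simp
          moreover have "c4 * g x ^ 4 * norm x powr \<alpha> = c4 * (g x ^ 3 * (g x * norm x powr \<alpha>))" by (simp add: numeral_eq_Suc)
          ultimately show "norm (f x) * norm x powr \<alpha> \<le> c4 * (\<epsilon> powr \<alpha> * g x ^ 3)"
            unfolding mult.commute[of "\<epsilon> powr \<alpha>"] by linarith
        qed (use Ch A in auto)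
        also have "\<dots> = 2 * c4 * (Ch * \<epsilon> powr \<alpha> + A * \<epsilon>) * g x ^ 3 + 2 * (norm (f x) * norm (v x - p x))"
          by (simp add: algebra_simps)
        finally show ?thesis .
      qed
      finally show ?case by (simp add: b_def algebra_simps)
    qed
    have if_: "integrable ?M f" by (intro L2_lebesgue_on_integrable S_open f2)
    have i\<psi>: "integrable ?M (\<lambda>x. \<psi> x * spinor \<sigma> (Q x - v x))"
    proof -
      have "L2_mem ?M \<psi>" by (intro L2_mem_continuous S_open C_infinity_continuous \<psi>)
      moreover have "L2_mem ?M (\<lambda>x. spinor \<sigma> (Q x - v x))"
        by (intro L2_mem_subset[OF _ S_sub sets_\<Omega> sets_sector] L2_mem_bounded_linear[OF bounded_linear_spinor] L2_mem_diff Q H1_memD v)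
      ultimately have maj: "integrable ?M (\<lambda>x. norm (\<psi> x) * norm (spinor \<sigma> (Q x - v x)))"
        and meas: "(\<lambda>x. \<psi> x * spinor \<sigma> (Q x - v x)) \<in> borel_measurable ?M"
        by (auto intro: L2_Cauchy_Schwarz(1) borel_measurable_times simp: L2_mem_def)
      show ?thesis by (rule integrable_dominated[OF maj meas]) (simp add: norm_mult)
    qed
    have "norm ((LINT x|?M. f x) * X - J) \<le> (LINT x|?M. b x)"
    proof -
      have "(LINT x|?M. f x) * X - J = (LINT x|?M. f x * X - \<psi> x * spinor \<sigma> (Q x - v x))"
        unfolding J_def using if_ i\<psi> by simp
      also have "norm \<dots> \<le> (LINT x|?M. norm (f x * X - \<psi> x * spinor \<sigma> (Q x - v x)))" by (rule integral_norm_bound)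
      also have "\<dots> \<le> (LINT x|?M. b x)"
        using pw ib if_ i\<psi> by (intro integral_mono_AE) auto
      finally show ?thesis .
    qed
    then have 1: "norm (LINT x|?M. f x) * norm X \<le> norm J + (LINT x|?M. b x)"
      using norm_triangle_sub[of "(LINT x|?M. f x) * X" J] by (simp add: norm_mult)
    have "norm ((LINT x|?M. f x) - of_real (\<epsilon>\<^sup>2) * ?V) \<le> K2 * \<epsilon> ^ 4"
      using kernel_integral[OF \<sigma> \<theta>' c(1) \<epsilon> h cone[OF \<epsilon>] C_infinity_continuous[OF f(1)] f(3)]
      by (simp add: K2_def \<Delta>_def)
    moreover have "norm (of_real (\<epsilon>\<^sup>2) * ?V) = \<epsilon>\<^sup>2 * norm ?V"
      unfolding norm_mult norm_of_real by simp
    ultimately have "\<epsilon>\<^sup>2 * norm ?V - K2 * \<epsilon> ^ 4 \<le> norm (LINT x|?M. f x)"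
      using norm_triangle_sub[of "of_real (\<epsilon>\<^sup>2) * ?V" "(LINT x|?M. f x)"] by (simp add: norm_minus_commute)
    then have "(\<epsilon>\<^sup>2 * norm ?V - K2 * \<epsilon> ^ 4) * norm X \<le> norm (LINT x|?M. f x) * norm X"
      by (rule mult_right_mono) simp
    also note 1
    also have "norm J + (LINT x|?M. b x) \<le> K1 * \<epsilon> ^ 4 + (norm X * (M0 * \<epsilon> ^ 4) * m + 2 * c4 * (Ch * \<epsilon> powr \<alpha> + A * \<epsilon>) * (\<Delta> * \<epsilon>\<^sup>2) + 2 * (c4 * sqrt \<Delta> * \<epsilon> * T))"
      using J_le b_int by (rule add_mono)
    finally have "\<epsilon>\<^sup>2 * (norm X * (norm ?V - (K2 + M0 * m) * \<epsilon>\<^sup>2))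
        \<le> \<epsilon>\<^sup>2 * (K1 * \<epsilon>\<^sup>2 + (2 * c4 * \<Delta> * Ch) * \<epsilon> powr \<alpha> + (2 * c4 * \<Delta>) * (A * \<epsilon>) + (2 * c4 * sqrt \<Delta>) * (T / \<epsilon>))"
      using \<epsilon> by (simp add: algebra_simps power2_eq_square numeral_eq_Suc)
    then have "norm X * (norm ?V - (K2 + M0 * m) * \<epsilon>\<^sup>2)
        \<le> K1 * \<epsilon>\<^sup>2 + (2 * c4 * \<Delta> * Ch) * \<epsilon> powr \<alpha> + (2 * c4 * \<Delta>) * (A * \<epsilon>) + (2 * c4 * sqrt \<Delta>) * (T / \<epsilon>)"
      using \<epsilon> by simp
    also have "\<dots> \<le> K * \<epsilon>\<^sup>2 + K * \<epsilon> powr \<alpha> + K * (A * \<epsilon>) + K * (T / \<epsilon>)"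
      using K_ge \<epsilon> A T0 by (intro add_mono mult_right_mono) auto
    finally have "norm X * (norm ?V - (K2 + M0 * m) * \<epsilon>\<^sup>2) \<le> K * (\<epsilon>\<^sup>2 + \<epsilon> powr \<alpha> + A * \<epsilon> + T / \<epsilon>)"
      by (simp add: distrib_left)
    moreover have "norm X * (norm ?V - K * \<epsilon>\<^sup>2) \<le> norm X * (norm ?V - (K2 + M0 * m) * \<epsilon>\<^sup>2)"
      using K_ge(1) by (intro mult_left_mono diff_left_mono mult_right_mono) auto
    ultimately show "norm (spinor \<sigma> (F0 - a)) * (norm ?V - K * \<epsilon>\<^sup>2) \<le> K * (\<epsilon>\<^sup>2 + \<epsilon> powr \<alpha> + A * \<epsilon> + T / \<epsilon>)"
      unfolding X_def by linarith
  qed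
qed

end

section \<open>Limits along the approximating sequence\<close>

lemma norm_le_spinors: "norm y \<le> norm (spinor \<i> y) + norm (spinor (- \<i>) y)"
proof -
  have "2 * y $ 1 = spinor \<i> y + spinor (- \<i>) y" by (simp add: spinor_def)
  then have 1: "2 * norm (y $ 1) \<le> norm (spinor \<i> y) + norm (spinor (- \<i>) y)"
    using norm_triangle_ineq[of "spinor \<i> y" "spinor (- \<i>) y"] norm_mult[of 2 "y $ 1"] by simp
  have "(2 * \<i>) * y $ 2 = spinor \<i> y - spinor (- \<i>) y" by (simp add: spinor_def)
  then have 2: "2 * norm (y $ 2) \<le> norm (spinor \<i> y) + norm (spinor (- \<i>) y)"
    using norm_triangle_ineq4[of "spinor \<i> y" "spinor (- \<i>) y"] norm_mult[of "2 * \<i>" "y $ 2"] by (simp add: norm_mult)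
  have "norm y \<le> norm (y $ 1) + norm (y $ 2)"
    unfolding norm_complex_vec by (rule sqrt_sum_squares_le_sum) auto
  then show ?thesis using 1 2 by linarith
qed

lemma tendsto_of_nat_powr_0: "s < 0 \<Longrightarrow> (\<lambda>j. real j powr s) \<longlonglongrightarrow> 0"
  by (rule tendsto_neg_powr[OF _ filterlim_real_sequentially])

text \<open>The scale \<rho> varies continuously, the approximation by the index j. With y =
  \<rho>^(-1/\<kappa>) >= 1 the ceiling of y lies between y and 2 y, so j^(-\<kappa>) matches \<rho>
  up to the factor 2^\<kappa>.\<close>

lemma matching_index:
  assumes \<kappa>: "\<kappa> > (0::real)"
  obtains J :: "real \<Rightarrow> nat" where "filterlim J sequentially (at_right 0)"
    "\<And>\<rho>. \<rho> \<in> {0<..<1} \<Longrightarrow> J \<rho> \<ge> 1"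
    "\<And>\<rho>. \<rho> \<in> {0<..<1} \<Longrightarrow> real (J \<rho>) powr (- \<kappa>) \<le> \<rho>"
    "\<And>\<rho>. \<rho> \<in> {0<..<1} \<Longrightarrow> \<rho> \<le> 2 powr \<kappa> * real (J \<rho>) powr (- \<kappa>)"
proof -
  define J where "J \<rho> = nat \<lceil>\<rho> powr (- 1 / \<kappa>)\<rceil>" for \<rho> :: real
  have J: "J \<rho> \<ge> 1" "real (J \<rho>) powr (- \<kappa>) \<le> \<rho>" "\<rho> \<le> 2 powr \<kappa> * real (J \<rho>) powr (- \<kappa>)" if \<rho>: "\<rho> \<in> {0<..<1}" for \<rho>
  proof -
    define y where "y = \<rho> powr (- 1 / \<kappa>)"
    have y1: "y \<ge> 1"
      unfolding y_def using powr_mono2'[of "- 1 / \<kappa>" \<rho> 1] \<rho> \<kappa> by simp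
    have y\<kappa>: "y powr (- \<kappa>) = \<rho>" using \<rho> \<kappa> by (simp add: y_def powr_powr)
    have J1: "y \<le> real (J \<rho>)" unfolding J_def y_def[symmetric] by (rule real_nat_ceiling_ge)
    have J2: "real (J \<rho>) \<le> y + 1"
      unfolding J_def y_def[symmetric] using y1 of_int_ceiling_le_add_one[of y] by simp
    show "J \<rho> \<ge> 1" using J1 y1 by linarith
    show "real (J \<rho>) powr (- \<kappa>) \<le> \<rho>"
      using powr_mono2'[of "- \<kappa>" y "real (J \<rho>)"] \<kappa> y1 J1 y\<kappa> by simp
    have "(2 * y) powr (- \<kappa>) \<le> real (J \<rho>) powr (- \<kappa>)"
      using \<kappa> y1 J1 J2 by (intro powr_mono2') auto
    moreover have "(2 * y) powr (- \<kappa>) = \<rho> / 2 powr \<kappa>"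
      using y1 y\<kappa> by (simp add: powr_mult powr_minus divide_inverse mult.commute)
    ultimately have "\<rho> / 2 powr \<kappa> \<le> real (J \<rho>) powr (- \<kappa>)" by simp
    then show "\<rho> \<le> 2 powr \<kappa> * real (J \<rho>) powr (- \<kappa>)"
      by (simp add: divide_le_eq mult.commute)
  qed
  have "filterlim J sequentially (at_right 0)"
    unfolding filterlim_at_top
  proof
    fix Z :: nat
    define d where "d = min 1 (real (Suc Z) powr (- \<kappa>))"
    have d: "d > 0" by (simp add: d_def)
    have "Z \<le> J \<rho>" if \<rho>: "0 < \<rho>" "\<rho> < d" for \<rho>
    proof (rule ccontr)
      assume "\<not> Z \<le> J \<rho>"
      have \<rho>1: "\<rho> \<in> {0<..<1}" using \<rho> by (simp add: d_def)
      have "real (Suc Z) powr (- \<kappa>) \<le> real (J \<rho>) powr (- \<kappa>)"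
        using \<kappa> J(1)[OF \<rho>1] \<open>\<not> Z \<le> J \<rho>\<close> by (intro powr_mono2') auto
      also have "\<dots> \<le> \<rho>" by (rule J(2)[OF \<rho>1])
      finally show False using \<rho> by (simp add: d_def)
    qed
    then show "\<forall>\<^sub>F \<rho> in at_right 0. Z \<le> J \<rho>"
      unfolding eventually_at_right_field using d by blast
  qed
  then show thesis by (rule that) (use J in auto)
qed

context transmission
begin

lemma vertex_value:
  assumes angle: "\<theta>M - \<theta>m \<noteq> pi" and \<omega>: "\<omega> > 0" and \<alpha>: "0 < \<alpha>" "\<alpha> < 1" and Ch: "Ch \<ge> 0"
    and QF: "AE x in lebesgue_on (truncated_sector \<theta>m \<theta>M h). norm (Q x - F0) \<le> Ch * norm x powr \<alpha>"
    and \<beta>: "0 < \<beta>" "\<beta> < \<gamma>" and M: "M \<ge> 0"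
    and p: "\<And>j. j \<ge> 1 \<Longrightarrow> continuous_on UNIV (p j)"
      "\<And>j x. j \<ge> 1 \<Longrightarrow> norm (p j x - p j 0) \<le> M * real j powr \<beta> * norm x"
    and vp: "\<And>j. j \<ge> 1 \<Longrightarrow>
      L2_norm (lebesgue_on (truncated_sector \<theta>m \<theta>M h)) (\<lambda>x. v x - p j x) \<le> real j powr (- \<gamma>)"
  shows "(\<lambda>j. norm (F0 - p j 0)) \<longlonglongrightarrow> 0"
proof -
  \<comment> \<open>With \<epsilon> = j^(-\<kappa>) the Lipschitz error is of order j^(\<beta> -
    \<kappa>) and the approximation error j^(\<kappa> - \<gamma>); the midpoint makes both decay at
    the same rate.\<close>
  define \<kappa> where "\<kappa> = (\<beta> + \<gamma>) / 2"
  have \<kappa>: "\<beta> < \<kappa>" "\<kappa> < \<gamma>" "0 < \<kappa>" using \<beta> by (auto simp: \<kappa>_def)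
  define R where "R j = real j powr (- (2 * \<kappa>)) + real j powr (- (\<kappa> * \<alpha>)) + M * real j powr (\<beta> - \<kappa>) + real j powr (\<kappa> - \<gamma>)" for j
  have R: "R \<longlonglongrightarrow> 0"
    unfolding R_def
    by (intro tendsto_add_zero tendsto_mult_right_zero tendsto_of_nat_powr_0) (use \<kappa> \<alpha> in auto)
  have spin: "(\<lambda>j. norm (spinor \<sigma> (F0 - p j 0))) \<longlonglongrightarrow> 0" if \<sigma>: "\<sigma>\<^sup>2 = -1" for \<sigma>
  proof -
    let ?m = "norm (vertex_moment \<sigma> \<theta>m \<theta>M)"
    have m: "?m > 0" using vertex_moment_nonzero[OF \<sigma> \<theta> angle] by simp
    obtain K where K: "\<And>\<epsilon> a A T q. \<epsilon> > 0 \<Longrightarrow> A \<ge> 0 \<Longrightarrow> continuous_on UNIV q \<Longrightarrow>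
      (\<And>x. norm (q x - a) \<le> A * norm x) \<Longrightarrow>
      L2_norm (lebesgue_on (truncated_sector \<theta>m \<theta>M h)) (\<lambda>x. v x - q x) \<le> T \<Longrightarrow>
      norm (spinor \<sigma> (F0 - a)) * (?m - K * \<epsilon>\<^sup>2) \<le> K * (\<epsilon>\<^sup>2 + \<epsilon> powr \<alpha> + A * \<epsilon> + T / \<epsilon>)"
      by (rule concentration[OF \<sigma> \<omega> \<alpha> Ch QF]) (erule that)
    have le: "norm (spinor \<sigma> (F0 - p j 0)) * (?m - K * real j powr (- (2 * \<kappa>))) \<le> K * R j" if j: "j \<ge> 1" for j
    proof -
      define \<epsilon> where "\<epsilon> = real j powr (- \<kappa>)"
      have \<epsilon>: "\<epsilon> > 0" using j by (simp add: \<epsilon>_def)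
      have e: "\<epsilon>\<^sup>2 = real j powr (- (2 * \<kappa>))" "\<epsilon> powr \<alpha> = real j powr (- (\<kappa> * \<alpha>))"
        "M * real j powr \<beta> * \<epsilon> = M * real j powr (\<beta> - \<kappa>)" "real j powr (- \<gamma>) / \<epsilon> = real j powr (\<kappa> - \<gamma>)"
        by (simp_all add: \<epsilon>_def power2_eq_square powr_powr mult.assoc powr_add[symmetric] powr_diff[symmetric])
      have "M * real j powr \<beta> \<ge> 0" using M by simp
      from K[OF \<epsilon> this p(1)[OF j] p(2)[OF j] vp[OF j]] show ?thesis unfolding e R_def .
    qed
    \<comment> \<open>Eventually the term subtracted from the moment is less than half of it, so the
      nonzero moment can be divided out.\<close>
    have "(\<lambda>j. K * real j powr (- (2 * \<kappa>))) \<longlonglongrightarrow> 0"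
      using \<kappa> by (intro tendsto_mult_right_zero tendsto_of_nat_powr_0) auto
    then have "\<forall>\<^sub>F j in sequentially. K * real j powr (- (2 * \<kappa>)) < ?m / 2"
      using m by (intro order_tendstoD(2)) auto
    then have "\<forall>\<^sub>F j in sequentially. norm (spinor \<sigma> (F0 - p j 0)) \<le> 2 / ?m * (K * R j)"
      using eventually_ge_at_top[of 1]
    proof eventually_elim
      case (elim j)
      have "norm (spinor \<sigma> (F0 - p j 0)) * (?m / 2) \<le> norm (spinor \<sigma> (F0 - p j 0)) * (?m - K * real j powr (- (2 * \<kappa>)))"
        using elim by (intro mult_left_mono) auto
      also have "\<dots> \<le> K * R j" by (rule le) (use elim in simp)
      finally show ?case using m by (simp add: field_simps)
    qed
    note upper = this
    have "(\<lambda>j. 2 / ?m * (K * R j)) \<longlonglongrightarrow> 0" by (intro tendsto_mult_right_zero R)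
    from tendsto_sandwich[OF _ upper tendsto_const this] show ?thesis by simp
  qed
  have "(\<lambda>j. norm (spinor \<i> (F0 - p j 0)) + norm (spinor (- \<i>) (F0 - p j 0))) \<longlonglongrightarrow> 0"
    by (intro tendsto_add_zero spin) auto
  then show ?thesis
    by (rule tendsto_0_le) (auto intro: norm_le_spinors)
qed

text \<open>The area is of order \<rho>^2 and the Poincare inequality supplies one factor \<rho>, so
  the gradient integrals remain divided by \<rho>. That is the quotient treated by
  \<open>L2_scaled_average_tendsto\<close>.\<close>

lemma average_bound:
  assumes \<rho>: "0 < \<rho>" "\<rho> \<le> h" and \<alpha>: "0 < \<alpha>" and Ch: "Ch \<ge> 0"
    and QF: "AE x in lebesgue_on (truncated_sector \<theta>m \<theta>M h). norm (Q x - F0) \<le> Ch * norm x powr \<alpha>"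
    and p: "continuous_on UNIV p" "\<And>x. norm (p x - a) \<le> A * norm x" and A: "A \<ge> 0"
    and vp: "L2_norm (lebesgue_on (truncated_sector \<theta>m \<theta>M h)) (\<lambda>x. v x - p x) \<le> T"
  shows "(LINT x|lebesgue_on (truncated_sector \<theta>m \<theta>M \<rho>). norm (Q x - w x)) / measure lebesgue (truncated_sector \<theta>m \<theta>M \<rho>)
    \<le> Ch * \<rho> powr \<alpha> + norm (F0 - a) + A * \<rho> + T / \<rho> / sqrt ((\<theta>M - \<theta>m) / 2)
      + 2 * ((LINT x|lebesgue_on (truncated_sector \<theta>m \<theta>M \<rho>). norm (DU 1 x)) / \<rho>
        + (LINT x|lebesgue_on (truncated_sector \<theta>m \<theta>M \<rho>). norm (DU 2 x)) / \<rho>)"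
proof -
  let ?S = "truncated_sector \<theta>m \<theta>M \<rho>" and ?Sh = "truncated_sector \<theta>m \<theta>M h"
  let ?M = "lebesgue_on ?S"
  define \<Delta> where "\<Delta> = \<theta>M - \<theta>m"
  have \<Delta>: "\<Delta> > 0" using \<theta> by (simp add: \<Delta>_def)
  define m where "m = measure lebesgue ?S"
  have m: "m = \<Delta> * \<rho>\<^sup>2 / 2" unfolding m_def \<Delta>_def by (rule measure_truncated_sector[OF \<theta>' \<rho>(1)])
  have m0: "m > 0" using \<Delta> \<rho> by (simp add: m)
  have S_open: "bounded ?S" "open ?S" by (intro open_truncated_sector bounded_truncated_sector \<theta>')+
  have finS: "finite_measure ?M" by (intro finite_measure_lebesgue_on bounded_open_lmeasurable S_open)
  interpret S: finite_measure ?M by (rule finS)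
  have meas: "measure ?M ?S = m" using sets_sector by (simp add: m_def measure_restrict_space)
  have SSh: "?S \<subseteq> ?Sh" using \<rho> by (auto simp: truncated_sector_def)
  note sub\<Omega> = sector_subset[OF \<rho>(2)] sets_\<Omega> sets_sector
  have L2: "L2_mem ?M f" if "L2_mem (lebesgue_on \<Omega>) f" for f :: "plane \<Rightarrow> complex^2"
    by (rule L2_mem_subset[OF that sub\<Omega>])
  have iQ: "integrable ?M Q" and iv: "integrable ?M v" and iw: "integrable ?M w"
    by (intro L2_lebesgue_on_integrable S_open L2 Q H1_memD v w)+
  have p2: "L2_mem (lebesgue_on ?Sh) p"
    by (intro L2_mem_continuous open_truncated_sector bounded_truncated_sector \<theta>' p)
  have vpSh: "L2_mem (lebesgue_on ?Sh) (\<lambda>x. v x - p x)"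
    by (intro L2_mem_diff p2 L2_mem_subset[OF H1_memD[OF v] sector_subset sets_\<Omega> sets_sector] order_refl)
  have vp_S: "L2_norm ?M (\<lambda>x. v x - p x) \<le> T"
    using L2_norm_subset[OF vpSh SSh sets_sector sets_sector] vp by linarith
  note vpS = L2_mem_subset[OF vpSh SSh sets_sector sets_sector]
  have "(LINT x|?M. norm (v x - p x)) \<le> sqrt (measure ?M (space ?M)) * L2_norm ?M (\<lambda>x. v x - p x)"
    by (rule L2_mem_L1(2)[OF finS vpS])
  also have "\<dots> \<le> sqrt m * T"
    using vp_S m0 by (simp add: meas mult_left_mono)
  finally have I1: "(LINT x|?M. norm (v x - p x)) \<le> sqrt m * T" .
  have I2: "(LINT x|?M. norm (w x - v x)) \<le> \<Delta> * \<rho> * ((LINT x|?M. norm (DU 1 x)) + (LINT x|?M. norm (DU 2 x)))"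
    unfolding \<Delta>_def by (rule Poincare[OF \<rho>])
  have QF': "AE x in ?M. norm (Q x - F0) \<le> Ch * norm x powr \<alpha>"
    using QF SSh sets_sector by (auto simp: AE_restrict_space_iff elim!: eventually_mono)
  have "AE x in ?M. norm (Q x - w x) \<le> (Ch * \<rho> powr \<alpha> + norm (F0 - a) + A * \<rho>) + norm (v x - p x) + norm (w x - v x)"
    using QF' AE_space
  proof eventually_elim
    case (elim x)
    then have nx: "norm x \<le> \<rho>" by (simp add: truncated_sector_def)
    have "Ch * norm x powr \<alpha> \<le> Ch * \<rho> powr \<alpha>"
      using Ch \<alpha> nx by (intro mult_left_mono powr_mono2) auto
    moreover have "A * norm x \<le> A * \<rho>" using A nx by (rule mult_left_mono[rotated])
    moreover have "Q x - w x = (Q x - F0) + (F0 - a) - (p x - a) - (v x - p x) - (w x - v x)" by simp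
    from arg_cong[OF this, of norm] have "norm (Q x - w x) \<le> norm (Q x - F0) + norm (F0 - a) + norm (p x - a) + norm (v x - p x) + norm (w x - v x)"
      using norm_triangle_ineq[of "Q x - F0" "F0 - a"] norm_triangle_ineq4[of "(Q x - F0) + (F0 - a)" "p x - a"]
        norm_triangle_ineq4[of "(Q x - F0) + (F0 - a) - (p x - a)" "v x - p x"]
        norm_triangle_ineq4[of "(Q x - F0) + (F0 - a) - (p x - a) - (v x - p x)" "w x - v x"] by linarith
    ultimately show ?case using elim(1) p(2)[of x] by linarith
  qed
  then have "(LINT x|?M. norm (Q x - w x)) \<le> (LINT x|?M. (Ch * \<rho> powr \<alpha> + norm (F0 - a) + A * \<rho>) + norm (v x - p x) + norm (w x - v x))"
    using iQ iv iw L2_mem_L1(1)[OF finS vpS] by (intro integral_mono_AE) auto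
  also have "\<dots> = (Ch * \<rho> powr \<alpha> + norm (F0 - a) + A * \<rho>) * m + (LINT x|?M. norm (v x - p x)) + (LINT x|?M. norm (w x - v x))"
    using iv iw L2_mem_L1(1)[OF finS vpS] by (simp add: meas mult.commute)
  also have "\<dots> \<le> (Ch * \<rho> powr \<alpha> + norm (F0 - a) + A * \<rho>) * m + sqrt m * T
      + \<Delta> * \<rho> * ((LINT x|?M. norm (DU 1 x)) + (LINT x|?M. norm (DU 2 x)))"
    using I1 I2 by linarith
  \<comment> \<open>All terms become multiples of the area m = \<Delta> \<rho>^2 / 2: hence 1 /
    (\<rho> sqrt(\<Delta> / 2)) for the L2 error and 2 / \<rho> for the Poincare term.\<close>
  also have "\<dots> = (Ch * \<rho> powr \<alpha> + norm (F0 - a) + A * \<rho> + T / \<rho> / sqrt (\<Delta> / 2)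
      + 2 * ((LINT x|?M. norm (DU 1 x)) / \<rho> + (LINT x|?M. norm (DU 2 x)) / \<rho>)) * m"
  proof -
    have s: "sqrt m = sqrt (\<Delta> / 2) * \<rho>" using \<rho> by (simp add: m real_sqrt_mult real_sqrt_divide)
    have "m = sqrt m * sqrt m" using m0 by simp
    then have "sqrt m * T = T / \<rho> / sqrt (\<Delta> / 2) * m"
      unfolding s using \<rho> \<Delta> by (simp add: field_simps)
    moreover have "\<Delta> * \<rho> * d = 2 * (d / \<rho>) * m" for d
      using \<rho> by (simp add: m power2_eq_square)
    ultimately show ?thesis by (simp add: distrib_right add_divide_distrib distrib_left)
  qed
  finally show ?thesis using m0 by (simp add: m_def[symmetric] \<Delta>_def[symmetric] divide_le_eq)
qed

lemma average_tendsto_0: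
  assumes angle: "\<theta>M - \<theta>m \<noteq> pi" and \<omega>: "\<omega> > 0" and \<alpha>: "0 < \<alpha>" "\<alpha> < 1" and Ch: "Ch \<ge> 0"
    and QF: "AE x in lebesgue_on (truncated_sector \<theta>m \<theta>M h). norm (Q x - F0) \<le> Ch * norm x powr \<alpha>"
    and \<beta>: "0 < \<beta>" "\<beta> < \<gamma>" and M: "M \<ge> 0"
    and p: "\<And>j. j \<ge> 1 \<Longrightarrow> continuous_on UNIV (p j)"
      "\<And>j x. j \<ge> 1 \<Longrightarrow> norm (p j x - p j 0) \<le> M * real j powr \<beta> * norm x"
    and vp: "\<And>j. j \<ge> 1 \<Longrightarrow>
      L2_norm (lebesgue_on (truncated_sector \<theta>m \<theta>M h)) (\<lambda>x. v x - p j x) \<le> real j powr (- \<gamma>)"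
  shows "((\<lambda>\<rho>. (LINT x|lebesgue_on (\<Omega> \<inter> ball 0 \<rho>). norm (Q x - w x)) / measure lebesgue (\<Omega> \<inter> ball 0 \<rho>)) \<longlongrightarrow> 0) (at_right 0)"
proof -
  define \<kappa> where "\<kappa> = (\<beta> + \<gamma>) / 2"
  have \<kappa>: "\<beta> < \<kappa>" "\<kappa> < \<gamma>" "0 < \<kappa>" using \<beta> by (auto simp: \<kappa>_def)
  define s where "s = sqrt ((\<theta>M - \<theta>m) / 2)"
  have s: "s > 0" using \<theta> by (simp add: s_def)
  define N where "N i \<rho> = (LINT x|lebesgue_on (\<Omega> \<inter> ball 0 \<rho>). norm (DU i x)) / \<rho>" for i \<rho>
  have N: "(N i \<longlongrightarrow> 0) (at_right 0)" for i
    unfolding N_def by (intro L2_scaled_average_tendsto sets_\<Omega> L2_mem_diff L2_mem_weak_pd v w)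
  obtain J :: "real \<Rightarrow> nat" where J: "filterlim J sequentially (at_right 0)"
    "\<And>\<rho>. \<rho> \<in> {0<..<1} \<Longrightarrow> J \<rho> \<ge> 1"
    "\<And>\<rho>. \<rho> \<in> {0<..<1} \<Longrightarrow> real (J \<rho>) powr (- \<kappa>) \<le> \<rho>"
    "\<And>\<rho>. \<rho> \<in> {0<..<1} \<Longrightarrow> \<rho> \<le> 2 powr \<kappa> * real (J \<rho>) powr (- \<kappa>)"
    by (rule matching_index[OF \<kappa>(3)]) (rule that; assumption)
  define b where "b j = norm (F0 - p j 0) + M * 2 powr \<kappa> * real j powr (\<beta> - \<kappa>) + real j powr (\<kappa> - \<gamma>) / s" for j
  have "b \<longlonglongrightarrow> 0"
    unfolding b_def
    by (intro tendsto_add_zero tendsto_mult_right_zero tendsto_divide_zero tendsto_of_nat_powr_0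
        vertex_value[OF angle \<omega> \<alpha> Ch QF \<beta> M p vp]) (use \<kappa> in auto)
  then have bJ: "((\<lambda>\<rho>. b (J \<rho>)) \<longlongrightarrow> 0) (at_right 0)" by (rule filterlim_compose[OF _ J(1)])
  have r\<alpha>: "((\<lambda>\<rho>. \<rho> powr \<alpha>) \<longlongrightarrow> 0) (at_right (0::real))"
  proof (rule tendsto_zero_powrI[OF _ tendsto_const])
    show "((\<lambda>\<rho>::real. \<rho>) \<longlongrightarrow> 0) (at_right 0)" by (rule tendsto_ident_at)
    show "\<forall>\<^sub>F \<rho> in at_right (0::real). 0 \<le> \<rho>" by (auto simp: eventually_at_filter)
  qed (use \<alpha> in auto)
  define B where "B \<rho> = Ch * \<rho> powr \<alpha> + b (J \<rho>) + 2 * (N 1 \<rho> + N 2 \<rho>)" for \<rho>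
  have B: "(B \<longlongrightarrow> 0) (at_right 0)"
    unfolding B_def by (intro tendsto_add_zero tendsto_mult_right_zero r\<alpha> bJ N)
  let ?a = "\<lambda>\<rho>. (LINT x|lebesgue_on (\<Omega> \<inter> ball 0 \<rho>). norm (Q x - w x)) / measure lebesgue (\<Omega> \<inter> ball 0 \<rho>)"
  have le: "?a \<rho> \<le> B \<rho>" if \<rho>: "0 < \<rho>" "\<rho> < min 1 h" for \<rho>
  proof -
    have \<rho>1: "\<rho> \<in> {0<..<1}" and \<rho>h: "\<rho> \<le> h" using \<rho> by auto
    let ?j = "J \<rho>"
    note j = J(2)[OF \<rho>1]
    \<comment> \<open>Both directions of the matching are used: \<rho> <= 2^\<kappa> j^(-\<kappa>)
      for the Lipschitz term here, and j^(-\<kappa>) <= \<rho> for the approximation term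
      below.\<close>
    have "M * real ?j powr \<beta> * \<rho> \<le> M * real ?j powr \<beta> * (2 powr \<kappa> * real ?j powr (- \<kappa>))"
      using J(4)[OF \<rho>1] M by (intro mult_left_mono) auto
    also have "\<dots> = M * 2 powr \<kappa> * real ?j powr (\<beta> - \<kappa>)"
      by (simp add: powr_diff powr_minus divide_inverse)
    finally have 1: "M * real ?j powr \<beta> * \<rho> \<le> M * 2 powr \<kappa> * real ?j powr (\<beta> - \<kappa>)" .
    have "real ?j powr (- \<gamma>) / \<rho> \<le> real ?j powr (- \<gamma>) / real ?j powr (- \<kappa>)"
      using J(3)[OF \<rho>1] \<rho> j by (intro divide_left_mono mult_pos_pos) auto
    also have "\<dots> = real ?j powr (\<kappa> - \<gamma>)" by (simp add: powr_diff[symmetric])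
    finally have 2: "real ?j powr (- \<gamma>) / \<rho> / s \<le> real ?j powr (\<kappa> - \<gamma>) / s"
      using s by (intro divide_right_mono) auto
    have A0: "M * real ?j powr \<beta> \<ge> 0" using M by simp
    have "?a \<rho> \<le> Ch * \<rho> powr \<alpha> + norm (F0 - p ?j 0) + M * real ?j powr \<beta> * \<rho> + real ?j powr (- \<gamma>) / \<rho> / s + 2 * (N 1 \<rho> + N 2 \<rho>)"
      using average_bound[OF \<rho>(1) \<rho>h \<alpha>(1) Ch QF p(1)[OF j] p(2)[OF j] A0 vp[OF j]]
      unfolding sector_eq[OF \<rho>h] N_def s_def by simp
    then show ?thesis using 1 2 unfolding B_def b_def by linarith
  qed
  show ?thesis
  proof (rule tendsto_sandwich[OF _ _ tendsto_const B])
    show "\<forall>\<^sub>F \<rho> in at_right 0. 0 \<le> ?a \<rho>" by (intro always_eventually allI divide_nonneg_nonneg) auto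
    have "min 1 h > 0" using h by simp
    then show "\<forall>\<^sub>F \<rho> in at_right 0. ?a \<rho> \<le> B \<rho>" unfolding eventually_at_right_field using le by blast
  qed
qed

end

theorem corollary2p2:
  fixes la mu \<omega> h \<theta>m \<theta>M \<alpha> \<gamma> \<beta>1 \<beta>2 :: real
    and \<Omega> \<Gamma> :: "(real^2) set"
    and V :: "real^2 \<Rightarrow> real"
    and v w :: "real^2 \<Rightarrow> complex^2"
    and gp gs :: "nat \<Rightarrow> real^2 \<Rightarrow> complex"
  assumes lame_constants: "mu > 0" "2 * la + 2 * mu > 0"
    and V: "Linfinity_mem (lebesgue_on \<Omega>) V" "\<not> (AE x in lebesgue_on \<Omega>. V x = 0)"
    and domain: "bounded_lipschitz_domain \<Omega>" "connected (- closure \<Omega>)" "0 \<in> frontier \<Omega>"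
    and angles: "- pi < \<theta>m" "\<theta>m < \<theta>M" "\<theta>M < pi" "\<theta>M - \<theta>m \<noteq> pi"
    and corner: "h > 0" "\<Omega> \<inter> ball 0 h = truncated_sector \<theta>m \<theta>M h"
    and H1: "H1_mem \<Omega> v" "H1_mem \<Omega> w"
    and omega: "\<omega> > 0"
    and v_eq: "\<And>\<phi>. test_function \<Omega> \<phi> \<Longrightarrow>
        lame la mu (regular_distribution \<Omega> v) \<phi> + \<omega>\<^sup>2 *\<^sub>R regular_distribution \<Omega> v \<phi> = 0"
    and w_eq: "\<And>\<phi>. test_function \<Omega> \<phi> \<Longrightarrow>
        lame la mu (regular_distribution \<Omega> w) \<phi>
          + \<omega>\<^sup>2 *\<^sub>R regular_distribution \<Omega> (\<lambda>x. (1 + V x) *\<^sub>R w x) \<phi> = 0"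
    and Gamma: "openin (top_of_set (frontier \<Omega>)) \<Gamma>"
        "(ray \<theta>M \<union> ray \<theta>m) \<inter> ball 0 h \<subseteq> \<Gamma>"
    and boundary: "trace_eq_on \<Omega> \<Gamma> w v" "traction_eq_on la mu \<Omega> \<Gamma> v w"
    and alpha: "0 < \<alpha>" "\<alpha> < 1"
    and holder: "holder_class \<alpha> (truncated_sector \<theta>m \<theta>M h) (\<lambda>x. (1 + V x) *\<^sub>R w x)"
    and exponents: "\<gamma> > max \<beta>1 \<beta>2" "max \<beta>1 \<beta>2 > 0"
    and kernels: "\<And>j. j \<ge> 1 \<Longrightarrow> L2_mem circle_measure (gp j)"
        "\<And>j. j \<ge> 1 \<Longrightarrow> L2_mem circle_measure (gs j)"
    and approx: "\<And>j. j \<ge> 1 \<Longrightarrow>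
        H1_norm (truncated_sector \<theta>m \<theta>M h)
          (\<lambda>x. v x - herglotz la mu \<omega> (gp j) (gs j) x) \<le> real j powr (- \<gamma>)"
    and kernel_bounds: "\<And>j. j \<ge> 1 \<Longrightarrow> L2_norm circle_measure (gp j) \<le> real j powr \<beta>1"
        "\<And>j. j \<ge> 1 \<Longrightarrow> L2_norm circle_measure (gs j) \<le> real j powr \<beta>2"
  shows "((\<lambda>\<rho>. (LINT x|lebesgue_on (ball 0 \<rho> \<inter> \<Omega>). norm (V x *\<^sub>R w x))
             / measure lebesgue (ball 0 \<rho> \<inter> \<Omega>)) \<longlongrightarrow> 0) (at_right 0)"
proof -
  let ?S = "truncated_sector \<theta>m \<theta>M h"
  define Q where "Q x = (1 + V x) *\<^sub>R w x" for x
  have \<Omega>: "bounded \<Omega>" "open \<Omega>" using domain(1) by (auto simp: bounded_lipschitz_domain_def)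
  have \<Gamma>: "\<Gamma> \<subseteq> frontier \<Omega>" using openin_imp_subset[OF Gamma(1)] .
  have Q: "L2_mem (lebesgue_on \<Omega>) Q"
  proof -
    from V(1) obtain C where C: "AE x in lebesgue_on \<Omega>. \<bar>V x\<bar> \<le> C" and [measurable]: "V \<in> borel_measurable (lebesgue_on \<Omega>)"
      by (auto simp: Linfinity_mem_def)
    have [measurable]: "w \<in> borel_measurable (lebesgue_on \<Omega>)" using H1_memD[OF H1(2)] by (simp add: L2_mem_def)
    show ?thesis
    proof (rule L2_mem_bounded_mult[OF H1_memD[OF H1(2)]])
      show "Q \<in> borel_measurable (lebesgue_on \<Omega>)" unfolding Q_def by measurable
      show "AE x in lebesgue_on \<Omega>. norm (Q x) \<le> (1 + C) * norm (w x)"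
        using C
      proof eventually_elim
        case (elim x)
        then have "\<bar>1 + V x\<bar> \<le> 1 + C" by linarith
        then show ?case by (simp add: Q_def mult_right_mono)
      qed
    qed
  qed
  obtain \<Phi> :: "nat \<Rightarrow> plane \<Rightarrow> complex^2" where \<Phi>_side:
    "\<And>e. norm e = 1 \<Longrightarrow> (\<And>r. r \<in> {0<..<h} \<Longrightarrow> r *\<^sub>R e \<in> \<Gamma>) \<Longrightarrow>
      (\<lambda>n. integral {0..h} (\<lambda>r. norm (\<Phi> n (r *\<^sub>R e)))) \<longlonglongrightarrow> 0"
    and \<Phi>: "\<And>n. C_infinity (\<Phi> n)"
    "(\<lambda>n. LINT x|lebesgue_on \<Omega>. norm (\<Phi> n x - (w x - v x))) \<longlonglongrightarrow> 0"
    "\<And>i. (\<lambda>n. LINT x|lebesgue_on \<Omega>. norm (pd i (\<Phi> n) x - (weak_pd \<Omega> i w x - weak_pd \<Omega> i v x))) \<longlonglongrightarrow> 0"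
    by (rule trace_eq_approx[OF \<Omega> boundary(1) \<Gamma> corner(1)]) (erule that)
  have side: "(\<lambda>n. integral {0..h} (\<lambda>r. norm (\<Phi> n (polar r \<theta>)))) \<longlonglongrightarrow> 0"
    if \<theta>: "\<theta> = \<theta>m \<or> \<theta> = \<theta>M" for \<theta>
  proof -
    have "r *\<^sub>R polar 1 \<theta> \<in> \<Gamma>" if r: "r \<in> {0<..<h}" for r
    proof -
      have "norm (polar r \<theta>) = r" using r by (simp add: norm_polar)
      moreover have "polar_angle (polar r \<theta>) = \<theta>" using r \<theta> angles by (intro polar_angle_polar) auto
      ultimately have "polar r \<theta> \<in> (ray \<theta>M \<union> ray \<theta>m) \<inter> ball 0 h" using \<theta> r by (auto simp: ray_def)
      then show ?thesis using Gamma(2) unfolding polar_scaleR[of r] by blast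
    qed
    then have "(\<lambda>n. integral {0..h} (\<lambda>r. norm (\<Phi> n (r *\<^sub>R polar 1 \<theta>)))) \<longlonglongrightarrow> 0"
      by (intro \<Phi>_side) (simp add: norm_polar)
    then show ?thesis unfolding polar_scaleR[symmetric] .
  qed
  have tr: "transmission \<Omega> \<theta>m \<theta>M h v w \<Phi> la mu \<omega> Q \<Gamma>"
  proof unfold_locales
    show "integrable (lebesgue_on \<Omega>) (\<lambda>x. w x - v x)"
      by (intro L2_lebesgue_on_integrable \<Omega> L2_mem_diff H1_memD H1)
    show "integrable (lebesgue_on \<Omega>) (\<lambda>x. weak_pd \<Omega> i w x - weak_pd \<Omega> i v x)" for i
      by (intro L2_lebesgue_on_integrable \<Omega> L2_mem_diff L2_mem_weak_pd H1)
    show "is_weak_div \<Omega> (\<lambda>i x. traction_formula la mu (weak_jacobian \<Omega> v x) (axis i 1)) (\<lambda>x. - (\<omega>\<^sup>2) *\<^sub>R v x)"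
      by (rule is_weak_div_traction[OF \<Omega> H1(1) H1_memD[OF H1(1)] v_eq])
    show "is_weak_div \<Omega> (\<lambda>i x. traction_formula la mu (weak_jacobian \<Omega> w x) (axis i 1)) (\<lambda>x. - (\<omega>\<^sup>2) *\<^sub>R Q x)"
      by (rule is_weak_div_traction[OF \<Omega> H1(2) Q]) (use w_eq in \<open>simp add: Q_def[abs_def]\<close>)
  qed (fact \<Omega> angles corner \<Phi> side[OF disjI1[OF refl]] side[OF disjI2[OF refl]] H1 Q Gamma(2) boundary(2))+
  obtain F where F: "holder_on \<alpha> (closure ?S) F" and QF: "AE x in lebesgue_on ?S. Q x = F x"
    using holder by (auto simp: holder_class_def Q_def)
  from F obtain C where C: "\<forall>x\<in>closure ?S. \<forall>y\<in>closure ?S. dist (F x) (F y) \<le> C * dist x y powr \<alpha>"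
    by (auto simp: holder_on_def)
  \<comment> \<open>The Hoelder representative is controlled on the closure of the sector; its value
    at the vertex may be used because 0 is a frontier point of \<Omega>.\<close>
  have "0 \<in> ball (0::plane) h \<inter> closure \<Omega>" using domain(3) corner(1) by (simp add: frontier_def)
  then have zero: "0 \<in> closure ?S"
    using open_Int_closure_subset[of "ball (0::plane) h" \<Omega>] corner(2) by (auto simp: Int_commute)
  \<comment> \<open>\<open>holder_on\<close> allows any real constant, hence the maximum with
    0.\<close>
  have Q0: "AE x in lebesgue_on ?S. norm (Q x - F 0) \<le> max C 0 * norm x powr \<alpha>"
    using QF AE_space
  proof eventually_elim
    case (elim x)
    then have "x \<in> closure ?S" using closure_subset[of ?S] by auto
    from bspec[OF bspec[OF C this] zero] have "norm (Q x - F 0) \<le> C * norm x powr \<alpha>"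
      using elim(1) by (simp add: dist_norm)
    also have "\<dots> \<le> max C 0 * norm x powr \<alpha>" by (intro mult_right_mono) auto
    finally show ?case .
  qed
  define p where "p j = herglotz la mu \<omega> (gp j) (gs j)" for j
  define \<beta> where "\<beta> = max \<beta>1 \<beta>2"
  have "la + 2 * mu > 0" using lame_constants by linarith
  then obtain K where K: "K \<ge> 0" "\<And>gp gs x y. L2_mem circle_measure gp \<Longrightarrow> L2_mem circle_measure gs \<Longrightarrow>
      norm (herglotz la mu \<omega> gp gs x - herglotz la mu \<omega> gp gs y)
        \<le> K * (L2_norm circle_measure gp + L2_norm circle_measure gs) * norm (x - y)"
    by (rule herglotz_Lipschitz[OF lame_constants(1) _ omega]) (erule that)
  have lip: "norm (p j x - p j y) \<le> 2 * K * real j powr \<beta> * norm (x - y)" if j: "j \<ge> 1" for j x y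
  proof -
    have "norm (p j x - p j y) \<le> K * (L2_norm circle_measure (gp j) + L2_norm circle_measure (gs j)) * norm (x - y)"
      unfolding p_def by (rule K(2)[OF kernels(1)[OF j] kernels(2)[OF j]])
    also have "\<dots> \<le> K * (real j powr \<beta> + real j powr \<beta>) * norm (x - y)"
    proof (intro mult_right_mono mult_left_mono add_mono K)
      have "real j powr b \<le> real j powr \<beta>" if "b \<le> \<beta>" for b using j that by (intro powr_mono) auto
      then show "L2_norm circle_measure (gp j) \<le> real j powr \<beta>" "L2_norm circle_measure (gs j) \<le> real j powr \<beta>"
        using kernel_bounds(1)[OF j] kernel_bounds(2)[OF j] by (auto simp: \<beta>_def intro: order_trans)
    qed simp
    finally show ?thesis by simp
  qed
  have cont: "continuous_on UNIV (p j)" if j: "j \<ge> 1" for j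
  proof (rule lipschitz_on_continuous_on[OF lipschitz_onI])
    show "dist (p j x) (p j y) \<le> 2 * K * real j powr \<beta> * dist x y" for x y
      unfolding dist_norm by (rule lip[OF j])
  qed (use K in simp)
  have vp: "L2_norm (lebesgue_on ?S) (\<lambda>x. v x - p j x) \<le> real j powr (- \<gamma>)" if j: "j \<ge> 1" for j
    unfolding p_def by (rule order_trans[OF H1_norm_ge(1) approx[OF j]])
  have "((\<lambda>\<rho>. (LINT x|lebesgue_on (\<Omega> \<inter> ball 0 \<rho>). norm (Q x - w x)) / measure lebesgue (\<Omega> \<inter> ball 0 \<rho>)) \<longlongrightarrow> 0) (at_right 0)"
  proof (rule transmission.average_tendsto_0[OF tr angles(4) omega alpha _ Q0])
    show "0 < \<beta>" "\<beta> < \<gamma>" using exponents by (simp_all add: \<beta>_def)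
    show "norm (p j x - p j 0) \<le> 2 * K * real j powr \<beta> * norm x" if "j \<ge> 1" for j x
      using lip[OF that, of x 0] by simp
  qed (use K cont vp in auto)
  moreover have "Q x - w x = V x *\<^sub>R w x" for x by (simp add: Q_def scaleR_left_distrib)
  ultimately show ?thesis by (simp only: Int_commute)
qed

end
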